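(* Let $\Delta$ be a $(d-1)$-dimensional simplicial complex on $[n]$, $\Bbbk$ an infinite field, $S=\Bbbk[x_1,\dots,x_n]$, and let $\theta_1,\dots,\theta_d\in S$ be generic linear forms. For $0\le m\le d$ and $0<\ell\le d-m$ there is a graded isomorphism of $S$-modules $$\bigoplus_{i\ge 1} H^\ell_{\mathfrak m}\big(\Bbbk[\Delta]/(\theta_1,\dots,\theta_m)\big)_{-i}\;\cong\;\bigoplus_{i\ge 1}\ker^{\ell+m}_{m,\,i+m-1}$$ compatible with the direct sum, so that $H^\ell_{\mathfrak m}(\Bbbk[\Delta]/(\theta_1,\dots,\theta_m))_{-i}\cong\ker^{\ell+m}_{m,\,i+m-1}$ for each $i\ge1$. Thus $$\dim_\Bbbk H^\ell_{\mathfrak m}\big(\Bbbk[\Delta]/(\theta_1,\dots,\theta_m)\big)_{-i}=\sum_{F\in\Delta}\binom{i-1}{|F|-m-1}\cdot\dim_\Bbbk H^{\ell+m-1}_F(\Delta)\qquad\text{for }\ell,i>0.$$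
   Context: The face ring is $\Bbbk[\Delta]=S/I_\Delta$ with $I_\Delta=(x_{i_1}\cdots x_{i_k}:\{i_1,\dots,i_k\}\notin\Delta)$; $\mathfrak m=(x_1,\dots,x_n)$, $H^i_{\mathfrak m}$ is local cohomology, and subscripts denote graded pieces in the standard $\mathbb Z$-grading ($\deg x_t=1$). For integers $\ell,m,i$, $$\ker^\ell_{m,i}:=\bigcap_{p=1}^m\ker\big(\cdot\theta_p: H^\ell_{\mathfrak m}(\Bbbk[\Delta])_{-(i+1)}\to H^\ell_{\mathfrak m}(\Bbbk[\Delta])_{-i}\big),\qquad \ker^\ell_m:=\bigoplus_{i\in\mathbb Z}\ker^\ell_{m,i},$$ where $\cdot\theta_p$ is multiplication by $\theta_p$ (for $m=0$ the empty intersection is $H^\ell_{\mathfrak m}(\Bbbk[\Delta])_{-(i+1)}$). Thus $\ker^\ell_m$ is a graded submodule of $H^\ell_{\mathfrak m}(\Bbbk[\Delta])$ and $\ker^\ell_{m,i}=(\ker^\ell_m)_{-(i+1)}$. The direct sums over $i\ge1$ are regarded as $S$-modules by truncation: the left one is the quotient of $H^\ell_{\mathfrak m}(\Bbbk[\Delta]/(\theta_1,\dots,\theta_m))$ by its part in degrees $\ge 0$, and the right one is the quotient of $\ker^{\ell+m}_m$ by its part in degrees $\ge -m$. The isomorphism matches the summands indexed by the same $i$. For $F\in\Delta$, $\mathrm{cost}\,F=\{\sigma\in\Delta:\sigma\not\supset F\}$, meaning the faces not containing $F$, and $H^i_F(\Delta):=H^i(\Delta,\mathrm{cost}\,F)$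 is simplicial relative cohomology with coefficients in $\Bbbk$ (so $H^i_\varnothing(\Delta)=\tilde H^i(\Delta;\Bbbk)$). Convention: $\binom ab=0$ if $b<0$. Genericity: the assertion holds for generic linear forms $\theta_p=\sum_t a_{t,p}x_t$ ($1\le p\le d$) if there is a nonempty Zariski-open subset of the space $\Bbbk^{n\times d}$ of coefficient matrices $(a_{t,p})$ such that it holds for every choice of coefficients in this subset. *)

theory Defs
  imports
    "Jordan_Normal_Form.VS_Connect"
    "HOL-Algebra.QuotRing"
    "HOL-Library.Poly_Mapping"
begin

section \<open>Polynomials and the Zariski topology\<close>

text \<open>
  A polynomial is a finitely supported function from exponent vectors to coefficients, with the
  convolution product of the type class instance for \<open>\<Rightarrow>\<^sub>0\<close>. The indeterminates of the ring
  \<open>poly_ring V\<close> are indexed by the elements of \<open>V\<close>; thus \<open>S = k[x\<^sub>1, \<dots>, x\<^sub>n]\<close> is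
  \<open>poly_ring {1..n}\<close>. The coefficient field is a type \<open>'k\<close>, seen as a ring object via
  \<open>class_ring\<close> when vector spaces over it are considered.
\<close>

type_synonym ('v, 'k) mpoly = "('v \<Rightarrow>\<^sub>0 nat) \<Rightarrow>\<^sub>0 'k"

definition poly_ring :: "'v set \<Rightarrow> ('v, 'k::field) mpoly ring" where
  "poly_ring V = \<lparr>carrier = {f. \<forall>e \<in> Poly_Mapping.keys f. Poly_Mapping.keys e \<subseteq> V},
     mult = (*), one = 1, zero = 0, add = (+)\<rparr>"

definition poly_var :: "'v \<Rightarrow> ('v, 'k::field) mpoly" where
  "poly_var t = Poly_Mapping.single (Poly_Mapping.single t 1) 1"

definition poly_const :: "'k \<Rightarrow> ('v, 'k::field) mpoly" where
  "poly_const c = Poly_Mapping.single 0 c"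

definition poly_eval :: "('v \<Rightarrow> 'k) \<Rightarrow> ('v, 'k::field) mpoly \<Rightarrow> 'k" where
  "poly_eval a f = (\<Sum>e \<in> Poly_Mapping.keys f. Poly_Mapping.lookup f e *
     (\<Prod>v \<in> Poly_Mapping.keys e. a v ^ Poly_Mapping.lookup e v))"

text \<open>
  The affine space \<open>k\<^sup>V\<close> is \<open>V \<rightarrow>\<^sub>E UNIV\<close>; its open sets are the complements of the common zero
  sets of families of polynomials.
\<close>

definition zariski_open :: "'v set \<Rightarrow> ('v \<Rightarrow> 'k::field) set \<Rightarrow> bool" where
  "zariski_open V U \<longleftrightarrow> (\<exists>P \<subseteq> carrier (poly_ring V).
     U = {a \<in> V \<rightarrow>\<^sub>E UNIV. \<exists>f \<in> P. poly_eval a f \<noteq> 0})"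

definition homogeneous :: "nat set \<Rightarrow> int \<Rightarrow> (nat, 'k::field) mpoly set" where
  "homogeneous V j = {f \<in> carrier (poly_ring V). \<forall>e \<in> Poly_Mapping.keys f.
     int (\<Sum>t \<in> Poly_Mapping.keys e. Poly_Mapping.lookup e t) = j}"

definition linear_form :: "nat \<Rightarrow> (nat \<times> nat \<Rightarrow> 'k::field) \<Rightarrow> nat \<Rightarrow> (nat, 'k) mpoly" where
  "linear_form n a p = (\<Sum>t = 1..n. poly_const (a (t, p)) * poly_var t)"

definition face_monom :: "nat set \<Rightarrow> (nat, 'k::field) mpoly" where
  "face_monom F = (\<Prod>t \<in> F. poly_var t)"


section \<open>Constructions with modules\<close>

text \<open>
  Records of type \<open>module\<close> extend those of type \<open>ring\<close>; the fields \<open>mult\<close> and \<open>one\<close> play no role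
  for modules and are filled with zeros.
\<close>

definition quot_module :: "('a, 'b, 'c) module_scheme \<Rightarrow> 'b set \<Rightarrow> ('a, 'b set) module" where
  "quot_module M N = \<lparr>carrier = a_rcosets\<^bsub>M\<^esub> N, mult = (\<lambda>_ _. N), one = N, zero = N,
     add = set_add M, smult = (\<lambda>r X. \<Union>x \<in> X. N +>\<^bsub>M\<^esub> (r \<odot>\<^bsub>M\<^esub> x))\<rparr>"

definition prod_module :: "'i set \<Rightarrow> ('i \<Rightarrow> ('a, 'b) module) \<Rightarrow> ('a, 'i \<Rightarrow> 'b) module" where
  "prod_module I M = \<lparr>carrier = (\<Pi>\<^sub>E i \<in> I. carrier (M i)),
     mult = (\<lambda>_ _. \<lambda>i \<in> I. \<zero>\<^bsub>M i\<^esub>), one = (\<lambda>i \<in> I. \<zero>\<^bsub>M i\<^esub>), zero = (\<lambda>i \<in> I. \<zero>\<^bsub>M i\<^esub>),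
     add = (\<lambda>u v. \<lambda>i \<in> I. u i \<oplus>\<^bsub>M i\<^esub> v i), smult = (\<lambda>r u. \<lambda>i \<in> I. r \<odot>\<^bsub>M i\<^esub> u i)\<rparr>"

text \<open>A ring \<open>A\<close> as a module over the source of a ring homomorphism \<open>\<phi>\<close> into \<open>A\<close>.\<close>

definition ring_module :: "('a \<Rightarrow> 'b) \<Rightarrow> 'b ring \<Rightarrow> ('a, 'b) module" where
  "ring_module \<phi> A = \<lparr>carrier = carrier A, mult = mult A, one = one A, zero = zero A,
     add = add A, smult = (\<lambda>r x. \<phi> r \<otimes>\<^bsub>A\<^esub> x)\<rparr>"

text \<open>
  The subset \<open>W\<close> of a module over a polynomial ring, as a vector space over the field of
  constants.
\<close>

definition vspace :: "(('v, 'k::field) mpoly, 'b) module \<Rightarrow> 'b set \<Rightarrow> ('k, 'b) module" where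
  "vspace M W = \<lparr>carrier = W, mult = mult M, one = one M, zero = zero M, add = add M,
     smult = (\<lambda>c x. poly_const c \<odot>\<^bsub>M\<^esub> x)\<rparr>"

definition module_iso ::
    "('a, 'r) ring_scheme \<Rightarrow> ('a, 'b, 'm) module_scheme \<Rightarrow> ('a, 'c, 'n) module_scheme \<Rightarrow>
     ('b \<Rightarrow> 'c) set" where
  "module_iso R M N = {f \<in> LinearCombinations.module_hom R M N. bij_betw f (carrier M) (carrier N)}"

text \<open>
  The fraction \<open>x / f\<^sup>a\<close> in the localization \<open>M\<^sub>f\<close>: the class of \<open>(x, a)\<close> under
  \<open>(x, a) \<sim> (y, b) \<longleftrightarrow> (\<exists>c. f\<^sup>c f\<^sup>b x = f\<^sup>c f\<^sup>a y)\<close>.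
\<close>

definition mod_frac ::
    "('a, 'r) ring_scheme \<Rightarrow> ('a, 'b, 'm) module_scheme \<Rightarrow> 'a \<Rightarrow> 'b \<Rightarrow> nat \<Rightarrow> ('b \<times> nat) set" where
  "mod_frac R M f x a = {(y, b). y \<in> carrier M \<and>
     (\<exists>c. (f [^]\<^bsub>R\<^esub> (c + b)) \<odot>\<^bsub>M\<^esub> x = (f [^]\<^bsub>R\<^esub> (c + a)) \<odot>\<^bsub>M\<^esub> y)}"

definition localization ::
    "('a, 'r) ring_scheme \<Rightarrow> ('a, 'b, 'm) module_scheme \<Rightarrow> 'a \<Rightarrow> ('a, ('b \<times> nat) set) module" where
  "localization R M f = \<lparr>carrier = {mod_frac R M f x a | x a. x \<in> carrier M},
     mult = (\<lambda>_ _. mod_frac R M f \<zero>\<^bsub>M\<^esub> 0), one = mod_frac R M f \<zero>\<^bsub>M\<^esub> 0, zero = mod_frac R M f \<zero>\<^bsub>M\<^esub> 0,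
     add = (\<lambda>X Y. \<Union>(x, a) \<in> X. \<Union>(y, b) \<in> Y.
       mod_frac R M f ((f [^]\<^bsub>R\<^esub> b) \<odot>\<^bsub>M\<^esub> x \<oplus>\<^bsub>M\<^esub> (f [^]\<^bsub>R\<^esub> a) \<odot>\<^bsub>M\<^esub> y) (a + b)),
     smult = (\<lambda>r X. \<Union>(x, a) \<in> X. mod_frac R M f (r \<odot>\<^bsub>M\<^esub> x) a)\<rparr>"

text \<open>The canonical map \<open>M\<^sub>f \<rightarrow> M\<^sub>f\<^sub>g\<close>, sending \<open>x / f\<^sup>a\<close> to \<open>g\<^sup>a x / (f g)\<^sup>a\<close>.\<close>

definition localization_map ::
    "('a, 'r) ring_scheme \<Rightarrow> ('a, 'b, 'm) module_scheme \<Rightarrow> 'a \<Rightarrow> 'a \<Rightarrow>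
     ('b \<times> nat) set \<Rightarrow> ('b \<times> nat) set" where
  "localization_map R M f g X =
     (\<Union>(x, a) \<in> X. mod_frac R M (f \<otimes>\<^bsub>R\<^esub> g) ((g [^]\<^bsub>R\<^esub> a) \<odot>\<^bsub>M\<^esub> x) a)"


section \<open>Cochain complexes\<close>

definition cocycles ::
    "(int \<Rightarrow> ('a, 'b) module) \<Rightarrow> (int \<Rightarrow> 'b \<Rightarrow> 'b) \<Rightarrow> int \<Rightarrow> 'b set" where
  "cocycles C \<delta> p = {z \<in> carrier (C p). \<delta> p z = \<zero>\<^bsub>C (p + 1)\<^esub>}"

definition coboundaries ::
    "(int \<Rightarrow> ('a, 'b) module) \<Rightarrow> (int \<Rightarrow> 'b \<Rightarrow> 'b) \<Rightarrow> int \<Rightarrow> 'b set" where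
  "coboundaries C \<delta> p = \<delta> (p - 1) ` carrier (C (p - 1))"

definition cohomology ::
    "(int \<Rightarrow> ('a, 'b) module) \<Rightarrow> (int \<Rightarrow> 'b \<Rightarrow> 'b) \<Rightarrow> int \<Rightarrow> ('a, 'b set) module" where
  "cohomology C \<delta> p =
     quot_module ((C p)\<lparr>carrier := cocycles C \<delta> p\<rparr>) (coboundaries C \<delta> p)"


section \<open>Local cohomology\<close>

text \<open>
  Local cohomology of a module \<open>M\<close> over \<open>S = k[x\<^sub>1, \<dots>, x\<^sub>n]\<close> with support in
  \<open>(x\<^sub>1, \<dots>, x\<^sub>n)\<close>, as the cohomology of the Cech complex with
  \<open>C\<^sup>p = \<Oplus> {M\<^bsub>x\<^sub>F\<^esub> | F \<subseteq> {1..n}, card F = p}\<close>, where \<open>x\<^sub>F\<close> is the product of the \<open>x\<^sub>t\<close> with \<open>t \<in> F\<close>.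
\<close>

definition subsets_of_card :: "nat \<Rightarrow> int \<Rightarrow> nat set set" where
  "subsets_of_card n p = {F. F \<subseteq> {1..n} \<and> int (card F) = p}"

definition cech_module ::
    "nat \<Rightarrow> ((nat, 'k::field) mpoly, 'b) module \<Rightarrow> int \<Rightarrow>
     ((nat, 'k) mpoly, nat set \<Rightarrow> ('b \<times> nat) set) module" where
  "cech_module n M p =
     prod_module (subsets_of_card n p) (\<lambda>F. localization (poly_ring {1..n}) M (face_monom F))"

definition cech_diff ::
    "nat \<Rightarrow> ((nat, 'k::field) mpoly, 'b) module \<Rightarrow> int \<Rightarrow>
     (nat set \<Rightarrow> ('b \<times> nat) set) \<Rightarrow> (nat set \<Rightarrow> ('b \<times> nat) set)" where
  "cech_diff n M p u = (\<lambda>F \<in> subsets_of_card n (p + 1).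
     let L = localization (poly_ring {1..n}) M (face_monom F) in
     (\<Oplus>\<^bsub>L\<^esub> t \<in> F. ((- 1) ^ card {s \<in> F. s < t}) \<odot>\<^bsub>L\<^esub>
        localization_map (poly_ring {1..n}) M (face_monom (F - {t})) (poly_var t) (u (F - {t}))))"

definition local_cohomology ::
    "nat \<Rightarrow> ((nat, 'k::field) mpoly, 'b) module \<Rightarrow> int \<Rightarrow>
     ((nat, 'k) mpoly, (nat set \<Rightarrow> ('b \<times> nat) set) set) module" where
  "local_cohomology n M l = cohomology (cech_module n M) (cech_diff n M) l"

text \<open>
  If \<open>M\<close> is graded with components \<open>G j\<close>, then \<open>x / x\<^sub>F\<^sup>a\<close> has degree \<open>j\<close> if \<open>x\<close> has degree
  \<open>j + a * card F\<close>, a Cech cochain has degree \<open>j\<close> if all its entries do, and a cohomology class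
  has degree \<open>j\<close> if it is represented by a cocycle of degree \<open>j\<close>.
\<close>

definition localization_deg ::
    "nat \<Rightarrow> ((nat, 'k::field) mpoly, 'b) module \<Rightarrow> (int \<Rightarrow> 'b set) \<Rightarrow> nat set \<Rightarrow> int \<Rightarrow>
     ('b \<times> nat) set set" where
  "localization_deg n M G F j =
     {mod_frac (poly_ring {1..n}) M (face_monom F) x a | x a. x \<in> G (j + int a * int (card F))}"

definition local_cohomology_deg ::
    "nat \<Rightarrow> ((nat, 'k::field) mpoly, 'b) module \<Rightarrow> (int \<Rightarrow> 'b set) \<Rightarrow> int \<Rightarrow> int \<Rightarrow>
     (nat set \<Rightarrow> ('b \<times> nat) set) set set" where
  "local_cohomology_deg n M G l j =
     {coboundaries (cech_module n M) (cech_diff n M) l +>\<^bsub>cech_module n M l\<^esub> z | z.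
        z \<in> cocycles (cech_module n M) (cech_diff n M) l \<and>
        (\<forall>F \<in> subsets_of_card n l. z F \<in> localization_deg n M G F j)}"


section \<open>Graded parts and truncations\<close>

text \<open>The internal sum \<open>\<Sum>j \<in> J. G j\<close> of a family of subgroups of \<open>M\<close>.\<close>

definition sum_of_parts :: "('a, 'b, 'm) module_scheme \<Rightarrow> (int \<Rightarrow> 'b set) \<Rightarrow> int set \<Rightarrow> 'b set" where
  "sum_of_parts M G J =
     {(\<Oplus>\<^bsub>M\<^esub> j \<in> K. x j) | K x. finite K \<and> K \<subseteq> J \<and> x \<in> (\<Pi> j \<in> K. G j)}"

text \<open>
  The quotient of a graded module by its part in degrees \<open>\<ge> c\<close>, and the component of degree \<open>j\<close>
  of this quotient.
\<close>

definition truncation ::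
    "('a, 'b, 'm) module_scheme \<Rightarrow> (int \<Rightarrow> 'b set) \<Rightarrow> int \<Rightarrow> ('a, 'b set) module" where
  "truncation M G c = quot_module M (sum_of_parts M G {c..})"

definition truncation_deg ::
    "('a, 'b, 'm) module_scheme \<Rightarrow> (int \<Rightarrow> 'b set) \<Rightarrow> int \<Rightarrow> int \<Rightarrow> 'b set set" where
  "truncation_deg M G c j = (\<lambda>x. sum_of_parts M G {c..} +>\<^bsub>M\<^esub> x) ` G j"


section \<open>Simplicial complexes\<close>

definition simplicial_complex :: "nat \<Rightarrow> nat set set \<Rightarrow> bool" where
  "simplicial_complex n \<Delta> \<longleftrightarrow>
     \<Delta> \<noteq> {} \<and> \<Delta> \<subseteq> Pow {1..n} \<and> (\<forall>F \<in> \<Delta>. \<forall>G. G \<subseteq> F \<longrightarrow> G \<in> \<Delta>)"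

definition complex_dim :: "nat set set \<Rightarrow> int" where
  "complex_dim \<Delta> = Max ((\<lambda>F. int (card F) - 1) ` \<Delta>)"

definition cost :: "nat set set \<Rightarrow> nat set \<Rightarrow> nat set set" where
  "cost \<Delta> F = {\<sigma> \<in> \<Delta>. \<not> F \<subseteq> \<sigma>}"

text \<open>
  Relative simplicial cochains of \<open>(\<Delta>, \<Gamma>)\<close> are functions on the faces in \<open>\<Delta> - \<Gamma>\<close>. The empty
  face, of dimension \<open>- 1\<close>, is included, so that \<open>\<Gamma> = {}\<close> yields reduced cohomology. For a
  nonempty complex \<open>\<Gamma>\<close> the empty face lies in \<open>\<Gamma>\<close> and does not contribute.
\<close>

definition rel_faces :: "nat set set \<Rightarrow> nat set set \<Rightarrow> int \<Rightarrow> nat set set" where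
  "rel_faces \<Delta> \<Gamma> i = {\<sigma> \<in> \<Delta> - \<Gamma>. int (card \<sigma>) = i + 1}"

definition rel_cochains ::
    "nat set set \<Rightarrow> nat set set \<Rightarrow> int \<Rightarrow> ('k::field, nat set \<Rightarrow> 'k) module" where
  "rel_cochains \<Delta> \<Gamma> i = ring.func_space class_ring (rel_faces \<Delta> \<Gamma> i)"

definition rel_diff ::
    "nat set set \<Rightarrow> nat set set \<Rightarrow> int \<Rightarrow> (nat set \<Rightarrow> 'k::field) \<Rightarrow> (nat set \<Rightarrow> 'k)" where
  "rel_diff \<Delta> \<Gamma> i u = (\<lambda>\<sigma> \<in> rel_faces \<Delta> \<Gamma> (i + 1). \<Sum>t \<in> \<sigma>.
     (- 1) ^ card {s \<in> \<sigma>. s < t} * (if \<sigma> - {t} \<in> \<Gamma> then 0 else u (\<sigma> - {t})))"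

text \<open>\<open>H\<^sup>i\<^sub>F(\<Delta>) = H\<^sup>i(\<Delta>, cost F)\<close>\<close>

definition face_cohomology ::
    "nat set set \<Rightarrow> nat set \<Rightarrow> int \<Rightarrow> ('k::field, (nat set \<Rightarrow> 'k) set) module" where
  "face_cohomology \<Delta> F i =
     cohomology (rel_cochains \<Delta> (cost \<Delta> F)) (rel_diff \<Delta> (cost \<Delta> F)) i"


section \<open>Face rings and their reductions modulo linear forms\<close>

definition face_ideal :: "nat \<Rightarrow> nat set set \<Rightarrow> (nat, 'k::field) mpoly set" where
  "face_ideal n \<Delta> = Idl\<^bsub>poly_ring {1..n}\<^esub> {face_monom F | F. F \<subseteq> {1..n} \<and> F \<notin> \<Delta>}"

definition face_ring :: "nat \<Rightarrow> nat set set \<Rightarrow> (nat, 'k::field) mpoly set ring" where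
  "face_ring n \<Delta> = poly_ring {1..n} Quot face_ideal n \<Delta>"

definition face_proj ::
    "nat \<Rightarrow> nat set set \<Rightarrow> (nat, 'k::field) mpoly \<Rightarrow> (nat, 'k) mpoly set" where
  "face_proj n \<Delta> f = face_ideal n \<Delta> +>\<^bsub>poly_ring {1..n}\<^esub> f"

definition face_module ::
    "nat \<Rightarrow> nat set set \<Rightarrow> ((nat, 'k::field) mpoly, (nat, 'k) mpoly set) module" where
  "face_module n \<Delta> = ring_module (face_proj n \<Delta>) (face_ring n \<Delta>)"

definition face_module_deg ::
    "nat \<Rightarrow> nat set set \<Rightarrow> int \<Rightarrow> (nat, 'k::field) mpoly set set" where
  "face_module_deg n \<Delta> j = face_proj n \<Delta> ` homogeneous {1..n} j"

definition theta_ideal ::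
    "nat \<Rightarrow> nat set set \<Rightarrow> (nat \<Rightarrow> (nat, 'k::field) mpoly) \<Rightarrow> nat \<Rightarrow>
     (nat, 'k) mpoly set set" where
  "theta_ideal n \<Delta> \<theta> m = Idl\<^bsub>face_ring n \<Delta>\<^esub> {face_proj n \<Delta> (\<theta> p) | p. p \<in> {1..m}}"

definition reduced_ring ::
    "nat \<Rightarrow> nat set set \<Rightarrow> (nat \<Rightarrow> (nat, 'k::field) mpoly) \<Rightarrow> nat \<Rightarrow>
     (nat, 'k) mpoly set set ring" where
  "reduced_ring n \<Delta> \<theta> m = face_ring n \<Delta> Quot theta_ideal n \<Delta> \<theta> m"

definition reduced_proj ::
    "nat \<Rightarrow> nat set set \<Rightarrow> (nat \<Rightarrow> (nat, 'k::field) mpoly) \<Rightarrow> nat \<Rightarrow>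
     (nat, 'k) mpoly \<Rightarrow> (nat, 'k) mpoly set set" where
  "reduced_proj n \<Delta> \<theta> m f = theta_ideal n \<Delta> \<theta> m +>\<^bsub>face_ring n \<Delta>\<^esub> face_proj n \<Delta> f"

definition reduced_module ::
    "nat \<Rightarrow> nat set set \<Rightarrow> (nat \<Rightarrow> (nat, 'k::field) mpoly) \<Rightarrow> nat \<Rightarrow>
     ((nat, 'k) mpoly, (nat, 'k) mpoly set set) module" where
  "reduced_module n \<Delta> \<theta> m = ring_module (reduced_proj n \<Delta> \<theta> m) (reduced_ring n \<Delta> \<theta> m)"

definition reduced_module_deg ::
    "nat \<Rightarrow> nat set set \<Rightarrow> (nat \<Rightarrow> (nat, 'k::field) mpoly) \<Rightarrow> nat \<Rightarrow> int \<Rightarrow>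
     (nat, 'k) mpoly set set set" where
  "reduced_module_deg n \<Delta> \<theta> m j = reduced_proj n \<Delta> \<theta> m ` homogeneous {1..n} j"

definition H_reduced where
  "H_reduced n \<Delta> \<theta> m l = local_cohomology n (reduced_module n \<Delta> \<theta> m) l"

definition H_reduced_deg where
  "H_reduced_deg n \<Delta> \<theta> m l j =
     local_cohomology_deg n (reduced_module n \<Delta> \<theta> m) (reduced_module_deg n \<Delta> \<theta> m) l j"

definition H_face where
  "H_face n \<Delta> l = local_cohomology n (face_module n \<Delta>) l"

definition H_face_deg where
  "H_face_deg n \<Delta> l j = local_cohomology_deg n (face_module n \<Delta>) (face_module_deg n \<Delta>) l j"

text \<open>
  \<open>theta_ker n \<Delta> \<theta> l m i\<close> is \<open>ker\<^sup>l\<^bsub>m,i\<^esub>\<close>, the component of degree \<open>- (i + 1)\<close> of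
  \<open>theta_ker_module n \<Delta> \<theta> l m\<close>, which is \<open>ker\<^sup>l\<^sub>m\<close>.
\<close>

definition theta_ker where
  "theta_ker n \<Delta> \<theta> l m i =
     {h \<in> H_face_deg n \<Delta> l (- (i + 1)). \<forall>p \<in> {1..m}. \<theta> p \<odot>\<^bsub>H_face n \<Delta> l\<^esub> h = \<zero>\<^bsub>H_face n \<Delta> l\<^esub>}"

definition theta_ker_module where
  "theta_ker_module n \<Delta> \<theta> l m = (H_face n \<Delta> l)
     \<lparr>carrier := sum_of_parts (H_face n \<Delta> l) (theta_ker n \<Delta> \<theta> l m) UNIV\<rparr>"

definition theta_ker_deg where
  "theta_ker_deg n \<Delta> \<theta> l m j = theta_ker n \<Delta> \<theta> l m (- j - 1)"

definition binomial0 :: "nat \<Rightarrow> int \<Rightarrow> nat" where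
  "binomial0 a b = (if b < 0 then 0 else a choose nat b)"

end

(*
  Genericity is only used through the condition that for every face F the first |F| columns of the
  coefficient matrix, restricted to the rows in F, form an invertible matrix. The product of these
  determinants is a polynomial that does not vanish at Vandermonde matrices.

  The localizations of a quotient S/I at the x_F are subquotients of the Laurent polynomial ring, so
  the Cech complexes become complexes of Laurent polynomials. There theta_1, ..., theta_d is a regular
  sequence on every proper localization of the face ring: modulo the ideal attached to the link of F
  this is Gaussian elimination when m <= |F|, and for m > |F| the localized quotient vanishes.
  Hence the kernel of theta_(m+1) on the m-th reduction has no local cohomology in positive
  cohomological degrees, and iterating the connecting homomorphisms relates H^l of the reduction modulo
  theta_1, ..., theta_m to the common kernel of these forms on H^(l+m) of the face ring. This
  relation is an isomorphism in negative degrees as soon as theta_(m+1) maps the common kernel of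
  theta_1, ..., theta_m onto itself in degrees < -m.

  In the fine grading the part of H^p of degree alpha <= 0 is the relative cohomology of
  (Delta, cost(supp alpha)), and a degree alpha with a positive entry contributes nothing because a
  cone contracts it. A linear form acts on these families by a weighted sum over alpha - e_t, so
  the surjectivity follows by induction on the size of supports, solving the equations with the
  invertible matrix of each face. The dimensions follow from rank-nullity, by Pascal's rule in m.
*)
theory Submission
  imports Defs "HOL-Library.Function_Algebras" "Jordan_Normal_Form.Determinant"
begin

text \<open>Connecting homomorphisms depend on choices, so none is built as a map:
  \<open>Rel\<close> relates representatives, and \<open>presents_iso\<close> turns such an additive
  correspondence into an isomorphism. For this, every record of cosets of classes of fractions is
  first read as a quotient of explicit sets of families of Laurent polynomials. The bound on degrees
  comes from surjectivity. A preimage of w under theta_(m+1) must also be annihilated by theta_1,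
  ..., theta_m, so m + 1 equations are solved at once, with right-hand sides 0, ..., 0, w; that w
  lies in the common kernel is exactly their compatibility. On inverse monomials with support N,
  each equation uses up one variable of N and one unit of degree. If the variables run out first,
  the remaining equations concern the empty support, which occurs only in degree 0; right-hand sides
  of degree at most -(m+1) never get there. Each connecting homomorphism shifts the degree by one,
  so that on the m-th reduction this bound reads: degree at most -1.\<close>

declare One_nat_def [simp del]

section \<open>Module records as quotients of explicit subgroups\<close>

section \<open>Subquotients presenting module records\<close>

locale action =
  fixes R :: "('r, 'q) ring_scheme" (structure) and act :: "'r \<Rightarrow> 'x::ab_group_add \<Rightarrow> 'x"
  assumes cring_R: "cring R"
    and act_add: "r \<in> carrier R \<Longrightarrow> act r (x + y) = act r x + act r y"
    and act_plus: "r \<in> carrier R \<Longrightarrow> s \<in> carrier R \<Longrightarrow> act (r \<oplus> s) x = act r x + act s x"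
    and act_mult: "r \<in> carrier R \<Longrightarrow> s \<in> carrier R \<Longrightarrow> act (r \<otimes> s) x = act r (act s x)"
    and act_one: "act \<one> x = x"
begin

lemma act_zero: "r \<in> carrier R \<Longrightarrow> act r 0 = 0"
  using act_add[of r 0 0] by simp

lemma act_minus: "r \<in> carrier R \<Longrightarrow> act r (x - y) = act r x - act r y"
  using act_add[of r "x - y" y] by (simp add: algebra_simps)

lemma act_sum: "r \<in> carrier R \<Longrightarrow> act r (sum f A) = (\<Sum>i\<in>A. act r (f i))"
  by (induction A rule: infinite_finite_induct) (auto simp: act_zero act_add)

end

text \<open>One predicate for ideals, S-submodules and k-subspaces: only the ring and its action
  vary.\<close>

definition submod :: "('r, 'q) ring_scheme \<Rightarrow> ('r \<Rightarrow> 'x::ab_group_add \<Rightarrow> 'x) \<Rightarrow> 'x set \<Rightarrow> bool" where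
  "submod R act A \<longleftrightarrow> 0 \<in> A \<and> (\<forall>x\<in>A. \<forall>y\<in>A. x - y \<in> A) \<and> (\<forall>r\<in>carrier R. \<forall>x\<in>A. act r x \<in> A)"

lemma submodI:
  assumes "0 \<in> A" "\<And>x y. x \<in> A \<Longrightarrow> y \<in> A \<Longrightarrow> x - y \<in> A"
    "\<And>r x. r \<in> carrier R \<Longrightarrow> x \<in> A \<Longrightarrow> act r x \<in> A"
  shows "submod R act A"
  using assms by (simp add: submod_def)

lemma submod_0: "submod R act A \<Longrightarrow> 0 \<in> A"
  and submod_diff: "submod R act A \<Longrightarrow> x \<in> A \<Longrightarrow> y \<in> A \<Longrightarrow> x - y \<in> A"
  and submod_act: "submod R act A \<Longrightarrow> r \<in> carrier R \<Longrightarrow> x \<in> A \<Longrightarrow> act r x \<in> A"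
  by (auto simp: submod_def)

lemma submod_uminus: "submod R act A \<Longrightarrow> x \<in> A \<Longrightarrow> - x \<in> A"
  using submod_diff[of R act A 0 x] submod_0[of R act A] by simp

lemma submod_add: "submod R act A \<Longrightarrow> x \<in> A \<Longrightarrow> y \<in> A \<Longrightarrow> x + y \<in> A"
  using submod_diff[of R act A x "- y"] submod_uminus[of R act A y] by simp

lemma submod_sum: "submod R act A \<Longrightarrow> (\<And>i. i \<in> I \<Longrightarrow> f i \<in> A) \<Longrightarrow> sum f I \<in> A"
  by (induction I rule: infinite_finite_induct) (auto simp: submod_0 submod_add)

lemma submod_diff_iff:
  assumes "submod R act A" "x - y \<in> A"
  shows "x \<in> A \<longleftrightarrow> y \<in> A"
proof
  assume "x \<in> A"
  then have "x - (x - y) \<in> A" using assms submod_diff by blast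
  then show "y \<in> A" by simp
next
  assume "y \<in> A"
  then have "(x - y) + y \<in> A" using assms submod_add by blast
  then show "x \<in> A" by simp
qed

text \<open>\<open>\<rho>\<close> identifies the module record \<open>M\<close> with \<open>A / D\<close>.\<close>

definition presents where
  "presents R act A D \<rho> M \<longleftrightarrow> action R act \<and> submod R act A \<and> submod R act D \<and> D \<subseteq> A \<and>
     carrier M = \<rho> ` A \<and> \<zero>\<^bsub>M\<^esub> = \<rho> 0 \<and>
     (\<forall>x\<in>A. \<forall>y\<in>A. \<rho> (x + y) = \<rho> x \<oplus>\<^bsub>M\<^esub> \<rho> y) \<and>
     (\<forall>r\<in>carrier R. \<forall>x\<in>A. \<rho> (act r x) = r \<odot>\<^bsub>M\<^esub> \<rho> x) \<and>
     (\<forall>x\<in>A. \<forall>y\<in>A. \<rho> x = \<rho> y \<longleftrightarrow> x - y \<in> D)"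

lemma presents_module:
  assumes "presents R act A D \<rho> M"
  shows "Module.module R M"
proof -
  interpret action R act using assms by (simp add: presents_def)
  have A: "submod R act A" and c: "carrier M = \<rho> ` A" and z: "\<zero>\<^bsub>M\<^esub> = \<rho> 0"
    using assms by (auto simp: presents_def)
  have a: "\<rho> x \<oplus>\<^bsub>M\<^esub> \<rho> y = \<rho> (x + y)" if "x \<in> A" "y \<in> A" for x y
    using assms that by (auto simp: presents_def)
  have s: "r \<odot>\<^bsub>M\<^esub> \<rho> x = \<rho> (act r x)" if "r \<in> carrier R" "x \<in> A" for r x
    using assms that by (auto simp: presents_def)
  note A' = submod_0[OF A] submod_add[OF A] submod_act[OF A] submod_uminus[OF A]
  interpret R: cring R by (rule cring_R)
  have ab: "abelian_group M"
  proof (rule abelian_groupI, goal_cases)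
    case (6 x)
    then obtain x' where "x' \<in> A" "x = \<rho> x'" using c by auto
    then show ?case using A' a[of "- x'" x'] by (auto simp: c z intro!: bexI[of _ "- x'"])
  qed (auto simp: c z a A' ac_simps)
  show ?thesis
    by (rule moduleI[OF cring_R ab]) (auto simp: c s a A' act_add act_plus act_mult act_one)
qed

lemma presents_submod:
  assumes "presents R act A D \<rho> M" "submod R act A'" "A' \<subseteq> A"
  shows "presents R act A' (D \<inter> A') \<rho> (M\<lparr>carrier := \<rho> ` A'\<rparr>)"
proof -
  have "submod R act (D \<inter> A')"
    using assms by (auto simp: presents_def submod_def)
  moreover have "x - y \<in> A'" if "x \<in> A'" "y \<in> A'" for x y
    using assms that by (auto simp: submod_def)
  ultimately show ?thesis
    using assms by (auto simp: presents_def subset_iff)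
qed

lemma presents_coset:
  assumes "presents R act A D \<rho> M" "E \<subseteq> A" "x \<in> A"
  shows "\<rho> ` E +>\<^bsub>M\<^esub> \<rho> x = \<rho> ` ((\<lambda>e. e + x) ` E)"
proof -
  have "\<rho> e \<oplus>\<^bsub>M\<^esub> \<rho> x = \<rho> (e + x)" if "e \<in> E" for e
    using assms that by (auto simp: presents_def)
  then show ?thesis by (simp add: a_r_coset_def' image_image UNION_singleton_eq_range)
qed

text \<open>Cosets in \<open>M\<close> are images under \<open>\<rho>\<close> of translates of E.
  Since E contains D, comparing two cosets reduces to a membership in E.\<close>

lemma presents_quot:
  assumes P: "presents R act A D \<rho> M" and E: "submod R act E" "D \<subseteq> E" "E \<subseteq> A"
  shows "presents R act A E (\<lambda>x. \<rho> ` E +>\<^bsub>M\<^esub> \<rho> x) (quot_module M (\<rho> ` E))"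
proof -
  interpret action R act using P by (simp add: presents_def)
  have A: "submod R act A" and D: "submod R act D" and c: "carrier M = \<rho> ` A" and z: "\<zero>\<^bsub>M\<^esub> = \<rho> 0"
    using P by (auto simp: presents_def)
  have a: "\<rho> x \<oplus>\<^bsub>M\<^esub> \<rho> y = \<rho> (x + y)" if "x \<in> A" "y \<in> A" for x y
    using P that by (auto simp: presents_def)
  have s: "r \<odot>\<^bsub>M\<^esub> \<rho> x = \<rho> (act r x)" if "r \<in> carrier R" "x \<in> A" for r x
    using P that by (auto simp: presents_def)
  have k: "\<rho> x = \<rho> y \<longleftrightarrow> x - y \<in> D" if "x \<in> A" "y \<in> A" for x y
    using P that by (auto simp: presents_def)
  note A' = submod_0[OF A] submod_add[OF A] submod_act[OF A] submod_uminus[OF A] submod_diff[OF A]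
  note E' = submod_0[OF E(1)] submod_add[OF E(1)] submod_act[OF E(1)] submod_diff[OF E(1)]
  have EA: "e \<in> A" if "e \<in> E" for e using that E by auto
  note co = presents_coset[OF P E(3)]
  have co_eq: "\<rho> ` E +>\<^bsub>M\<^esub> \<rho> x = \<rho> ` E +>\<^bsub>M\<^esub> \<rho> y \<longleftrightarrow> x - y \<in> E" if xy: "x \<in> A" "y \<in> A" for x y
  proof
    assume "\<rho> ` E +>\<^bsub>M\<^esub> \<rho> x = \<rho> ` E +>\<^bsub>M\<^esub> \<rho> y"
    then have "\<rho> (0 + x) \<in> \<rho> ` ((\<lambda>e. e + y) ` E)"
      unfolding co[OF xy(1)] co[OF xy(2)] using E'(1) by blast
    then obtain e where e: "e \<in> E" "\<rho> x = \<rho> (e + y)" by auto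
    then have "x - (e + y) \<in> D" using k xy A'(2) EA by blast
    then have "(x - (e + y)) + e \<in> E" using E e E' by blast
    then show "x - y \<in> E" by (simp add: algebra_simps)
  next
    have *: "\<rho> ` (\<lambda>e. e + x) ` E \<subseteq> \<rho> ` (\<lambda>e. e + y) ` E" if "x - y \<in> E" for x y
    proof
      fix v assume "v \<in> \<rho> ` (\<lambda>e. e + x) ` E"
      then obtain e where "e \<in> E" "v = \<rho> (e + x)" by auto
      moreover from this that have "e + (x - y) \<in> E" using E' by blast
      moreover have "e + (x - y) + y = e + x" by simp
      ultimately show "v \<in> \<rho> ` (\<lambda>e. e + y) ` E" by (metis image_eqI)
    qed
    assume "x - y \<in> E"
    moreover from this have "y - x \<in> E" using submod_uminus[OF E(1)] by fastforce
    ultimately show "\<rho> ` E +>\<^bsub>M\<^esub> \<rho> x = \<rho> ` E +>\<^bsub>M\<^esub> \<rho> y"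
      unfolding co[OF xy(1)] co[OF xy(2)] using *[of x y] *[of y x] by blast
  qed
  have zero: "\<rho> ` E +>\<^bsub>M\<^esub> \<rho> 0 = \<rho> ` E"
    unfolding co[OF A'(1)] by simp
  have add: "set_add M (\<rho> ` E +>\<^bsub>M\<^esub> \<rho> x) (\<rho> ` E +>\<^bsub>M\<^esub> \<rho> y) = \<rho> ` E +>\<^bsub>M\<^esub> \<rho> (x + y)"
    if xy: "x \<in> A" "y \<in> A" for x y
  proof (rule subset_antisym; rule subsetI)
    fix v assume "v \<in> set_add M (\<rho> ` E +>\<^bsub>M\<^esub> \<rho> x) (\<rho> ` E +>\<^bsub>M\<^esub> \<rho> y)"
    then obtain e e' where e: "e \<in> E" "e' \<in> E" and v: "v = \<rho> (e + x) \<oplus>\<^bsub>M\<^esub> \<rho> (e' + y)"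
      unfolding co[OF xy(1)] co[OF xy(2)] by (auto simp: set_add_def')
    then have "v = \<rho> ((e + e') + (x + y))"
      using xy EA A' by (simp add: a algebra_simps)
    then show "v \<in> \<rho> ` E +>\<^bsub>M\<^esub> \<rho> (x + y)"
      unfolding co[OF A'(2)[OF xy]] using e E' by blast
  next
    fix v assume "v \<in> \<rho> ` E +>\<^bsub>M\<^esub> \<rho> (x + y)"
    then obtain e where e: "e \<in> E" "v = \<rho> (e + (x + y))"
      unfolding co[OF A'(2)[OF xy]] by auto
    then have "v = \<rho> (e + x) \<oplus>\<^bsub>M\<^esub> \<rho> (0 + y)"
      using xy EA A' by (simp add: a algebra_simps)
    then show "v \<in> set_add M (\<rho> ` E +>\<^bsub>M\<^esub> \<rho> x) (\<rho> ` E +>\<^bsub>M\<^esub> \<rho> y)"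
      unfolding co[OF xy(1)] co[OF xy(2)] set_add_def' using e E'(1) by blast
  qed
  \<comment> \<open>Scalar multiplication of a coset is a union over its elements; all sets in this
    union coincide.\<close>
  have sm: "(\<Union>v\<in>\<rho> ` E +>\<^bsub>M\<^esub> \<rho> x. \<rho> ` E +>\<^bsub>M\<^esub> (r \<odot>\<^bsub>M\<^esub> v)) = \<rho> ` E +>\<^bsub>M\<^esub> \<rho> (act r x)"
    if rx: "r \<in> carrier R" "x \<in> A" for r x
  proof -
    have "\<rho> ` E +>\<^bsub>M\<^esub> (r \<odot>\<^bsub>M\<^esub> \<rho> (e + x)) = \<rho> ` E +>\<^bsub>M\<^esub> \<rho> (act r x)" if "e \<in> E" for e
    proof -
      have "act r (e + x) - act r x \<in> E"
        using rx that E' by (simp add: act_add)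
      moreover have "act r (e + x) \<in> A" by (rule A'(3)[OF rx(1) A'(2)[OF EA[OF that] rx(2)]])
      ultimately show ?thesis
        using rx that EA A' by (subst s) (auto simp: co_eq)
    qed
    moreover have "E \<noteq> {}" using E' by auto
    ultimately show ?thesis
      unfolding co[OF rx(2)] by auto
  qed
  show ?thesis
    unfolding presents_def quot_module_def
    using A E co_eq add sm zero c action_axioms
    by (simp add: A_RCOSETS_def' image_image UNION_singleton_eq_range)
qed

text \<open>The correspondence Q need not be single-valued. Because differences of related pairs are
  related, the condition \<open>ker\<close> gives well-definedness and injectivity on classes at the
  same time. Targets have to be reached only up to D2.\<close>

lemma presents_iso:
  assumes P1: "presents R act1 A1 D1 \<rho>1 M1" and P2: "presents R act2 A2 D2 \<rho>2 M2"
    and dom: "\<And>x y. Q x y \<Longrightarrow> x \<in> A1 \<and> y \<in> A2"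
    and tot: "\<And>x. x \<in> A1 \<Longrightarrow> \<exists>y. Q x y"
    and sur: "\<And>y. y \<in> A2 \<Longrightarrow> \<exists>x y'. Q x y' \<and> y - y' \<in> D2"
    and diff: "\<And>x y x' y'. Q x y \<Longrightarrow> Q x' y' \<Longrightarrow> Q (x - x') (y - y')"
    and smul: "\<And>r x y. r \<in> carrier R \<Longrightarrow> Q x y \<Longrightarrow> Q (act1 r x) (act2 r y)"
    and ker: "\<And>x y. Q x y \<Longrightarrow> x \<in> D1 \<longleftrightarrow> y \<in> D2"
  shows "\<exists>\<phi>\<in>module_iso R M1 M2. \<forall>x y. Q x y \<longrightarrow> \<phi> (\<rho>1 x) = \<rho>2 y"
proof -
  have eq1: "\<rho>1 x = \<rho>1 y \<longleftrightarrow> x - y \<in> D1" if "x \<in> A1" "y \<in> A1" for x y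
    using P1 that by (auto simp: presents_def)
  have eq2: "\<rho>2 x = \<rho>2 y \<longleftrightarrow> x - y \<in> D2" if "x \<in> A2" "y \<in> A2" for x y
    using P2 that by (auto simp: presents_def)
  have c1: "carrier M1 = \<rho>1 ` A1" and c2: "carrier M2 = \<rho>2 ` A2"
    using P1 P2 by (auto simp: presents_def)
  \<comment> \<open>Any related y will do: by \<open>wd\<close> its class depends only on the class
    of x.\<close>
  define \<phi> where "\<phi> X = \<rho>2 (SOME y. \<exists>x. \<rho>1 x = X \<and> Q x y)" for X
  have wd: "\<rho>1 x = \<rho>1 x' \<longleftrightarrow> \<rho>2 y = \<rho>2 y'" if "Q x y" "Q x' y'" for x y x' y'
    using ker[OF diff[OF that]] dom[OF that(1)] dom[OF that(2)] eq1 eq2 by auto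
  have \<phi>: "\<phi> (\<rho>1 x) = \<rho>2 y" if "Q x y" for x y
  proof -
    have "\<exists>y x'. \<rho>1 x' = \<rho>1 x \<and> Q x' y" using that by auto
    from someI_ex[OF this] obtain x' where "\<rho>1 x' = \<rho>1 x" "Q x' (SOME y. \<exists>x'. \<rho>1 x' = \<rho>1 x \<and> Q x' y)"
      by blast
    with wd[OF this(2) that] show ?thesis unfolding \<phi>_def by simp
  qed
  \<comment> \<open>Only differences of related pairs are at hand, so x + x' is written as x - ((x'
    - x') - x').\<close>
  have add: "Q (x + x') (y + y')" if "Q x y" "Q x' y'" for x y x' y'
    using diff[OF that(1) diff[OF diff[OF that(2) that(2)] that(2)]] by simp
  have rep: "\<exists>x y. X = \<rho>1 x \<and> Q x y" if "X \<in> carrier M1" for X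
    using that tot unfolding c1 by blast
  have hom: "\<phi> \<in> LinearCombinations.module_hom R M1 M2"
    unfolding LinearCombinations.module_hom_def
  proof (safe, goal_cases)
    case (1 X)
    then obtain x y where "X = \<rho>1 x" "Q x y" using rep by blast
    then show ?case using \<phi> dom by (auto simp: c2)
  next
    case (2 X X')
    then obtain x y x' y' where *: "X = \<rho>1 x" "Q x y" "X' = \<rho>1 x'" "Q x' y'"
      using rep by blast
    have "\<phi> (\<rho>1 (x + x')) = \<rho>2 (y + y')" using \<phi> add * by blast
    then show ?case
      using * dom \<phi>[OF *(2)] \<phi>[OF *(4)] P1 P2 by (simp add: presents_def)
  next
    case (3 r X)
    then obtain x y where *: "X = \<rho>1 x" "Q x y"
      using rep by blast
    have "\<phi> (\<rho>1 (act1 r x)) = \<rho>2 (act2 r y)" using \<phi> smul * 3 by blast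
    then show ?case
      using * 3 dom \<phi>[OF *(2)] P1 P2 by (simp add: presents_def)
  qed
  have "bij_betw \<phi> (carrier M1) (carrier M2)"
    unfolding bij_betw_def
  proof (intro conjI inj_onI subset_antisym subsetI)
    fix X X' assume "X \<in> carrier M1" "X' \<in> carrier M1" and e: "\<phi> X = \<phi> X'"
    then obtain x y x' y' where *: "X = \<rho>1 x" "Q x y" "X' = \<rho>1 x'" "Q x' y'"
      using rep by blast
    then show "X = X'" using e \<phi> wd by metis
  next
    fix Y assume "Y \<in> \<phi> ` carrier M1"
    then show "Y \<in> carrier M2" using hom by (auto simp: LinearCombinations.module_hom_def)
  next
    fix Y assume "Y \<in> carrier M2"
    then obtain y where y: "y \<in> A2" "Y = \<rho>2 y" by (auto simp: c2)
    then obtain x y' where "Q x y'" "y - y' \<in> D2" using sur by blast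
    then have "Y = \<phi> (\<rho>1 x)" "\<rho>1 x \<in> carrier M1" using \<phi> eq2 y dom c1 by auto
    then show "Y \<in> \<phi> ` carrier M1" by blast
  qed
  with hom \<phi> show ?thesis by (auto simp: module_iso_def)
qed

section \<open>Ring homomorphisms given on terms; exponents in the integers\<close>

section \<open>Linear extensions and the Laurent polynomial ring\<close>

lemma poly_mapping_sum_single: "f = (\<Sum>e\<in>Poly_Mapping.keys f. Poly_Mapping.single e (Poly_Mapping.lookup f e))"
  by (rule poly_mapping_eqI) (simp add: lookup_sum lookup_single when_def in_keys_iff)

lemma poly_mapping_add_induct [case_names zero single add]:
  fixes f :: "'a \<Rightarrow>\<^sub>0 'b::comm_monoid_add"
  assumes "P 0" "\<And>e c. P (Poly_Mapping.single e c)" "\<And>f g. P f \<Longrightarrow> P g \<Longrightarrow> P (f + g)"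
  shows "P f"
proof -
  have "P (\<Sum>e\<in>A. Poly_Mapping.single e (Poly_Mapping.lookup f e))" for A
    by (induction A rule: infinite_finite_induct) (auto intro: assms)
  then show ?thesis using poly_mapping_sum_single[of f] by metis
qed

lemma keys_plus_eq:
  fixes e :: "'v \<Rightarrow>\<^sub>0 nat"
  shows "Poly_Mapping.keys (e + e') = Poly_Mapping.keys e \<union> Poly_Mapping.keys e'"
  by (auto simp: in_keys_iff lookup_add)

lemma lookup_single_mult:
  fixes f :: "'a::ab_group_add \<Rightarrow>\<^sub>0 'b::comm_ring_1"
  shows "Poly_Mapping.lookup (Poly_Mapping.single \<alpha> c * f) \<beta> = c * Poly_Mapping.lookup f (\<beta> - \<alpha>)"
  by (induction f rule: poly_mapping_add_induct)
     (auto simp: mult_single lookup_single lookup_add distrib_left when_def algebra_simps)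

text \<open>Evaluation, substitution and the embedding into Laurent polynomials are all of this
  kind; \<open>monomial_hom\<close> says when the result is a ring homomorphism.\<close>

definition lin_ext :: "('a \<Rightarrow> 'c \<Rightarrow> 'r) \<Rightarrow> ('a \<Rightarrow>\<^sub>0 'c::comm_ring_1) \<Rightarrow> 'r::comm_ring_1" where
  "lin_ext \<phi> f = (\<Sum>e\<in>Poly_Mapping.keys f. \<phi> e (Poly_Mapping.lookup f e))"

locale monomial_hom =
  fixes \<phi> :: "'a::comm_monoid_add \<Rightarrow> 'c::comm_ring_1 \<Rightarrow> 'r::comm_ring_1"
  assumes hom_add: "\<phi> e (c + c') = \<phi> e c + \<phi> e c'"
    and hom_mult: "\<phi> (e + e') (c * c') = \<phi> e c * \<phi> e' c'"
    and hom_one: "\<phi> 0 1 = 1"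
begin

lemma hom_zero: "\<phi> e 0 = 0"
  using hom_add[of e 0 0] by simp

lemma lin_ext_zero [simp]: "lin_ext \<phi> 0 = 0"
  by (simp add: lin_ext_def)

lemma lin_ext_single [simp]: "lin_ext \<phi> (Poly_Mapping.single e c) = \<phi> e c"
  by (simp add: lin_ext_def hom_zero)

lemma lin_ext_one [simp]: "lin_ext \<phi> 1 = 1"
  by (simp add: lin_ext_def hom_one)

lemma lin_ext_add: "lin_ext \<phi> (f + g) = lin_ext \<phi> f + lin_ext \<phi> g"
  unfolding lin_ext_def by (rule setsum_keys_plus_distrib) (simp_all add: hom_zero hom_add)

lemma lin_ext_mult: "lin_ext \<phi> (f * g) = lin_ext \<phi> f * lin_ext \<phi> g"
proof (induction f rule: poly_mapping_add_induct)
  case (single e c)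
  show ?case
    by (induction g rule: poly_mapping_add_induct)
       (simp_all add: mult_single hom_mult distrib_left lin_ext_add)
qed (simp_all add: distrib_right lin_ext_add)

lemma lin_ext_minus: "lin_ext \<phi> (f - g) = lin_ext \<phi> f - lin_ext \<phi> g"
  using lin_ext_add[of "f - g" g] by (simp add: algebra_simps)

lemma lin_ext_sum: "lin_ext \<phi> (sum f A) = (\<Sum>i\<in>A. lin_ext \<phi> (f i))"
  by (induction A rule: infinite_finite_induct) (simp_all add: lin_ext_add)

lemma lin_ext_prod: "lin_ext \<phi> (prod f A) = (\<Prod>i\<in>A. lin_ext \<phi> (f i))"
  by (induction A rule: infinite_finite_induct) (simp_all add: lin_ext_mult)

lemma lin_ext_power: "lin_ext \<phi> (f ^ k) = lin_ext \<phi> f ^ k"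
  by (induction k) (simp_all add: lin_ext_mult)

end

definition monom_eval :: "('v \<Rightarrow> 'r::comm_ring_1) \<Rightarrow> ('v \<Rightarrow>\<^sub>0 nat) \<Rightarrow> 'r" where
  "monom_eval a e = (\<Prod>v\<in>Poly_Mapping.keys e. a v ^ Poly_Mapping.lookup e v)"

lemma monom_eval_superset:
  assumes "finite A" "Poly_Mapping.keys e \<subseteq> A"
  shows "monom_eval a e = (\<Prod>v\<in>A. a v ^ Poly_Mapping.lookup e v)"
  unfolding monom_eval_def by (rule prod.mono_neutral_left) (use assms in \<open>auto simp: in_keys_iff\<close>)

lemma monom_eval_add: "monom_eval a (e + e') = monom_eval a e * monom_eval a e'"
proof -
  let ?A = "Poly_Mapping.keys e \<union> Poly_Mapping.keys e'"
  have "monom_eval a x = (\<Prod>v\<in>?A. a v ^ Poly_Mapping.lookup x v)" if "x \<in> {e, e', e + e'}" for x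
    by (rule monom_eval_superset) (use that in \<open>auto simp: keys_plus_eq\<close>)
  then show ?thesis by (simp add: lookup_add power_add prod.distrib)
qed

lemma monom_eval_single: "monom_eval a (Poly_Mapping.single v k) = a v ^ k"
  by (simp add: monom_eval_def)

lemma monom_eval_zero [simp]: "monom_eval a 0 = 1"
  by (simp add: monom_eval_def)

lemma poly_eval_lin_ext: "poly_eval a = lin_ext (\<lambda>e c. c * monom_eval a e)"
  by (rule ext) (simp add: poly_eval_def lin_ext_def monom_eval_def)

interpretation poly_eval: monomial_hom "\<lambda>e c. c * monom_eval a e" for a :: "'v \<Rightarrow> 'k::field"
  by standard (simp_all add: algebra_simps monom_eval_add)

lemma poly_const_add: "poly_const (c + c') = poly_const c + poly_const c'"
  and poly_const_mult: "poly_const (c * c') = poly_const c * poly_const c'"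
  and poly_const_one [simp]: "poly_const 1 = 1"
  and poly_const_zero [simp]: "poly_const 0 = 0"
  by (simp_all add: poly_const_def single_add mult_single)

interpretation poly_subst: monomial_hom "\<lambda>e c. poly_const c * monom_eval \<sigma> e"
  for \<sigma> :: "'v \<Rightarrow> ('w, 'k::field) mpoly"
  by standard (simp_all add: algebra_simps monom_eval_add poly_const_add poly_const_mult)

type_synonym 'k laurent = "(nat \<Rightarrow>\<^sub>0 int) \<Rightarrow>\<^sub>0 'k"

definition int_exp :: "(nat \<Rightarrow>\<^sub>0 nat) \<Rightarrow> (nat \<Rightarrow>\<^sub>0 int)" where
  "int_exp e = Poly_Mapping.map int e"

lemma lookup_int_exp [simp]: "Poly_Mapping.lookup (int_exp e) t = int (Poly_Mapping.lookup e t)"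
  by (simp add: int_exp_def Poly_Mapping.map.rep_eq when_def)

lemma keys_int_exp [simp]: "Poly_Mapping.keys (int_exp e) = Poly_Mapping.keys e"
  by (auto simp: in_keys_iff)

lemma int_exp_add: "int_exp (e + e') = int_exp e + int_exp e'"
  by (rule poly_mapping_eqI) (simp add: lookup_add)

lemma int_exp_zero [simp]: "int_exp 0 = 0"
  by (rule poly_mapping_eqI) simp

lemma int_exp_single [simp]: "int_exp (Poly_Mapping.single t a) = Poly_Mapping.single t (int a)"
  by (rule poly_mapping_eqI) (simp add: lookup_single when_def)

lemma inj_int_exp: "int_exp e = int_exp e' \<longleftrightarrow> e = e'"
  by (auto simp: poly_mapping_eq_iff fun_eq_iff dest: arg_cong[where f = Poly_Mapping.lookup])

lemma int_exp_surj:
  assumes "\<And>t. Poly_Mapping.lookup \<alpha> t \<ge> 0"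
  obtains e where "\<alpha> = int_exp e"
proof
  show "\<alpha> = int_exp (Poly_Mapping.map nat \<alpha>)"
    by (rule poly_mapping_eqI) (simp add: Poly_Mapping.map.rep_eq when_def assms)
qed

definition emb :: "(nat, 'k::field) mpoly \<Rightarrow> 'k laurent" where
  "emb = lin_ext (\<lambda>e c. Poly_Mapping.single (int_exp e) c)"

interpretation emb: monomial_hom "\<lambda>e c. Poly_Mapping.single (int_exp e) c :: 'k::field laurent"
  rewrites "lin_ext (\<lambda>e c. Poly_Mapping.single (int_exp e) c :: 'k laurent) = emb"
  by (standard; simp add: single_add mult_single int_exp_add emb_def)+

lemma lookup_emb: "Poly_Mapping.lookup (emb f) (int_exp e) = Poly_Mapping.lookup f e"
  by (induction f rule: poly_mapping_add_induct)
     (simp_all add: emb.lin_ext_add lookup_add lookup_single when_def inj_int_exp)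

lemma keys_emb: "Poly_Mapping.keys (emb f) = int_exp ` Poly_Mapping.keys f"
proof
  show "Poly_Mapping.keys (emb f) \<subseteq> int_exp ` Poly_Mapping.keys f"
    unfolding emb_def lin_ext_def by (rule order_trans[OF keys_sum]) (auto split: if_splits)
qed (auto simp: in_keys_iff lookup_emb)

lemma emb_inj: "emb f = emb g \<longleftrightarrow> f = g"
  by (metis lookup_emb poly_mapping_eqI)

lemma emb_surj:
  assumes "\<And>\<alpha> t. \<alpha> \<in> Poly_Mapping.keys f \<Longrightarrow> Poly_Mapping.lookup \<alpha> t \<ge> 0"
  obtains g where "f = emb g"
proof -
  have "\<exists>g. emb g = (\<Sum>\<alpha>\<in>A. Poly_Mapping.single \<alpha> (Poly_Mapping.lookup f \<alpha>))"
    if "A \<subseteq> Poly_Mapping.keys f" "finite A" for A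
    using that(2,1)
  proof (induction rule: finite_induct)
    case empty
    show ?case by (intro exI[of _ 0]) simp
  next
    case (insert \<alpha> A)
    then obtain g where "emb g = (\<Sum>\<alpha>\<in>A. Poly_Mapping.single \<alpha> (Poly_Mapping.lookup f \<alpha>))" by auto
    moreover obtain e where "\<alpha> = int_exp e"
      using int_exp_surj assms insert.prems by blast
    ultimately show ?case
      using insert.hyps by (intro exI[of _ "Poly_Mapping.single e (Poly_Mapping.lookup f \<alpha>) + g"])
        (simp add: emb.lin_ext_add)
  qed
  from this[of "Poly_Mapping.keys f"] that poly_mapping_sum_single[of f] show ?thesis by auto
qed

subsection \<open>Polynomial rings as records\<close>

lemma poly_ring_simps [simp]:
  "\<zero>\<^bsub>poly_ring V\<^esub> = 0" "\<one>\<^bsub>poly_ring V\<^esub> = 1" "f \<oplus>\<^bsub>poly_ring V\<^esub> g = f + g" "f \<otimes>\<^bsub>poly_ring V\<^esub> g = f * g"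
  by (simp_all add: poly_ring_def)

lemma in_poly_ring: "f \<in> carrier (poly_ring V) \<longleftrightarrow> (\<forall>e\<in>Poly_Mapping.keys f. Poly_Mapping.keys e \<subseteq> V)"
  by (simp add: poly_ring_def)

lemma poly_ring_zero [simp, intro]: "0 \<in> carrier (poly_ring V)"
  and poly_ring_one [simp, intro]: "1 \<in> carrier (poly_ring V)"
  and poly_ring_const [simp, intro]: "poly_const c \<in> carrier (poly_ring V)"
  and poly_ring_var: "t \<in> V \<Longrightarrow> poly_var t \<in> carrier (poly_ring V)"
  by (simp_all add: in_poly_ring poly_const_def poly_var_def)

lemma poly_ring_add [intro]:
  "f \<in> carrier (poly_ring V) \<Longrightarrow> g \<in> carrier (poly_ring V) \<Longrightarrow> f + g \<in> carrier (poly_ring V)"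
  using keys_add[of f g] by (fastforce simp: in_poly_ring)

lemma poly_ring_uminus [intro]: "f \<in> carrier (poly_ring V) \<Longrightarrow> - f \<in> carrier (poly_ring V)"
  by (simp add: in_poly_ring in_keys_iff)

lemma poly_ring_minus [intro]:
  "f \<in> carrier (poly_ring V) \<Longrightarrow> g \<in> carrier (poly_ring V) \<Longrightarrow> f - g \<in> carrier (poly_ring V)"
  using poly_ring_add[of f V "- g"] poly_ring_uminus[of g V] by simp

lemma poly_ring_mult [intro]:
  assumes "f \<in> carrier (poly_ring V)" "g \<in> carrier (poly_ring V)"
  shows "f * g \<in> carrier (poly_ring V)"
  unfolding in_poly_ring
proof
  fix e assume "e \<in> Poly_Mapping.keys (f * g)"
  then obtain a b where "e = a + b" "a \<in> Poly_Mapping.keys f" "b \<in> Poly_Mapping.keys g"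
    using keys_mult[of f g] by auto
  then show "Poly_Mapping.keys e \<subseteq> V" using assms by (auto simp: in_poly_ring keys_plus_eq)
qed

lemma poly_ring_power [intro]: "f \<in> carrier (poly_ring V) \<Longrightarrow> f ^ k \<in> carrier (poly_ring V)"
  by (induction k) auto

lemma poly_ring_sum [intro]:
  "(\<And>i. i \<in> A \<Longrightarrow> f i \<in> carrier (poly_ring V)) \<Longrightarrow> sum f A \<in> carrier (poly_ring V)"
  by (induction A rule: infinite_finite_induct) auto

lemma poly_ring_prod [intro]:
  "(\<And>i. i \<in> A \<Longrightarrow> f i \<in> carrier (poly_ring V)) \<Longrightarrow> prod f A \<in> carrier (poly_ring V)"
  by (induction A rule: infinite_finite_induct) auto

lemma cring_poly_ring: "cring (poly_ring V)"
proof (rule cringI)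
  show "abelian_group (poly_ring V)"
    by (rule abelian_groupI)
       (auto simp: algebra_simps intro!: bexI[of _ "- x" for x])
  show "Group.comm_monoid (poly_ring V)"
    by (rule comm_monoidI) (auto simp: algebra_simps)
qed (auto simp: algebra_simps)

lemma poly_ring_nat_pow [simp]: "f [^]\<^bsub>poly_ring V\<^esub> (k::nat) = f ^ k"
  by (induction k) (simp_all add: algebra_simps)

lemma poly_ring_a_inv [simp]:
  assumes "f \<in> carrier (poly_ring V)"
  shows "\<ominus>\<^bsub>poly_ring V\<^esub> f = - f"
proof -
  interpret cring "poly_ring V" by (rule cring_poly_ring)
  show ?thesis by (rule minus_equality) (use assms in auto)
qed

lemma action_poly_ring:
  assumes "\<And>r x y. act r (x + y) = act r x + act r (y::'x::ab_group_add)"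
    "\<And>r s x. act (r + s) x = act r x + act s x" "\<And>r s x. act (r * s) x = act r (act s x)" "\<And>x. act 1 x = x"
  shows "action (poly_ring V) act"
  by (rule action.intro[OF cring_poly_ring]) (simp_all add: assms)

lemma poly_ring_face_monom [intro]: "F \<subseteq> V \<Longrightarrow> face_monom F \<in> carrier (poly_ring V)"
  by (auto simp: face_monom_def intro!: poly_ring_prod poly_ring_var)

lemma poly_ring_linear_form [intro]: "linear_form n a p \<in> carrier (poly_ring {1..n})"
  by (auto simp: linear_form_def intro!: poly_ring_sum poly_ring_mult poly_ring_var)

subsection \<open>Restriction of supports and degrees\<close>

definition restr :: "('a \<Rightarrow> bool) \<Rightarrow> ('a \<Rightarrow>\<^sub>0 'b::comm_monoid_add) \<Rightarrow> ('a \<Rightarrow>\<^sub>0 'b)" where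
  "restr P f = (\<Sum>e\<in>{e \<in> Poly_Mapping.keys f. P e}. Poly_Mapping.single e (Poly_Mapping.lookup f e))"

lemma lookup_restr: "Poly_Mapping.lookup (restr P f) e = (if P e then Poly_Mapping.lookup f e else 0)"
  by (simp add: restr_def lookup_sum lookup_single when_def in_keys_iff)

lemma keys_restr: "Poly_Mapping.keys (restr P f) = {e \<in> Poly_Mapping.keys f. P e}"
  by (auto simp: in_keys_iff lookup_restr split: if_splits)

lemma restr_add: "restr P (f + g) = restr P f + restr P g"
  and restr_zero [simp]: "restr P 0 = 0"
  by (rule poly_mapping_eqI; simp add: lookup_restr lookup_add)+

lemma restr_minus:
  fixes f :: "'a \<Rightarrow>\<^sub>0 'b::ab_group_add"
  shows "restr P (f - g) = restr P f - restr P g"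
  by (rule poly_mapping_eqI) (simp add: lookup_restr lookup_minus)

lemma restr_sum: "restr P (sum f A) = (\<Sum>i\<in>A. restr P (f i))"
  by (induction A rule: infinite_finite_induct) (simp_all add: restr_add)

lemma restr_single_mult:
  fixes f :: "'a::ab_group_add \<Rightarrow>\<^sub>0 'b::comm_ring_1"
  shows "restr P (Poly_Mapping.single \<alpha> c * f) = Poly_Mapping.single \<alpha> c * restr (\<lambda>\<beta>. P (\<alpha> + \<beta>)) f"
  by (rule poly_mapping_eqI) (simp add: lookup_restr lookup_single_mult)

definition exp_deg :: "(nat \<Rightarrow>\<^sub>0 'c::comm_monoid_add) \<Rightarrow> 'c" where
  "exp_deg \<alpha> = (\<Sum>t\<in>Poly_Mapping.keys \<alpha>. Poly_Mapping.lookup \<alpha> t)"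

lemma exp_deg_add: "exp_deg (\<alpha> + \<beta>) = exp_deg \<alpha> + exp_deg \<beta>"
  unfolding exp_deg_def by (rule setsum_keys_plus_distrib) simp_all

lemma exp_deg_zero [simp]: "exp_deg 0 = 0"
  by (simp add: exp_deg_def)

lemma exp_deg_single [simp]: "exp_deg (Poly_Mapping.single t a) = a"
  by (simp add: exp_deg_def)

lemma exp_deg_minus: "exp_deg (\<alpha> - \<beta>) = exp_deg \<alpha> - exp_deg (\<beta> :: nat \<Rightarrow>\<^sub>0 int)"
  using exp_deg_add[of "\<alpha> - \<beta>" \<beta>] by simp

lemma exp_deg_int_exp [simp]: "exp_deg (int_exp e) = int (exp_deg e)"
  by (simp add: exp_deg_def)

lemma in_homogeneous:
  "f \<in> homogeneous V j \<longleftrightarrow> f \<in> carrier (poly_ring V) \<and> (\<forall>e\<in>Poly_Mapping.keys f. int (exp_deg e) = j)"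
  by (simp add: homogeneous_def exp_deg_def)

abbreviation hcomp :: "int \<Rightarrow> 'k::field laurent \<Rightarrow> 'k laurent" where
  "hcomp j \<equiv> restr (\<lambda>\<alpha>. exp_deg \<alpha> = j)"

lemma hcomp_mult:
  assumes "\<And>\<alpha>. \<alpha> \<in> Poly_Mapping.keys g \<Longrightarrow> exp_deg \<alpha> = e"
  shows "hcomp j (g * f) = g * hcomp (j - e) f"
proof -
  have "hcomp j (Poly_Mapping.single \<alpha> c * f) = Poly_Mapping.single \<alpha> c * hcomp (j - e) f"
    if "exp_deg \<alpha> = e" for \<alpha> c
  proof -
    have "(\<lambda>\<beta>. exp_deg (\<alpha> + \<beta>) = j) = (\<lambda>\<beta>. exp_deg \<beta> = j - e)"
      using that by (auto simp: exp_deg_add)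
    then show ?thesis by (simp add: restr_single_mult)
  qed
  then have "hcomp j ((\<Sum>\<alpha>\<in>Poly_Mapping.keys g. Poly_Mapping.single \<alpha> (Poly_Mapping.lookup g \<alpha>)) * f) =
      (\<Sum>\<alpha>\<in>Poly_Mapping.keys g. Poly_Mapping.single \<alpha> (Poly_Mapping.lookup g \<alpha>)) * hcomp (j - e) f"
    using assms by (simp add: sum_distrib_right restr_sum)
  then show ?thesis using poly_mapping_sum_single[of g] by simp
qed

section \<open>Fractions as Laurent polynomials\<close>

section \<open>Localizations of cyclic modules\<close>

definition const_exp :: "nat set \<Rightarrow> int \<Rightarrow> (nat \<Rightarrow>\<^sub>0 int)" where
  "const_exp F a = (\<Sum>t\<in>F. Poly_Mapping.single t a)"

lemma lookup_const_exp: "finite F \<Longrightarrow> Poly_Mapping.lookup (const_exp F a) t = (if t \<in> F then a else 0)"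
  by (simp add: const_exp_def lookup_sum lookup_single when_def)

lemma const_exp_add: "const_exp F (a + b) = const_exp F a + const_exp F b"
  by (simp add: const_exp_def single_add sum.distrib)

lemma const_exp_zero [simp]: "const_exp F 0 = 0"
  by (simp add: const_exp_def)

lemma exp_deg_const_exp: "exp_deg (const_exp F a) = int (card F) * a"
  unfolding const_exp_def by (induction F rule: infinite_finite_induct) (simp_all add: exp_deg_add algebra_simps)

definition xpow :: "nat set \<Rightarrow> int \<Rightarrow> 'k::field laurent" where
  "xpow F a = Poly_Mapping.single (const_exp F a) 1"

lemma xpow_add: "xpow F (a + b) = xpow F a * xpow F b"
  by (simp add: xpow_def mult_single const_exp_add)

lemma xpow_zero [simp]: "xpow F 0 = 1"
  by (simp add: xpow_def)

lemma xpow_minus_cancel [simp]: "xpow F a * xpow F (- a) = 1" "xpow F (- a) * xpow F a = 1"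
  using xpow_add[of F a "- a"] xpow_add[of F "- a" a] by simp_all

lemma xpow_cancel_left [simp]:
  "xpow F a * (xpow F (- a) * f) = f" "xpow F (- a) * (xpow F a * f) = f"
  by (simp_all flip: mult.assoc)

lemma xpow_mult_left: "xpow F a * (xpow F b * f) = xpow F (a + b) * f"
  by (simp add: xpow_add mult.assoc)

lemma xpow_Un:
  assumes "finite F" "finite G" "F \<inter> G = {}"
  shows "xpow (F \<union> G) a = xpow F a * xpow G a"
  using assms by (simp add: xpow_def const_exp_def mult_single sum.union_disjoint)

lemma emb_poly_var: "emb (poly_var t) = xpow {t} 1"
  by (simp add: poly_var_def xpow_def const_exp_def)

lemma emb_poly_const: "emb (poly_const c) = Poly_Mapping.single 0 c"
  by (simp add: poly_const_def)

lemma emb_face_monom: "finite F \<Longrightarrow> emb (face_monom F) = xpow F 1"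
proof (induction F rule: finite_induct)
  case (insert t F)
  have "xpow ({t} \<union> F) 1 = xpow {t} 1 * (xpow F 1 :: 'a laurent)"
    using insert by (intro xpow_Un) auto
  then show ?case using insert
    by (simp add: face_monom_def emb.lin_ext_mult emb_poly_var)
qed (simp add: face_monom_def xpow_def const_exp_def)

lemma xpow_power: "xpow F a ^ k = xpow F (int k * a)"
  by (induction k) (simp_all add: algebra_simps xpow_add)

lemma emb_face_monom_power: "finite F \<Longrightarrow> emb (face_monom F ^ k) = xpow F (int k)"
  by (simp add: emb.lin_ext_power emb_face_monom xpow_power)

text \<open>The localization of I at x_F, realized inside the Laurent polynomials, where x_F is
  already a unit. No classes of fractions are needed.\<close>

definition loc :: "(nat, 'k::field) mpoly set \<Rightarrow> nat set \<Rightarrow> 'k laurent set" where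
  "loc I F = {f. \<exists>a::nat. xpow F (int a) * f \<in> emb ` I}"

abbreviation lact :: "(nat, 'k::field) mpoly \<Rightarrow> 'k laurent \<Rightarrow> 'k laurent" where
  "lact r f \<equiv> emb r * f"

lemma action_lact: "action (poly_ring V) lact"
  by (rule action_poly_ring) (simp_all add: algebra_simps emb.lin_ext_add emb.lin_ext_mult)

abbreviation ideal_of :: "nat \<Rightarrow> (nat, 'k::field) mpoly set \<Rightarrow> bool" where
  "ideal_of n I \<equiv> submod (poly_ring {1..n}) (*) I"

lemma ideal_of_carrier: "ideal_of n (carrier (poly_ring {1..n}))"
  by (rule submodI) auto

context
  fixes n :: nat and I :: "(nat, 'k::field) mpoly set" and F :: "nat set"
  assumes I: "ideal_of n I" and F: "F \<subseteq> {1..n}"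
begin

lemma finite_F: "finite F"
  using F finite_subset by blast

lemma emb_xpow_mult:
  assumes "xpow F (int a) * f \<in> emb ` I" "a \<le> b"
  shows "xpow F (int b) * f \<in> emb ` I"
proof -
  have "int b = int (b - a) + int a" using assms(2) by simp
  then have *: "xpow F (int b) * f = xpow F (int (b - a)) * (xpow F (int a) * f)"
    by (metis xpow_add mult.assoc)
  obtain g where g: "g \<in> I" "xpow F (int a) * f = emb g" using assms(1) by auto
  have "face_monom F ^ (b - a) * g \<in> I"
    using g F by (intro submod_act[OF I]) auto
  moreover have "xpow F (int b) * f = emb (face_monom F ^ (b - a) * g)"
    unfolding * g(2) by (simp add: emb.lin_ext_mult emb_face_monom_power[OF finite_F])
  ultimately show ?thesis by blast
qed

lemma submod_loc: "submod (poly_ring {1..n}) lact (loc I F)"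
proof (rule submodI)
  show "0 \<in> loc I F"
    using submod_0[OF I] by (auto simp: loc_def image_iff intro!: exI[of _ 0] bexI[of _ 0])
next
  fix f g assume "f \<in> loc I F" "g \<in> loc I F"
  then obtain a b where "xpow F (int a) * f \<in> emb ` I" "xpow F (int b) * g \<in> emb ` I"
    by (auto simp: loc_def)
  then have "xpow F (int (max a b)) * f \<in> emb ` I" "xpow F (int (max a b)) * g \<in> emb ` I"
    by (auto intro: emb_xpow_mult)
  then obtain f' g' where fg: "f' \<in> I" "g' \<in> I" "xpow F (int (max a b)) * f = emb f'"
    "xpow F (int (max a b)) * g = emb g'" by blast
  then have "xpow F (int (max a b)) * (f - g) = emb (f' - g')"
    by (simp only: right_diff_distrib emb.lin_ext_minus)
  moreover have "f' - g' \<in> I" using fg submod_diff[OF I] by blast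
  ultimately have "xpow F (int (max a b)) * (f - g) = emb (f' - g')" "f' - g' \<in> I" .
  then show "f - g \<in> loc I F" unfolding loc_def by blast
next
  fix r :: "(nat, 'k) mpoly" and f assume r: "r \<in> carrier (poly_ring {1..n})" and "f \<in> loc I F"
  then obtain a g where "xpow F (int a) * f = emb g" "g \<in> I" by (auto simp: loc_def)
  then have "xpow F (int a) * (emb r * f) = emb (r * g)" "r * g \<in> I"
    using submod_act[OF I r] by (simp_all add: emb.lin_ext_mult ac_simps)
  then show "emb r * f \<in> loc I F" unfolding loc_def by blast
qed

lemma emb_in_loc: "g \<in> I \<Longrightarrow> xpow F (- int a) * emb g \<in> loc I F"
  unfolding loc_def by (auto intro!: exI[of _ a])

lemma locE:
  assumes "f \<in> loc I F"
  obtains g a where "g \<in> I" "f = xpow F (- int a) * emb g"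
proof -
  obtain a g where "xpow F (int a) * f = emb g" "g \<in> I" using assms by (auto simp: loc_def)
  then show ?thesis using that[of g a] by (metis xpow_cancel_left(2))
qed

lemma xpow_loc:
  assumes "f \<in> loc I F"
  shows "xpow F b * f \<in> loc I F"
proof -
  obtain g a where g: "g \<in> I" "f = xpow F (- int a) * emb g" by (rule locE[OF assms])
  have "xpow F b * f = xpow F (- int (a + nat (- b))) * emb (face_monom F ^ nat b * g)"
  proof -
    have "xpow F b * f = xpow F (b - int a) * emb g" by (simp add: g xpow_mult_left)
    moreover have "b - int a = - int (a + nat (- b)) + int (nat b)" by simp
    ultimately show ?thesis
      by (simp only: xpow_add emb.lin_ext_mult emb_face_monom_power[OF finite_F] mult.assoc)
  qed
  moreover have "face_monom F ^ nat b * g \<in> I" using g F by (intro submod_act[OF I]) auto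
  ultimately show ?thesis by (simp only: emb_in_loc)
qed

lemma loc_mono:
  assumes "F \<subseteq> G" "G \<subseteq> {1..n}"
  shows "loc I F \<subseteq> loc I G"
proof
  fix f assume "f \<in> loc I F"
  then obtain a g where g: "xpow F (int a) * f = emb g" "g \<in> I" by (auto simp: loc_def)
  have fin: "finite G" "finite (G - F)" using assms finite_subset by blast+
  have "xpow G (int a) = xpow (G - F) (int a) * (xpow F (int a) :: 'k laurent)"
    using xpow_Un[of "G - F" F "int a"] fin finite_F assms(1) by (simp add: Un_absorb2 Int_commute)
  then have "xpow G (int a) * f = emb (face_monom (G - F) ^ a * g)"
    using g fin by (simp add: emb.lin_ext_mult emb_face_monom_power mult.assoc)
  moreover have "face_monom (G - F) ^ a * g \<in> I"
    using g assms by (intro submod_act[OF I]) auto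
  ultimately show "f \<in> loc I G" unfolding loc_def by blast
qed

end

lemma loc_mono_ideal: "I \<subseteq> I' \<Longrightarrow> loc I F \<subseteq> loc I' F"
  by (auto simp: loc_def)

lemma presents_finsum:
  assumes P: "presents R act A D \<rho> M" and f: "\<And>i. i \<in> I \<Longrightarrow> f i \<in> A" and "finite I"
  shows "(\<Oplus>\<^bsub>M\<^esub>i\<in>I. \<rho> (f i)) = \<rho> (\<Sum>i\<in>I. f i)"
proof -
  interpret Module.module R M by (rule presents_module[OF P])
  have A: "submod R act A" using P by (simp add: presents_def)
  show ?thesis using \<open>finite I\<close> f
  proof (induction I rule: finite_induct)
    case (insert i I)
    then have "sum f I \<in> A" by (intro submod_sum[OF A]) auto
    then show ?case
      using insert P by (subst finsum_insert) (auto simp: presents_def)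
  qed (use P in \<open>auto simp: presents_def\<close>)
qed

text \<open>The face ring and all its reductions are quotients S / I, so localizations and the Cech
  complex are computed once, for an arbitrary I.\<close>

locale cyclic =
  fixes n :: nat and I :: "(nat, 'k::field) mpoly set" and q :: "(nat, 'k) mpoly \<Rightarrow> 'b"
    and M :: "((nat, 'k) mpoly, 'b) module"
  assumes cyclic: "presents (poly_ring {1..n}) (*) (carrier (poly_ring {1..n})) I q M"
begin

abbreviation "S \<equiv> carrier (poly_ring {1..n} :: (nat, 'k) mpoly ring)"

lemma I: "ideal_of n I" and I_sub: "I \<subseteq> S" and carrier_M: "carrier M = q ` S"
  and q_zero: "\<zero>\<^bsub>M\<^esub> = q 0"
  and q_add: "f \<in> S \<Longrightarrow> g \<in> S \<Longrightarrow> q f \<oplus>\<^bsub>M\<^esub> q g = q (f + g)"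
  and q_smult: "f \<in> S \<Longrightarrow> g \<in> S \<Longrightarrow> f \<odot>\<^bsub>M\<^esub> q g = q (f * g)"
  and q_eq: "f \<in> S \<Longrightarrow> g \<in> S \<Longrightarrow> q f = q g \<longleftrightarrow> f - g \<in> I"
  using cyclic by (auto simp: presents_def)

text \<open>The element of M_(x_F) that corresponds to the class of f under the identification
  M_(x_F) = S_(x_F) / I_(x_F).\<close>

definition cls :: "nat set \<Rightarrow> 'k laurent \<Rightarrow> ('b \<times> nat) set" where
  "cls F f = {(q h, b) | h b. h \<in> S \<and> xpow F (- int b) * emb h - f \<in> loc I F}"

context
  fixes F assumes F: "F \<subseteq> {1..n}"
begin

lemmas lI = submod_loc[OF I F] and lS = submod_loc[OF ideal_of_carrier F]

lemma in_cls:
  assumes "g \<in> S"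
  shows "(q g, b) \<in> cls F f \<longleftrightarrow> xpow F (- int b) * emb g - f \<in> loc I F"
proof
  assume "(q g, b) \<in> cls F f"
  then obtain h where h: "q g = q h" "h \<in> S" "xpow F (- int b) * emb h - f \<in> loc I F"
    by (auto simp: cls_def)
  then have "g - h \<in> I" using q_eq assms by simp
  then have "xpow F (- int b) * emb (g - h) \<in> loc I F" by (rule emb_in_loc[OF I F])
  from submod_add[OF lI this h(3)] show "xpow F (- int b) * emb g - f \<in> loc I F"
    by (simp add: emb.lin_ext_minus algebra_simps)
qed (use assms in \<open>auto simp: cls_def\<close>)

lemma mod_frac_cls:
  assumes "g \<in> S"
  shows "mod_frac (poly_ring {1..n}) M (face_monom F) (q g) a = cls F (xpow F (- int a) * emb g)"
proof -
  let ?f = "face_monom F :: (nat, 'k) mpoly"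
  have fin: "finite F" using F finite_subset by blast
  have fS: "?f ^ k \<in> S" for k using F by auto
  have "(\<exists>c. q (?f ^ (c + b) * g) = q (?f ^ (c + a) * h)) \<longleftrightarrow>
      xpow F (- int b) * emb h - xpow F (- int a) * emb g \<in> loc I F" (is "?l \<longleftrightarrow> ?r")
    if h: "h \<in> S" for h b
  proof -
    \<comment> \<open>The cross-multiplied difference is the difference of the two fractions times
      x_F^(c+a+b). Hence equality of fractions for some c becomes membership in
      \<open>loc I F\<close>.\<close>
    have e: "emb (?f ^ (c + a) * h - ?f ^ (c + b) * g) =
        xpow F (int (c + a + b)) * (xpow F (- int b) * emb h - xpow F (- int a) * emb g)" for c
      by (simp add: emb.lin_ext_minus emb.lin_ext_mult emb_face_monom_power fin right_diff_distrib xpow_mult_left)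
    have "?l \<longleftrightarrow> (\<exists>c. ?f ^ (c + a) * h - ?f ^ (c + b) * g \<in> I)"
      using h assms fS by (subst q_eq) (auto intro!: ex_cong1 dest: submod_uminus[OF I])
    also have "\<dots> \<longleftrightarrow> (\<exists>c. emb (?f ^ (c + a) * h - ?f ^ (c + b) * g) \<in> emb ` I)"
      by (auto simp: emb_inj image_iff)
    also have "\<dots> \<longleftrightarrow> (\<exists>c. xpow F (int (c + a + b)) * (xpow F (- int b) * emb h - xpow F (- int a) * emb g) \<in> emb ` I)"
      unfolding e ..
    also have "(\<exists>c. xpow F (int (c + a + b)) * (xpow F (- int b) * emb h - xpow F (- int a) * emb g) \<in> emb ` I)
        \<longleftrightarrow> ?r"
    proof
      assume ?r
      then obtain c where "xpow F (int c) * (xpow F (- int b) * emb h - xpow F (- int a) * emb g) \<in> emb ` I"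
        by (auto simp: loc_def)
      then have "xpow F (int (c + a + b)) * (xpow F (- int b) * emb h - xpow F (- int a) * emb g) \<in> emb ` I"
        by (rule emb_xpow_mult[OF I F]) simp
      then show "\<exists>c. xpow F (int (c + a + b)) * (xpow F (- int b) * emb h - xpow F (- int a) * emb g) \<in> emb ` I"
        by blast
    qed (auto simp: loc_def simp del: of_nat_add)
    finally show ?thesis .
  qed
  moreover have "face_monom F [^]\<^bsub>poly_ring {1..n}\<^esub> k \<odot>\<^bsub>M\<^esub> q h = q (?f ^ k * h)" if "h \<in> S" for h k
    using q_smult[OF fS that] by simp
  ultimately show ?thesis
    using assms by (fastforce simp: mod_frac_def cls_def carrier_M simp del: poly_ring_nat_pow)
qed

lemma cls_eq:
  assumes "f \<in> loc S F" "f' \<in> loc S F"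
  shows "cls F f = cls F f' \<longleftrightarrow> f - f' \<in> loc I F"
proof
  assume eq: "cls F f = cls F f'"
  obtain g a where g: "g \<in> S" "f = xpow F (- int a) * emb g" by (rule locE[OF ideal_of_carrier F assms(1)])
  then have "(q g, a) \<in> cls F f'" unfolding eq[symmetric] by (simp add: in_cls submod_0[OF lI])
  then show "f - f' \<in> loc I F" by (simp only: in_cls[OF g(1)] g(2))
next
  assume d: "f - f' \<in> loc I F"
  have "x - f \<in> loc I F \<longleftrightarrow> x - f' \<in> loc I F" for x
    using submod_add[OF lI d, of "x - f"] submod_diff[OF lI _ d, of "x - f'"] by auto
  then show "cls F f = cls F f'" by (simp add: cls_def)
qed

lemma cls_nonempty:
  assumes "f \<in> loc S F"
  obtains g a where "g \<in> S" "(q g, a) \<in> cls F f"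
proof -
  obtain g a where "g \<in> S" "f = xpow F (- int a) * emb g" by (rule locE[OF ideal_of_carrier F assms])
  then show ?thesis using that[of g a] by (simp add: in_cls submod_0[OF lI])
qed

lemma cls_cases:
  assumes "(x, a) \<in> cls F f"
  obtains g where "x = q g" "g \<in> S" "xpow F (- int a) * emb g - f \<in> loc I F"
  using assms by (auto simp: cls_def)

lemma presents_localization:
  "presents (poly_ring {1..n}) lact (loc S F) (loc I F) (cls F) (localization (poly_ring {1..n}) M (face_monom F))"
proof -
  let ?R = "poly_ring {1..n} :: (nat, 'k) mpoly ring" and ?f = "face_monom F :: (nat, 'k) mpoly"
  have fin: "finite F" using F finite_subset by blast
  have fS: "?f ^ k \<in> S" for k using F by auto
  have SlocS: "xpow F (- int a) * emb g \<in> loc S F" if "g \<in> S" for g a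
    using emb_in_loc[OF ideal_of_carrier F that] .
  have car: "{mod_frac ?R M ?f x a |x a. x \<in> carrier M} = cls F ` loc S F"
  proof (rule subset_antisym; rule subsetI)
    fix X assume "X \<in> cls F ` loc S F"
    then obtain f where f: "f \<in> loc S F" "X = cls F f" by auto
    obtain g a where "g \<in> S" "f = xpow F (- int a) * emb g" by (rule locE[OF ideal_of_carrier F f(1)])
    then show "X \<in> {mod_frac ?R M ?f x a |x a. x \<in> carrier M}"
      using f mod_frac_cls carrier_M by blast
  qed (use mod_frac_cls carrier_M SlocS in auto)
  have add: "(\<Union>(x, a)\<in>cls F f. \<Union>(y, b)\<in>cls F f'. mod_frac ?R M ?f
      ((?f [^]\<^bsub>?R\<^esub> b) \<odot>\<^bsub>M\<^esub> x \<oplus>\<^bsub>M\<^esub> (?f [^]\<^bsub>?R\<^esub> a) \<odot>\<^bsub>M\<^esub> y) (a + b)) = cls F (f + f')"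
    if f: "f \<in> loc S F" "f' \<in> loc S F" for f f'
  proof -
    have "mod_frac ?R M ?f ((?f [^]\<^bsub>?R\<^esub> b) \<odot>\<^bsub>M\<^esub> x \<oplus>\<^bsub>M\<^esub> (?f [^]\<^bsub>?R\<^esub> a) \<odot>\<^bsub>M\<^esub> y) (a + b) = cls F (f + f')"
      if xy: "(x, a) \<in> cls F f" "(y, b) \<in> cls F f'" for x a y b
    proof -
      obtain g where g: "x = q g" "g \<in> S" "xpow F (- int a) * emb g - f \<in> loc I F"
        by (rule cls_cases[OF xy(1)])
      obtain h where h: "y = q h" "h \<in> S" "xpow F (- int b) * emb h - f' \<in> loc I F"
        by (rule cls_cases[OF xy(2)])
      have S: "?f ^ b * g \<in> S" "?f ^ a * h \<in> S" "?f ^ b * g + ?f ^ a * h \<in> S"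
        using g h fS by (auto intro!: poly_ring_add poly_ring_mult)
      have "(?f [^]\<^bsub>?R\<^esub> b) \<odot>\<^bsub>M\<^esub> x \<oplus>\<^bsub>M\<^esub> (?f [^]\<^bsub>?R\<^esub> a) \<odot>\<^bsub>M\<^esub> y = q (?f ^ b * g + ?f ^ a * h)"
        using g h fS S by (simp add: q_smult q_add)
      then have "mod_frac ?R M ?f ((?f [^]\<^bsub>?R\<^esub> b) \<odot>\<^bsub>M\<^esub> x \<oplus>\<^bsub>M\<^esub> (?f [^]\<^bsub>?R\<^esub> a) \<odot>\<^bsub>M\<^esub> y) (a + b) =
          cls F (xpow F (- int (a + b)) * emb (?f ^ b * g + ?f ^ a * h))"
        using mod_frac_cls[OF S(3)] by simp
      also have "xpow F (- int (a + b)) * emb (?f ^ b * g + ?f ^ a * h) =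
          xpow F (- int a) * emb g + xpow F (- int b) * emb h"
        by (simp add: emb.lin_ext_add emb.lin_ext_mult emb_face_monom_power fin distrib_left xpow_mult_left)
      also have "cls F \<dots> = cls F (f + f')"
      proof (subst cls_eq)
        have "xpow F (- int a) * emb g + xpow F (- int b) * emb h - (f + f') =
          (xpow F (- int a) * emb g - f) + (xpow F (- int b) * emb h - f')" by simp
        then show "xpow F (- int a) * emb g + xpow F (- int b) * emb h - (f + f') \<in> loc I F"
          using submod_add[OF lI g(3) h(3)] by metis
      qed (use f g h in \<open>auto intro!: submod_add[OF lS] SlocS\<close>)
      finally show ?thesis .
    qed
    moreover obtain x a where "(x, a) \<in> cls F f" using cls_nonempty[OF f(1)] by metis
    moreover obtain y b where "(y, b) \<in> cls F f'" using cls_nonempty[OF f(2)] by metis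
    ultimately show ?thesis by fast
  qed
  have smul: "(\<Union>(x, a)\<in>cls F f. mod_frac ?R M ?f (r \<odot>\<^bsub>M\<^esub> x) a) = cls F (emb r * f)"
    if r: "r \<in> S" and f: "f \<in> loc S F" for f r
  proof -
    have "mod_frac ?R M ?f (r \<odot>\<^bsub>M\<^esub> x) a = cls F (emb r * f)" if xa: "(x, a) \<in> cls F f" for x a
    proof -
      obtain g where g: "x = q g" "g \<in> S" "xpow F (- int a) * emb g - f \<in> loc I F"
        by (rule cls_cases[OF xa])
      have rg: "r * g \<in> S" using r g by auto
      have "mod_frac ?R M ?f (r \<odot>\<^bsub>M\<^esub> x) a = cls F (xpow F (- int a) * emb (r * g))"
        using g r mod_frac_cls[OF rg] by (simp add: q_smult)
      also have "\<dots> = cls F (emb r * f)"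
      proof (subst cls_eq)
        have "xpow F (- int a) * emb (r * g) - emb r * f = emb r * (xpow F (- int a) * emb g - f)"
          by (simp add: algebra_simps emb.lin_ext_mult)
        then show "xpow F (- int a) * emb (r * g) - emb r * f \<in> loc I F"
          using submod_act[OF lI r g(3)] by metis
      qed (use r f rg in \<open>auto intro!: submod_act[OF lS] SlocS\<close>)
      finally show ?thesis .
    qed
    moreover obtain x a where "(x, a) \<in> cls F f" using cls_nonempty[OF f] by metis
    ultimately show ?thesis by fast
  qed
  have zero: "mod_frac ?R M ?f \<zero>\<^bsub>M\<^esub> 0 = cls F 0"
    using mod_frac_cls[of 0 0] by (simp add: q_zero)
  let ?L = "localization ?R M ?f"
  have 1: "carrier ?L = cls F ` loc S F" using car by (simp add: localization_def)
  have 2: "cls F (f + f') = cls F f \<oplus>\<^bsub>?L\<^esub> cls F f'" if "f \<in> loc S F" "f' \<in> loc S F" for f f'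
    using add[OF that] by (simp add: localization_def)
  have 3: "cls F (lact r f) = r \<odot>\<^bsub>?L\<^esub> cls F f" if "r \<in> S" "f \<in> loc S F" for r f
    using smul[OF that] by (simp add: localization_def)
  have 4: "\<zero>\<^bsub>?L\<^esub> = cls F 0" using zero by (simp add: localization_def)
  show ?thesis
    unfolding presents_def
    by (intro conjI ballI) (simp_all add: lI lS cls_eq loc_mono_ideal[OF I_sub] action_lact 1 2 3 4)
qed

end

text \<open>As Laurent polynomials x / f^a and g^a x / (f g)^a are equal, so the maps of the Cech
  complex are induced by inclusions.\<close>

lemma localization_map_cls:
  assumes G: "G \<subseteq> {1..n}" and t: "t \<in> G" and f: "f \<in> loc S (G - {t})"
  shows "localization_map (poly_ring {1..n}) M (face_monom (G - {t})) (poly_var t) (cls (G - {t}) f) = cls G f"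
proof -
  let ?F = "G - {t}" and ?R = "poly_ring {1..n} :: (nat, 'k) mpoly ring"
  have F: "?F \<subseteq> {1..n}" and fin: "finite G" "finite ?F" using G finite_subset by blast+
  have tS: "poly_var t ^ k \<in> S" for k using t G by (auto intro!: poly_ring_power poly_ring_var)
  have "face_monom ?F \<otimes>\<^bsub>?R\<^esub> poly_var t = face_monom G"
    using t fin by (simp add: face_monom_def prod.remove[of G t] mult.commute)
  moreover have "mod_frac ?R M (face_monom G) ((poly_var t [^]\<^bsub>?R\<^esub> a) \<odot>\<^bsub>M\<^esub> x) a = cls G f"
    if xa: "(x, a) \<in> cls ?F f" for x a
  proof -
    obtain g where g: "x = q g" "g \<in> S" "xpow ?F (- int a) * emb g - f \<in> loc I ?F"
      by (rule cls_cases[OF F xa])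
    have tg: "poly_var t ^ a * g \<in> S" using g tS by auto
    have "mod_frac ?R M (face_monom G) ((poly_var t [^]\<^bsub>?R\<^esub> a) \<odot>\<^bsub>M\<^esub> x) a =
        cls G (xpow G (- int a) * emb (poly_var t ^ a * g))"
      using g tS mod_frac_cls[OF G tg] by (simp add: q_smult)
    also have "xpow G (- int a) * emb (poly_var t ^ a * g) = xpow ?F (- int a) * emb g"
    proof -
      have "xpow ({t} \<union> ?F) (- int a) = xpow {t} (- int a) * (xpow ?F (- int a) :: 'k laurent)"
        using fin by (intro xpow_Un) auto
      moreover have "{t} \<union> ?F = G" using t by auto
      ultimately show ?thesis
        by (simp add: emb.lin_ext_mult emb.lin_ext_power emb_poly_var xpow_power ac_simps xpow_mult_left)
    qed
    also have "cls G \<dots> = cls G f"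
    proof (subst cls_eq[OF G])
      show "xpow ?F (- int a) * emb g \<in> loc S G" "f \<in> loc S G"
        using emb_in_loc[OF ideal_of_carrier F g(2)] f loc_mono[OF ideal_of_carrier F _ G] by blast+
      show "xpow ?F (- int a) * emb g - f \<in> loc I G"
        using g(3) loc_mono[OF I F _ G] by blast
    qed
    finally show ?thesis .
  qed
  moreover obtain x a where "(x, a) \<in> cls ?F f" using cls_nonempty[OF F f] by metis
  ultimately show ?thesis unfolding localization_map_def by fastforce
qed

end

section \<open>Cohomology of the Cech complex through Laurent cochains\<close>

section \<open>The Cech complex\<close>

definition sgn_in :: "nat set \<Rightarrow> nat \<Rightarrow> 'r::comm_ring_1" where
  "sgn_in G t = (- 1) ^ card {s \<in> G. s < t}"

lemma sgn_in_square [simp]: "sgn_in G t * sgn_in G t = 1" "sgn_in G t * (sgn_in G t * x) = x"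
  unfolding sgn_in_def by (simp_all flip: mult.assoc power_mult_distrib)

lemma sgn_in_remove:
  assumes "finite G" "s \<in> G"
  shows "sgn_in (G - {s}) t = (if s < t then - sgn_in G t else sgn_in G t)"
proof (cases "s < t")
  case True
  have "{r \<in> G. r < t} = insert s {r \<in> G - {s}. r < t}" using True assms by auto
  then have "card {r \<in> G. r < t} = Suc (card {r \<in> G - {s}. r < t})" using assms by simp
  then show ?thesis using True by (simp add: sgn_in_def)
next
  case False
  then have "{r \<in> G - {s}. r < t} = {r \<in> G. r < t}" by auto
  then show ?thesis using False by (simp add: sgn_in_def)
qed

text \<open>Of the two removals only that of the smaller element changes a sign. This is the
  cancellation behind d^2 = 0 and behind the cone homotopy.\<close>

lemma sgn_in_swap:
  assumes "finite G" "s \<in> G" "t \<in> G" "s \<noteq> t"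
  shows "sgn_in G t * sgn_in (G - {t}) s = - (sgn_in G s * sgn_in (G - {s}) t)"
  using assms by (cases s t rule: linorder_cases) (auto simp: sgn_in_remove)

text \<open>With X the full power set this is the Cech differential, with X = \<Delta> the
  simplicial one; identities such as d^2 = 0 are proved once for both.\<close>

definition cdiff :: "nat set set \<Rightarrow> (nat set \<Rightarrow> 'r::comm_ring_1) \<Rightarrow> nat set \<Rightarrow> 'r" where
  "cdiff X u = (\<lambda>G. if G \<in> X then \<Sum>t\<in>G. sgn_in G t * u (G - {t}) else 0)"

definition subset_closed :: "nat set set \<Rightarrow> bool" where
  "subset_closed X \<longleftrightarrow> (\<forall>G\<in>X. finite G \<and> (\<forall>F\<subseteq>G. F \<in> X))"

lemma subset_closed_Pow: "subset_closed (Pow {1..n})"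
  by (auto simp: subset_closed_def intro: finite_subset)

lemma cdiff_cdiff:
  assumes "subset_closed X"
  shows "cdiff X (cdiff X u) = 0"
proof (rule ext)
  fix G
  show "cdiff X (cdiff X u) G = 0 G"
  proof (cases "G \<in> X")
    case True
    then have fin: "finite G" and sub: "G - {t} \<in> X" for t
      using assms by (auto simp: subset_closed_def)
    define f where "f t s = sgn_in G t * sgn_in (G - {t}) s * u (G - {t} - {s})" for t s
    have "cdiff X (cdiff X u) G = (\<Sum>t\<in>G. \<Sum>s\<in>G - {t}. f t s)"
      using True sub by (simp add: cdiff_def f_def sum_distrib_left mult.assoc)
    \<comment> \<open>Ordered pairs are split by which element is smaller; exchanging the two names
      matches each term of one half with the negative of a term of the other.\<close>
    also have "\<dots> = (\<Sum>t\<in>G. (\<Sum>s\<in>{s \<in> G. s < t}. f t s) + (\<Sum>s\<in>{s \<in> G. t < s}. f t s))"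
    proof (rule sum.cong)
      fix t assume "t \<in> G"
      have "G - {t} = {s \<in> G. s < t} \<union> {s \<in> G. t < s}" by auto
      show "(\<Sum>s\<in>G - {t}. f t s) = (\<Sum>s\<in>{s \<in> G. s < t}. f t s) + (\<Sum>s\<in>{s \<in> G. t < s}. f t s)"
        unfolding \<open>G - {t} = _\<close> by (rule sum.union_disjoint) (use fin in auto)
    qed simp
    also have "\<dots> = (\<Sum>t\<in>G. \<Sum>s\<in>{s \<in> G. s < t}. f t s) + (\<Sum>t\<in>G. \<Sum>s\<in>{s \<in> G. t < s}. f t s)"
      by (simp add: sum.distrib)
    also have "(\<Sum>t\<in>G. \<Sum>s\<in>{s \<in> G. t < s}. f t s) = (\<Sum>s\<in>G. \<Sum>t\<in>{t \<in> G. t < s}. f t s)"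
      by (rule sum.swap_restrict[OF fin fin])
    also have "\<dots> = (\<Sum>s\<in>G. \<Sum>t\<in>{t \<in> G. t < s}. - f s t)"
    proof (intro sum.cong refl)
      fix s t assume "s \<in> G" "t \<in> {t \<in> G. t < s}"
      then have "sgn_in G t * sgn_in (G - {t}) s = - (sgn_in G s * sgn_in (G - {s}) t :: 'a)"
        by (intro sgn_in_swap fin) auto
      moreover have "G - {t} - {s} = G - {s} - {t}" by auto
      ultimately show "f t s = - f s t" by (simp add: f_def)
    qed
    finally show ?thesis by (simp add: sum_negf)
  qed (simp add: cdiff_def)
qed

lemma cdiff_add: "cdiff X (u + v) = cdiff X u + cdiff X v"
  by (rule ext) (simp add: cdiff_def algebra_simps sum.distrib)

lemma cdiff_zero [simp]: "cdiff X 0 = 0"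
  by (rule ext) (simp add: cdiff_def)

lemma cdiff_minus: "cdiff X (u - v) = cdiff X u - cdiff X v"
  using cdiff_add[of X "u - v" v] by (simp add: algebra_simps)

lemma cdiff_scale: "cdiff X (\<lambda>F. c * u F) = (\<lambda>F. c * cdiff X u F)"
  by (rule ext) (simp add: cdiff_def sum_distrib_left ac_simps)

abbreviation cact :: "(nat, 'k::field) mpoly \<Rightarrow> (nat set \<Rightarrow> 'k laurent) \<Rightarrow> nat set \<Rightarrow> 'k laurent" where
  "cact r u \<equiv> (\<lambda>F. emb r * u F)"

lemma action_cact: "action (poly_ring V) cact"
  by (rule action_poly_ring) (simp_all add: fun_eq_iff algebra_simps emb.lin_ext_add emb.lin_ext_mult)

definition cochains :: "nat \<Rightarrow> (nat set \<Rightarrow> 'r::zero set) \<Rightarrow> int \<Rightarrow> (nat set \<Rightarrow> 'r) set" where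
  "cochains n T p = {u. (\<forall>F\<in>subsets_of_card n p. u F \<in> T F) \<and> (\<forall>F. F \<notin> subsets_of_card n p \<longrightarrow> u F = 0)}"

text \<open>Representatives for the complex with terms L F / J F: being zero is replaced by having
  values in J, and the quotients are never formed.\<close>

definition cech_cocycles :: "nat \<Rightarrow> (nat set \<Rightarrow> 'r::comm_ring_1 set) \<Rightarrow> (nat set \<Rightarrow> 'r set) \<Rightarrow> int \<Rightarrow> (nat set \<Rightarrow> 'r) set" where
  "cech_cocycles n L J p = {u \<in> cochains n L p. cdiff (Pow {1..n}) u \<in> cochains n J (p + 1)}"

definition cech_coboundaries :: "nat \<Rightarrow> (nat set \<Rightarrow> 'r::comm_ring_1 set) \<Rightarrow> (nat set \<Rightarrow> 'r set) \<Rightarrow> int \<Rightarrow> (nat set \<Rightarrow> 'r) set" where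
  "cech_coboundaries n L J p =
     {u \<in> cochains n L p. \<exists>v\<in>cochains n L (p - 1). u - cdiff (Pow {1..n}) v \<in> cochains n J p}"

definition good_family :: "nat \<Rightarrow> (nat set \<Rightarrow> 'k::field laurent set) \<Rightarrow> bool" where
  "good_family n T \<longleftrightarrow> (\<forall>F. F \<subseteq> {1..n} \<longrightarrow> submod (poly_ring {1..n}) lact (T F)) \<and>
     (\<forall>F G. F \<subseteq> G \<longrightarrow> G \<subseteq> {1..n} \<longrightarrow> T F \<subseteq> T G)"

lemma good_family_loc: "ideal_of n I \<Longrightarrow> good_family n (loc I)"
  unfolding good_family_def
  by (intro conjI allI impI; rule submod_loc loc_mono) (auto intro: order_trans)

lemma subsets_of_cardD: "F \<in> subsets_of_card n p \<Longrightarrow> F \<subseteq> {1..n}" "F \<in> subsets_of_card n p \<Longrightarrow> finite F"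
  by (auto simp: subsets_of_card_def intro: finite_subset)

lemma subsets_of_card_remove:
  assumes "F \<subseteq> {1..n}" "t \<in> F"
  shows "F - {t} \<in> subsets_of_card n p \<longleftrightarrow> F \<in> subsets_of_card n (p + 1)"
proof -
  have "finite F" using assms finite_subset by blast
  then have "card F = Suc (card (F - {t}))" using assms(2) by (metis card_Suc_Diff1)
  then show ?thesis using assms by (auto simp: subsets_of_card_def)
qed

lemma submod_sgn: "submod R act A \<Longrightarrow> x \<in> A \<Longrightarrow> sgn_in G t * (x :: 'r::comm_ring_1) \<in> A"
  by (cases "even (card {s \<in> G. s < t})") (simp_all add: sgn_in_def submod_uminus)

context
  fixes n :: nat and T :: "nat set \<Rightarrow> 'k::field laurent set"
  assumes T: "good_family n T"
begin

lemma good_submod: "F \<subseteq> {1..n} \<Longrightarrow> submod (poly_ring {1..n}) lact (T F)"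
  and good_mono: "F \<subseteq> G \<Longrightarrow> G \<subseteq> {1..n} \<Longrightarrow> x \<in> T F \<Longrightarrow> x \<in> T G"
  using T unfolding good_family_def by blast+

lemma submod_cochains: "submod (poly_ring {1..n}) cact (cochains n T p)"
  by (rule submodI)
    (auto simp: cochains_def intro!: submod_0[OF good_submod] submod_diff[OF good_submod] submod_act[OF good_submod]
      dest: subsets_of_cardD(1))

lemma cdiff_cochains:
  assumes "u \<in> cochains n T p"
  shows "cdiff (Pow {1..n}) u \<in> cochains n T (p + 1)"
proof -
  have "cdiff (Pow {1..n}) u F \<in> T F" if F: "F \<in> subsets_of_card n (p + 1)" for F
  proof -
    have "u (F - {t}) \<in> T F" if "t \<in> F" for t
    proof (rule good_mono)
      show "u (F - {t}) \<in> T (F - {t})"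
        using assms that F subsets_of_card_remove[OF subsets_of_cardD(1)[OF F] that] by (auto simp: cochains_def)
    qed (use subsets_of_cardD[OF F] in auto)
    then show ?thesis using subsets_of_cardD(1)[OF F]
      by (auto simp: cdiff_def intro!: submod_sum[OF good_submod] submod_sgn[OF good_submod])
  qed
  moreover have "cdiff (Pow {1..n}) u F = 0" if "F \<notin> subsets_of_card n (p + 1)" for F
  proof (cases "F \<subseteq> {1..n}")
    case True
    then have "u (F - {t}) = 0" if "t \<in> F" for t
      using subsets_of_card_remove[OF True that, of p] \<open>F \<notin> _\<close> assms by (auto simp: cochains_def)
    then show ?thesis by (simp add: cdiff_def)
  qed (simp add: cdiff_def)
  ultimately show ?thesis by (simp add: cochains_def)
qed

end

lemma cochains_mono: "(\<And>F. F \<subseteq> {1..n} \<Longrightarrow> J F \<subseteq> L F) \<Longrightarrow> cochains n J p \<subseteq> cochains n L p"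
  unfolding cochains_def using subsets_of_cardD(1) by blast

context
  fixes n :: nat and L J :: "nat set \<Rightarrow> 'k::field laurent set"
  assumes L: "good_family n L" and J: "good_family n J" and JL: "\<And>F. F \<subseteq> {1..n} \<Longrightarrow> J F \<subseteq> L F"
begin

lemma submod_cocycles: "submod (poly_ring {1..n}) cact (cech_cocycles n L J p)"
proof -
  note L' = submod_cochains[OF L] and J' = submod_cochains[OF J]
  show ?thesis
    by (rule submodI)
      (auto simp: cech_cocycles_def cdiff_minus cdiff_scale
        intro: submod_0[OF L'] submod_0[OF J'] submod_diff[OF L'] submod_diff[OF J'] submod_act[OF L'] submod_act[OF J'])
qed

lemma submod_coboundaries: "submod (poly_ring {1..n}) cact (cech_coboundaries n L J p)"
proof -
  note L' = submod_cochains[OF L] and J' = submod_cochains[OF J]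
  interpret action "poly_ring {1..n} :: (nat, 'k) mpoly ring" cact by (rule action_cact)
  show ?thesis
  proof (rule submodI)
    show "0 \<in> cech_coboundaries n L J p"
      using submod_0[OF L'] submod_0[OF J'] by (auto simp: cech_coboundaries_def intro!: bexI[of _ 0])
  next
    fix u u' assume "u \<in> cech_coboundaries n L J p" "u' \<in> cech_coboundaries n L J p"
    then obtain v v' where *: "v \<in> cochains n L (p - 1)" "u - cdiff (Pow {1..n}) v \<in> cochains n J p"
      "v' \<in> cochains n L (p - 1)" "u' - cdiff (Pow {1..n}) v' \<in> cochains n J p" "u \<in> cochains n L p" "u' \<in> cochains n L p"
      by (auto simp: cech_coboundaries_def)
    have "(u - u') - cdiff (Pow {1..n}) (v - v') = (u - cdiff (Pow {1..n}) v) - (u' - cdiff (Pow {1..n}) v')"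
      by (simp add: cdiff_minus)
    with submod_diff[OF J' *(2,4)] have "(u - u') - cdiff (Pow {1..n}) (v - v') \<in> cochains n J p" by metis
    then show "u - u' \<in> cech_coboundaries n L J p"
      using submod_diff[OF L' *(1,3)] submod_diff[OF L' *(5,6)] by (auto simp: cech_coboundaries_def)
  next
    fix r u assume r: "r \<in> carrier (poly_ring {1..n} :: (nat, 'k) mpoly ring)" and "u \<in> cech_coboundaries n L J p"
    then obtain v where *: "v \<in> cochains n L (p - 1)" "u - cdiff (Pow {1..n}) v \<in> cochains n J p" "u \<in> cochains n L p"
      by (auto simp: cech_coboundaries_def)
    have "cact r u - cdiff (Pow {1..n}) (cact r v) = cact r (u - cdiff (Pow {1..n}) v)"
      by (rule ext) (simp add: cdiff_minus cdiff_scale right_diff_distrib)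
    with submod_act[OF J' r *(2)] have "cact r u - cdiff (Pow {1..n}) (cact r v) \<in> cochains n J p" by metis
    then show "cact r u \<in> cech_coboundaries n L J p"
      using submod_act[OF L' r *(1)] submod_act[OF L' r *(3)] by (auto simp: cech_coboundaries_def)
  qed
qed

lemma coboundaries_subset: "cech_coboundaries n L J p \<subseteq> cech_cocycles n L J p"
proof
  fix u assume "u \<in> cech_coboundaries n L J p"
  then obtain v where *: "v \<in> cochains n L (p - 1)" "u - cdiff (Pow {1..n}) v \<in> cochains n J p" "u \<in> cochains n L p"
    by (auto simp: cech_coboundaries_def)
  have "cdiff (Pow {1..n}) (u - cdiff (Pow {1..n}) v) \<in> cochains n J (p + 1)"
    by (rule cdiff_cochains[OF J *(2)])
  then have "cdiff (Pow {1..n}) u \<in> cochains n J (p + 1)"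
    unfolding cdiff_minus cdiff_cdiff[OF subset_closed_Pow] by simp
  then show "u \<in> cech_cocycles n L J p"
    using * by (simp add: cech_cocycles_def)
qed

lemma zero_cochains_subset: "cochains n J p \<subseteq> cech_coboundaries n L J p"
  using cochains_mono[of n J L p] JL submod_0[OF submod_cochains[OF L]]
  by (auto simp: cech_coboundaries_def intro!: bexI[of _ 0])

end

context cyclic
begin

abbreviation "R \<equiv> poly_ring {1..n} :: (nat, 'k) mpoly ring"

lemma good_S: "good_family n (loc S)" and good_I: "good_family n (loc I)"
  by (rule good_family_loc[OF ideal_of_carrier], rule good_family_loc[OF I])

definition cech_cls :: "int \<Rightarrow> (nat set \<Rightarrow> 'k laurent) \<Rightarrow> nat set \<Rightarrow> ('b \<times> nat) set" where
  "cech_cls p u = (\<lambda>F\<in>subsets_of_card n p. cls F (u F))"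

lemma presents_cech:
  "presents R cact (cochains n (loc S) p) (cochains n (loc I) p) (cech_cls p) (cech_module n M p)"
proof -
  let ?X = "subsets_of_card n p"
  let ?L = "\<lambda>F. localization R M (face_monom F)"
  have P: "presents R lact (loc S F) (loc I F) (cls F) (?L F)" if "F \<in> ?X" for F
    using that subsets_of_cardD(1) by (intro presents_localization) auto
  have car: "carrier (?L F) = cls F ` loc S F" and zero: "\<zero>\<^bsub>?L F\<^esub> = cls F 0"
    and add: "f \<in> loc S F \<Longrightarrow> g \<in> loc S F \<Longrightarrow> cls F (f + g) = cls F f \<oplus>\<^bsub>?L F\<^esub> cls F g"
    and smul: "r \<in> S \<Longrightarrow> f \<in> loc S F \<Longrightarrow> cls F (emb r * f) = r \<odot>\<^bsub>?L F\<^esub> cls F f"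
    and eq: "f \<in> loc S F \<Longrightarrow> g \<in> loc S F \<Longrightarrow> cls F f = cls F g \<longleftrightarrow> f - g \<in> loc I F"
    if "F \<in> ?X" for F f g r
    using P[OF that] by (simp_all add: presents_def)
  have 1: "carrier (cech_module n M p) = cech_cls p ` cochains n (loc S) p"
  proof (rule subset_antisym; rule subsetI)
    fix X assume "X \<in> carrier (cech_module n M p)"
    then have X: "X \<in> (\<Pi>\<^sub>E F\<in>?X. cls F ` loc S F)"
      using car by (simp add: cech_module_def prod_module_def PiE_iff)
    define u where "u F = (if F \<in> ?X then SOME f. f \<in> loc S F \<and> X F = cls F f else 0)" for F
    have u: "u F \<in> loc S F \<and> X F = cls F (u F)" if "F \<in> ?X" for F
    proof -
      have "\<exists>f. f \<in> loc S F \<and> X F = cls F f" using X that by auto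
      from someI_ex[OF this] show ?thesis using that by (simp add: u_def)
    qed
    then have "X = cech_cls p u" using X
      by (auto simp: cech_cls_def fun_eq_iff restrict_def PiE_iff extensional_def)
    moreover have "u \<in> cochains n (loc S) p" using u by (auto simp: cochains_def u_def)
    ultimately show "X \<in> cech_cls p ` cochains n (loc S) p" by blast
  next
    fix X assume "X \<in> cech_cls p ` cochains n (loc S) p"
    then show "X \<in> carrier (cech_module n M p)"
      using car by (auto simp: cech_module_def prod_module_def cech_cls_def cochains_def)
  qed
  have 2: "cech_cls p (u + v) = cech_cls p u \<oplus>\<^bsub>cech_module n M p\<^esub> cech_cls p v"
    if "u \<in> cochains n (loc S) p" "v \<in> cochains n (loc S) p" for u v
    using that by (auto simp: cech_cls_def cech_module_def prod_module_def cochains_def fun_eq_iff add restrict_def)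
  have 3: "cech_cls p (cact r u) = r \<odot>\<^bsub>cech_module n M p\<^esub> cech_cls p u"
    if "r \<in> S" "u \<in> cochains n (loc S) p" for r u
    using that by (auto simp: cech_cls_def cech_module_def prod_module_def cochains_def fun_eq_iff smul restrict_def)
  have 4: "\<zero>\<^bsub>cech_module n M p\<^esub> = cech_cls p 0"
    by (simp add: cech_cls_def cech_module_def prod_module_def zero cong: restrict_cong)
  have 5: "cech_cls p u = cech_cls p v \<longleftrightarrow> u - v \<in> cochains n (loc I) p"
    if "u \<in> cochains n (loc S) p" "v \<in> cochains n (loc S) p" for u v
    using that eq by (auto simp: cech_cls_def cochains_def fun_eq_iff restrict_def)
  have 6: "cochains n (loc I) p \<subseteq> cochains n (loc S) p"
    by (rule cochains_mono) (rule loc_mono_ideal[OF I_sub])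
  show ?thesis
    unfolding presents_def
    by (intro conjI ballI)
      (simp_all add: action_cact submod_cochains[OF good_S] submod_cochains[OF good_I] 1 2 3 4 5 6)
qed

lemma cech_diff_cls:
  assumes u: "u \<in> cochains n (loc S) p"
  shows "cech_diff n M p (cech_cls p u) = cech_cls (p + 1) (cdiff (Pow {1..n}) u)"
  unfolding cech_diff_def cech_cls_def[of "p + 1"]
proof (rule restrict_ext)
  fix G assume G: "G \<in> subsets_of_card n (p + 1)"
  note G' = subsets_of_cardD[OF G]
  let ?L = "localization R M (face_monom G)"
  have P: "presents R lact (loc S G) (loc I G) (cls G) ?L"
    by (rule presents_localization[OF G'(1)])
  have *: "(- 1) ^ card {s \<in> G. s < t} \<odot>\<^bsub>?L\<^esub>
      localization_map R M (face_monom (G - {t})) (poly_var t) (cech_cls p u (G - {t})) =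
      cls G (sgn_in G t * u (G - {t}))" and **: "sgn_in G t * u (G - {t}) \<in> loc S G" if t: "t \<in> G" for t
  proof -
    have X: "G - {t} \<in> subsets_of_card n p" using subsets_of_card_remove[OF G'(1) t] G by simp
    then have uF: "u (G - {t}) \<in> loc S (G - {t})" using u by (simp add: cochains_def)
    then have uG: "u (G - {t}) \<in> loc S G" using good_mono[OF good_S _ G'(1)] by blast
    then show "sgn_in G t * u (G - {t}) \<in> loc S G"
      by (rule submod_sgn[OF good_submod[OF good_S G'(1)]])
    have e: "emb ((- 1) ^ card {s \<in> G. s < t}) = (sgn_in G t :: 'k laurent)"
    proof -
      have "emb (- 1) = (- 1 :: 'k laurent)" using emb.lin_ext_minus[of 0 1] by simp
      then show ?thesis by (simp add: sgn_in_def emb.lin_ext_power)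
    qed
    have "(- 1) ^ card {s \<in> G. s < t} \<in> S"
      by (intro poly_ring_power poly_ring_uminus poly_ring_one)
    then have "cls G (emb ((- 1) ^ card {s \<in> G. s < t}) * u (G - {t})) =
        (- 1) ^ card {s \<in> G. s < t} \<odot>\<^bsub>?L\<^esub> cls G (u (G - {t}))"
      using P uG by (simp add: presents_def)
    then show "(- 1) ^ card {s \<in> G. s < t} \<odot>\<^bsub>?L\<^esub>
      localization_map R M (face_monom (G - {t})) (poly_var t) (cech_cls p u (G - {t})) =
      cls G (sgn_in G t * u (G - {t}))"
      using X localization_map_cls[OF G'(1) t uF] by (simp add: cech_cls_def e)
  qed
  interpret L: Module.module R ?L by (rule presents_module[OF P])
  have "(\<Oplus>\<^bsub>?L\<^esub> t\<in>G. (- 1) ^ card {s \<in> G. s < t} \<odot>\<^bsub>?L\<^esub>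
      localization_map R M (face_monom (G - {t})) (poly_var t) (cech_cls p u (G - {t}))) =
    (\<Oplus>\<^bsub>?L\<^esub> t\<in>G. cls G (sgn_in G t * u (G - {t})))"
    by (rule L.finsum_cong') (use * ** P in \<open>auto simp: presents_def\<close>)
  also have "\<dots> = cls G (\<Sum>t\<in>G. sgn_in G t * u (G - {t}))"
    by (rule presents_finsum[OF P]) (use ** G' in auto)
  finally show "(let L = ?L in \<Oplus>\<^bsub>L\<^esub>t\<in>G. (- 1) ^ card {s \<in> G. s < t} \<odot>\<^bsub>L\<^esub>
      localization_map R M (face_monom (G - {t})) (poly_var t) (cech_cls p u (G - {t}))) =
      cls G (cdiff (Pow {1..n}) u G)"
    using G'(1) by (simp add: Let_def cdiff_def)
qed

abbreviation "Z p \<equiv> cech_cocycles n (loc S) (loc I) p"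
abbreviation "B p \<equiv> cech_coboundaries n (loc S) (loc I) p"

lemma loc_I_sub: "loc I F \<subseteq> loc S F"
  by (rule loc_mono_ideal[OF I_sub])

lemma cocycles_cls: "cocycles (cech_module n M) (cech_diff n M) p = cech_cls p ` Z p"
proof -
  have P: "presents R cact (cochains n (loc S) q) (cochains n (loc I) q) (cech_cls q) (cech_module n M q)" for q
    by (rule presents_cech)
  have "cech_diff n M p (cech_cls p u) = \<zero>\<^bsub>cech_module n M (p + 1)\<^esub> \<longleftrightarrow> u \<in> Z p"
    if u: "u \<in> cochains n (loc S) p" for u
  proof -
    have du: "cdiff (Pow {1..n}) u \<in> cochains n (loc S) (p + 1)"
      by (rule cdiff_cochains[OF good_S u])
    have "cech_cls (p + 1) (cdiff (Pow {1..n}) u) = cech_cls (p + 1) 0 \<longleftrightarrow>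
        cdiff (Pow {1..n}) u - 0 \<in> cochains n (loc I) (p + 1)"
      using P[of "p + 1"] du submod_0[OF submod_cochains[OF good_S]] unfolding presents_def by blast
    moreover have "\<zero>\<^bsub>cech_module n M (p + 1)\<^esub> = cech_cls (p + 1) 0"
      using P[of "p + 1"] by (simp add: presents_def)
    ultimately show ?thesis using u by (simp add: cech_diff_cls cech_cocycles_def)
  qed
  moreover have "carrier (cech_module n M p) = cech_cls p ` cochains n (loc S) p"
    using P[of p] by (simp add: presents_def)
  moreover have "Z p \<subseteq> cochains n (loc S) p" by (auto simp: cech_cocycles_def)
  ultimately show ?thesis unfolding cocycles_def by (auto 0 3)
qed

lemma coboundaries_cls: "coboundaries (cech_module n M) (cech_diff n M) p = cech_cls p ` B p"
proof -
  have P: "presents R cact (cochains n (loc S) q) (cochains n (loc I) q) (cech_cls q) (cech_module n M q)" for q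
    by (rule presents_cech)
  have "coboundaries (cech_module n M) (cech_diff n M) p =
      (\<lambda>v. cech_cls p (cdiff (Pow {1..n}) v)) ` cochains n (loc S) (p - 1)"
    using P[of "p - 1"] cech_diff_cls[of _ "p - 1"]
    by (auto simp: coboundaries_def presents_def image_iff)
  also have "\<dots> = cech_cls p ` B p"
  proof (rule subset_antisym; rule subsetI)
    fix X assume "X \<in> (\<lambda>v. cech_cls p (cdiff (Pow {1..n}) v)) ` cochains n (loc S) (p - 1)"
    then obtain v where v: "v \<in> cochains n (loc S) (p - 1)" "X = cech_cls p (cdiff (Pow {1..n}) v)" by auto
    then have "cdiff (Pow {1..n}) v \<in> B p"
      using cdiff_cochains[OF good_S v(1)] submod_0[OF submod_cochains[OF good_I]]
      by (auto simp: cech_coboundaries_def intro!: bexI[of _ v])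
    then show "X \<in> cech_cls p ` B p" using v by blast
  next
    fix X assume "X \<in> cech_cls p ` B p"
    then obtain u v where u: "u \<in> cochains n (loc S) p" "v \<in> cochains n (loc S) (p - 1)"
      "u - cdiff (Pow {1..n}) v \<in> cochains n (loc I) p" "X = cech_cls p u"
      by (auto simp: cech_coboundaries_def)
    have "cdiff (Pow {1..n}) v \<in> cochains n (loc S) p"
      using cdiff_cochains[OF good_S u(2)] by simp
    then have "cech_cls p u = cech_cls p (cdiff (Pow {1..n}) v)"
      using P[of p] u unfolding presents_def by blast
    then show "X \<in> (\<lambda>v. cech_cls p (cdiff (Pow {1..n}) v)) ` cochains n (loc S) (p - 1)"
      using u by blast
  qed
  finally show ?thesis .
qed

definition coh_cls :: "int \<Rightarrow> (nat set \<Rightarrow> 'k laurent) \<Rightarrow> (nat set \<Rightarrow> ('b \<times> nat) set) set" where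
  "coh_cls p u = cech_cls p ` B p +>\<^bsub>cech_module n M p\<^esub> cech_cls p u"

lemma presents_local_cohomology: "presents R cact (Z p) (B p) (coh_cls p) (local_cohomology n M p)"
proof -
  let ?C = "(cech_module n M p)\<lparr>carrier := cech_cls p ` Z p\<rparr>"
  note sub = good_S good_I loc_I_sub
  have "cochains n (loc I) p \<inter> Z p = cochains n (loc I) p"
    using coboundaries_subset[OF sub, of p] zero_cochains_subset[OF sub, of p] by blast
  moreover have "presents R cact (Z p) (cochains n (loc I) p \<inter> Z p) (cech_cls p) ?C"
    by (rule presents_submod[OF presents_cech submod_cocycles[OF sub]]) (auto simp: cech_cocycles_def)
  ultimately have "presents R cact (Z p) (cochains n (loc I) p) (cech_cls p) ?C" by simp
  then have "presents R cact (Z p) (B p) (\<lambda>x. cech_cls p ` B p +>\<^bsub>?C\<^esub> cech_cls p x) (quot_module ?C (cech_cls p ` B p))"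
    using coboundaries_subset[OF sub, of p] zero_cochains_subset[OF sub, of p]
    by (intro presents_quot[OF _ submod_coboundaries[OF sub]]) auto
  moreover have "(\<lambda>x. cech_cls p ` B p +>\<^bsub>?C\<^esub> cech_cls p x) = coh_cls p"
    by (simp add: coh_cls_def fun_eq_iff a_r_coset_def')
  ultimately show ?thesis
    by (simp add: local_cohomology_def cohomology_def cocycles_cls coboundaries_cls)
qed

end

definition hom_deg :: "int \<Rightarrow> (nat set \<Rightarrow> 'k::field laurent) \<Rightarrow> bool" where
  "hom_deg j u \<longleftrightarrow> (\<forall>F. \<forall>\<alpha>\<in>Poly_Mapping.keys (u F). exp_deg \<alpha> = j)"

lemma hom_emb_iff:
  "f \<in> homogeneous V j \<longleftrightarrow> f \<in> carrier (poly_ring V) \<and> (\<forall>\<alpha>\<in>Poly_Mapping.keys (emb f). exp_deg \<alpha> = j)"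
  by (auto simp: in_homogeneous keys_emb)

lemma keys_xpow_mult: "Poly_Mapping.keys (xpow F a * f) = (+) (const_exp F a) ` Poly_Mapping.keys f"
proof -
  have "\<alpha> \<in> Poly_Mapping.keys (xpow F a * f) \<longleftrightarrow> \<alpha> - const_exp F a \<in> Poly_Mapping.keys f" for \<alpha>
    by (simp add: in_keys_iff xpow_def lookup_single_mult)
  moreover have "\<alpha> - const_exp F a \<in> Poly_Mapping.keys f \<longleftrightarrow> \<alpha> \<in> (+) (const_exp F a) ` Poly_Mapping.keys f" for \<alpha>
    by (auto simp: image_iff intro!: bexI[of _ "\<alpha> - const_exp F a"])
  ultimately show ?thesis by blast
qed

context cyclic
begin

lemma localization_deg_cls:
  assumes F: "F \<subseteq> {1..n}"
  shows "localization_deg n M (\<lambda>j. q ` homogeneous {1..n} j) F j =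
    cls F ` {f \<in> loc S F. \<forall>\<alpha>\<in>Poly_Mapping.keys f. exp_deg \<alpha> = j}"
proof (rule subset_antisym; rule subsetI)
  fix X assume "X \<in> localization_deg n M (\<lambda>j. q ` homogeneous {1..n} j) F j"
  then obtain g a where g: "g \<in> homogeneous {1..n} (j + int a * int (card F))"
    and X: "X = mod_frac R M (face_monom F) (q g) a"
    by (auto simp: localization_deg_def)
  have gS: "g \<in> S" using g by (simp add: hom_emb_iff)
  have "X = cls F (xpow F (- int a) * emb g)" using X mod_frac_cls[OF F gS] by simp
  moreover have "xpow F (- int a) * emb g \<in> loc S F" by (rule emb_in_loc[OF ideal_of_carrier F gS])
  moreover have "\<forall>\<alpha>\<in>Poly_Mapping.keys (xpow F (- int a) * emb g). exp_deg \<alpha> = j"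
    using g by (auto simp: keys_xpow_mult hom_emb_iff exp_deg_add exp_deg_const_exp)
  ultimately show "X \<in> cls F ` {f \<in> loc S F. \<forall>\<alpha>\<in>Poly_Mapping.keys f. exp_deg \<alpha> = j}" by blast
next
  fix X assume "X \<in> cls F ` {f \<in> loc S F. \<forall>\<alpha>\<in>Poly_Mapping.keys f. exp_deg \<alpha> = j}"
  then obtain f where f: "f \<in> loc S F" "\<forall>\<alpha>\<in>Poly_Mapping.keys f. exp_deg \<alpha> = j" "X = cls F f" by auto
  obtain g a where g: "g \<in> S" "f = xpow F (- int a) * emb g" by (rule locE[OF ideal_of_carrier F f(1)])
  have "emb g = xpow F (int a) * f" by (simp add: g)
  then have "g \<in> homogeneous {1..n} (j + int a * int (card F))"
    using g(1) f(2) by (auto simp: hom_emb_iff keys_xpow_mult exp_deg_add exp_deg_const_exp)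
  moreover have "X = mod_frac R M (face_monom F) (q g) a"
    using mod_frac_cls[OF F g(1)] g f by simp
  ultimately show "X \<in> localization_deg n M (\<lambda>j. q ` homogeneous {1..n} j) F j"
    unfolding localization_deg_def by blast
qed

text \<open>Homogeneity of a cocycle is given entry by entry and only modulo I. Choosing a
  homogeneous representative of each entry changes the cochain by values in \<open>loc I\<close>, so
  it remains a cocycle of the same class.\<close>

lemma local_cohomology_deg_cls:
  "local_cohomology_deg n M (\<lambda>j. q ` homogeneous {1..n} j) p j = coh_cls p ` {u \<in> Z p. hom_deg j u}"
proof -
  let ?X = "subsets_of_card n p" and ?deg = "localization_deg n M (\<lambda>j. q ` homogeneous {1..n} j)"
  have "{z \<in> cech_cls p ` Z p. \<forall>F\<in>?X. z F \<in> ?deg F j} = cech_cls p ` {u \<in> Z p. hom_deg j u}"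
  proof (rule subset_antisym; rule subsetI)
    fix z assume "z \<in> {z \<in> cech_cls p ` Z p. \<forall>F\<in>?X. z F \<in> ?deg F j}"
    then obtain u where u: "u \<in> Z p" "z = cech_cls p u" and z: "\<forall>F\<in>?X. z F \<in> ?deg F j" by auto
    define w where "w F = (if F \<in> ?X then SOME f. f \<in> loc S F \<and> (\<forall>\<alpha>\<in>Poly_Mapping.keys f. exp_deg \<alpha> = j) \<and> z F = cls F f else 0)" for F
    have w: "w F \<in> loc S F \<and> (\<forall>\<alpha>\<in>Poly_Mapping.keys (w F). exp_deg \<alpha> = j) \<and> z F = cls F (w F)" if F: "F \<in> ?X" for F
    proof -
      have "\<exists>f. f \<in> loc S F \<and> (\<forall>\<alpha>\<in>Poly_Mapping.keys f. exp_deg \<alpha> = j) \<and> z F = cls F f"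
        using bspec[OF z F] unfolding localization_deg_cls[OF subsets_of_cardD(1)[OF F]] by blast
      from someI_ex[OF this] show ?thesis using F by (simp add: w_def)
    qed
    have wC: "w \<in> cochains n (loc S) p" using w by (auto simp: cochains_def w_def)
    moreover have "hom_deg j w" using w by (auto simp: hom_deg_def w_def split: if_splits)
    moreover have zw: "z = cech_cls p w" using w u by (auto simp: cech_cls_def fun_eq_iff)
    moreover have "w \<in> Z p"
    proof -
      have "u \<in> cochains n (loc S) p" using u by (simp add: cech_cocycles_def)
      then have "u - w \<in> cochains n (loc I) p"
        using presents_cech[of p] wC zw u unfolding presents_def by metis
      then have "u - w \<in> Z p"
        using zero_cochains_subset[OF good_S good_I loc_I_sub] coboundaries_subset[OF good_S good_I loc_I_sub] by blast
      from submod_diff[OF submod_cocycles[OF good_S good_I loc_I_sub] u(1) this] show ?thesis by simp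
    qed
    ultimately show "z \<in> cech_cls p ` {u \<in> Z p. hom_deg j u}" by blast
  next
    fix z assume "z \<in> cech_cls p ` {u \<in> Z p. hom_deg j u}"
    then obtain u where u: "u \<in> Z p" "hom_deg j u" "z = cech_cls p u" by auto
    have "z F \<in> ?deg F j" if "F \<in> ?X" for F
    proof -
      have "u F \<in> loc S F" using u that by (simp add: cech_cocycles_def cochains_def)
      then show ?thesis using u that localization_deg_cls[OF subsets_of_cardD(1)[OF that]]
        by (auto simp: cech_cls_def hom_deg_def)
    qed
    then show "z \<in> {z \<in> cech_cls p ` Z p. \<forall>F\<in>?X. z F \<in> ?deg F j}" using u by blast
  qed
  moreover have "local_cohomology_deg n M (\<lambda>j. q ` homogeneous {1..n} j) p j =
      (\<lambda>z. cech_cls p ` B p +>\<^bsub>cech_module n M p\<^esub> z) ` {z \<in> cech_cls p ` Z p. \<forall>F\<in>?X. z F \<in> ?deg F j}"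
    unfolding local_cohomology_deg_def cocycles_cls coboundaries_cls by blast
  ultimately show ?thesis by (simp only: coh_cls_def[abs_def] image_image)
qed

end

section \<open>Ideals of the face ring and of its reductions, pulled back to S\<close>

section \<open>Quotient rings of the polynomial ring\<close>

abbreviation "polys n \<equiv> carrier (poly_ring {1..n})"

definition presents_ring where
  "presents_ring n I q A \<longleftrightarrow> ring A \<and> q \<in> Ring.ring_hom (poly_ring {1..n}) A \<and>
     q ` carrier (poly_ring {1..n}) = carrier A \<and> ideal_of n I \<and> I \<subseteq> carrier (poly_ring {1..n}) \<and>
     (\<forall>f\<in>carrier (poly_ring {1..n}). \<forall>g\<in>carrier (poly_ring {1..n}). q f = q g \<longleftrightarrow> f - g \<in> I)"

context
  fixes n :: nat and I :: "(nat, 'k::field) mpoly set" and q :: "(nat, 'k) mpoly \<Rightarrow> 'b" and A :: "'b ring"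
  assumes P: "presents_ring n I q A"
begin

lemma pr_props:
  shows "ring A" "ideal_of n I" "I \<subseteq> polys n" "carrier A = q ` polys n"
    and "\<And>f g. f \<in> polys n \<Longrightarrow> g \<in> polys n \<Longrightarrow> q f \<oplus>\<^bsub>A\<^esub> q g = q (f + g)"
    and "\<And>f g. f \<in> polys n \<Longrightarrow> g \<in> polys n \<Longrightarrow> q f \<otimes>\<^bsub>A\<^esub> q g = q (f * g)"
    and "\<And>f g. f \<in> polys n \<Longrightarrow> g \<in> polys n \<Longrightarrow> q f = q g \<longleftrightarrow> f - g \<in> I"
  using P by (auto simp: presents_ring_def Ring.ring_hom_def)

lemma pr_zero: "\<zero>\<^bsub>A\<^esub> = q 0"
proof -
  interpret A: ring A by (rule pr_props)
  have "q 0 \<oplus>\<^bsub>A\<^esub> q 0 = q 0" "q 0 \<in> carrier A" using pr_props(5)[of 0 0] pr_props(4) by auto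
  then show ?thesis using A.add.l_cancel_one[of "q 0" "q 0"] by simp
qed

lemma pr_minus: "f \<in> polys n \<Longrightarrow> g \<in> polys n \<Longrightarrow> q f \<ominus>\<^bsub>A\<^esub> q g = q (f - g)"
proof -
  assume fg: "f \<in> polys n" "g \<in> polys n"
  interpret A: ring A by (rule pr_props)
  have in_A: "q h \<in> carrier A" if "h \<in> polys n" for h using that pr_props(4) by auto
  have "q g \<oplus>\<^bsub>A\<^esub> q (- g) = \<zero>\<^bsub>A\<^esub>" using fg pr_props(5)[of g "- g"] by (auto simp: pr_zero)
  then have "q (- g) = \<ominus>\<^bsub>A\<^esub> q g"
    using fg in_A[of g] in_A[of "- g"] A.minus_equality[of "q (- g)" "q g"]
    by (simp add: A.a_comm[of "q g"] poly_ring_uminus)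
  then show ?thesis using fg pr_props(5)[of f "- g"] by (auto simp: a_minus_def)
qed

lemma presents_ring_module: "presents (poly_ring {1..n}) (*) (polys n) I q (ring_module q A)"
  unfolding presents_def ring_module_def
  using pr_props pr_zero ideal_of_carrier
  by (auto intro!: action_poly_ring simp: algebra_simps)

lemma ideal_image:
  assumes "ideal_of n W" "W \<subseteq> polys n"
  shows "ideal (q ` W) A"
proof -
  interpret A: ring A by (rule pr_props)
  have WS: "w \<in> polys n" if "w \<in> W" for w using assms that by auto
  have in_A: "q h \<in> carrier A" if "h \<in> polys n" for h using that pr_props(4) by auto
  show ?thesis
  proof (rule idealI[OF A.ring_axioms])
    show "subgroup (q ` W) (add_monoid A)"
    proof (rule A.add.subgroupI)
      fix a assume "a \<in> q ` W"
      then obtain w where w: "w \<in> W" "a = q w" by auto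
      have "\<zero>\<^bsub>A\<^esub> \<ominus>\<^bsub>A\<^esub> a = q (0 - w)" using w WS by (simp only: pr_zero) (rule pr_minus, auto)
      moreover have "\<zero>\<^bsub>A\<^esub> \<ominus>\<^bsub>A\<^esub> a = \<ominus>\<^bsub>A\<^esub> a" using w WS in_A by (simp add: a_minus_def)
      ultimately show "\<ominus>\<^bsub>A\<^esub> a \<in> q ` W" using submod_uminus[OF assms(1) w(1)] by auto
    next
      fix a b assume "a \<in> q ` W" "b \<in> q ` W"
      then obtain v w where "v \<in> W" "a = q v" "w \<in> W" "b = q w" by auto
      then show "a \<oplus>\<^bsub>A\<^esub> b \<in> q ` W" using pr_props(5) WS submod_add[OF assms(1)] by auto
    qed (use in_A WS submod_0[OF assms(1)] in auto)
  next
    fix a x assume "a \<in> q ` W" "x \<in> carrier A"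
    then obtain w f where "w \<in> W" "a = q w" "f \<in> polys n" "x = q f" using pr_props(4) by auto
    then show "x \<otimes>\<^bsub>A\<^esub> a \<in> q ` W" "a \<otimes>\<^bsub>A\<^esub> x \<in> q ` W"
      using pr_props(6) WS submod_act[OF assms(1), of f w] by (auto simp: mult.commute)
  qed
qed

lemma presents_ring_Quot:
  assumes "ideal T A"
  shows "presents_ring n {f \<in> polys n. q f \<in> T} (\<lambda>f. T +>\<^bsub>A\<^esub> q f) (A Quot T)"
proof -
  interpret A: ring A by (rule pr_props)
  interpret T: ideal T A by fact
  have in_A: "q h \<in> carrier A" if "h \<in> polys n" for h using that pr_props(4) by auto
  have "(\<lambda>f. T +>\<^bsub>A\<^esub> q f) \<in> Ring.ring_hom (poly_ring {1..n}) (A Quot T)"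
    using ring_hom_trans[of q "poly_ring {1..n}" A "(+>\<^bsub>A\<^esub>) T"] P T.rcos_ring_hom
    by (auto simp: presents_ring_def comp_def)
  moreover have "(\<lambda>f. T +>\<^bsub>A\<^esub> q f) ` polys n = carrier (A Quot T)"
    using pr_props(4) by (auto simp: FactRing_def A_RCOSETS_def')
  moreover have "ideal_of n {f \<in> polys n. q f \<in> T}"
  proof (rule submodI)
    fix f g assume "f \<in> {f \<in> polys n. q f \<in> T}" "g \<in> {f \<in> polys n. q f \<in> T}"
    then show "f - g \<in> {f \<in> polys n. q f \<in> T}"
      using pr_minus[of f g] T.a_closed[of "q f" "\<ominus>\<^bsub>A\<^esub> q g"] by (auto simp: a_minus_def)
  next
    fix r f :: "(nat, 'k) mpoly" assume "r \<in> polys n" "f \<in> {f \<in> polys n. q f \<in> T}"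
    then show "r * f \<in> {f \<in> polys n. q f \<in> T}"
      using pr_props(6)[of r f] T.I_l_closed[of "q f" "q r"] in_A by auto
  qed (use pr_zero T.zero_closed in auto)
  moreover have "T +>\<^bsub>A\<^esub> q f = T +>\<^bsub>A\<^esub> q g \<longleftrightarrow> f - g \<in> {f \<in> polys n. q f \<in> T}" if "f \<in> polys n" "g \<in> polys n" for f g
    using A.quotient_eq_iff_same_a_r_cos[OF assms in_A[OF that(1)] in_A[OF that(2)]] pr_minus[OF that] that by auto
  ultimately show ?thesis
    unfolding presents_ring_def using T.quotient_is_ring by auto
qed

text \<open>Ideals of A correspond to the ideals of S that contain I. The preimage of a generated
  ideal is therefore recognized by minimality among the latter.\<close>

lemma genideal_presents:
  assumes G: "G \<subseteq> polys n" and W: "ideal_of n W" "W \<subseteq> polys n" "G \<subseteq> W" "I \<subseteq> W"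
    and min: "\<And>V. ideal_of n V \<Longrightarrow> V \<subseteq> polys n \<Longrightarrow> G \<subseteq> V \<Longrightarrow> I \<subseteq> V \<Longrightarrow> W \<subseteq> V"
  shows "{f \<in> polys n. q f \<in> genideal A (q ` G)} = W"
proof (rule subset_antisym)
  interpret A: ring A by (rule pr_props)
  have sub: "q ` G \<subseteq> carrier A" using G pr_props(4) by auto
  show "{f \<in> polys n. q f \<in> genideal A (q ` G)} \<subseteq> W"
  proof
    fix f assume f: "f \<in> {f \<in> polys n. q f \<in> genideal A (q ` G)}"
    have "genideal A (q ` G) \<subseteq> q ` W"
      using W by (intro A.genideal_minimal ideal_image) auto
    then obtain w where w: "w \<in> W" "q f = q w" using f by auto
    moreover from w have "w \<in> polys n" using W by auto
    ultimately have "f - w \<in> I" using pr_props(7)[of f w] f by blast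
    then have "f - w \<in> W" using W by auto
    then show "f \<in> W" using submod_add[OF W(1) _ w(1), of "f - w"] by simp
  qed
  have id: "ideal (genideal A (q ` G)) A" using sub by (rule A.genideal_ideal)
  have "presents_ring n {f \<in> polys n. q f \<in> genideal A (q ` G)}
      (\<lambda>f. genideal A (q ` G) +>\<^bsub>A\<^esub> q f) (A Quot genideal A (q ` G))"
    by (rule presents_ring_Quot[OF id])
  then have *: "ideal_of n {f \<in> polys n. q f \<in> genideal A (q ` G)}" by (simp add: presents_ring_def)
  show "W \<subseteq> {f \<in> polys n. q f \<in> genideal A (q ` G)}"
  proof (rule min[OF *])
    show "I \<subseteq> {f \<in> polys n. q f \<in> genideal A (q ` G)}"
    proof
      fix f assume "f \<in> I"
      then have "f \<in> polys n" "q f = \<zero>\<^bsub>A\<^esub>" using pr_props(3) pr_props(7)[of f 0] by (auto simp: pr_zero)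
      then show "f \<in> {f \<in> polys n. q f \<in> genideal A (q ` G)}"
        using additive_subgroup.zero_closed[OF ideal.axioms(1)[OF id]] by simp
    qed
    show "G \<subseteq> {f \<in> polys n. q f \<in> genideal A (q ` G)}" using A.genideal_self[OF sub] G by auto
  qed auto
qed

end

text \<open>Membership in a monomial ideal is decided term by term; for a subset-closed \<Delta>
  this is the Stanley-Reisner ideal, in the form in which localizations can be read off.\<close>

definition nonface_ideal :: "nat \<Rightarrow> nat set set \<Rightarrow> (nat, 'k::field) mpoly set" where
  "nonface_ideal n \<Delta> = {f \<in> carrier (poly_ring {1..n}). \<forall>e\<in>Poly_Mapping.keys f. Poly_Mapping.keys e \<notin> \<Delta>}"

text \<open>The forms are indexed by an arbitrary set, because elimination removes forms other than
  the last one.\<close>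

definition form_ideal :: "nat \<Rightarrow> nat set set \<Rightarrow> (nat \<Rightarrow> (nat, 'k::field) mpoly) \<Rightarrow> nat set \<Rightarrow> (nat, 'k) mpoly set" where
  "form_ideal n \<Delta> \<theta> P = {f + (\<Sum>p\<in>P. \<theta> p * g p) | f g. f \<in> nonface_ideal n \<Delta> \<and> g ` P \<subseteq> carrier (poly_ring {1..n})}"

lemma nonface_ideal_empty: "nonface_ideal n {} = carrier (poly_ring {1..n})"
  by (simp add: nonface_ideal_def)

lemma ideal_of_nonface:
  assumes "subset_closed \<Delta>"
  shows "ideal_of n (nonface_ideal n \<Delta>)"
proof (rule submodI)
  fix f g :: "(nat, 'a) mpoly" assume "f \<in> nonface_ideal n \<Delta>" "g \<in> nonface_ideal n \<Delta>"
  moreover have "Poly_Mapping.keys (f - g) \<subseteq> Poly_Mapping.keys f \<union> Poly_Mapping.keys g"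
    by (auto simp: in_keys_iff lookup_minus)
  ultimately show "f - g \<in> nonface_ideal n \<Delta>" by (auto simp: nonface_ideal_def)
next
  fix r f :: "(nat, 'a) mpoly" assume rf: "r \<in> carrier (poly_ring {1..n})" "f \<in> nonface_ideal n \<Delta>"
  have "Poly_Mapping.keys e \<notin> \<Delta>" if "e \<in> Poly_Mapping.keys (r * f)" for e
  proof -
    have "e \<in> {a + b |a b. a \<in> Poly_Mapping.keys r \<and> b \<in> Poly_Mapping.keys f}"
      using that keys_mult by (rule subsetD[rotated])
    then obtain a b where "e = a + b" "b \<in> Poly_Mapping.keys f" by blast
    then have "Poly_Mapping.keys b \<subseteq> Poly_Mapping.keys e" "Poly_Mapping.keys b \<notin> \<Delta>"
      using rf by (auto simp: nonface_ideal_def keys_plus_eq)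
    then show ?thesis using assms by (auto simp: subset_closed_def)
  qed
  then show "r * f \<in> nonface_ideal n \<Delta>" using rf by (auto simp: nonface_ideal_def)
qed (simp add: nonface_ideal_def)

lemma nonface_ideal_sub: "nonface_ideal n \<Delta> \<subseteq> carrier (poly_ring {1..n})"
  by (auto simp: nonface_ideal_def)

lemma form_idealI:
  "f \<in> nonface_ideal n \<Delta> \<Longrightarrow> g ` P \<subseteq> carrier (poly_ring {1..n}) \<Longrightarrow> x = f + (\<Sum>p\<in>P. \<theta> p * g p) \<Longrightarrow>
    x \<in> form_ideal n \<Delta> \<theta> P"
  unfolding form_ideal_def by (intro CollectI exI conjI)

lemma ideal_of_form:
  assumes "subset_closed \<Delta>"
  shows "ideal_of n (form_ideal n \<Delta> \<theta> P)"
proof (rule submodI)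
  show "0 \<in> form_ideal n \<Delta> \<theta> P"
    unfolding form_ideal_def
    using submod_0[OF ideal_of_nonface[OF assms]] by (intro CollectI exI[of _ 0] exI[of _ "\<lambda>_. 0"]) auto
next
  fix x y assume "x \<in> form_ideal n \<Delta> \<theta> P" "y \<in> form_ideal n \<Delta> \<theta> P"
  then obtain f g f' g' where *: "x = f + (\<Sum>p\<in>P. \<theta> p * g p)" "y = f' + (\<Sum>p\<in>P. \<theta> p * g' p)"
    "f \<in> nonface_ideal n \<Delta>" "f' \<in> nonface_ideal n \<Delta>"
    "g ` P \<subseteq> carrier (poly_ring {1..n})" "g' ` P \<subseteq> carrier (poly_ring {1..n})"
    by (auto simp: form_ideal_def)
  have "x - y = (f - f') + (\<Sum>p\<in>P. \<theta> p * (g p - g' p))"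
    by (simp add: * right_diff_distrib sum_subtractf)
  moreover have "f - f' \<in> nonface_ideal n \<Delta>" using * submod_diff[OF ideal_of_nonface[OF assms]] by blast
  moreover have "(\<lambda>p. g p - g' p) ` P \<subseteq> carrier (poly_ring {1..n})" using * by auto
  ultimately show "x - y \<in> form_ideal n \<Delta> \<theta> P" by (intro form_idealI)
next
  fix r x assume r: "r \<in> carrier (poly_ring {1..n} :: (nat, 'a) mpoly ring)" and "x \<in> form_ideal n \<Delta> \<theta> P"
  then obtain f g where *: "x = f + (\<Sum>p\<in>P. \<theta> p * g p)" "f \<in> nonface_ideal n \<Delta>"
    "g ` P \<subseteq> carrier (poly_ring {1..n})" by (auto simp: form_ideal_def)
  have "r * x = r * f + (\<Sum>p\<in>P. \<theta> p * (r * g p))"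
    by (simp add: * distrib_left sum_distrib_left ac_simps)
  moreover have "r * f \<in> nonface_ideal n \<Delta>" using * submod_act[OF ideal_of_nonface[OF assms] r] by blast
  moreover have "(\<lambda>p. r * g p) ` P \<subseteq> carrier (poly_ring {1..n})" using * r by auto
  ultimately show "r * x \<in> form_ideal n \<Delta> \<theta> P" by (intro form_idealI)
qed

lemma form_ideal_sub:
  "(\<And>p. p \<in> P \<Longrightarrow> \<theta> p \<in> carrier (poly_ring {1..n})) \<Longrightarrow> form_ideal n \<Delta> \<theta> P \<subseteq> carrier (poly_ring {1..n})"
  using nonface_ideal_sub[of n \<Delta>] by (auto simp: form_ideal_def intro!: poly_ring_add poly_ring_sum poly_ring_mult)

lemma form_ideal_nonface: "nonface_ideal n \<Delta> \<subseteq> form_ideal n \<Delta> \<theta> P"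
proof
  fix f :: "(nat, 'a) mpoly" assume "f \<in> nonface_ideal n \<Delta>"
  then show "f \<in> form_ideal n \<Delta> \<theta> P"
    unfolding form_ideal_def by (intro CollectI exI[of _ f] exI[of _ "\<lambda>_. 0"]) auto
qed

lemma form_ideal_empty: "form_ideal n \<Delta> \<theta> {} = nonface_ideal n \<Delta>"
  by (simp add: form_ideal_def)

lemma form_ideal_insert:
  assumes "finite P" "p \<notin> P"
  shows "form_ideal n \<Delta> \<theta> (insert p P) = {f + \<theta> p * g | f g. f \<in> form_ideal n \<Delta> \<theta> P \<and> g \<in> carrier (poly_ring {1..n})}"
proof (rule subset_antisym; rule subsetI)
  fix x assume "x \<in> form_ideal n \<Delta> \<theta> (insert p P)"
  then obtain f g where *: "x = f + (\<Sum>p\<in>insert p P. \<theta> p * g p)" "f \<in> nonface_ideal n \<Delta>"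
    "g ` insert p P \<subseteq> carrier (poly_ring {1..n})" by (auto simp: form_ideal_def)
  then have "x = (f + (\<Sum>p\<in>P. \<theta> p * g p)) + \<theta> p * g p" using assms by (simp add: ac_simps)
  moreover have "f + (\<Sum>p\<in>P. \<theta> p * g p) \<in> form_ideal n \<Delta> \<theta> P" using * by (intro form_idealI) auto
  ultimately show "x \<in> {f + \<theta> p * g | f g. f \<in> form_ideal n \<Delta> \<theta> P \<and> g \<in> carrier (poly_ring {1..n})}"
    using * by blast
next
  fix x assume "x \<in> {f + \<theta> p * g | f g. f \<in> form_ideal n \<Delta> \<theta> P \<and> g \<in> carrier (poly_ring {1..n})}"
  then obtain f g h where *: "x = (f + (\<Sum>p\<in>P. \<theta> p * g p)) + \<theta> p * h" "f \<in> nonface_ideal n \<Delta>"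
    "g ` P \<subseteq> carrier (poly_ring {1..n})" "h \<in> carrier (poly_ring {1..n})" by (auto simp: form_ideal_def)
  have "(\<Sum>q\<in>P. \<theta> q * (g(p := h)) q) = (\<Sum>q\<in>P. \<theta> q * g q)"
    using assms by (intro sum.cong) auto
  then have "x = f + (\<Sum>q\<in>insert p P. \<theta> q * (g(p := h)) q)"
    using assms by (simp add: * ac_simps)
  moreover have "(g(p := h)) ` insert p P \<subseteq> carrier (poly_ring {1..n})" using * by auto
  ultimately show "x \<in> form_ideal n \<Delta> \<theta> (insert p P)" using * by (intro form_idealI)
qed

lemma form_in_form_ideal:
  assumes "subset_closed \<Delta>" "finite P" "p \<in> P"
  shows "\<theta> p \<in> form_ideal n \<Delta> \<theta> P"
proof -
  have "insert p (P - {p}) = P" using assms by auto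
  moreover have "0 + \<theta> p * 1 \<in> form_ideal n \<Delta> \<theta> (insert p (P - {p}))"
    using submod_0[OF ideal_of_form[OF assms(1)]] assms by (subst form_ideal_insert) blast+
  ultimately show ?thesis by simp
qed

lemma simplicial_subset_closed: "simplicial_complex n \<Delta> \<Longrightarrow> subset_closed \<Delta>"
  unfolding simplicial_complex_def subset_closed_def
  by (meson PowD finite_atLeastAtMost finite_subset subsetD)

lemma presents_poly_ring: "presents_ring n {0} id (poly_ring {1..n})"
proof -
  interpret cring "poly_ring {1..n}" by (rule cring_poly_ring)
  show ?thesis
    unfolding presents_ring_def by (auto simp: ring_axioms Ring.ring_hom_def submod_def)
qed

lemma face_ideal_eq:
  assumes "subset_closed \<Delta>"
  shows "face_ideal n \<Delta> = (nonface_ideal n \<Delta> :: (nat, 'k::field) mpoly set)"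
proof -
  let ?G = "{face_monom F | F. F \<subseteq> {1..n} \<and> F \<notin> \<Delta>} :: (nat, 'k) mpoly set"
  have fm: "face_monom F = (Poly_Mapping.single (\<Sum>t\<in>F. Poly_Mapping.single t 1) 1 :: (nat, 'k) mpoly)"
    if "finite F" for F
    using that unfolding face_monom_def by (induction F rule: finite_induct) (simp_all add: poly_var_def mult_single)
  \<comment> \<open>A term with support F is divisible by x_F; the quotient has its exponents on F
    lowered by one.\<close>
  have single: "Poly_Mapping.single e c = face_monom (Poly_Mapping.keys e) * Poly_Mapping.single (Poly_Mapping.map (\<lambda>k. k - 1) e) c"
    for e :: "nat \<Rightarrow>\<^sub>0 nat" and c :: 'k
  proof -
    have "(\<Sum>t\<in>Poly_Mapping.keys e. Poly_Mapping.single t 1) + Poly_Mapping.map (\<lambda>k. k - 1) e = e"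
      by (rule poly_mapping_eqI)
        (auto simp: lookup_add lookup_sum lookup_single Poly_Mapping.map.rep_eq when_def in_keys_iff)
    then show ?thesis by (simp add: fm mult_single)
  qed
  have keys_fm: "Poly_Mapping.keys (face_monom F :: (nat, 'k) mpoly) = {\<Sum>t\<in>F. Poly_Mapping.single t 1}" if "finite F" for F
    by (simp add: fm[OF that])
  have "{f \<in> carrier (poly_ring {1..n}). id f \<in> genideal (poly_ring {1..n}) (id ` ?G)} = nonface_ideal n \<Delta>"
  proof (rule genideal_presents[OF presents_poly_ring _ ideal_of_nonface[OF assms] nonface_ideal_sub])
    show "?G \<subseteq> carrier (poly_ring {1..n})" by auto
    show "?G \<subseteq> nonface_ideal n \<Delta>"
    proof
      fix f assume "f \<in> ?G"
      then obtain F where F: "F \<subseteq> {1..n}" "F \<notin> \<Delta>" "f = face_monom F" by auto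
      then have fin: "finite F" using finite_subset by blast
      have "Poly_Mapping.keys (\<Sum>t\<in>F. Poly_Mapping.single t (1::nat)) = F"
        using fin by (auto simp: in_keys_iff lookup_sum lookup_single when_def split: if_splits)
      then have "Poly_Mapping.keys e = F" if "e \<in> Poly_Mapping.keys f" for e
        using that fin F(3) keys_fm by simp
      then show "f \<in> nonface_ideal n \<Delta>"
        using F by (auto simp: nonface_ideal_def)
    qed
    fix V :: "(nat, 'k) mpoly set" assume V: "ideal_of n V" "?G \<subseteq> V"
    show "nonface_ideal n \<Delta> \<subseteq> V"
    proof
      fix f :: "(nat, 'k) mpoly" assume f: "f \<in> nonface_ideal n \<Delta>"
      have "Poly_Mapping.single e (Poly_Mapping.lookup f e) \<in> V" if e: "e \<in> Poly_Mapping.keys f" for e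
      proof -
        have ke: "Poly_Mapping.keys e \<subseteq> {1..n}" "Poly_Mapping.keys e \<notin> \<Delta>"
          using f e by (auto simp: nonface_ideal_def in_poly_ring)
        then have "face_monom (Poly_Mapping.keys e) \<in> V" using V by blast
        moreover have "Poly_Mapping.single (Poly_Mapping.map (\<lambda>k. k - 1) e) (Poly_Mapping.lookup f e) \<in> carrier (poly_ring {1..n})"
          using ke by (auto simp: in_poly_ring in_keys_iff Poly_Mapping.map.rep_eq when_def split: if_splits)
        ultimately show ?thesis
          by (subst single, subst mult.commute) (rule submod_act[OF V(1)])
      qed
      then have "(\<Sum>e\<in>Poly_Mapping.keys f. Poly_Mapping.single e (Poly_Mapping.lookup f e)) \<in> V"
        by (intro submod_sum[OF V(1)])
      then show "f \<in> V" using poly_mapping_sum_single[of f] by simp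
    qed
  qed (use submod_0[OF ideal_of_nonface[OF assms]] in auto)
  moreover have "genideal (poly_ring {1..n}) ?G \<subseteq> carrier (poly_ring {1..n} :: (nat, 'k) mpoly ring)"
  proof -
    interpret R: cring "poly_ring {1..n} :: (nat, 'k) mpoly ring" by (rule cring_poly_ring)
    have "ideal (genideal (poly_ring {1..n}) ?G) (poly_ring {1..n})" by (rule R.genideal_ideal) auto
    then interpret ideal "genideal (poly_ring {1..n}) ?G" "poly_ring {1..n} :: (nat, 'k) mpoly ring" .
    show ?thesis by (rule a_subset)
  qed
  ultimately have "genideal (poly_ring {1..n}) ?G = nonface_ideal n \<Delta>"
    by (simp only: image_id id_apply) (simp add: Collect_conj_eq Int_absorb1)
  then show ?thesis by (simp only: face_ideal_def)
qed

context
  fixes n :: nat and \<Delta> :: "nat set set"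
  assumes \<Delta>: "subset_closed \<Delta>"
begin

lemma presents_face_ring:
  "presents_ring n (nonface_ideal n \<Delta>) (face_proj n \<Delta>) (face_ring n \<Delta> :: (nat, 'k::field) mpoly set ring)"
proof -
  have "ideal (id ` nonface_ideal n \<Delta>) (poly_ring {1..n} :: (nat, 'k) mpoly ring)"
    by (rule ideal_image[OF presents_poly_ring ideal_of_nonface[OF \<Delta>] nonface_ideal_sub])
  then have "ideal (face_ideal n \<Delta>) (poly_ring {1..n} :: (nat, 'k) mpoly ring)"
    using face_ideal_eq[OF \<Delta>, of n, where 'k = 'k] by simp
  from presents_ring_Quot[OF presents_poly_ring this] show ?thesis
    using nonface_ideal_sub[of n \<Delta>, where 'a = 'k] face_ideal_eq[OF \<Delta>, of n, where 'k = 'k]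
    by (simp add: face_ring_def face_proj_def[abs_def] Collect_conj_eq Int_absorb1)
qed

lemma cyclic_face_module: "cyclic n (nonface_ideal n \<Delta>) (face_proj n \<Delta>) (face_module n \<Delta>)"
  unfolding cyclic_def face_module_def by (rule presents_ring_module[OF presents_face_ring])

lemma cyclic_reduced_module:
  assumes "\<And>p. \<theta> p \<in> carrier (poly_ring {1..n})"
  shows "cyclic n (form_ideal n \<Delta> \<theta> {1..m}) (reduced_proj n \<Delta> \<theta> m) (reduced_module n \<Delta> \<theta> m)"
proof -
  have e: "{face_proj n \<Delta> (\<theta> p) | p. p \<in> {1..m}} = face_proj n \<Delta> ` \<theta> ` {1..m}" by auto
  have sub: "\<theta> ` {1..m} \<subseteq> carrier (poly_ring {1..n})" using assms by auto
  have "{f \<in> carrier (poly_ring {1..n}). face_proj n \<Delta> f \<in> theta_ideal n \<Delta> \<theta> m} = form_ideal n \<Delta> \<theta> {1..m}"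
    unfolding theta_ideal_def e
  proof (rule genideal_presents[OF presents_face_ring sub ideal_of_form[OF \<Delta>] form_ideal_sub _ form_ideal_nonface])
    show "\<theta> ` {1..m} \<subseteq> form_ideal n \<Delta> \<theta> {1..m}" using form_in_form_ideal[OF \<Delta>] by auto
    fix V assume V: "ideal_of n V" "\<theta> ` {1..m} \<subseteq> V" "nonface_ideal n \<Delta> \<subseteq> V"
    show "form_ideal n \<Delta> \<theta> {1..m} \<subseteq> V"
    proof
      fix x assume "x \<in> form_ideal n \<Delta> \<theta> {1..m}"
      then obtain f g where *: "x = f + (\<Sum>p\<in>{1..m}. \<theta> p * g p)" "f \<in> nonface_ideal n \<Delta>"
        "g ` {1..m} \<subseteq> carrier (poly_ring {1..n})" by (auto simp: form_ideal_def)
      have "g p * \<theta> p \<in> V" if "p \<in> {1..m}" for p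
        using that * V by (intro submod_act[OF V(1)]) auto
      then show "x \<in> V" using * V
        by (auto intro!: submod_add[OF V(1)] submod_sum[OF V(1)] simp: mult.commute)
    qed
  qed (use assms in auto)
  moreover have "ideal (theta_ideal n \<Delta> \<theta> m) (face_ring n \<Delta>)"
    unfolding theta_ideal_def e
    using sub pr_props[OF presents_face_ring] by (intro ring.genideal_ideal) auto
  from presents_ring_Quot[OF presents_face_ring this]
  have "presents_ring n {f \<in> carrier (poly_ring {1..n}). face_proj n \<Delta> f \<in> theta_ideal n \<Delta> \<theta> m}
      (reduced_proj n \<Delta> \<theta> m) (reduced_ring n \<Delta> \<theta> m)"
    by (simp add: reduced_ring_def reduced_proj_def[abs_def])
  ultimately show ?thesis
    unfolding cyclic_def reduced_module_def using presents_ring_module by metis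
qed

end

subsection \<open>Localizations of monomial ideals\<close>

text \<open>After multiplication by a high power of x_F all exponents on F are positive, so each
  term acquires the support F united with its old one. Negative entries can be cured only on
  F.\<close>

lemma loc_nonface_iff:
  fixes f :: "'k::field laurent"
  assumes \<Delta>: "subset_closed \<Delta>" and F: "F \<subseteq> {1..n}"
  shows "f \<in> loc (nonface_ideal n \<Delta>) F \<longleftrightarrow> (\<forall>\<alpha>\<in>Poly_Mapping.keys f. Poly_Mapping.keys \<alpha> \<subseteq> {1..n} \<and>
     (\<forall>t. Poly_Mapping.lookup \<alpha> t < 0 \<longrightarrow> t \<in> F) \<and> F \<union> Poly_Mapping.keys \<alpha> \<notin> \<Delta>)" (is "_ \<longleftrightarrow> ?r")
proof
  have fin: "finite F" using F finite_subset by blast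
  assume "f \<in> loc (nonface_ideal n \<Delta>) F"
  then obtain a g where g: "xpow F (int a) * f = emb g" "g \<in> nonface_ideal n \<Delta>" by (auto simp: loc_def)
  show ?r
  proof (intro ballI)
    fix \<alpha> assume "\<alpha> \<in> Poly_Mapping.keys f"
    then have "const_exp F (int a) + \<alpha> \<in> Poly_Mapping.keys (emb g)"
      using g(1) by (metis keys_xpow_mult imageI)
    then obtain e where e: "e \<in> Poly_Mapping.keys g" "const_exp F (int a) + \<alpha> = int_exp e"
      by (auto simp: keys_emb)
    have look: "(if t \<in> F then int a else 0) + Poly_Mapping.lookup \<alpha> t = int (Poly_Mapping.lookup e t)" for t
      using arg_cong[OF e(2), of "\<lambda>x. Poly_Mapping.lookup x t"] fin by (simp add: lookup_add lookup_const_exp)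
    have ke: "Poly_Mapping.keys e \<subseteq> {1..n}" "Poly_Mapping.keys e \<notin> \<Delta>"
      using g e by (auto simp: nonface_ideal_def in_poly_ring)
    have "Poly_Mapping.keys \<alpha> \<subseteq> F \<union> Poly_Mapping.keys e"
    proof
      fix t assume "t \<in> Poly_Mapping.keys \<alpha>"
      then show "t \<in> F \<union> Poly_Mapping.keys e" using look[of t] by (auto simp: in_keys_iff split: if_splits)
    qed
    moreover have "t \<in> F" if "Poly_Mapping.lookup \<alpha> t < 0" for t
      using look[of t] that by (auto split: if_splits)
    moreover have "Poly_Mapping.keys e \<subseteq> F \<union> Poly_Mapping.keys \<alpha>"
    proof
      fix t assume "t \<in> Poly_Mapping.keys e"
      then show "t \<in> F \<union> Poly_Mapping.keys \<alpha>" using look[of t] by (auto simp: in_keys_iff split: if_splits)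
    qed
    ultimately show "Poly_Mapping.keys \<alpha> \<subseteq> {1..n} \<and>
        (\<forall>t. Poly_Mapping.lookup \<alpha> t < 0 \<longrightarrow> t \<in> F) \<and> F \<union> Poly_Mapping.keys \<alpha> \<notin> \<Delta>"
      using ke F \<Delta> unfolding subset_closed_def by blast
  qed
next
  have fin: "finite F" using F finite_subset by blast
  assume r: ?r
  \<comment> \<open>Larger than the absolute value of every exponent in f, so that all exponents on
    F become strictly positive and the new supports contain F.\<close>
  define a where "a = (\<Sum>\<alpha>\<in>Poly_Mapping.keys f. \<Sum>t\<in>Poly_Mapping.keys \<alpha>. nat \<bar>Poly_Mapping.lookup \<alpha> t\<bar>) + 1"
  have a: "\<bar>Poly_Mapping.lookup \<alpha> t\<bar> < int a" if "\<alpha> \<in> Poly_Mapping.keys f" for \<alpha> t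
  proof (cases "t \<in> Poly_Mapping.keys \<alpha>")
    case True
    have "nat \<bar>Poly_Mapping.lookup \<alpha> t\<bar> \<le> (\<Sum>t\<in>Poly_Mapping.keys \<alpha>. nat \<bar>Poly_Mapping.lookup \<alpha> t\<bar>)"
      using True by (intro member_le_sum) auto
    also have "\<dots> \<le> (\<Sum>\<alpha>\<in>Poly_Mapping.keys f. \<Sum>t\<in>Poly_Mapping.keys \<alpha>. nat \<bar>Poly_Mapping.lookup \<alpha> t\<bar>)"
      using that by (intro member_le_sum[where f = "\<lambda>\<alpha>. \<Sum>t\<in>Poly_Mapping.keys \<alpha>. nat \<bar>Poly_Mapping.lookup \<alpha> t\<bar>"]) auto
    finally have "nat \<bar>Poly_Mapping.lookup \<alpha> t\<bar> < a" by (simp add: a_def)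
    then show ?thesis by linarith
  qed (simp add: a_def in_keys_iff sum_nonneg)
  have look: "Poly_Mapping.lookup (const_exp F (int a) + \<alpha>) t = (if t \<in> F then int a else 0) + Poly_Mapping.lookup \<alpha> t" for \<alpha> t
    using fin by (simp add: lookup_add lookup_const_exp)
  obtain g where g: "xpow F (int a) * f = emb g"
  proof (rule emb_surj)
    fix \<beta> t assume "\<beta> \<in> Poly_Mapping.keys (xpow F (int a) * f)"
    then obtain \<alpha> where \<alpha>: "\<alpha> \<in> Poly_Mapping.keys f" "\<beta> = const_exp F (int a) + \<alpha>" by (auto simp: keys_xpow_mult)
    then show "0 \<le> Poly_Mapping.lookup \<beta> t"
      using r a[OF \<alpha>(1), of t] look[of \<alpha> t] by (cases "t \<in> F") (auto simp: not_less[symmetric])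
  qed
  have "g \<in> nonface_ideal n \<Delta>"
    unfolding nonface_ideal_def in_poly_ring
  proof (intro CollectI conjI ballI)
    fix e assume "e \<in> Poly_Mapping.keys g"
    then have "int_exp e \<in> Poly_Mapping.keys (xpow F (int a) * f)" using g by (simp add: keys_emb)
    then obtain \<alpha> where \<alpha>: "\<alpha> \<in> Poly_Mapping.keys f" "int_exp e = const_exp F (int a) + \<alpha>" by (auto simp: keys_xpow_mult)
    have l: "int (Poly_Mapping.lookup e t) = (if t \<in> F then int a else 0) + Poly_Mapping.lookup \<alpha> t" for t
      using look[of \<alpha> t] \<alpha>(2) by (metis lookup_int_exp)
    have "Poly_Mapping.keys e = F \<union> Poly_Mapping.keys \<alpha>"
    proof (rule Set.set_eqI)
      fix t show "t \<in> Poly_Mapping.keys e \<longleftrightarrow> t \<in> F \<union> Poly_Mapping.keys \<alpha>"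
        using l[of t] a[OF \<alpha>(1), of t] by (auto simp: in_keys_iff split: if_splits)
    qed
    then show "Poly_Mapping.keys e \<subseteq> {1..n}" "Poly_Mapping.keys e \<notin> \<Delta>"
      using r \<alpha>(1) F by auto
  qed
  then show "f \<in> loc (nonface_ideal n \<Delta>) F" using g unfolding loc_def by blast
qed

abbreviation "Lpoly n \<equiv> loc (polys n)"

lemma Lpoly_iff:
  assumes F: "F \<subseteq> {1..n}"
  shows "f \<in> Lpoly n F \<longleftrightarrow> (\<forall>\<alpha>\<in>Poly_Mapping.keys f. Poly_Mapping.keys \<alpha> \<subseteq> {1..n} \<and>
     (\<forall>t. Poly_Mapping.lookup \<alpha> t < 0 \<longrightarrow> t \<in> F))"
proof -
  \<comment> \<open>For the empty family every set is a nonface, and the ideal of nonfaces is the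
    whole ring.\<close>
  have "subset_closed {}" by (simp add: subset_closed_def)
  from loc_nonface_iff[OF this F, of f] show ?thesis by (simp add: nonface_ideal_empty)
qed

lemma loc_form_insert:
  assumes F: "F \<subseteq> {1..n}" and P: "finite P" "p \<notin> P" and \<Delta>: "subset_closed \<Delta>"
    and \<theta>: "\<And>p. \<theta> p \<in> carrier (poly_ring {1..n})"
  shows "loc (form_ideal n \<Delta> \<theta> (insert p P)) F =
    {f + emb (\<theta> p) * g | f g. f \<in> loc (form_ideal n \<Delta> \<theta> P) F \<and> g \<in> Lpoly n F}"
proof (rule subset_antisym; rule subsetI)
  fix x assume "x \<in> loc (form_ideal n \<Delta> \<theta> (insert p P)) F"
  then obtain y a where "y \<in> form_ideal n \<Delta> \<theta> (insert p P)" and x: "x = xpow F (- int a) * emb y"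
    by (rule locE[OF ideal_of_form[OF \<Delta>] F])
  then obtain f g where f: "f \<in> form_ideal n \<Delta> \<theta> P" "g \<in> carrier (poly_ring {1..n})" "y = f + \<theta> p * g"
    unfolding form_ideal_insert[OF P] by auto
  then have "x = xpow F (- int a) * emb f + emb (\<theta> p) * (xpow F (- int a) * emb g)"
    by (simp add: x emb.lin_ext_add emb.lin_ext_mult distrib_left ac_simps)
  moreover have "xpow F (- int a) * emb f \<in> loc (form_ideal n \<Delta> \<theta> P) F"
    by (rule emb_in_loc[OF ideal_of_form[OF \<Delta>] F f(1)])
  moreover have "xpow F (- int a) * emb g \<in> Lpoly n F"
    by (rule emb_in_loc[OF ideal_of_carrier F f(2)])
  ultimately show "x \<in> {f + emb (\<theta> p) * g | f g. f \<in> loc (form_ideal n \<Delta> \<theta> P) F \<and> g \<in> Lpoly n F}"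
    by blast
next
  let ?I = "form_ideal n \<Delta> \<theta> (insert p P)"
  fix x assume "x \<in> {f + emb (\<theta> p) * g | f g. f \<in> loc (form_ideal n \<Delta> \<theta> P) F \<and> g \<in> Lpoly n F}"
  then obtain f g where f: "f \<in> loc (form_ideal n \<Delta> \<theta> P) F" "g \<in> Lpoly n F" "x = f + emb (\<theta> p) * g" by blast
  have id: "ideal_of n ?I" by (rule ideal_of_form[OF \<Delta>])
  obtain h a where h: "h \<in> carrier (poly_ring {1..n})" "g = xpow F (- int a) * emb h"
    by (rule locE[OF ideal_of_carrier F f(2)])
  have "\<theta> p \<in> ?I" using P by (intro form_in_form_ideal[OF \<Delta>]) auto
  then have "h * \<theta> p \<in> ?I" using submod_act[OF id h(1)] by blast
  then have "xpow F (- int a) * emb (h * \<theta> p) \<in> loc ?I F" by (rule emb_in_loc[OF id F])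
  then have 1: "emb (\<theta> p) * g \<in> loc ?I F" by (simp add: h emb.lin_ext_mult ac_simps)
  have "form_ideal n \<Delta> \<theta> P \<subseteq> ?I"
  proof
    fix y assume "y \<in> form_ideal n \<Delta> \<theta> P"
    then have "y + \<theta> p * 0 \<in> ?I" unfolding form_ideal_insert[OF P] by blast
    then show "y \<in> ?I" by simp
  qed
  then have "f \<in> loc ?I F" using f loc_mono_ideal by blast
  then show "x \<in> loc ?I F" using submod_add[OF submod_loc[OF id F] _ 1] f by blast
qed

section \<open>Gaussian elimination on the star of a face; torsion outside it\<close>

section \<open>Generic linear forms are regular on localizations\<close>

definition col_indep :: "(nat \<times> nat \<Rightarrow> 'k::field) \<Rightarrow> nat set \<Rightarrow> nat set \<Rightarrow> bool" where
  "col_indep b T P \<longleftrightarrow> (\<forall>c. (\<forall>t\<in>T. (\<Sum>p\<in>P. c p * b (t, p)) = 0) \<longrightarrow> (\<forall>p\<in>P. c p = 0))"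

text \<open>Column operations with pivot (\<open>t0\<close>, \<open>p0\<close>), which clear row
  \<open>t0\<close> if the pivot is nonzero; column \<open>p0\<close> itself is then
  dropped.\<close>

definition eliminate :: "(nat \<times> nat \<Rightarrow> 'k::field) \<Rightarrow> nat \<Rightarrow> nat \<Rightarrow> nat \<times> nat \<Rightarrow> 'k" where
  "eliminate b t0 p0 = (\<lambda>(t, p). b (t, p) - b (t0, p) / b (t0, p0) * b (t, p0))"

lemma col_indep_mono: "col_indep b T P \<Longrightarrow> T \<subseteq> T' \<Longrightarrow> col_indep b T' P"
  unfolding col_indep_def by blast

lemma col_indep_pivot:
  assumes "col_indep b T P" "p \<in> P" "finite P"
  obtains t where "t \<in> T" "b (t, p) \<noteq> 0"
proof -
  have "\<exists>t\<in>T. b (t, p) \<noteq> 0"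
  proof (rule ccontr)
    assume "\<not> (\<exists>t\<in>T. b (t, p) \<noteq> 0)"
    then have "\<forall>t\<in>T. (\<Sum>p'\<in>P. (if p' = p then 1 else 0) * b (t, p')) = 0"
      using assms by (auto intro!: sum.neutral)
    then show False
      using assms(1)[unfolded col_indep_def, rule_format, of "\<lambda>p'. if p' = p then 1 else 0" p] assms(2) by simp
  qed
  then show ?thesis using that by blast
qed

lemma col_indep_subset:
  assumes "col_indep b T P" "finite P" "Q \<subseteq> P"
  shows "col_indep b T Q"
  unfolding col_indep_def
proof (intro allI impI)
  fix c assume *: "\<forall>t\<in>T. (\<Sum>p\<in>Q. c p * b (t, p)) = 0"
  define c' where "c' p = (if p \<in> Q then c p else 0)" for p
  have "(\<Sum>p\<in>P. c' p * b (t, p)) = (\<Sum>p\<in>Q. c p * b (t, p))" for t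
    by (rule sum.mono_neutral_cong_right) (use assms in \<open>auto simp: c'_def\<close>)
  then have "\<forall>p\<in>P. c' p = 0" using assms(1) * by (simp add: col_indep_def)
  then have "c' p = 0" if "p \<in> Q" for p using assms(3) that by blast
  then show "\<forall>p\<in>Q. c p = 0" by (simp add: c'_def)
qed

lemma eliminate_pivot: "b (t0, p0) \<noteq> 0 \<Longrightarrow> eliminate b t0 p0 (t0, p) = 0"
  by (simp add: eliminate_def)

lemma col_indep_eliminate:
  assumes b: "col_indep b T P" and P: "finite P" "p0 \<in> P" and t0: "b (t0, p0) \<noteq> 0"
  shows "col_indep (eliminate b t0 p0) (T - {t0}) (P - {p0})"
  unfolding col_indep_def
proof (intro allI impI)
  fix c assume *: "\<forall>t\<in>T - {t0}. (\<Sum>p\<in>P - {p0}. c p * eliminate b t0 p0 (t, p)) = 0"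
  \<comment> \<open>The value at \<open>p0\<close> undoes the column operations: the combination of
    the old columns with \<open>c'\<close> equals that of the new columns with \<open>c\<close>, and
    in row \<open>t0\<close> it vanishes by itself.\<close>
  define c' where "c' = c(p0 := - (\<Sum>p\<in>P - {p0}. c p * (b (t0, p) / b (t0, p0))))"
  have "(\<Sum>p\<in>P. c' p * b (t, p)) = (\<Sum>p\<in>P - {p0}. c p * eliminate b t0 p0 (t, p))" for t
  proof -
    have "(\<Sum>p\<in>P. c' p * b (t, p)) = c' p0 * b (t, p0) + (\<Sum>p\<in>P - {p0}. c p * b (t, p))"
      using P by (subst sum.remove[OF P]) (auto simp: c'_def intro!: sum.cong)
    then show ?thesis
      by (simp add: c'_def eliminate_def right_diff_distrib sum_subtractf sum_distrib_right mult.assoc)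
  qed
  moreover have "(\<Sum>p\<in>P - {p0}. c p * eliminate b t0 p0 (t0, p)) = 0"
    by (simp add: eliminate_pivot[of b t0 p0, OF t0])
  ultimately have "\<forall>t\<in>T. (\<Sum>p\<in>P. c' p * b (t, p)) = 0" using * by (metis DiffI singletonD)
  then have "\<forall>p\<in>P. c' p = 0" using b by (simp add: col_indep_def)
  then have "c' p = 0" if "p \<in> P - {p0}" for p using that by blast
  then show "\<forall>p\<in>P - {p0}. c p = 0" by (simp add: c'_def)
qed

lemma emb_linear_form: "emb (linear_form n b p) = (\<Sum>t = 1..n. Poly_Mapping.single (Poly_Mapping.single t 1) (b (t, p)))"
  by (simp add: linear_form_def emb.lin_ext_sum emb.lin_ext_mult emb_poly_const emb_poly_var xpow_def const_exp_def mult_single)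

lemma lookup_linear_form_mult:
  "Poly_Mapping.lookup (emb (linear_form n b p) * f) \<beta> =
     (\<Sum>t = 1..n. b (t, p) * Poly_Mapping.lookup f (\<beta> - Poly_Mapping.single t 1))"
  by (simp add: emb_linear_form sum_distrib_right lookup_sum lookup_single_mult)

lemma linear_form_eliminate:
  fixes b :: "nat \<times> nat \<Rightarrow> 'k::field"
  shows "linear_form n (eliminate b t0 p0) p = linear_form n b p - poly_const (b (t0, p) / b (t0, p0)) * linear_form n b p0"
proof -
  have "poly_const (x - y * z) = (poly_const x - poly_const y * poly_const z :: (nat, 'k) mpoly)" for x y z :: 'k
    by (simp add: poly_const_def single_diff mult_single)
  then show ?thesis
    by (simp add: linear_form_def eliminate_def left_diff_distrib sum_subtractf sum_distrib_left mult.assoc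
      del: times_divide_eq_left)
qed

definition link_of :: "nat set set \<Rightarrow> nat set \<Rightarrow> nat set set" where
  "link_of \<Delta> G = {H. H \<union> G \<in> \<Delta>}"

lemma subset_closed_link: "subset_closed \<Delta> \<Longrightarrow> subset_closed (link_of \<Delta> G)"
  unfolding subset_closed_def link_of_def
  by (metis (mono_tags, lifting) Un_mono finite_Un mem_Collect_eq order_refl)

lemma emb_link_iff:
  assumes "subset_closed \<Delta>" "G \<subseteq> {1..n}" "h \<in> carrier (poly_ring {1..n})"
  shows "emb h \<in> loc (nonface_ideal n \<Delta>) G \<longleftrightarrow> h \<in> nonface_ideal n (link_of \<Delta> G)"
  unfolding loc_nonface_iff[OF assms(1,2)]
  using assms(3) by (auto simp: nonface_ideal_def link_of_def keys_emb in_poly_ring Un_commute)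

text \<open>Modulo this ideal x_t is a free variable, because t lies in G. The leading part of h
  with respect to x_t thus survives multiplication by a form in which x_t occurs.\<close>

lemma linear_form_nonzerodivisor:
  assumes \<Delta>: "subset_closed \<Delta>" and G: "G \<subseteq> {1..n}" and t: "t \<in> G" "b (t, p) \<noteq> 0"
    and h: "h \<in> carrier (poly_ring {1..n})"
    and lh: "linear_form n b p * h \<in> nonface_ideal n (link_of \<Delta> G)"
  shows "h \<in> nonface_ideal n (link_of \<Delta> G)"
proof (rule ccontr)
  assume "h \<notin> nonface_ideal n (link_of \<Delta> G)"
  \<comment> \<open>The terms of h that are nonzero modulo the ideal. For one with the largest
    exponent at t, no other term contributes to the coefficient at
    \<open>e + Poly_Mapping.single t 1\<close>.\<close>
  define E where "E = {e \<in> Poly_Mapping.keys h. Poly_Mapping.keys e \<union> G \<in> \<Delta>}"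
  have "E \<noteq> {}" "finite E"
    using \<open>h \<notin> _\<close> h by (auto simp: E_def nonface_ideal_def link_of_def)
  then have "Max ((\<lambda>e. Poly_Mapping.lookup e t) ` E) \<in> (\<lambda>e. Poly_Mapping.lookup e t) ` E" by simp
  then obtain e where e: "e \<in> E" and "Poly_Mapping.lookup e t = Max ((\<lambda>e. Poly_Mapping.lookup e t) ` E)" by auto
  then have e_max: "Poly_Mapping.lookup e' t \<le> Poly_Mapping.lookup e t" if "e' \<in> E" for e'
    using that \<open>finite E\<close> by simp
  let ?e = "e + Poly_Mapping.single t 1"
  have t': "t \<in> {1..n}" using t G by auto
  have "Poly_Mapping.lookup (linear_form n b p * h) ?e =
      (\<Sum>s = 1..n. b (s, p) * Poly_Mapping.lookup (emb h) (int_exp ?e - Poly_Mapping.single s 1))"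
    by (simp only: lookup_emb[symmetric] emb.lin_ext_mult lookup_linear_form_mult)
  also have "\<dots> = (\<Sum>s\<in>{t}. b (s, p) * Poly_Mapping.lookup (emb h) (int_exp ?e - Poly_Mapping.single s 1))"
  proof (rule sum.mono_neutral_right)
    show "\<forall>s\<in>{1..n} - {t}. b (s, p) * Poly_Mapping.lookup (emb h) (int_exp ?e - Poly_Mapping.single s 1) = 0"
    proof
      fix s assume s: "s \<in> {1..n} - {t}"
      have "Poly_Mapping.lookup (emb h) (int_exp ?e - Poly_Mapping.single s 1) = 0"
      proof (rule ccontr)
        assume "Poly_Mapping.lookup (emb h) (int_exp ?e - Poly_Mapping.single s 1) \<noteq> 0"
        then have "int_exp ?e - Poly_Mapping.single s 1 \<in> Poly_Mapping.keys (emb h)"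
          by (simp only: in_keys_iff) simp
        then obtain e' where e': "e' \<in> Poly_Mapping.keys h" "int_exp ?e - Poly_Mapping.single s 1 = int_exp e'"
          unfolding keys_emb by blast
        have l: "int (Poly_Mapping.lookup e' v) = int (Poly_Mapping.lookup ?e v) - (if v = s then 1 else 0)" for v
          using arg_cong[OF e'(2), of "\<lambda>x. Poly_Mapping.lookup x v"]
          by (simp add: lookup_minus lookup_single when_def)
        have "Poly_Mapping.keys e' \<subseteq> Poly_Mapping.keys ?e"
        proof
          fix v assume "v \<in> Poly_Mapping.keys e'"
          then show "v \<in> Poly_Mapping.keys ?e" using l[of v] by (auto simp: in_keys_iff split: if_splits)
        qed
        then have "Poly_Mapping.keys e' \<union> G \<subseteq> Poly_Mapping.keys e \<union> G" using t by (auto simp: keys_plus_eq)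
        then have "e' \<in> E" using e e' \<Delta> unfolding E_def subset_closed_def by blast
        moreover have "Poly_Mapping.lookup e' t = Poly_Mapping.lookup e t + 1"
          using l[of t] s by (simp add: lookup_add)
        ultimately show False using e_max[of e'] by simp
      qed
      then show "b (s, p) * Poly_Mapping.lookup (emb h) (int_exp ?e - Poly_Mapping.single s 1) = 0" by simp
    qed
  qed (use t' in auto)
  also have "\<dots> = b (t, p) * Poly_Mapping.lookup h e"
    by (simp add: int_exp_add lookup_emb)
  finally have "?e \<in> Poly_Mapping.keys (linear_form n b p * h)"
    using e t by (simp add: E_def in_keys_iff)
  then have "Poly_Mapping.keys ?e \<union> G \<notin> \<Delta>" using lh by (auto simp: nonface_ideal_def link_of_def)
  moreover have "Poly_Mapping.keys ?e \<union> G = Poly_Mapping.keys e \<union> G"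
    using t by (auto simp: keys_plus_eq)
  ultimately show False using e by (simp add: E_def)
qed

lemma poly_var_power: "poly_var v ^ k = (Poly_Mapping.single (Poly_Mapping.single v k) 1 :: (nat, 'k::field) mpoly)"
  by (induction k) (simp_all add: poly_var_def mult_single plus_1_eq_Suc flip: single_add)

text \<open>The substitution \<open>x\<^sub>t \<mapsto> x\<^sub>t - f/b\<^sub>t\<close>, which kills the linear form \<open>f\<close> with coefficients \<open>b\<close>.\<close>

definition elim_subst :: "nat \<Rightarrow> (nat \<times> nat \<Rightarrow> 'k::field) \<Rightarrow> nat \<Rightarrow> nat \<Rightarrow> (nat, 'k) mpoly \<Rightarrow> (nat, 'k) mpoly" where
  "elim_subst n b t0 p0 = lin_ext (\<lambda>e c. poly_const c * monom_eval
     (\<lambda>v. if v = t0 then poly_var t0 - poly_const (1 / b (t0, p0)) * linear_form n b p0 else poly_var v) e)"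

context
  fixes n :: nat and b :: "nat \<times> nat \<Rightarrow> 'k::field" and t0 p0 :: nat
  assumes t0: "t0 \<in> {1..n}" "b (t0, p0) \<noteq> 0"
begin

abbreviation (input) "lf \<equiv> linear_form n b p0"
abbreviation (input) "\<sigma> v \<equiv> if v = t0 then poly_var t0 - poly_const (1 / b (t0, p0)) * lf else poly_var v"

lemma elim_subst_sum: "elim_subst n b t0 p0 (sum u A) = (\<Sum>i\<in>A. elim_subst n b t0 p0 (u i))"
  and elim_subst_mult: "elim_subst n b t0 p0 (f * g) = elim_subst n b t0 p0 f * elim_subst n b t0 p0 g"
  and elim_subst_add: "elim_subst n b t0 p0 (f + g) = elim_subst n b t0 p0 f + elim_subst n b t0 p0 g"
  and elim_subst_single: "elim_subst n b t0 p0 (Poly_Mapping.single e c) = poly_const c * monom_eval (\<lambda>v. \<sigma> v) e"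
  unfolding elim_subst_def
  by (rule poly_subst.lin_ext_sum poly_subst.lin_ext_mult poly_subst.lin_ext_add poly_subst.lin_ext_single)+

lemma elim_subst_linear_form:
  "elim_subst n b t0 p0 (linear_form n b' p) =
     linear_form n b' p - poly_const (b' (t0, p) / b (t0, p0)) * lf"
proof -
  have "elim_subst n b t0 p0 (poly_const c) = poly_const c" for c
    unfolding poly_const_def[of c] elim_subst_single by (simp add: poly_const_def)
  moreover have "elim_subst n b t0 p0 (poly_var v) = \<sigma> v" for v
    unfolding poly_var_def[of v] elim_subst_single by (simp add: monom_eval_single poly_var_def)
  ultimately have "elim_subst n b t0 p0 (linear_form n b' p) = (\<Sum>t = 1..n. poly_const (b' (t, p)) * \<sigma> t)"
    unfolding linear_form_def[of n b'] by (simp only: elim_subst_sum elim_subst_mult)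
  also have "\<dots> = (\<Sum>t = 1..n. poly_const (b' (t, p)) * poly_var t -
      (if t = t0 then poly_const (b' (t0, p) / b (t0, p0)) * lf else 0))"
  proof (rule sum.cong)
    have d: "poly_const (b' (t0, p) / b (t0, p0)) = (poly_const (b' (t0, p)) * poly_const (1 / b (t0, p0)) :: (nat, 'k) mpoly)"
      by (simp flip: poly_const_mult)
    show "poly_const (b' (t, p)) * \<sigma> t = poly_const (b' (t, p)) * poly_var t -
      (if t = t0 then poly_const (b' (t0, p) / b (t0, p0)) * lf else 0)" for t
      unfolding d by (simp add: right_diff_distrib mult.assoc)
  qed simp
  also have "\<dots> = linear_form n b' p - poly_const (b' (t0, p) / b (t0, p0)) * lf"
    unfolding sum_subtractf using t0 by (simp add: linear_form_def[of n b'])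
  finally show ?thesis .
qed

lemma elim_subst_form: "elim_subst n b t0 p0 lf = 0"
  using t0 by (simp add: elim_subst_linear_form)

text \<open>Each variable is moved by a multiple of the form, and congruence modulo the form, the
  relation \<open>C\<close>, is respected by sums, products and powers.\<close>

lemma elim_subst_cong:
  assumes "f \<in> polys n"
  shows "\<exists>h\<in>polys n. elim_subst n b t0 p0 f = f + lf * h"
proof -
  define C where "C = {(x, y). x \<in> polys n \<and> y \<in> polys n \<and> (\<exists>h\<in>polys n. x = y + lf * h)}"
  have lS: "lf \<in> polys n" by auto
  have mult: "(x * x', y * y') \<in> C" if xy: "(x, y) \<in> C" "(x', y') \<in> C" for x y x' y'
  proof -
    obtain h h' where h: "x \<in> polys n" "y \<in> polys n" "h \<in> polys n" "x = y + lf * h" "x' \<in> polys n" "y' \<in> polys n" "h' \<in> polys n" "x' = y' + lf * h'"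
      using xy by (auto simp: C_def)
    have "x * x' = y * y' + lf * (h * y' + y * h' + lf * h * h')" by (simp add: h(4,8) algebra_simps)
    moreover have "h * y' + y * h' + lf * h * h' \<in> polys n" using h lS by (auto intro!: poly_ring_add poly_ring_mult)
    ultimately show ?thesis using h unfolding C_def by blast
  qed
  have refl: "(x, x) \<in> C" if "x \<in> polys n" for x
    using that unfolding C_def by (auto intro!: bexI[of _ 0])
  have pow: "(x ^ k, y ^ k) \<in> C" if "(x, y) \<in> C" for x y k
    by (induction k) (auto intro: mult that refl)
  have prod: "(\<Prod>i\<in>A. x i, \<Prod>i\<in>A. y i) \<in> C" if "\<And>i. i \<in> A \<Longrightarrow> (x i, y i) \<in> C" for x y and A :: "nat set"
    using that by (induction A rule: infinite_finite_induct) (auto intro: mult refl)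
  have sum: "(\<Sum>i\<in>A. x i, \<Sum>i\<in>A. y i) \<in> C" if "\<And>i. i \<in> A \<Longrightarrow> (x i, y i) \<in> C" for x y and A :: "(nat \<Rightarrow>\<^sub>0 nat) set"
    using that
  proof (induction A rule: infinite_finite_induct)
    case (insert i A)
    then have "(x i, y i) \<in> C" "(sum x A, sum y A) \<in> C" by auto
    then obtain h h' where *: "x i \<in> polys n" "y i \<in> polys n" "h \<in> polys n" "x i = y i + lf * h" "sum x A \<in> polys n" "sum y A \<in> polys n" "h' \<in> polys n" "sum x A = sum y A + lf * h'"
      by (auto simp: C_def)
    then have "x i + sum x A = (y i + sum y A) + lf * (h + h')" by (simp only:) (simp add: algebra_simps)
    moreover have "x i + sum x A \<in> polys n" "y i + sum y A \<in> polys n" "h + h' \<in> polys n"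
      using * by blast+
    ultimately show ?case using insert.hyps unfolding C_def by auto
  qed (auto intro: refl)
  have var: "(\<sigma> v, poly_var v) \<in> C" if v: "v \<in> {1..n}" for v
  proof -
    have vS: "poly_var v \<in> polys n" "poly_const (- (1 / b (t0, p0))) \<in> polys n" using v by (auto intro: poly_ring_var)
    have "poly_var t0 - poly_const (1 / b (t0, p0)) * lf = poly_var t0 + lf * poly_const (- (1 / b (t0, p0)))"
      by (simp add: poly_const_def single_uminus)
    moreover have "poly_var t0 - poly_const (1 / b (t0, p0)) * lf \<in> polys n"
      using lS t0 by (auto intro!: poly_ring_minus poly_ring_mult poly_ring_var)
    ultimately show ?thesis
      using vS refl[OF vS(1)] unfolding C_def by auto
  qed
  have "(\<Sum>e\<in>Poly_Mapping.keys f. poly_const (Poly_Mapping.lookup f e) * monom_eval (\<lambda>v. \<sigma> v) e,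
      \<Sum>e\<in>Poly_Mapping.keys f. poly_const (Poly_Mapping.lookup f e) * monom_eval poly_var e) \<in> C"
  proof (intro sum mult refl)
    fix e assume "e \<in> Poly_Mapping.keys f"
    then have "Poly_Mapping.keys e \<subseteq> {1..n}" using assms by (auto simp: in_poly_ring)
    then show "(monom_eval (\<lambda>v. \<sigma> v) e, monom_eval poly_var e) \<in> C"
      unfolding monom_eval_def by (intro prod pow var) auto
  qed auto
  moreover have "poly_const c * monom_eval poly_var e = Poly_Mapping.single e c" for e :: "nat \<Rightarrow>\<^sub>0 nat" and c :: 'k
  proof -
    have "(\<Prod>v\<in>A. Poly_Mapping.single (g v) 1) = (Poly_Mapping.single (\<Sum>v\<in>A. g v) 1 :: (nat, 'k) mpoly)"
      for A and g :: "nat \<Rightarrow> (nat \<Rightarrow>\<^sub>0 nat)"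
      by (induction A rule: infinite_finite_induct) (simp_all add: mult_single)
    then show ?thesis
      by (simp add: monom_eval_def poly_var_power poly_const_def mult_single flip: poly_mapping_sum_single)
  qed
  ultimately have "(elim_subst n b t0 p0 f, f) \<in> C"
    by (simp add: elim_subst_def lin_ext_def flip: poly_mapping_sum_single)
  then show ?thesis by (auto simp: C_def)
qed

text \<open>Only x_(t0) is replaced, and t0 belongs to G: the other variables of a term already form
  a nonface together with G.\<close>

lemma elim_subst_link:
  assumes \<Delta>: "subset_closed \<Delta>" and G: "t0 \<in> G" and f: "f \<in> nonface_ideal n (link_of \<Delta> G)"
  shows "elim_subst n b t0 p0 f \<in> nonface_ideal n (link_of \<Delta> G)"
proof -
  note I = ideal_of_nonface[OF subset_closed_link[OF \<Delta>], of n G, where 'a = 'k]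
  have "poly_const (Poly_Mapping.lookup f e) * monom_eval (\<lambda>v. \<sigma> v) e \<in> nonface_ideal n (link_of \<Delta> G)"
    if e: "e \<in> Poly_Mapping.keys f" for e
  proof -
    have ke: "Poly_Mapping.keys e \<subseteq> {1..n}" "Poly_Mapping.keys e \<union> G \<notin> \<Delta>"
      using f e by (auto simp: nonface_ideal_def in_poly_ring link_of_def)
    let ?A = "Poly_Mapping.keys e - {t0}"
    have "(\<Prod>v\<in>?A. poly_var v ^ Poly_Mapping.lookup e v) =
        (Poly_Mapping.single (\<Sum>v\<in>?A. Poly_Mapping.single v (Poly_Mapping.lookup e v)) 1 :: (nat, 'k) mpoly)"
      unfolding poly_var_power
      by (rule finite_induct[of ?A]) (simp_all add: mult_single)
    moreover have "Poly_Mapping.keys (\<Sum>v\<in>?A. Poly_Mapping.single v (Poly_Mapping.lookup e v)) = ?A"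
      by (auto simp: in_keys_iff lookup_sum lookup_single when_def split: if_splits)
    moreover have "?A \<union> G \<notin> \<Delta>"
    proof -
      have "?A \<union> G = Poly_Mapping.keys e \<union> G" using G by auto
      then show ?thesis using ke by simp
    qed
    ultimately have 1: "(\<Prod>v\<in>?A. poly_var v ^ Poly_Mapping.lookup e v :: (nat, 'k) mpoly) \<in> nonface_ideal n (link_of \<Delta> G)"
      using ke by (auto simp: nonface_ideal_def in_poly_ring link_of_def)
    have "monom_eval (\<lambda>v. \<sigma> v) e = (\<Prod>v\<in>insert t0 ?A. \<sigma> v ^ Poly_Mapping.lookup e v)"
      by (rule monom_eval_superset) auto
    also have "\<dots> = \<sigma> t0 ^ Poly_Mapping.lookup e t0 * (\<Prod>v\<in>?A. \<sigma> v ^ Poly_Mapping.lookup e v)"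
      by (rule prod.insert) auto
    also have "(\<Prod>v\<in>?A. \<sigma> v ^ Poly_Mapping.lookup e v) = (\<Prod>v\<in>?A. poly_var v ^ Poly_Mapping.lookup e v)"
      by (rule prod.cong) auto
    finally have 2: "poly_const (Poly_Mapping.lookup f e) * monom_eval (\<lambda>v. \<sigma> v) e =
        (poly_const (Poly_Mapping.lookup f e) * \<sigma> t0 ^ Poly_Mapping.lookup e t0) *
        (\<Prod>v\<in>?A. poly_var v ^ Poly_Mapping.lookup e v)" by (simp add: mult.assoc)
    have "poly_const (Poly_Mapping.lookup f e) * \<sigma> t0 ^ Poly_Mapping.lookup e t0 \<in> polys n"
      using t0 by (auto intro!: poly_ring_mult poly_ring_power poly_ring_minus poly_ring_var)
    from submod_act[OF I this 1] show ?thesis unfolding 2 .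
  qed
  then show ?thesis unfolding elim_subst_def lin_ext_def by (intro submod_sum[OF I])
qed

end

text \<open>Substitution kills one form and turns the others into the eliminated ones, which are
  still independent on G, so the relation becomes shorter. Undoing the substitution costs a multiple
  of the killed form, and that form is among those allowed in the conclusion.\<close>

lemma regular_sequence_link:
  fixes b :: "nat \<times> nat \<Rightarrow> 'k::field"
  assumes \<Delta>: "subset_closed \<Delta>" and G: "G \<subseteq> {1..n}" and "finite P" "p \<in> P" "col_indep b G P"
    and "g ` P \<subseteq> carrier (poly_ring {1..n})"
    and "(\<Sum>p\<in>P. linear_form n b p * g p) \<in> nonface_ideal n (link_of \<Delta> G)"
  shows "g p \<in> form_ideal n (link_of \<Delta> G) (linear_form n b) (P - {p})"
  using assms(3-)
proof (induction "card P" arbitrary: P b g)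
  case 0
  then show ?case by auto
next
  case (Suc k)
  let ?S = "carrier (poly_ring {1..n} :: (nat, 'k) mpoly ring)"
  let ?I = "nonface_ideal n (link_of \<Delta> G) :: (nat, 'k) mpoly set"
  note I = ideal_of_nonface[OF subset_closed_link[OF \<Delta>], of n G, where 'a = 'k]
  show ?case
  proof (cases "P = {p}")
    case True
    obtain t where "t \<in> G" "b (t, p) \<noteq> 0" using col_indep_pivot Suc.prems by metis
    then show ?thesis
      using linear_form_nonzerodivisor[OF \<Delta> G, of t b p "g p"] Suc.prems True by (auto simp: form_ideal_empty)
  next
    case False
    then obtain p0 where p0: "p0 \<in> P" "p0 \<noteq> p" using Suc.prems by auto
    obtain t0 where t0: "t0 \<in> G" "b (t0, p0) \<noteq> 0" using col_indep_pivot Suc.prems p0 by metis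
    then have t0n: "t0 \<in> {1..n}" using G by auto
    let ?b = "eliminate b t0 p0" and ?P = "P - {p0}" and ?l = "linear_form n b p0"
    let ?sub = "elim_subst n b t0 p0"
    let ?r = "\<lambda>p. poly_const (b (t0, p) / b (t0, p0)) :: (nat, 'k) mpoly"
    have gS: "g q \<in> ?S" if "q \<in> P" for q using Suc.prems that by auto
    have subS: "?sub f \<in> ?S" if f: "f \<in> ?S" for f
    proof -
      obtain h where "h \<in> ?S" "?sub f = f + ?l * h"
        using elim_subst_cong[where b = b, OF t0n t0(2) f] by blast
      then show ?thesis using f by auto
    qed
    have l_sub: "?sub (linear_form n ?b q) = linear_form n ?b q" for q
      using eliminate_pivot[of b t0 p0, OF t0(2)] by (simp add: elim_subst_linear_form[where b = b, OF t0n t0(2)])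
    have "(\<Sum>q\<in>P. linear_form n b q * g q) = ?l * g p0 + (\<Sum>q\<in>?P. linear_form n b q * g q)"
      using Suc.prems p0 by (subst sum.remove[of P p0]) auto
    also have "(\<Sum>q\<in>?P. linear_form n b q * g q) =
        (\<Sum>q\<in>?P. linear_form n ?b q * g q) + ?l * (\<Sum>q\<in>?P. ?r q * g q)"
      by (simp add: linear_form_eliminate sum.distrib[symmetric] sum_distrib_left algebra_simps)
    finally have "?sub (\<Sum>q\<in>P. linear_form n b q * g q) = (\<Sum>q\<in>?P. linear_form n ?b q * ?sub (g q))"
      using t0n t0(2)
      by (simp add: elim_subst_add elim_subst_sum elim_subst_mult elim_subst_form[where b = b, OF t0n t0(2)] l_sub)
    moreover have "?sub (\<Sum>q\<in>P. linear_form n b q * g q) \<in> ?I"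
      by (rule elim_subst_link[where b = b, OF t0n t0(2) \<Delta> t0(1) Suc.prems(5)])
    ultimately have "(\<Sum>q\<in>?P. linear_form n ?b q * ?sub (g q)) \<in> ?I" by simp
    moreover have "col_indep ?b G ?P"
      using col_indep_eliminate[OF Suc.prems(3,1) p0(1) t0(2)] by (rule col_indep_mono) auto
    ultimately have "?sub (g p) \<in> form_ideal n (link_of \<Delta> G) (linear_form n ?b) (?P - {p})"
      using Suc.hyps(2) Suc.prems p0 gS subS by (intro Suc.hyps(1)[of ?P ?b "\<lambda>q. ?sub (g q)"]) auto
    then obtain f h where f: "f \<in> ?I" "h ` (?P - {p}) \<subseteq> ?S"
      "?sub (g p) = f + (\<Sum>q\<in>?P - {p}. linear_form n ?b q * h q)"
      by (auto simp: form_ideal_def)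
    obtain h0 where h0: "h0 \<in> ?S" "?sub (g p) = g p + ?l * h0"
      using elim_subst_cong[where b = b, OF t0n t0(2) gS[OF Suc.prems(2)]] by blast
    \<comment> \<open>The coefficient of the killed form gathers two corrections: \<open>h0\<close>
      from undoing the substitution, and the multiples of \<open>?l\<close> contained in the
      eliminated forms.\<close>
    define h' where "h' = h(p0 := - h0 - (\<Sum>q\<in>?P - {p}. ?r q * h q))"
    have "g p = f + (\<Sum>q\<in>?P - {p}. linear_form n b q * h q) + ?l * (- h0 - (\<Sum>q\<in>?P - {p}. ?r q * h q))"
      using f(3) unfolding h0(2) linear_form_eliminate
      by (simp add: algebra_simps sum_subtractf sum_distrib_left eq_diff_eq)
    also have "(\<Sum>q\<in>?P - {p}. linear_form n b q * h q) = (\<Sum>q\<in>?P - {p}. linear_form n b q * h' q)"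
      by (rule sum.cong) (auto simp: h'_def)
    also have "f + (\<Sum>q\<in>?P - {p}. linear_form n b q * h' q) + ?l * (- h0 - (\<Sum>q\<in>?P - {p}. ?r q * h q)) =
        f + (\<Sum>q\<in>P - {p}. linear_form n b q * h' q)"
    proof -
      have "P - {p} - {p0} = ?P - {p}" by auto
      then show ?thesis using Suc.prems p0 by (subst sum.remove[of "P - {p}" p0]) (auto simp: h'_def)
    qed
    finally have "g p = f + (\<Sum>q\<in>P - {p}. linear_form n b q * h' q)" .
    moreover have "h' ` (P - {p}) \<subseteq> ?S"
    proof -
      have "- h0 - (\<Sum>q\<in>?P - {p}. ?r q * h q) \<in> ?S"
        using f h0 by (auto intro!: poly_ring_minus poly_ring_uminus poly_ring_sum poly_ring_mult)
      then show ?thesis using f by (auto simp: h'_def)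
    qed
    ultimately show ?thesis using f(1) by (intro form_idealI)
  qed
qed

lemma nonface_ideal_link:
  assumes "subset_closed \<Delta>"
  shows "nonface_ideal n \<Delta> \<subseteq> nonface_ideal n (link_of \<Delta> G)"
  using assms unfolding nonface_ideal_def link_of_def subset_closed_def by blast

text \<open>Both conditions express that the square matrix of a face is invertible.
  \<open>indep\<close> drives the elimination, and \<open>solve\<close> isolates one variable of the
  face in a combination of the first |G| forms.\<close>

locale generic_forms =
  fixes n d :: nat and \<Delta> :: "nat set set" and a :: "nat \<times> nat \<Rightarrow> 'k::field"
  assumes closed: "subset_closed \<Delta>" and faces_sub: "\<Delta> \<subseteq> Pow {1..n}"
    and card_le: "F \<in> \<Delta> \<Longrightarrow> card F \<le> d"
    and indep: "G \<in> \<Delta> \<Longrightarrow> col_indep a G {1..card G}"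
    and solve: "G \<in> \<Delta> \<Longrightarrow> t \<in> G \<Longrightarrow> \<exists>c. \<forall>s\<in>G. (\<Sum>p = 1..card G. c p * a (s, p)) = (if s = t then 1 else 0)"
begin

abbreviation "\<theta> \<equiv> linear_form n a"
abbreviation "L \<equiv> Lpoly n :: nat set \<Rightarrow> 'k laurent set"
abbreviation "I m \<equiv> form_ideal n \<Delta> \<theta> {1..m}"

definition J :: "nat \<Rightarrow> nat set \<Rightarrow> 'k laurent set" where
  "J m = loc (I m)"

lemma ideal_of_I: "ideal_of n (I m)"
  by (rule ideal_of_form[OF closed])

lemma I_sub: "I m \<subseteq> polys n"
  by (rule form_ideal_sub) auto

lemma good_L: "good_family n L"
  by (rule good_family_loc[OF ideal_of_carrier])

lemma good_J: "good_family n (J m)"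
  unfolding J_def by (rule good_family_loc[OF ideal_of_I])

lemma J_sub: "J m F \<subseteq> L F"
  unfolding J_def by (rule loc_mono_ideal[OF I_sub])

lemma J_0: "J 0 F = loc (nonface_ideal n \<Delta>) F"
  by (simp add: J_def form_ideal_empty)

lemma J_Suc:
  assumes "F \<subseteq> {1..n}"
  shows "J (Suc m) F = {f + emb (\<theta> (Suc m)) * g | f g. f \<in> J m F \<and> g \<in> L F}"
proof -
  have "{1..Suc m} = insert (Suc m) {1..m}" by auto
  then show ?thesis
    unfolding J_def using loc_form_insert[OF assms _ _ closed, of "{1..m}" "Suc m" \<theta>] by auto
qed

lemma J_nonface: "F \<subseteq> {1..n} \<Longrightarrow> loc (nonface_ideal n \<Delta>) F \<subseteq> J m F"
  unfolding J_def by (rule loc_mono_ideal[OF form_ideal_nonface])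

lemma J_mono: "F \<subseteq> {1..n} \<Longrightarrow> J m F \<subseteq> J (Suc m) F"
proof
  fix f assume F: "F \<subseteq> {1..n}" and "f \<in> J m F"
  then have "f + emb (\<theta> (Suc m)) * 0 \<in> J (Suc m) F"
    unfolding J_Suc[OF F] using submod_0[OF good_submod[OF good_L F]] by blast
  then show "f \<in> J (Suc m) F" by simp
qed

lemma J_form:
  assumes "F \<subseteq> {1..n}" "p \<in> {1..m}" "f \<in> L F"
  shows "emb (\<theta> p) * f \<in> J m F"
proof -
  obtain h e where h: "h \<in> polys n" "f = xpow F (- int e) * emb h" by (rule locE[OF ideal_of_carrier assms(1,3)])
  have "\<theta> p \<in> I m" using assms by (intro form_in_form_ideal[OF closed]) auto
  then have "h * \<theta> p \<in> I m" by (rule submod_act[OF ideal_of_I h(1)])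
  from emb_in_loc[OF ideal_of_I assms(1) this, of e] show ?thesis
    by (simp add: J_def h emb.lin_ext_mult ac_simps)
qed

text \<open>With denominators cleared, the hypothesis is a relation among theta_1, ..., theta_(m+1)
  modulo the ideal of the star of G, and at least m + 1 columns are independent on G.\<close>

lemma regular_small:
  assumes G: "G \<in> \<Delta>" "Suc m \<le> card G" and f: "f \<in> L G" "emb (\<theta> (Suc m)) * f \<in> J m G"
  shows "f \<in> J m G"
proof -
  have Gn: "G \<subseteq> {1..n}" and fin: "finite G" using G faces_sub closed by (auto simp: subset_closed_def)
  let ?x = "face_monom G :: (nat, 'k) mpoly"
  have xS: "?x ^ k \<in> polys n" for k using Gn by auto
  obtain f' e where f': "f' \<in> polys n" "f = xpow G (- int e) * emb f'" by (rule locE[OF ideal_of_carrier Gn f(1)])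
  obtain w c where w: "w \<in> I m" "emb (\<theta> (Suc m)) * f = xpow G (- int c) * emb w"
    using f(2) unfolding J_def by (rule locE[OF ideal_of_I Gn])
  obtain i g where ig: "i \<in> nonface_ideal n \<Delta>" "g ` {1..m} \<subseteq> polys n" "w = i + (\<Sum>p\<in>{1..m}. \<theta> p * g p)"
    using w(1) by (auto simp: form_ideal_def)
  have "xpow G (int c) * (xpow G (int e) * (emb (\<theta> (Suc m)) * f)) = emb (?x ^ c * (\<theta> (Suc m) * f'))"
    by (simp add: f'(2) emb.lin_ext_mult emb_face_monom_power[OF fin] ac_simps)
  moreover have "xpow G (int c) * (xpow G (int e) * (emb (\<theta> (Suc m)) * f)) = emb (?x ^ e * w)"
    by (subst mult.left_commute, subst w(2)) (simp add: emb.lin_ext_mult emb_face_monom_power[OF fin])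
  ultimately have eq: "?x ^ c * (\<theta> (Suc m) * f') = ?x ^ e * w" by (simp only: emb_inj)
  \<comment> \<open>If x_G^e clears f to f' and x_G^c clears theta f to w, then x_G^c theta f' =
    x_G^e w. \<open>h\<close> collects the coefficients of all forms after w is expanded, which
    leaves an element of the nonface ideal.\<close>
  define h where "h p = (if p = Suc m then ?x ^ c * f' else - (?x ^ e * g p))" for p
  have ins: "{1..Suc m} = insert (Suc m) {1..m}" by auto
  have "(\<Sum>p\<in>{1..Suc m}. \<theta> p * h p) = \<theta> (Suc m) * (?x ^ c * f') + (\<Sum>p\<in>{1..m}. \<theta> p * - (?x ^ e * g p))"
    unfolding ins by (subst sum.insert) (auto simp: h_def intro!: sum.cong)
  also have "\<dots> = ?x ^ e * i"
    using eq by (simp add: ig(3) distrib_left sum_negf sum_distrib_left ac_simps)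
  finally have "(\<Sum>p\<in>{1..Suc m}. \<theta> p * h p) \<in> nonface_ideal n (link_of \<Delta> G)"
    using submod_act[OF ideal_of_nonface[OF closed] xS ig(1)] nonface_ideal_link[OF closed] by auto
  moreover have "h ` {1..Suc m} \<subseteq> polys n"
    using f'(1) ig(2) xS by (auto simp: h_def intro!: poly_ring_mult poly_ring_uminus)
  moreover have "col_indep a G {1..Suc m}"
    by (rule col_indep_subset[OF indep[OF G(1)]]) (use G(2) in auto)
  ultimately have "h (Suc m) \<in> form_ideal n (link_of \<Delta> G) \<theta> ({1..Suc m} - {Suc m})"
    by (intro regular_sequence_link[OF closed Gn]) auto
  moreover have "{1..Suc m} - {Suc m} = {1..m}" by auto
  ultimately obtain i' h' where ih: "i' \<in> nonface_ideal n (link_of \<Delta> G)" "h' ` {1..m} \<subseteq> polys n"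
    "?x ^ c * f' = i' + (\<Sum>p\<in>{1..m}. \<theta> p * h' p)" by (auto simp: form_ideal_def h_def)
  note JG = good_submod[OF good_J Gn, of m]
  have "emb i' \<in> J m G"
    using emb_link_iff[OF closed Gn, of i'] ih(1) J_nonface[OF Gn] nonface_ideal_sub[of n "link_of \<Delta> G"] by blast
  moreover have "emb (\<theta> p) * emb (h' p) \<in> J m G" if "p \<in> {1..m}" for p
  proof (rule J_form[OF Gn that])
    have "h' p \<in> polys n" using ih(2) that by auto
    from emb_in_loc[OF ideal_of_carrier Gn this, of 0] show "emb (h' p) \<in> L G" by simp
  qed
  ultimately have "emb (?x ^ c * f') \<in> J m G"
    unfolding ih(3) emb.lin_ext_add emb.lin_ext_sum emb.lin_ext_mult
    by (intro submod_add[OF JG] submod_sum[OF JG]) auto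
  then have "xpow G (- int c - int e) * emb (?x ^ c * f') \<in> J m G"
    unfolding J_def by (rule xpow_loc[OF ideal_of_I Gn])
  also have "xpow G (- int c - int e) * emb (?x ^ c * f') = f"
    by (simp add: f'(2) emb.lin_ext_mult emb_face_monom_power[OF fin] xpow_mult_left)
  finally show ?thesis .
qed

text \<open>In each term of the binomial expansion one of the two exponents is large enough.\<close>

lemma nilpotent_add:
  assumes A: "ideal_of n (A :: (nat, 'k) mpoly set)" and h: "h \<in> polys n" "h ^ N \<in> A" and k: "k \<in> polys n" "k ^ M \<in> A"
  shows "(h + k) ^ (N + M) \<in> A"
proof -
  have nat_S: "of_nat i \<in> polys n" for i by (induction i) auto
  have "of_nat ((N + M) choose i) * h ^ i * k ^ (N + M - i) \<in> A" if "i \<le> N + M" for i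
  proof (cases "N \<le> i")
    case True
    then have "of_nat ((N + M) choose i) * h ^ i * k ^ (N + M - i) =
        (of_nat ((N + M) choose i) * h ^ (i - N) * k ^ (N + M - i)) * h ^ N"
      by (simp add: ac_simps flip: power_add)
    then show ?thesis using h k nat_S by (simp only:) (intro submod_act[OF A], auto)
  next
    case False
    then have "N + M - i = (N - i) + M" by simp
    then have "of_nat ((N + M) choose i) * h ^ i * k ^ (N + M - i) =
        (of_nat ((N + M) choose i) * h ^ i * k ^ (N - i)) * k ^ M"
      by (simp add: ac_simps power_add)
    then show ?thesis using h k nat_S by (simp only:) (intro submod_act[OF A], auto)
  qed
  then show ?thesis unfolding binomial_ring by (intro submod_sum[OF A]) auto
qed

text \<open>For \<open>m \<ge> |G|\<close> the forms \<open>\<theta>\<^sub>1, \<dots>, \<theta>\<^sub>m\<close> express the unit \<open>x\<^sub>t\<close>, \<open>t \<in> G\<close>, through the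
  variables outside \<open>G\<close>, so that an element killed by powers of the latter vanishes.\<close>

lemma regular_big:
  assumes G: "G \<in> \<Delta>" "G \<noteq> {}" "card G \<le> m" and f: "f \<in> L G"
    and *: "\<And>s. s \<in> {1..n} - G \<Longrightarrow> \<exists>N. xpow {s} (int N) * f \<in> J m G"
  shows "f \<in> J m G"
proof -
  have Gn: "G \<subseteq> {1..n}" and fin: "finite G" using G faces_sub closed by (auto simp: subset_closed_def)
  note JG = good_submod[OF good_J Gn, of m]
  define A where "A = {h \<in> polys n. emb h * f \<in> J m G}"
  have A: "ideal_of n A"
    by (rule submodI)
      (auto simp: A_def emb.lin_ext_minus emb.lin_ext_mult left_diff_distrib mult.assoc
        intro: submod_0[OF JG] submod_diff[OF JG] submod_act[OF JG])
  \<comment> \<open>The radical of the annihilator \<open>A\<close> of f modulo J. It contains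
    theta_1, ..., theta_m and the variables outside G, hence by \<open>solve\<close> also a variable
    x_t with t in G; but x_t is a unit in this localization.\<close>
  define Rd where "Rd = {h \<in> polys n. \<exists>N. h ^ N \<in> A}"
  have Rd_add: "h + k \<in> Rd" if "h \<in> Rd" "k \<in> Rd" for h k
    using that nilpotent_add[OF A] unfolding Rd_def by blast
  have Rd_mult: "r * h \<in> Rd" if rh: "r \<in> polys n" "h \<in> Rd" for r h
  proof -
    obtain N where "h \<in> polys n" "h ^ N \<in> A" using rh by (auto simp: Rd_def)
    moreover from this rh have "r ^ N * h ^ N \<in> A" by (intro submod_act[OF A]) auto
    ultimately show ?thesis using rh by (auto simp: Rd_def power_mult_distrib)
  qed
  have Rd_0: "0 \<in> Rd" using submod_0[OF A] by (auto simp: Rd_def intro!: exI[of _ "Suc 0"])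
  have Rd_sum: "(\<Sum>i\<in>X. u i) \<in> Rd" if "\<And>i. i \<in> X \<Longrightarrow> u i \<in> Rd" for u and X :: "nat set"
    using that by (induction X rule: infinite_finite_induct) (auto intro: Rd_add Rd_0)
  have \<theta>_Rd: "\<theta> p \<in> Rd" if "p \<in> {1..m}" for p
    using J_form[OF Gn that f] by (auto simp: Rd_def A_def intro!: exI[of _ "Suc 0"])
  have var_Rd: "poly_var s \<in> Rd" if s: "s \<in> {1..n} - G" for s
  proof -
    obtain N where "xpow {s} (int N) * f \<in> J m G" using *[OF s] by blast
    moreover have "poly_var s ^ N \<in> polys n" "poly_var s \<in> polys n" using s by (auto intro!: poly_ring_var poly_ring_power)
    ultimately show ?thesis
      by (auto simp: Rd_def A_def emb.lin_ext_power emb_poly_var xpow_power intro!: exI[of _ N])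
  qed
  obtain t where t: "t \<in> G" using G by auto
  obtain c where c: "\<And>s. s \<in> G \<Longrightarrow> (\<Sum>p = 1..card G. c p * a (s, p)) = (if s = t then 1 else 0)"
    using solve[OF G(1) t] by blast
  define b where "b s = (\<Sum>p = 1..card G. c p * a (s, p))" for s
  have const_sum: "poly_const (sum u X) = (\<Sum>i\<in>X. poly_const (u i) :: (nat, 'k) mpoly)" for u :: "nat \<Rightarrow> 'k" and X
    by (induction X rule: infinite_finite_induct) (simp_all add: poly_const_add)
  have "(\<Sum>p = 1..card G. poly_const (c p) * \<theta> p) = (\<Sum>p = 1..card G. \<Sum>s = 1..n. poly_const (c p * a (s, p)) * poly_var s)"
    by (simp add: linear_form_def sum_distrib_left poly_const_mult mult.assoc)
  also have "\<dots> = (\<Sum>s = 1..n. poly_const (b s) * poly_var s)"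
    unfolding b_def const_sum sum_distrib_right by (rule sum.swap)
  also have "\<dots> = (\<Sum>s\<in>G. poly_const (b s) * poly_var s) + (\<Sum>s\<in>{1..n} - G. poly_const (b s) * poly_var s)"
    using sum.subset_diff[OF Gn] by (simp add: add.commute)
  also have "(\<Sum>s\<in>G. poly_const (b s) * poly_var s) = (\<Sum>s\<in>G. if s = t then poly_var t else 0)"
    using c by (intro sum.cong) (auto simp: b_def)
  also have "\<dots> = poly_var t" using t fin by simp
  finally have "poly_var t = (\<Sum>p = 1..card G. poly_const (c p) * \<theta> p) +
      (\<Sum>s\<in>{1..n} - G. poly_const (- 1) * (poly_const (b s) * poly_var s))"
    by (simp add: poly_const_def single_uminus sum_negf)
  also have "\<dots> \<in> Rd"
    using G(3) by (intro Rd_add Rd_sum Rd_mult \<theta>_Rd var_Rd) auto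
  finally obtain N where "poly_var t ^ N \<in> A" by (auto simp: Rd_def)
  then have 1: "xpow {t} (int N) * f \<in> J m G"
    by (simp add: A_def emb.lin_ext_power emb_poly_var xpow_power)
  have "face_monom (G - {t}) ^ N \<in> polys n" using Gn by auto
  from submod_act[OF JG this 1] have "xpow (G - {t}) (int N) * (xpow {t} (int N) * f) \<in> J m G"
    using fin by (simp add: emb_face_monom_power)
  moreover have "xpow (G - {t}) (int N) * (xpow {t} (int N) * f) = xpow G (int N) * f"
  proof -
    have "xpow ((G - {t}) \<union> {t}) (int N) = xpow (G - {t}) (int N) * (xpow {t} (int N) :: 'k laurent)"
      using fin by (intro xpow_Un) auto
    moreover have "(G - {t}) \<union> {t} = G" using t by auto
    ultimately show ?thesis by (simp add: mult.assoc)
  qed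
  ultimately have "xpow G (- int N) * (xpow G (int N) * f) \<in> J m G"
    unfolding J_def using xpow_loc[OF ideal_of_I Gn] by metis
  then show ?thesis by simp
qed

text \<open>Descending induction on G. At a nonface the localized quotient is zero, and for |G| > m
  elimination applies. If |G| \<le> m, the claim for G with s added says that f is killed by a power
  of x_s, for every s outside G, and \<open>regular_big\<close> excludes such torsion. At the empty
  set torsion may exist.\<close>

theorem regular:
  assumes "G \<subseteq> {1..n}" "G \<noteq> {}" "f \<in> L G" "emb (\<theta> (Suc m)) * f \<in> J m G"
  shows "f \<in> J m G"
  using assms
proof (induction "card ({1..n} - G)" arbitrary: G rule: less_induct)
  case less
  note Gn = less.prems(1)
  have fin: "finite G" using Gn finite_subset by blast
  consider "G \<notin> \<Delta>" | "G \<in> \<Delta>" "Suc m \<le> card G" | "G \<in> \<Delta>" "card G \<le> m" by linarith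
  then show ?case
  proof cases
    case 1
    have "G \<union> K \<notin> \<Delta>" for K using 1 closed unfolding subset_closed_def by blast
    then have "f \<in> loc (nonface_ideal n \<Delta>) G"
      using less.prems(3) unfolding loc_nonface_iff[OF closed Gn] Lpoly_iff[OF Gn] by blast
    then show ?thesis using J_nonface[OF Gn] by blast
  next
    case 2
    then show ?thesis using regular_small less.prems by blast
  next
    case 3
    show ?thesis
    proof (rule regular_big[OF 3(1) less.prems(2) 3(2) less.prems(3)])
      fix s assume s: "s \<in> {1..n} - G"
      let ?H = "insert s G"
      have Hn: "?H \<subseteq> {1..n}" using s Gn by auto
      have "{1..n} - ?H \<subset> {1..n} - G" using s by blast
      then have "card ({1..n} - ?H) < card ({1..n} - G)" by (intro psubset_card_mono) auto
      then have "f \<in> J m ?H"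
        using less.prems good_mono[OF good_L, of G ?H] good_mono[OF good_J, of G ?H] Hn
        by (intro less.hyps) auto
      then obtain N g where g: "xpow ?H (int N) * f = emb g" "g \<in> I m" by (auto simp: J_def loc_def)
      have "xpow ({s} \<union> G) (int N) = xpow {s} (int N) * (xpow G (int N) :: 'k laurent)"
        using s fin by (intro xpow_Un) auto
      then have "xpow G (int N) * (xpow {s} (int N) * f) = emb g" using g(1) by (simp add: ac_simps)
      then have "xpow {s} (int N) * f \<in> J m G" using g(2) unfolding J_def loc_def by blast
      then show "\<exists>N. xpow {s} (int N) * f \<in> J m G" by blast
    qed
  qed
qed

subsection \<open>Homogeneous components\<close>

lemma hcomp_L: "F \<subseteq> {1..n} \<Longrightarrow> f \<in> L F \<Longrightarrow> hcomp j f \<in> L F"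
  by (auto simp: Lpoly_iff keys_restr)

lemma emb_\<theta>_deg: "\<alpha> \<in> Poly_Mapping.keys (emb (\<theta> p)) \<Longrightarrow> exp_deg \<alpha> = 1"
proof -
  assume "\<alpha> \<in> Poly_Mapping.keys (emb (\<theta> p))"
  then have "\<alpha> \<in> (\<Union>t\<in>{1..n}. Poly_Mapping.keys (Poly_Mapping.single (Poly_Mapping.single t (1::int)) (a (t, p))))"
    unfolding emb_linear_form by (rule subsetD[OF keys_sum])
  then show "exp_deg \<alpha> = 1" by (auto split: if_splits)
qed

lemma hcomp_\<theta>: "hcomp j (emb (\<theta> p) * f) = emb (\<theta> p) * hcomp (j - 1) f"
  by (rule hcomp_mult[OF emb_\<theta>_deg])

lemma hcomp_J: "F \<subseteq> {1..n} \<Longrightarrow> f \<in> J m F \<Longrightarrow> hcomp j f \<in> J m F"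
proof (induction m arbitrary: f j)
  case 0
  then show ?case by (auto simp: J_0 loc_nonface_iff[OF closed] keys_restr)
next
  case (Suc m)
  then obtain g h where g: "g \<in> J m F" "h \<in> L F" "f = g + emb (\<theta> (Suc m)) * h" by (auto simp: J_Suc)
  have "hcomp j f = hcomp j g + emb (\<theta> (Suc m)) * hcomp (j - 1) h"
    by (simp add: g(3) restr_add hcomp_\<theta>)
  moreover have "hcomp j g \<in> J m F" "hcomp (j - 1) h \<in> L F"
    using Suc.IH g hcomp_L Suc.prems(1) by auto
  ultimately show ?case
    unfolding J_Suc[OF Suc.prems(1)] by (intro CollectI exI conjI)
qed

end

section \<open>Dimension shifting along the forms, on the level of cocycles\<close>

section \<open>The connecting relations\<close>

definition hc :: "int \<Rightarrow> (nat set \<Rightarrow> 'k::field laurent) \<Rightarrow> nat set \<Rightarrow> 'k laurent" where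
  "hc j u = (\<lambda>F. hcomp j (u F))"

lemma hc_diff: "hc j (u - v) = hc j u - hc j v"
  and hc_add: "hc j (u + v) = hc j u + hc j v"
  by (simp_all add: hc_def fun_eq_iff restr_minus restr_add)

lemma hom_deg_hc: "hom_deg j u \<longleftrightarrow> hc j u = u"
proof
  assume "hom_deg j u"
  then have "exp_deg \<alpha> = j" if "Poly_Mapping.lookup (u F) \<alpha> \<noteq> 0" for F \<alpha>
    using that by (auto simp: hom_deg_def in_keys_iff)
  then show "hc j u = u"
    by (intro ext poly_mapping_eqI) (auto simp: hc_def lookup_restr)
next
  assume *: "hc j u = u"
  show "hom_deg j u"
    unfolding hom_deg_def
  proof (intro allI ballI)
    fix F \<alpha> assume "\<alpha> \<in> Poly_Mapping.keys (u F)"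
    then have "\<alpha> \<in> Poly_Mapping.keys (hc j u F)" using * by simp
    then show "exp_deg \<alpha> = j" by (simp add: hc_def keys_restr)
  qed
qed

lemma hom_deg_cong: "hom_deg j u \<Longrightarrow> j = j' \<Longrightarrow> hom_deg j' u"
  by simp

lemma hom_deg_hc_self: "hom_deg j (hc j u)"
  by (simp add: hom_deg_def hc_def keys_restr)

lemma hom_deg_diff: "hom_deg j u \<Longrightarrow> hom_deg j v \<Longrightarrow> hom_deg j (u - v)"
  by (simp add: hom_deg_hc hc_diff)

lemma hc_sgn: "hcomp j (sgn_in G t * f) = sgn_in G t * hcomp j (f :: 'k::field laurent)"
proof -
  have "hcomp j (- f) = - hcomp j f" using restr_minus[of _ 0 f] by simp
  then show ?thesis
    by (cases "even (card {s \<in> G. s < t})") (simp_all add: sgn_in_def)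
qed

lemma hc_cdiff: "hc j (cdiff X u) = cdiff X (hc j u)"
  by (simp add: hc_def cdiff_def fun_eq_iff restr_sum hc_sgn)

context generic_forms
begin

abbreviation "C p \<equiv> cochains n L p"
abbreviation "CJ m p \<equiv> cochains n (J m) p"
abbreviation "Z m p \<equiv> cech_cocycles n L (J m) p"
abbreviation "B m p \<equiv> cech_coboundaries n L (J m) p"
abbreviation "\<delta> \<equiv> cdiff (Pow {1..n})"

definition tact :: "nat \<Rightarrow> (nat set \<Rightarrow> 'k laurent) \<Rightarrow> nat set \<Rightarrow> 'k laurent" where
  "tact p u = cact (\<theta> p) u"

lemma tact_diff: "tact p (u - v) = tact p u - tact p v"
  and tact_delta: "\<delta> (tact p u) = tact p (\<delta> u)"
  and tact_cact: "tact p (cact r u) = cact r (tact p u)"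
  and hc_tact: "hc j (tact p u) = tact p (hc (j - 1) u)"
  by (simp_all add: tact_def hc_def fun_eq_iff right_diff_distrib cdiff_scale hcomp_\<theta> mult.left_commute)

lemma hom_deg_tact: "hom_deg (j - 1) u \<Longrightarrow> hom_deg j (tact p u)"
  by (simp add: hom_deg_hc hc_tact)

lemmas sub_C = submod_cochains[OF good_L] and sub_CJ = submod_cochains[OF good_J]
  and sub_Z = submod_cocycles[OF good_L good_J J_sub] and sub_B = submod_coboundaries[OF good_L good_J J_sub]
  and B_Z = coboundaries_subset[OF good_L good_J J_sub, THEN subsetD]
  and CJ_B = zero_cochains_subset[OF good_L good_J J_sub, THEN subsetD]
  and CJ_C = cochains_mono[OF J_sub, THEN subsetD]

lemma Z_C: "u \<in> Z m p \<Longrightarrow> u \<in> C p"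
  by (simp add: cech_cocycles_def)

lemma tact_C: "u \<in> C p \<Longrightarrow> tact q u \<in> C p"
  and tact_CJ: "u \<in> CJ m p \<Longrightarrow> tact q u \<in> CJ m p"
  and tact_Z: "u \<in> Z m p \<Longrightarrow> tact q u \<in> Z m p"
  and tact_B: "u \<in> B m p \<Longrightarrow> tact q u \<in> B m p"
  unfolding tact_def
  by (rule submod_act[OF sub_C] submod_act[OF sub_CJ] submod_act[OF sub_Z] submod_act[OF sub_B]; auto)+

lemma CJ_mono: "u \<in> CJ m p \<Longrightarrow> u \<in> CJ (Suc m) p"
  using cochains_mono[of n "J m" "J (Suc m)" p] J_mono by blast

lemma B_mono: "u \<in> B m p \<Longrightarrow> u \<in> B (Suc m) p"
  unfolding cech_coboundaries_def by (auto intro: CJ_mono)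

lemma B_I: "u \<in> C p \<Longrightarrow> v \<in> C (p - 1) \<Longrightarrow> u - \<delta> v \<in> CJ m p \<Longrightarrow> u \<in> B m p"
  unfolding cech_coboundaries_def by blast

lemma tact_CJ_Suc: "u \<in> C p \<Longrightarrow> tact (Suc m) u \<in> CJ (Suc m) p"
proof -
  assume u: "u \<in> C p"
  have "emb (\<theta> (Suc m)) * u F \<in> J (Suc m) F" if "F \<in> subsets_of_card n p" for F
    using u that by (intro J_form subsets_of_cardD(1)) (auto simp: cochains_def)
  then show ?thesis using u by (auto simp: cochains_def tact_def)
qed

lemma CJ_Suc_decomp:
  assumes "u \<in> CJ (Suc m) p"
  obtains w where "w \<in> C p" "u - tact (Suc m) w \<in> CJ m p"
proof -
  have "\<exists>g. g \<in> L F \<and> u F - emb (\<theta> (Suc m)) * g \<in> J m F" if F: "F \<in> subsets_of_card n p" for F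
  proof -
    have "u F \<in> J (Suc m) F" using assms F by (simp add: cochains_def)
    then show ?thesis unfolding J_Suc[OF subsets_of_cardD(1)[OF F]] by auto
  qed
  then obtain g where g: "\<And>F. F \<in> subsets_of_card n p \<Longrightarrow> g F \<in> L F \<and> u F - emb (\<theta> (Suc m)) * g F \<in> J m F"
    by metis
  define w where "w F = (if F \<in> subsets_of_card n p then g F else 0)" for F
  have "w \<in> C p" "u - tact (Suc m) w \<in> CJ m p"
    using g assms by (auto simp: cochains_def w_def tact_def)
  then show ?thesis by (rule that)
qed

lemma tact_regular:
  assumes "p \<ge> 1" "w \<in> C p" "tact (Suc m) w \<in> CJ m p"
  shows "w \<in> CJ m p"
proof -
  have "w F \<in> J m F" if F: "F \<in> subsets_of_card n p" for F
  proof (rule regular[OF subsets_of_cardD(1)[OF F]])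
    show "F \<noteq> {}" using F assms(1) by (auto simp: subsets_of_card_def)
  qed (use assms F in \<open>auto simp: cochains_def tact_def\<close>)
  then show ?thesis using assms(2) by (auto simp: cochains_def)
qed

lemma hc_C: "u \<in> C p \<Longrightarrow> hc j u \<in> C p" and hc_CJ: "u \<in> CJ m p \<Longrightarrow> hc j u \<in> CJ m p"
  by (auto simp: cochains_def hc_def hcomp_L[OF subsets_of_cardD(1)] hcomp_J[OF subsets_of_cardD(1)])

lemma hc_Z: "u \<in> Z m p \<Longrightarrow> hc j u \<in> Z m p"
  using hc_CJ[of "\<delta> u" m "p + 1" j] by (simp add: cech_cocycles_def hc_C hc_cdiff)

lemma hc_B: "u \<in> B m p \<Longrightarrow> hc j u \<in> B m p"
proof -
  assume "u \<in> B m p"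
  then obtain v where v: "u \<in> C p" "v \<in> C (p - 1)" "u - \<delta> v \<in> CJ m p" by (auto simp: cech_coboundaries_def)
  show ?thesis
    by (rule B_I[of _ _ "hc j v"]) (use v hc_CJ[OF v(3), of j] in \<open>simp_all add: hc_C hc_diff hc_cdiff\<close>)
qed

text \<open>The cocycle \<open>w\<close> arises from \<open>z\<close> by \<open>m\<close> connecting homomorphisms, each of which divides a
  coboundary by the last form.\<close>

primrec Rel :: "nat \<Rightarrow> int \<Rightarrow> (nat set \<Rightarrow> 'k laurent) \<Rightarrow> (nat set \<Rightarrow> 'k laurent) \<Rightarrow> bool" where
  "Rel 0 p z w \<longleftrightarrow> z \<in> Z 0 p \<and> w = z"
| "Rel (Suc m) p z w \<longleftrightarrow> z \<in> Z (Suc m) p \<and>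
     (\<exists>y\<in>Z m (p + 1). \<delta> z - tact (Suc m) y \<in> CJ m (p + 1) \<and> Rel m (p + 1) y w)"

declare Rel.simps(2) [simp del]

lemma Rel_SucI:
  "z \<in> Z (Suc m) p \<Longrightarrow> y \<in> Z m (p + 1) \<Longrightarrow> \<delta> z - tact (Suc m) y \<in> CJ m (p + 1) \<Longrightarrow> Rel m (p + 1) y w \<Longrightarrow>
    Rel (Suc m) p z w"
  unfolding Rel.simps(2) by blast

lemma Rel_SucE:
  assumes "Rel (Suc m) p z w"
  obtains y where "z \<in> Z (Suc m) p" "y \<in> Z m (p + 1)" "\<delta> z - tact (Suc m) y \<in> CJ m (p + 1)" "Rel m (p + 1) y w"
  using assms unfolding Rel.simps(2) by blast

lemma Rel_Z: "Rel m p z w \<Longrightarrow> z \<in> Z m p \<and> w \<in> Z 0 (p + int m)"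
proof (induction m arbitrary: p z)
  case (Suc m)
  obtain y where "z \<in> Z (Suc m) p" "Rel m (p + 1) y w" by (rule Rel_SucE[OF Suc.prems])
  then show ?case using Suc.IH[of "p + 1" y] by (simp add: algebra_simps)
qed simp

lemma Rel_diff: "Rel m p z w \<Longrightarrow> Rel m p z' w' \<Longrightarrow> Rel m p (z - z') (w - w')"
proof (induction m arbitrary: p z z')
  case 0
  then show ?case using submod_diff[OF sub_Z, of z 0 p z'] by (simp only: Rel.simps(1))
next
  case (Suc m)
  obtain y where *: "z \<in> Z (Suc m) p" "y \<in> Z m (p + 1)" "\<delta> z - tact (Suc m) y \<in> CJ m (p + 1)" "Rel m (p + 1) y w"
    by (rule Rel_SucE[OF Suc.prems(1)])
  obtain y' where **: "z' \<in> Z (Suc m) p" "y' \<in> Z m (p + 1)" "\<delta> z' - tact (Suc m) y' \<in> CJ m (p + 1)" "Rel m (p + 1) y' w'"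
    by (rule Rel_SucE[OF Suc.prems(2)])
  have "\<delta> (z - z') - tact (Suc m) (y - y') = (\<delta> z - tact (Suc m) y) - (\<delta> z' - tact (Suc m) y')"
    by (simp add: cdiff_minus tact_diff)
  with submod_diff[OF sub_CJ *(3) **(3)] have "\<delta> (z - z') - tact (Suc m) (y - y') \<in> CJ m (p + 1)" by metis
  then show ?case
    by (intro Rel_SucI[OF submod_diff[OF sub_Z *(1) **(1)] submod_diff[OF sub_Z *(2) **(2)] _ Suc.IH[OF *(4) **(4)]])
qed

lemma Rel_cact: "r \<in> polys n \<Longrightarrow> Rel m p z w \<Longrightarrow> Rel m p (cact r z) (cact r w)"
proof (induction m arbitrary: p z)
  case 0
  then show ?case using submod_act[OF sub_Z, of r z 0 p] by (simp only: Rel.simps(1))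
next
  case (Suc m)
  obtain y where *: "z \<in> Z (Suc m) p" "y \<in> Z m (p + 1)" "\<delta> z - tact (Suc m) y \<in> CJ m (p + 1)" "Rel m (p + 1) y w"
    by (rule Rel_SucE[OF Suc.prems(2)])
  have "\<delta> (cact r z) - tact (Suc m) (cact r y) = cact r (\<delta> z - tact (Suc m) y)"
    by (simp add: cdiff_scale tact_cact right_diff_distrib fun_eq_iff)
  with submod_act[OF sub_CJ Suc.prems(1) *(3)] have "\<delta> (cact r z) - tact (Suc m) (cact r y) \<in> CJ m (p + 1)" by metis
  then show ?case
    by (intro Rel_SucI[OF submod_act[OF sub_Z Suc.prems(1) *(1)] submod_act[OF sub_Z Suc.prems(1) *(2)] _ Suc.IH[OF Suc.prems(1) *(4)]])
qed

lemma Rel_tact: "Rel m p z w \<Longrightarrow> Rel m p (tact q z) (tact q w)"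
  unfolding tact_def by (rule Rel_cact) auto

text \<open>Each of the m divisions by a form lowers the degree by one.\<close>

lemma Rel_hc: "Rel m p z w \<Longrightarrow> Rel m p (hc j z) (hc (j - int m) w)"
proof (induction m arbitrary: p z j)
  case 0
  then show ?case using hc_Z by auto
next
  case (Suc m)
  obtain y where *: "z \<in> Z (Suc m) p" "y \<in> Z m (p + 1)" "\<delta> z - tact (Suc m) y \<in> CJ m (p + 1)" "Rel m (p + 1) y w"
    by (rule Rel_SucE[OF Suc.prems])
  have "\<delta> (hc j z) - tact (Suc m) (hc (j - 1) y) \<in> CJ m (p + 1)"
    using hc_CJ[OF *(3), of j] by (simp add: hc_diff hc_cdiff hc_tact)
  moreover have "Rel m (p + 1) (hc (j - 1) y) (hc (j - int (Suc m)) w)"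
    using Suc.IH[OF *(4), of "j - 1"] by (simp add: algebra_simps)
  ultimately show ?case
    by (rule Rel_SucI[OF hc_Z[OF *(1)] hc_Z[OF *(2)]])
qed

text \<open>Write \<delta> z as theta_(m+1) y modulo J m. Applying the differential once more shows
  that theta_(m+1) times \<delta> y vanishes modulo J m, and regularity cancels the form: y is a
  cocycle.\<close>

lemma Rel_total: "p \<ge> 0 \<Longrightarrow> z \<in> Z m p \<Longrightarrow> \<exists>w. Rel m p z w"
proof (induction m arbitrary: p z)
  case (Suc m)
  then have z: "z \<in> C p" "\<delta> z \<in> CJ (Suc m) (p + 1)" by (auto simp: cech_cocycles_def)
  obtain y where y: "y \<in> C (p + 1)" "\<delta> z - tact (Suc m) y \<in> CJ m (p + 1)" by (rule CJ_Suc_decomp[OF z(2)])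
  have "\<delta> (\<delta> z - tact (Suc m) y) \<in> CJ m (p + 1 + 1)" by (rule cdiff_cochains[OF good_J y(2)])
  then have "- tact (Suc m) (\<delta> y) \<in> CJ m (p + 1 + 1)"
    by (simp add: cdiff_minus cdiff_cdiff[OF subset_closed_Pow] tact_delta)
  then have "- (- tact (Suc m) (\<delta> y)) \<in> CJ m (p + 1 + 1)" by (rule submod_uminus[OF sub_CJ])
  then have "tact (Suc m) (\<delta> y) \<in> CJ m (p + 1 + 1)" by simp
  then have "\<delta> y \<in> CJ m (p + 1 + 1)"
    by (rule tact_regular[rotated 2]) (use Suc.prems(1) cdiff_cochains[OF good_L y(1)] in auto)
  then have yZ: "y \<in> Z m (p + 1)" using y by (simp add: cech_cocycles_def)
  then obtain w where "Rel m (p + 1) y w" using Suc.IH[of "p + 1" y] Suc.prems(1) by auto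
  then show ?case using Rel_SucI[OF Suc.prems(2) yZ y(2)] by blast
qed auto

text \<open>If z is \<delta> v modulo J (m+1), then z - \<delta> v is theta_(m+1) x modulo J m.
  Hence theta_(m+1) y and theta_(m+1) \<delta> x agree modulo J m, and cancelling the form shows
  that x bounds y.\<close>

lemma Rel_B_forward: "p \<ge> 0 \<Longrightarrow> Rel m p z w \<Longrightarrow> z \<in> B m p \<Longrightarrow> w \<in> B 0 (p + int m)"
proof (induction m arbitrary: p z)
  case (Suc m)
  obtain y where y: "y \<in> Z m (p + 1)" "\<delta> z - tact (Suc m) y \<in> CJ m (p + 1)" "Rel m (p + 1) y w"
    by (rule Rel_SucE[OF Suc.prems(2)])
  obtain v where v: "v \<in> C (p - 1)" "z - \<delta> v \<in> CJ (Suc m) p" using Suc.prems(3) by (auto simp: cech_coboundaries_def)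
  obtain x where x: "x \<in> C p" "z - \<delta> v - tact (Suc m) x \<in> CJ m p" by (rule CJ_Suc_decomp[OF v(2)])
  have "\<delta> (z - \<delta> v - tact (Suc m) x) \<in> CJ m (p + 1)" by (rule cdiff_cochains[OF good_J x(2)])
  then have "\<delta> z - tact (Suc m) (\<delta> x) \<in> CJ m (p + 1)"
    by (simp add: cdiff_minus cdiff_cdiff[OF subset_closed_Pow] tact_delta)
  from submod_diff[OF sub_CJ this y(2)] have "tact (Suc m) (y - \<delta> x) \<in> CJ m (p + 1)"
    by (simp add: tact_diff)
  then have "y - \<delta> x \<in> CJ m (p + 1)"
    by (rule tact_regular[rotated 2])
      (use Suc.prems(1) submod_diff[OF sub_C Z_C[OF y(1)] cdiff_cochains[OF good_L x(1)]] in auto)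
  then have "y \<in> B m (p + 1)" using x Z_C[OF y(1)] by (intro B_I[of _ _ x]) auto
  then have "w \<in> B 0 (p + 1 + int m)" using Suc.IH[of "p + 1" y] y Suc.prems by auto
  then show ?case by (simp add: algebra_simps)
qed simp

definition K :: "nat \<Rightarrow> int \<Rightarrow> (nat set \<Rightarrow> 'k laurent) set" where
  "K m p = {w \<in> Z 0 p. \<forall>q\<in>{1..m}. tact q w \<in> B 0 p}"

text \<open>In the m-th reduction theta_(m+1) y is the coboundary of z. As theta_(m+1) y is related
  to theta_(m+1) w, the latter bounds too.\<close>

lemma Rel_K: "p \<ge> 0 \<Longrightarrow> Rel m p z w \<Longrightarrow> w \<in> K m (p + int m)"
proof (induction m arbitrary: p z)
  case 0
  then show ?case by (simp add: K_def)
next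
  case (Suc m)
  obtain y where y: "z \<in> Z (Suc m) p" "y \<in> Z m (p + 1)" "\<delta> z - tact (Suc m) y \<in> CJ m (p + 1)" "Rel m (p + 1) y w"
    by (rule Rel_SucE[OF Suc.prems(2)])
  have e: "p + 1 + int m = p + int (Suc m)" by simp
  have "w \<in> K m (p + 1 + int m)" by (rule Suc.IH[OF _ y(4)]) (use Suc.prems in auto)
  moreover have "tact (Suc m) w \<in> B 0 (p + 1 + int m)"
  proof (rule Rel_B_forward[OF _ Rel_tact[OF y(4)]])
    have "tact (Suc m) y - \<delta> z \<in> CJ m (p + 1)" using submod_uminus[OF sub_CJ y(3)] by simp
    then show "tact (Suc m) y \<in> B m (p + 1)"
      using Z_C[OF y(1)] tact_C[OF Z_C[OF y(2)]] by (intro B_I[of _ _ z]) auto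
  qed (use Suc.prems in auto)
  moreover have "q \<in> {1..Suc m} \<Longrightarrow> q = Suc m \<or> q \<in> {1..m}" for q by auto
  ultimately show ?case unfolding K_def e by blast
qed

lemma sub_K: "submod (poly_ring {1..n}) cact (K m p)"
proof (rule submodI)
  fix x y assume "x \<in> K m p" "y \<in> K m p"
  then have xy: "x \<in> Z 0 p" "y \<in> Z 0 p" "q \<in> {1..m} \<Longrightarrow> tact q x \<in> B 0 p" "q \<in> {1..m} \<Longrightarrow> tact q y \<in> B 0 p" for q
    by (simp_all add: K_def)
  show "x - y \<in> K m p"
    by (simp add: K_def tact_diff submod_diff[OF sub_Z xy(1,2)] submod_diff[OF sub_B xy(3,4)] del: atLeastAtMost_iff)
next
  fix r :: "(nat, 'k) mpoly" and x assume "r \<in> polys n" "x \<in> K m p"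
  then have rx: "r \<in> polys n" "x \<in> Z 0 p" "q \<in> {1..m} \<Longrightarrow> tact q x \<in> B 0 p" for q
    by (simp_all add: K_def)
  show "cact r x \<in> K m p"
    by (simp add: K_def tact_cact submod_act[OF sub_Z rx(1,2)] submod_act[OF sub_B rx(1,3)] del: atLeastAtMost_iff)
next
  have "tact q 0 = 0" for q using tact_diff[of q 0 0] by simp
  then show "0 \<in> K m p" unfolding K_def by (simp add: submod_0[OF sub_Z] submod_0[OF sub_B])
qed

lemma hc_K: "u \<in> K m p \<Longrightarrow> hc j u \<in> K m p"
proof -
  assume u: "u \<in> K m p"
  have "tact q (hc j u) \<in> B 0 p" if "q \<in> {1..m}" for q
    using hc_B[of "tact q u" 0 p "j + 1"] u that by (simp add: K_def hc_tact)
  then show ?thesis using u hc_Z by (simp add: K_def)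
qed

lemma K_Suc: "u \<in> K (Suc m) p \<longleftrightarrow> u \<in> K m p \<and> tact (Suc m) u \<in> B 0 p"
proof -
  have "{1..Suc m} = insert (Suc m) {1..m}" by auto
  then show ?thesis by (auto simp: K_def)
qed

text \<open>Surjectivity in degrees below -m is a hypothesis here; its proof uses the fine grading
  and is supplied by \<open>theta_surjective\<close>.\<close>

context
  assumes surj: "\<And>m p i w. Suc m \<le> d \<Longrightarrow> int m < i \<Longrightarrow> w \<in> K m p \<Longrightarrow> hom_deg (- i) w \<Longrightarrow>
    \<exists>x\<in>K m p. hom_deg (- i - 1) x \<and> tact (Suc m) x - w \<in> B 0 p"
begin

text \<open>The two halves are proved together. Lifting w through one more form requires that
  theta_(m+1) y bounds, which is the second half at m. The second half at m + 1 requires theta_(m+1)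
  to be onto in the cohomology of the m-th reduction, and both halves at m are used to carry
  \<open>surj\<close> there.\<close>

lemma Rel_graded:
  assumes "m \<le> d"
  shows "\<And>p i w. p \<ge> 1 \<Longrightarrow> i \<ge> 1 \<Longrightarrow> w \<in> K m (p + int m) \<Longrightarrow> hom_deg (- i - int m) w \<Longrightarrow>
      \<exists>z. hom_deg (- i) z \<and> Rel m p z w"
    and "\<And>p i z w. p \<ge> 1 \<Longrightarrow> i \<ge> 1 \<Longrightarrow> Rel m p z w \<Longrightarrow> hom_deg (- i) z \<Longrightarrow> w \<in> B 0 (p + int m) \<Longrightarrow> z \<in> B m p"
proof -
  have "(\<forall>p i w. p \<ge> 1 \<longrightarrow> i \<ge> 1 \<longrightarrow> w \<in> K m (p + int m) \<longrightarrow> hom_deg (- i - int m) w \<longrightarrow>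
      (\<exists>z. hom_deg (- i) z \<and> Rel m p z w)) \<and>
    (\<forall>p i z w. p \<ge> 1 \<longrightarrow> i \<ge> 1 \<longrightarrow> Rel m p z w \<longrightarrow> hom_deg (- i) z \<longrightarrow> w \<in> B 0 (p + int m) \<longrightarrow> z \<in> B m p)"
    (is "?b m \<and> ?c m")
    using assms
  proof (induction m)
    case 0
    then show ?case by (auto simp: K_def)
  next
    case (Suc m)
    then have IHb: "\<And>p i w. p \<ge> 1 \<Longrightarrow> i \<ge> 1 \<Longrightarrow> w \<in> K m (p + int m) \<Longrightarrow> hom_deg (- i - int m) w \<Longrightarrow>
        \<exists>z. hom_deg (- i) z \<and> Rel m p z w"
      and IHc: "\<And>p i z w. p \<ge> 1 \<Longrightarrow> i \<ge> 1 \<Longrightarrow> Rel m p z w \<Longrightarrow> hom_deg (- i) z \<Longrightarrow> w \<in> B 0 (p + int m) \<Longrightarrow> z \<in> B m p"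
      by auto
    \<comment> \<open>\<open>surj\<close> transported along \<open>Rel\<close>. Degree -i of the
      reduction corresponds to degree -(i + m) of the face ring, so the condition m < i + m is just
      i \<ge> 1.\<close>
    have onto: "\<exists>x. x \<in> Z m p \<and> tact (Suc m) x - z0 \<in> B m p"
      if z0: "z0 \<in> Z m p" "hom_deg (- i) z0" and p: "p \<ge> 1" and i: "i \<ge> 1" for z0 p i
    proof -
      obtain w0 where "Rel m p z0 w0" using Rel_total z0(1) p by (meson le_cases order_trans zero_le_one)
      from Rel_hc[OF this, of "- i"] have w0: "Rel m p z0 (hc (- i - int m) w0)"
        using z0(2) by (simp add: hom_deg_hc)
      let ?w = "hc (- i - int m) w0"
      have "?w \<in> K m (p + int m)" using Rel_K[OF _ w0] p by simp
      moreover have "hom_deg (- (i + int m)) ?w" by (rule hom_deg_cong[OF hom_deg_hc_self]) simp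
      ultimately obtain x0 where x0: "x0 \<in> K m (p + int m)" "hom_deg (- (i + int m) - 1) x0"
          "tact (Suc m) x0 - ?w \<in> B 0 (p + int m)"
        using surj[of m "i + int m" ?w "p + int m"] Suc.prems i by auto
      have "hom_deg (- (i + 1) - int m) x0" by (rule hom_deg_cong[OF x0(2)]) simp
      then obtain x where "hom_deg (- (i + 1)) x" and x2: "Rel m p x x0"
        using IHb[of p "i + 1" x0] x0 p i by auto
      then have x: "hom_deg (- i - 1) x" "Rel m p x x0" by simp_all
      have "hom_deg (- i) (tact (Suc m) x - z0)"
        by (intro hom_deg_diff hom_deg_tact x(1) z0(2))
      then have "tact (Suc m) x - z0 \<in> B m p"
        using IHc[OF p i Rel_diff[OF Rel_tact[OF x(2)] w0]] x0(3) by blast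
      then show ?thesis using Rel_Z[OF x(2)] by blast
    qed
    have "?c (Suc m)"
    proof (intro allI impI)
      fix p i z w assume p: "p \<ge> 1" and i: "i \<ge> 1" and zw: "Rel (Suc m) p z w" and z: "hom_deg (- i) z"
        and wB: "w \<in> B 0 (p + int (Suc m))"
      obtain y0 where y0: "z \<in> Z (Suc m) p" "y0 \<in> Z m (p + 1)" "\<delta> z - tact (Suc m) y0 \<in> CJ m (p + 1)" "Rel m (p + 1) y0 w"
        by (rule Rel_SucE[OF zw])
      \<comment> \<open>As z is homogeneous, y may be replaced by its component of degree -i - 1;
        the induction hypothesis asks for homogeneous elements.\<close>
      let ?y = "hc (- i - 1) y0"
      have "hc (- i) (\<delta> z - tact (Suc m) y0) = \<delta> z - tact (Suc m) ?y"
        using z by (simp add: hc_diff hc_cdiff hc_tact hom_deg_hc)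
      then have y1: "\<delta> z - tact (Suc m) ?y \<in> CJ m (p + 1)" using hc_CJ[OF y0(3)] by metis
      have "Rel m (p + 1) ?y (hc (- i - 1 - int m) w)" by (rule Rel_hc[OF y0(4)])
      moreover have "hc (- i - 1 - int m) w \<in> B 0 (p + 1 + int m)"
        using hc_B[OF wB, of "- i - 1 - int m"] by (simp add: algebra_simps)
      moreover have "hom_deg (- (i + 1)) ?y" by (rule hom_deg_cong[OF hom_deg_hc_self]) simp
      ultimately have "?y \<in> B m (p + 1)"
        using IHc[of "p + 1" "i + 1" ?y] p i by auto
      then obtain v0 where v0: "v0 \<in> C p" "?y - \<delta> v0 \<in> CJ m (p + 1)" by (auto simp: cech_coboundaries_def)
      let ?v = "hc (- i - 1) v0"
      have "hc (- i - 1) (?y - \<delta> v0) = ?y - \<delta> ?v"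
        using hom_deg_hc_self[of "- i - 1" y0] by (simp add: hc_diff hc_cdiff hom_deg_hc)
      then have v: "?v \<in> C p" "?y - \<delta> ?v \<in> CJ m (p + 1)"
        using hc_CJ[OF v0(2)] hc_C[OF v0(1)] by metis+
      \<comment> \<open>Since y bounds by way of v, this correction is a cocycle already modulo J m.
        By \<open>onto\<close> it is theta_(m+1) x up to a coboundary, and multiples of theta_(m+1)
        are zero in the next reduction.\<close>
      let ?z0 = "z - tact (Suc m) ?v"
      have "\<delta> ?z0 = (\<delta> z - tact (Suc m) ?y) + tact (Suc m) (?y - \<delta> ?v)"
        by (simp add: cdiff_minus tact_delta tact_diff)
      then have "\<delta> ?z0 \<in> CJ m (p + 1)"
        using submod_add[OF sub_CJ y1 tact_CJ[OF v(2)]] by metis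
      then have z0Z: "?z0 \<in> Z m p"
        using submod_diff[OF sub_C Z_C[OF y0(1)] tact_C[OF v(1)]] by (simp add: cech_cocycles_def)
      have z0: "hom_deg (- i) ?z0"
        by (intro hom_deg_diff hom_deg_tact z hom_deg_hc_self)
      obtain x where x: "x \<in> Z m p" "tact (Suc m) x - ?z0 \<in> B m p"
        using onto[OF z0Z z0 p i] by blast
      have "z = tact (Suc m) x - (tact (Suc m) x - ?z0) + tact (Suc m) ?v" by simp
      moreover have "tact (Suc m) x \<in> B (Suc m) p" "tact (Suc m) ?v \<in> B (Suc m) p"
        using tact_CJ_Suc[OF Z_C[OF x(1)]] tact_CJ_Suc[OF v(1)] by (auto intro: CJ_B)
      ultimately show "z \<in> B (Suc m) p"
        using submod_add[OF sub_B submod_diff[OF sub_B _ B_mono[OF x(2)]]] by metis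
    qed
    moreover have "?b (Suc m)"
    proof (intro allI impI)
      fix p i w assume p: "p \<ge> 1" and i: "i \<ge> 1" and wK: "w \<in> K (Suc m) (p + int (Suc m))"
        and w: "hom_deg (- i - int (Suc m)) w"
      have e: "p + int (Suc m) = p + 1 + int m" by simp
      have wK': "w \<in> K m (p + 1 + int m)" "tact (Suc m) w \<in> B 0 (p + 1 + int m)"
        using wK unfolding e K_Suc by auto
      have "hom_deg (- (i + 1) - int m) w" by (rule hom_deg_cong[OF w]) simp
      then obtain y where "hom_deg (- (i + 1)) y" and y2: "Rel m (p + 1) y w"
        using IHb[of "p + 1" "i + 1" w] wK' p i by auto
      then have y: "hom_deg (- i - 1) y" "Rel m (p + 1) y w" by simp_all
      have "hom_deg (- i) (tact (Suc m) y)" by (intro hom_deg_tact y(1))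
      then have "tact (Suc m) y \<in> B m (p + 1)"
        using IHc[of "p + 1" i, OF _ i Rel_tact[OF y(2)]] wK'(2) p by auto
      then obtain z0 where z0: "z0 \<in> C p" "tact (Suc m) y - \<delta> z0 \<in> CJ m (p + 1)"
        by (auto simp: cech_coboundaries_def)
      let ?z = "hc (- i) z0"
      have yZ: "y \<in> Z m (p + 1)" using Rel_Z[OF y(2)] by blast
      have "hc (- i) (tact (Suc m) y - \<delta> z0) = tact (Suc m) y - \<delta> ?z"
        using \<open>hom_deg (- i) (tact (Suc m) y)\<close> by (simp add: hc_diff hc_cdiff hom_deg_hc)
      then have "tact (Suc m) y - \<delta> ?z \<in> CJ m (p + 1)" using hc_CJ[OF z0(2)] by metis
      from submod_uminus[OF sub_CJ this] have z1: "\<delta> ?z - tact (Suc m) y \<in> CJ m (p + 1)" by simp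
      from submod_add[OF sub_CJ CJ_mono[OF z1] tact_CJ_Suc[OF Z_C[OF yZ]]]
      have "\<delta> ?z \<in> CJ (Suc m) (p + 1)" by simp
      then have "?z \<in> Z (Suc m) p" using hc_C[OF z0(1)] by (simp add: cech_cocycles_def)
      then have "Rel (Suc m) p ?z w" by (rule Rel_SucI[OF _ yZ z1 y(2)])
      then show "\<exists>z. hom_deg (- i) z \<and> Rel (Suc m) p z w" using hom_deg_hc_self by blast
    qed
    ultimately show ?case by blast
  qed
  then show "\<And>p i w. p \<ge> 1 \<Longrightarrow> i \<ge> 1 \<Longrightarrow> w \<in> K m (p + int m) \<Longrightarrow> hom_deg (- i - int m) w \<Longrightarrow>
      \<exists>z. hom_deg (- i) z \<and> Rel m p z w"
    and "\<And>p i z w. p \<ge> 1 \<Longrightarrow> i \<ge> 1 \<Longrightarrow> Rel m p z w \<Longrightarrow> hom_deg (- i) z \<Longrightarrow> w \<in> B 0 (p + int m) \<Longrightarrow> z \<in> B m p"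
    by blast+
qed

end

end

section \<open>Koszul equations on inverse polynomials\<close>

section \<open>Solving linear forms on inverse monomials\<close>

abbreviation unit_exp :: "nat \<Rightarrow> nat \<Rightarrow>\<^sub>0 int" where
  "unit_exp t \<equiv> Poly_Mapping.single t 1"

definition sscale :: "'k::field \<Rightarrow> ('s \<Rightarrow> 'k) \<Rightarrow> 's \<Rightarrow> 'k" where
  "sscale c u = (\<lambda>F. c * u F)"

abbreviation subsp :: "('s \<Rightarrow> 'k::field) set \<Rightarrow> bool" where
  "subsp \<equiv> submod (class_ring :: 'k ring) sscale"

lemma subsp_scale: "subsp V \<Longrightarrow> u \<in> V \<Longrightarrow> sscale c u \<in> V"
  using submod_act[of class_ring sscale V c u] by simp

lemma subsp_scaleD:
  assumes "subsp V" "sscale c u \<in> V" "c \<noteq> 0"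
  shows "u \<in> V"
proof -
  have "sscale (1 / c) (sscale c u) \<in> V" by (rule subsp_scale[OF assms(1,2)])
  moreover have "sscale (1 / c) (sscale c u) = u" using assms(3) by (simp add: sscale_def fun_eq_iff)
  ultimately show ?thesis by simp
qed

lemma action_sscale: "action (class_ring :: 'k::field ring) (sscale :: 'k \<Rightarrow> ('s \<Rightarrow> 'k) \<Rightarrow> 's \<Rightarrow> 'k)"
proof -
  have "\<exists>y. x + y = 0" for x :: 'k by (rule exI[of _ "- x"]) simp
  then have "cring (class_ring :: 'k ring)"
    by (intro cringI abelian_groupI comm_monoidI) (auto simp: algebra_simps)
  then show ?thesis
    by unfold_locales (simp_all add: sscale_def fun_eq_iff algebra_simps cring_def)
qed

text \<open>A family \<open>x\<close> stands for \<open>\<Sum>\<^sub>\<alpha> x\<^sub>\<alpha> \<otimes> x\<^sup>\<alpha>\<close>, on which the linear form with coefficients \<open>b\<close> acts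
  by the following operator.\<close>

definition form_op :: "nat set \<Rightarrow> (nat \<times> nat \<Rightarrow> 'k::field) \<Rightarrow> nat \<Rightarrow>
    ((nat \<Rightarrow>\<^sub>0 int) \<Rightarrow> 's \<Rightarrow> 'k) \<Rightarrow> (nat \<Rightarrow>\<^sub>0 int) \<Rightarrow> 's \<Rightarrow> 'k" where
  "form_op N b q x \<alpha> = (\<lambda>F. \<Sum>t\<in>N. b (t, q) * x (\<alpha> - unit_exp t) F)"

lemma form_op_diff: "form_op N b q (\<lambda>\<alpha>. x \<alpha> - y \<alpha>) \<alpha> = form_op N b q x \<alpha> - form_op N b q y \<alpha>"
  and form_op_add: "form_op N b q (\<lambda>\<alpha>. x \<alpha> + y \<alpha>) \<alpha> = form_op N b q x \<alpha> + form_op N b q y \<alpha>"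
  and form_op_scale: "form_op N b q (\<lambda>\<alpha>. sscale c (x \<alpha>)) \<alpha> = sscale c (form_op N b q x \<alpha>)"
  by (simp_all add: form_op_def sscale_def fun_eq_iff algebra_simps sum.distrib sum_subtractf sum_distrib_left)

lemma form_op_cong: "(\<And>t. t \<in> N \<Longrightarrow> x (\<alpha> - unit_exp t) = y (\<alpha> - unit_exp t)) \<Longrightarrow> form_op N b q x \<alpha> = form_op N b q y \<alpha>"
  by (simp add: form_op_def)

lemma unit_exp_commute: "\<alpha> - unit_exp t - unit_exp s = \<alpha> - unit_exp s - unit_exp t"
  by (simp add: diff_diff_eq add.commute)

lemma form_op_commute:
  "form_op N b q (form_op N' b' q' x) \<alpha> = form_op N' b' q' (form_op N b q x) \<alpha>"
proof -
  have "(\<Sum>t\<in>N. \<Sum>s\<in>N'. b (t, q) * (b' (s, q') * x (\<alpha> - unit_exp t - unit_exp s) F)) =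
      (\<Sum>s\<in>N'. \<Sum>t\<in>N. b' (s, q') * (b (t, q) * x (\<alpha> - unit_exp s - unit_exp t) F))" for F
  proof -
    have "b (t, q) * (b' (s, q') * x (\<alpha> - unit_exp t - unit_exp s) F) =
        b' (s, q') * (b (t, q) * x (\<alpha> - unit_exp s - unit_exp t) F)" for s t
      unfolding unit_exp_commute[of \<alpha> t s] by (rule mult.left_commute)
    then show ?thesis by (subst sum.swap) (intro sum.cong refl)
  qed
  then show ?thesis by (simp add: form_op_def sum_distrib_left fun_eq_iff)
qed

lemma form_op_eliminate:
  "form_op N (eliminate b t0 p0) q x \<alpha> = form_op N b q x \<alpha> - sscale (b (t0, q) / b (t0, p0)) (form_op N b p0 x \<alpha>)"
  by (simp add: form_op_def sscale_def eliminate_def fun_eq_iff left_diff_distrib sum_subtractf sum_distrib_left mult.assoc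
    del: times_divide_eq_left)

lemma form_op_remove:
  assumes "b (t0, q) = 0"
  shows "form_op N b q x \<alpha> = form_op (N - {t0}) b q x \<alpha>"
proof (cases "finite N")
  case True
  then show ?thesis unfolding form_op_def
    by (intro ext sum.mono_neutral_right) (use assms in auto)
qed (simp add: form_op_def)

lemma form_op_insert:
  assumes "finite N" "t0 \<in> N"
  shows "form_op N b q x \<alpha> = sscale (b (t0, q)) (x (\<alpha> - unit_exp t0)) + form_op (N - {t0}) b q x \<alpha>"
  unfolding form_op_def sscale_def by (rule ext) (simp add: sum.remove[OF assms])

lemma sum_fun_apply: "(\<Sum>i\<in>A. f i) x = (\<Sum>i\<in>A. f i x)"
  by (induction A rule: infinite_finite_induct) auto

lemma form_op_mem:
  assumes "subsp V" "\<And>t. t \<in> N \<Longrightarrow> x (\<alpha> - unit_exp t) \<in> V"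
  shows "form_op N b q x \<alpha> \<in> V"
proof -
  have "form_op N b q x \<alpha> = (\<Sum>t\<in>N. sscale (b (t, q)) (x (\<alpha> - unit_exp t)))"
    by (rule ext) (simp add: form_op_def sscale_def sum_fun_apply)
  then show ?thesis using assms by (auto intro!: submod_sum[OF assms(1)] subsp_scale[OF assms(1)])
qed

text \<open>For finite N these exponents index the monomial basis, in degree -j, of the top local
  cohomology of the polynomial ring in the variables of N.\<close>

definition neg_exps :: "nat set \<Rightarrow> int \<Rightarrow> (nat \<Rightarrow>\<^sub>0 int) set" where
  "neg_exps N j = {\<alpha>. Poly_Mapping.keys \<alpha> = N \<and> (\<forall>t\<in>N. Poly_Mapping.lookup \<alpha> t < 0) \<and> exp_deg \<alpha> = - j}"

lemma lookup_unit_diff: "Poly_Mapping.lookup (\<alpha> - unit_exp t) s = Poly_Mapping.lookup \<alpha> s - (if s = t then 1 else 0)"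
  and lookup_unit_add: "Poly_Mapping.lookup (\<alpha> + unit_exp t) s = Poly_Mapping.lookup \<alpha> s + (if s = t then 1 else 0)"
  by (simp_all add: lookup_minus lookup_add lookup_single when_def)

lemma neg_exps_iff:
  "\<alpha> \<in> neg_exps N j \<longleftrightarrow> (\<forall>t\<in>N. Poly_Mapping.lookup \<alpha> t < 0) \<and> (\<forall>t. t \<notin> N \<longrightarrow> Poly_Mapping.lookup \<alpha> t = 0) \<and> exp_deg \<alpha> = - j"
  unfolding neg_exps_def by (force simp: in_keys_iff)

lemma neg_exps_minus: "\<alpha> \<in> neg_exps N j \<Longrightarrow> t \<in> N \<Longrightarrow> \<alpha> - unit_exp t \<in> neg_exps N (j + 1)"
  by (auto simp: neg_exps_iff lookup_unit_diff exp_deg_minus)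

lemma neg_exps_minus_new: "\<alpha> \<in> neg_exps (N - {t}) j \<Longrightarrow> t \<in> N \<Longrightarrow> \<alpha> - unit_exp t \<in> neg_exps N (j + 1)"
  by (auto simp: neg_exps_iff lookup_unit_diff exp_deg_minus)

lemma neg_exps_plus: "\<alpha> \<in> neg_exps N j \<Longrightarrow> Poly_Mapping.lookup \<alpha> t \<noteq> - 1 \<Longrightarrow> t \<in> N \<Longrightarrow> \<alpha> + unit_exp t \<in> neg_exps N (j - 1)"
  by (force simp: neg_exps_iff lookup_unit_add exp_deg_add)

lemma neg_exps_plus_last: "\<alpha> \<in> neg_exps N j \<Longrightarrow> Poly_Mapping.lookup \<alpha> t = - 1 \<Longrightarrow> \<alpha> + unit_exp t \<in> neg_exps (N - {t}) (j - 1)"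
  by (auto simp: neg_exps_iff lookup_unit_add exp_deg_add)

text \<open>A vanishing statement for Koszul cohomology with coefficients in V / W. The pivot
  equation determines x recursively along the exponent of \<open>t0\<close>. The initial values, at
  exponent -1, solve the eliminated system in one variable fewer. The errors of the other equations
  are zero modulo W there, and by compatibility they satisfy the homogeneous pivot equation, so they
  are zero everywhere.\<close>

lemma local_solve:
  fixes b :: "nat \<times> nat \<Rightarrow> 'k::field" and y :: "nat \<Rightarrow> (nat \<Rightarrow>\<^sub>0 int) \<Rightarrow> 's \<Rightarrow> 'k"
  assumes V: "subsp V" "subsp W"
  shows "finite P \<Longrightarrow> finite N \<Longrightarrow> P0 \<subseteq> P \<Longrightarrow> card P0 = min (card P) (card N) \<Longrightarrow> col_indep b N P0 \<Longrightarrow> int (card P) \<le> j \<Longrightarrow>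
    (\<And>q \<alpha>. q \<in> P \<Longrightarrow> \<alpha> \<in> neg_exps N j \<Longrightarrow> y q \<alpha> \<in> V) \<Longrightarrow>
    (\<And>q q' \<alpha>. q \<in> P \<Longrightarrow> q' \<in> P \<Longrightarrow> \<alpha> \<in> neg_exps N (j - 1) \<Longrightarrow>
       form_op N b q (y q') \<alpha> - form_op N b q' (y q) \<alpha> \<in> W) \<Longrightarrow>
    \<exists>x. (\<forall>\<alpha>\<in>neg_exps N (j + 1). x \<alpha> \<in> V) \<and> (\<forall>q\<in>P. \<forall>\<alpha>\<in>neg_exps N j. form_op N b q x \<alpha> - y q \<alpha> \<in> W)"
proof (induction "card P" arbitrary: P N P0 b j y)
  case 0
  then show ?case using submod_0[OF V(1)] by (intro exI[of _ "\<lambda>_. 0"]) (auto simp: zero_fun_def)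
next
  case (Suc k)
  note prems = Suc.prems
  show ?case
  proof (cases "N = {}")
    case True
    \<comment> \<open>Each elimination lowers \<open>card P\<close> and j by one, so j is positive
      as long as an equation is left. Once the variables are used up, no exponent of degree -j
      exists.\<close>
    have "neg_exps N j = {}"
    proof -
      have "j \<ge> 1" using prems(6) Suc.hyps(2) by simp
      have "False" if "\<alpha> \<in> neg_exps N j" for \<alpha>
      proof -
        have "Poly_Mapping.keys \<alpha> = {}" using that True by (simp add: neg_exps_def)
        then show False using that \<open>j \<ge> 1\<close> by (simp add: neg_exps_def exp_deg_def)
      qed
      then show ?thesis by blast
    qed
    then show ?thesis using submod_0[OF V(1)] by (intro exI[of _ "\<lambda>_. 0"]) (auto simp: zero_fun_def)
  next
    case False
    then have "card N \<noteq> 0" using prems(2) by simp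
    then have "card P0 \<noteq> 0" using prems(4) Suc.hyps(2) by simp
    then obtain p0 where p0: "p0 \<in> P0" by fastforce
    have finP0: "finite P0" using prems(1,3) finite_subset by blast
    have p0P: "p0 \<in> P" using p0 prems(3) by blast
    obtain t0 where t0: "t0 \<in> N" "b (t0, p0) \<noteq> 0" using col_indep_pivot[OF prems(5) p0 finP0] by blast
    let ?b = "eliminate b t0 p0" and ?N = "N - {t0}" and ?P = "P - {p0}"
    define \<mu> where "\<mu> q = b (t0, q) / b (t0, p0)" for q
    define y1 where "y1 q \<alpha> = y q \<alpha> - sscale (\<mu> q) (y p0 \<alpha>)" for q \<alpha>
    have op1: "form_op ?N ?b q u \<alpha> = form_op N b q u \<alpha> - sscale (\<mu> q) (form_op N b p0 u \<alpha>)" for q u \<alpha>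
    proof -
      have "form_op ?N ?b q u \<alpha> = form_op N ?b q u \<alpha>"
        by (rule form_op_remove[symmetric]) (rule eliminate_pivot[of b t0 p0, OF t0(2)])
      then show ?thesis by (simp only: form_op_eliminate \<mu>_def)
    qed
    have y1V: "y1 q \<alpha> \<in> V" if "q \<in> P" "\<alpha> \<in> neg_exps N j" for q \<alpha>
      unfolding y1_def using prems(7) that p0P by (intro submod_diff[OF V(1)] subsp_scale[OF V(1)])
    have y1op: "form_op N b p (y1 q) \<alpha> = form_op N b p (y q) \<alpha> - sscale (\<mu> q) (form_op N b p (y p0) \<alpha>)" for p q \<alpha>
      by (simp add: y1_def[abs_def] form_op_diff form_op_scale)
    have compat1: "form_op ?N ?b q (y1 q') \<alpha> - form_op ?N ?b q' (y1 q) \<alpha> \<in> W"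
      if q: "q \<in> P" "q' \<in> P" "\<alpha> \<in> neg_exps N (j - 1)" for q q' \<alpha>
    proof -
      let ?c = "\<lambda>q q'. form_op N b q (y q') \<alpha> - form_op N b q' (y q) \<alpha>"
      have "form_op ?N ?b q (y1 q') \<alpha> - form_op ?N ?b q' (y1 q) \<alpha> =
          ?c q q' - sscale (\<mu> q') (?c q p0) - sscale (\<mu> q) (?c p0 q')"
        unfolding op1 y1op by (rule ext) (simp add: sscale_def algebra_simps)
      also have "\<dots> \<in> W"
        by (rule submod_diff[OF V(2) submod_diff[OF V(2) prems(8)[OF q] subsp_scale[OF V(2) prems(8)[OF q(1) p0P q(3)]]]
          subsp_scale[OF V(2) prems(8)[OF p0P q(2,3)]]])
      finally show ?thesis .
    qed
    \<comment> \<open>The slice of exponents with entry -1 at \<open>t0\<close> is indexed by the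
      exponents on \<open>N - {t0}\<close>; the missing entry accounts for the shift by
      \<open>unit_exp t0\<close> and for the degree j - 1.\<close>
    have "\<exists>x. (\<forall>\<alpha>\<in>neg_exps ?N ((j - 1) + 1). x \<alpha> \<in> V) \<and>
        (\<forall>q\<in>?P. \<forall>\<alpha>\<in>neg_exps ?N (j - 1). form_op ?N ?b q x \<alpha> - y1 q (\<alpha> - unit_exp t0) \<in> W)"
    proof -
      have 1: "k = card ?P" "finite ?P" "finite ?N" "P0 - {p0} \<subseteq> ?P" using prems Suc.hyps(2) p0P by auto
      have 2: "card (P0 - {p0}) = min (card ?P) (card ?N)"
        using prems p0 p0P t0 finP0 by (simp add: min_diff)
      have 3: "col_indep ?b ?N (P0 - {p0})" by (rule col_indep_eliminate[OF prems(5) finP0 p0 t0(2)])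
      have 4: "int (card ?P) \<le> j - 1" using prems(1,6) p0P Suc.hyps(2) by simp
      have 5: "y1 q (\<alpha> - unit_exp t0) \<in> V" if "q \<in> ?P" "\<alpha> \<in> neg_exps ?N (j - 1)" for q \<alpha>
        using that neg_exps_minus_new[of \<alpha> N t0 "j - 1"] t0 by (intro y1V) auto
      have 6: "form_op ?N ?b q (\<lambda>\<alpha>. y1 q' (\<alpha> - unit_exp t0)) \<alpha> - form_op ?N ?b q' (\<lambda>\<alpha>. y1 q (\<alpha> - unit_exp t0)) \<alpha> \<in> W"
        if q: "q \<in> ?P" "q' \<in> ?P" "\<alpha> \<in> neg_exps ?N (j - 1 - 1)" for q q' \<alpha>
      proof -
        have "form_op ?N ?b p (\<lambda>\<alpha>. y1 q (\<alpha> - unit_exp t0)) \<alpha> = form_op ?N ?b p (y1 q) (\<alpha> - unit_exp t0)" for p q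
          by (simp add: form_op_def unit_exp_commute[of _ t0])
        then show ?thesis
          using compat1[of q q' "\<alpha> - unit_exp t0"] q neg_exps_minus_new[of \<alpha> N t0 "j - 1 - 1"] t0 by simp
      qed
      show ?thesis
        using Suc.hyps(1)[where y = "\<lambda>q \<alpha>. y1 q (\<alpha> - unit_exp t0)", OF 1 2 3 4 5 6] .
    qed
    then obtain x' where x': "\<And>\<alpha>. \<alpha> \<in> neg_exps ?N j \<Longrightarrow> x' \<alpha> \<in> V"
      "\<And>q \<alpha>. q \<in> ?P \<Longrightarrow> \<alpha> \<in> neg_exps ?N (j - 1) \<Longrightarrow> form_op ?N ?b q x' \<alpha> - y1 q (\<alpha> - unit_exp t0) \<in> W"
      by auto
    \<comment> \<open>The i-th function gives the solution on exponents with entry -(i + 1) at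
      \<open>t0\<close>. In the pivot equation the term in which \<open>t0\<close> is lowered has
      the nonzero coefficient \<open>b (t0, p0)\<close>, and it is solved for.\<close>
    define X where "X = rec_nat (\<lambda>\<alpha>. x' (\<alpha> + unit_exp t0))
      (\<lambda>_ u \<alpha>. sscale (1 / b (t0, p0)) (y p0 (\<alpha> + unit_exp t0) - form_op ?N b p0 u (\<alpha> + unit_exp t0)))"
    have X0: "X 0 \<alpha> = x' (\<alpha> + unit_exp t0)" for \<alpha> by (simp add: X_def)
    have XS: "X (Suc i) \<alpha> = sscale (1 / b (t0, p0)) (y p0 (\<alpha> + unit_exp t0) - form_op ?N b p0 (X i) (\<alpha> + unit_exp t0))" for i \<alpha>
      by (simp add: X_def)
    define lev where "lev \<alpha> = nat (- Poly_Mapping.lookup \<alpha> t0 - 1)" for \<alpha> :: "nat \<Rightarrow>\<^sub>0 int"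
    define x where "x \<alpha> = X (lev \<alpha>) \<alpha>" for \<alpha>
    have lev_diff: "lev (\<alpha> - unit_exp t) = lev \<alpha>" if "t \<noteq> t0" for \<alpha> t
      using that by (simp add: lev_def lookup_unit_diff)
    have lev_diff0: "lev (\<alpha> - unit_exp t0) = Suc (lev \<alpha>)" if "\<alpha> \<in> neg_exps N i" for \<alpha> i
    proof -
      have "Poly_Mapping.lookup \<alpha> t0 < 0" using that t0 by (simp add: neg_exps_iff)
      then show ?thesis by (simp add: lev_def lookup_unit_diff)
    qed
    have lev_pos: "\<alpha> + unit_exp t0 \<in> neg_exps N (i - 1) \<and> lev (\<alpha> + unit_exp t0) = l" if "\<alpha> \<in> neg_exps N i" "lev \<alpha> = Suc l" for \<alpha> i l
      using that t0 by (auto intro!: neg_exps_plus simp: lev_def lookup_unit_add)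
    have lev_0: "\<alpha> + unit_exp t0 \<in> neg_exps ?N (i - 1)" if "\<alpha> \<in> neg_exps N i" "lev \<alpha> = 0" for \<alpha> i
    proof (rule neg_exps_plus_last[OF that(1)])
      have "Poly_Mapping.lookup \<alpha> t0 < 0" using that t0 by (simp add: neg_exps_iff)
      then show "Poly_Mapping.lookup \<alpha> t0 = - 1" using that(2) by (simp add: lev_def)
    qed
    have xV: "x \<alpha> \<in> V" if "\<alpha> \<in> neg_exps N (j + 1)" for \<alpha>
      using that
    proof (induction "lev \<alpha>" arbitrary: \<alpha>)
      case 0
      then show ?case using x'(1) lev_0[OF 0(2)] by (simp add: x_def X0)
    next
      case (Suc l)
      have *: "\<alpha> + unit_exp t0 \<in> neg_exps N j" "lev (\<alpha> + unit_exp t0) = l"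
        using lev_pos[OF Suc(3), of l] Suc(2) by simp_all
      have "X l (\<alpha> + unit_exp t0 - unit_exp t) \<in> V" if t: "t \<in> ?N" for t
        using Suc(1)[of "\<alpha> + unit_exp t0 - unit_exp t"] neg_exps_minus[OF *(1), of t] lev_diff[of t] t *(2)
        by (simp add: x_def)
      then have "form_op ?N b p0 (X l) (\<alpha> + unit_exp t0) \<in> V" by (rule form_op_mem[OF V(1)])
      then show ?case
        unfolding x_def Suc(2)[symmetric] XS
        using prems(7)[OF p0P *(1)] by (intro subsp_scale[OF V(1)] submod_diff[OF V(1)])
    qed
    have eq0: "form_op N b p0 x \<alpha> = y p0 \<alpha>" if \<alpha>: "\<alpha> \<in> neg_exps N j" for \<alpha>
    proof -
      have "form_op ?N b p0 x \<alpha> = form_op ?N b p0 (X (lev \<alpha>)) \<alpha>"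
        by (rule form_op_cong) (auto simp: x_def lev_diff)
      moreover have "x (\<alpha> - unit_exp t0) = sscale (1 / b (t0, p0)) (y p0 \<alpha> - form_op ?N b p0 (X (lev \<alpha>)) \<alpha>)"
        by (simp add: x_def lev_diff0[OF \<alpha>] XS)
      ultimately show ?thesis
        using t0 unfolding form_op_insert[OF prems(2) t0(1)] by (auto simp: sscale_def fun_eq_iff)
    qed
    have eq1: "form_op ?N ?b q x \<alpha> - y1 q \<alpha> \<in> W" if q: "q \<in> ?P" and \<alpha>: "\<alpha> \<in> neg_exps N j" for q \<alpha>
      using \<alpha>
    proof (induction "lev \<alpha>" arbitrary: \<alpha>)
      case 0
      have e: "form_op ?N ?b q x \<alpha> = form_op ?N ?b q x' (\<alpha> + unit_exp t0)"
        using 0(1) by (auto simp: form_op_def x_def lev_diff X0 algebra_simps intro!: ext sum.cong)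
      have "form_op ?N ?b q x' (\<alpha> + unit_exp t0) - y1 q (\<alpha> + unit_exp t0 - unit_exp t0) \<in> W"
        using x'(2)[OF q lev_0[OF 0(2)]] 0(1) by metis
      then show ?case unfolding e add_diff_cancel_right' .
    next
      case (Suc l)
      let ?\<beta> = "\<alpha> + unit_exp t0"
      have *: "?\<beta> \<in> neg_exps N (j - 1)" "lev ?\<beta> = l"
        using lev_pos[OF Suc(3), of l] Suc(2) by simp_all
      let ?e = "\<lambda>\<alpha>. form_op ?N ?b q x \<alpha> - y1 q \<alpha>"
      \<comment> \<open>The operators commute and x satisfies the pivot equation exactly, so
        applying the pivot form to the error leaves only a compatibility defect.\<close>
      have "form_op N b p0 ?e ?\<beta> = form_op N b p0 (form_op ?N ?b q x) ?\<beta> - form_op N b p0 (y1 q) ?\<beta>"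
        by (rule form_op_diff)
      also have "form_op N b p0 (form_op ?N ?b q x) ?\<beta> = form_op ?N ?b q (form_op N b p0 x) ?\<beta>"
        by (rule form_op_commute)
      also have "\<dots> = form_op ?N ?b q (y p0) ?\<beta>"
        using neg_exps_minus[OF *(1)] by (intro form_op_cong eq0) auto
      also have "\<dots> - form_op N b p0 (y1 q) ?\<beta> = form_op N b q (y p0) ?\<beta> - form_op N b p0 (y q) ?\<beta>"
        unfolding op1 y1op by simp
      finally have e: "form_op N b p0 ?e ?\<beta> = form_op N b q (y p0) ?\<beta> - form_op N b p0 (y q) ?\<beta>" .
      have "form_op N b p0 ?e ?\<beta> \<in> W" unfolding e by (rule prems(8)[OF DiffD1[OF q] p0P *(1)])
      moreover have "form_op ?N b p0 ?e ?\<beta> \<in> W"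
      proof (rule form_op_mem[OF V(2)])
        fix t assume t: "t \<in> ?N"
        show "?e (?\<beta> - unit_exp t) \<in> W"
        proof (rule Suc(1))
          show "l = lev (?\<beta> - unit_exp t)" using lev_diff[of t ?\<beta>] t *(2) by simp
          show "?\<beta> - unit_exp t \<in> neg_exps N j" using neg_exps_minus[OF *(1), of t] t by simp
        qed
      qed
      ultimately have "form_op N b p0 ?e ?\<beta> - form_op ?N b p0 ?e ?\<beta> \<in> W" by (rule submod_diff[OF V(2)])
      then have "sscale (b (t0, p0)) (?e \<alpha>) \<in> W"
        unfolding form_op_insert[OF prems(2) t0(1), of b p0 ?e] add_diff_cancel_right' .
      then show ?case by (rule subsp_scaleD[OF V(2) _ t0(2)])
    qed
    have "form_op N b q x \<alpha> - y q \<alpha> \<in> W" if q: "q \<in> P" and \<alpha>: "\<alpha> \<in> neg_exps N j" for q \<alpha>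
    proof (cases "q = p0")
      case True
      then show ?thesis using eq0[OF \<alpha>] submod_0[OF V(2)] by simp
    next
      case False
      have "form_op N b q x \<alpha> - y q \<alpha> = form_op ?N ?b q x \<alpha> - y1 q \<alpha>"
        unfolding op1 eq0[OF \<alpha>] y1_def by simp
      moreover have "form_op ?N ?b q x \<alpha> - y1 q \<alpha> \<in> W" by (rule eq1) (use q \<alpha> False in auto)
      ultimately show ?thesis by (simp only:)
    qed
    then show ?thesis using xV by blast
  qed
qed

section \<open>Fine components: cocycles of the pair (\<Delta>, cost N)\<close>

section \<open>Fine degrees\<close>

text \<open>Relative cocycles, extended by zero to all sets. The index p counts vertices, as in the
  Cech complex, so the cohomology is \<open>face_cohomology\<close> in degree p - 1.\<close>

definition rel_cocyc :: "nat set set \<Rightarrow> nat set \<Rightarrow> int \<Rightarrow> (nat set \<Rightarrow> 'k::field) set" where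
  "rel_cocyc \<Delta> N p = {c. (\<forall>F. c F \<noteq> 0 \<longrightarrow> F \<in> \<Delta> \<and> N \<subseteq> F \<and> int (card F) = p) \<and> cdiff \<Delta> c = 0}"

definition rel_chains :: "nat set set \<Rightarrow> nat set \<Rightarrow> int \<Rightarrow> (nat set \<Rightarrow> 'k::field) set" where
  "rel_chains \<Delta> N p = {c. \<forall>F. c F \<noteq> 0 \<longrightarrow> F \<in> \<Delta> \<and> N \<subseteq> F \<and> int (card F) = p}"

definition rel_cobd :: "nat set set \<Rightarrow> nat set \<Rightarrow> int \<Rightarrow> (nat set \<Rightarrow> 'k::field) set" where
  "rel_cobd \<Delta> N p = cdiff \<Delta> ` rel_chains \<Delta> N (p - 1)"

lemma rel_cocyc_alt: "c \<in> rel_cocyc \<Delta> N p \<longleftrightarrow> c \<in> rel_chains \<Delta> N p \<and> cdiff \<Delta> c = 0"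
  by (simp add: rel_cocyc_def rel_chains_def)

lemma subsp_chains: "subsp (rel_chains \<Delta> N p)"
proof (rule submodI)
  fix x y :: "nat set \<Rightarrow> 'a" assume xy: "x \<in> rel_chains \<Delta> N p" "y \<in> rel_chains \<Delta> N p"
  have "x F \<noteq> 0 \<or> y F \<noteq> 0" if "(x - y) F \<noteq> 0" for F using that by auto
  then show "x - y \<in> rel_chains \<Delta> N p" using xy unfolding rel_chains_def by blast
qed (auto simp: rel_chains_def sscale_def)

lemma cdiff_sscale: "cdiff X (sscale c u) = sscale c (cdiff X u)"
  unfolding sscale_def by (rule cdiff_scale)

lemma subsp_cocyc: "subsp (rel_cocyc \<Delta> N p)"
proof (rule submodI)
  show "0 \<in> rel_cocyc \<Delta> N p" by (simp add: rel_cocyc_alt submod_0[OF subsp_chains])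
next
  fix x y :: "nat set \<Rightarrow> 'a" assume "x \<in> rel_cocyc \<Delta> N p" "y \<in> rel_cocyc \<Delta> N p"
  then show "x - y \<in> rel_cocyc \<Delta> N p"
    using submod_diff[OF subsp_chains, of x \<Delta> N p y] by (simp add: rel_cocyc_alt cdiff_minus)
next
  fix r :: 'a and x :: "nat set \<Rightarrow> 'a" assume "x \<in> rel_cocyc \<Delta> N p"
  moreover have "sscale r 0 = (0 :: nat set \<Rightarrow> 'a)" by (simp add: sscale_def fun_eq_iff)
  ultimately show "sscale r x \<in> rel_cocyc \<Delta> N p"
    using subsp_scale[OF subsp_chains, of x \<Delta> N p r] by (simp add: rel_cocyc_alt cdiff_sscale)
qed

lemma subsp_cobd: "subsp (rel_cobd \<Delta> N p)"
proof (rule submodI)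
  show "0 \<in> rel_cobd \<Delta> N p"
    unfolding rel_cobd_def by (rule image_eqI[of _ _ 0]) (simp_all add: submod_0[OF subsp_chains])
next
  fix x y :: "nat set \<Rightarrow> 'a" assume "x \<in> rel_cobd \<Delta> N p" "y \<in> rel_cobd \<Delta> N p"
  then obtain u v where "u \<in> rel_chains \<Delta> N (p - 1)" "v \<in> rel_chains \<Delta> N (p - 1)" "x - y = cdiff \<Delta> (u - v)"
    by (auto simp: rel_cobd_def cdiff_minus)
  then show "x - y \<in> rel_cobd \<Delta> N p"
    unfolding rel_cobd_def using submod_diff[OF subsp_chains] by blast
next
  fix r :: 'a and x :: "nat set \<Rightarrow> 'a" assume "x \<in> rel_cobd \<Delta> N p"
  then show "sscale r x \<in> rel_cobd \<Delta> N p"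
    unfolding rel_cobd_def by (auto simp flip: cdiff_sscale intro!: imageI subsp_scale[OF subsp_chains])
qed

text \<open>Because of the extension by zero, multiplication by x_t from degree \<alpha> - e_t to
  degree \<alpha> is a mere inclusion, even when t leaves the support.\<close>

lemma rel_chains_antimono: "N \<subseteq> N' \<Longrightarrow> rel_chains \<Delta> N' p \<subseteq> rel_chains \<Delta> N p"
  by (auto simp: rel_chains_def)

lemma rel_cocyc_antimono: "N \<subseteq> N' \<Longrightarrow> rel_cocyc \<Delta> N' p \<subseteq> rel_cocyc \<Delta> N p"
  by (auto simp: rel_cocyc_def)

lemma rel_cobd_antimono: "N \<subseteq> N' \<Longrightarrow> rel_cobd \<Delta> N' p \<subseteq> rel_cobd \<Delta> N p"
  unfolding rel_cobd_def by (intro image_mono rel_chains_antimono)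

lemma rel_chains_nonface: "subset_closed \<Delta> \<Longrightarrow> N \<notin> \<Delta> \<Longrightarrow> c \<in> rel_chains \<Delta> N p \<Longrightarrow> c = 0"
  by (rule ext) (auto simp: rel_chains_def subset_closed_def)

lemma cdiff_rel_chains:
  assumes "subset_closed \<Delta>" "c \<in> rel_chains \<Delta> N p"
  shows "cdiff \<Delta> c \<in> rel_chains \<Delta> N (p + 1)"
proof -
  have "G \<in> \<Delta> \<and> N \<subseteq> G \<and> int (card G) = p + 1" if nz: "cdiff \<Delta> c G \<noteq> 0" for G
  proof -
    have G: "G \<in> \<Delta>" using nz by (auto simp: cdiff_def split: if_splits)
    then obtain t where t: "t \<in> G" "c (G - {t}) \<noteq> 0"
      using nz by (force simp: cdiff_def intro: sum.neutral)
    have "finite G" using G assms(1) by (auto simp: subset_closed_def)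
    then have "card G = Suc (card (G - {t}))" using t by (metis card_Suc_Diff1)
    moreover have "N \<subseteq> G - {t}" "int (card (G - {t})) = p" using t assms(2) by (auto simp: rel_chains_def)
    ultimately show ?thesis using G by auto
  qed
  then show ?thesis by (simp add: rel_chains_def)
qed

lemma rel_cobd_cocyc: "subset_closed \<Delta> \<Longrightarrow> rel_cobd \<Delta> N p \<subseteq> rel_cocyc \<Delta> N p"
  using cdiff_rel_chains[of \<Delta> _ N "p - 1"] cdiff_cdiff[of \<Delta>]
  by (auto simp: rel_cobd_def rel_cocyc_alt)

definition nonpos_exps :: "nat \<Rightarrow> (nat \<Rightarrow>\<^sub>0 int) set" where
  "nonpos_exps n = {\<alpha>. Poly_Mapping.keys \<alpha> \<subseteq> {1..n} \<and> (\<forall>t. Poly_Mapping.lookup \<alpha> t \<le> 0)}"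

definition nonpos_deg :: "nat \<Rightarrow> int \<Rightarrow> (nat \<Rightarrow>\<^sub>0 int) set" where
  "nonpos_deg n j = {\<alpha> \<in> nonpos_exps n. exp_deg \<alpha> = - j}"

lemma nonpos_deg_neg: "\<alpha> \<in> nonpos_deg n j \<longleftrightarrow> \<alpha> \<in> neg_exps (Poly_Mapping.keys \<alpha>) j \<and> Poly_Mapping.keys \<alpha> \<subseteq> {1..n}"
  by (auto simp: nonpos_deg_def nonpos_exps_def neg_exps_iff in_keys_iff less_le)

lemma keys_minus_unit:
  assumes "\<alpha> \<in> nonpos_exps n"
  shows "Poly_Mapping.keys (\<alpha> - unit_exp t) = insert t (Poly_Mapping.keys \<alpha>)"
proof -
  have "Poly_Mapping.lookup \<alpha> t \<le> 0" using assms by (simp add: nonpos_exps_def)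
  then show ?thesis by (auto simp: in_keys_iff lookup_unit_diff split: if_splits)
qed

lemma nonpos_minus_unit:
  assumes "\<alpha> \<in> nonpos_exps n" "t \<in> {1..n}"
  shows "\<alpha> - unit_exp t \<in> nonpos_exps n"
proof -
  have "Poly_Mapping.keys (\<alpha> - unit_exp t) \<subseteq> {1..n}"
    using assms unfolding keys_minus_unit[OF assms(1)] by (simp add: nonpos_exps_def)
  moreover have "Poly_Mapping.lookup (\<alpha> - unit_exp t) s \<le> 0" for s
  proof -
    have "Poly_Mapping.lookup \<alpha> s \<le> 0" using assms by (simp add: nonpos_exps_def)
    then show ?thesis by (auto simp: lookup_unit_diff)
  qed
  ultimately show ?thesis by (simp add: nonpos_exps_def)
qed

lemma nonpos_deg_minus: "\<alpha> \<in> nonpos_deg n j \<Longrightarrow> t \<in> {1..n} \<Longrightarrow> \<alpha> - unit_exp t \<in> nonpos_deg n (j + 1)"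
  using nonpos_minus_unit by (auto simp: nonpos_deg_def exp_deg_minus)

text \<open>Without positive entries nothing cancels in the degree, so every entry lies between -j
  and 0.\<close>

lemma finite_nonpos_deg: "finite (nonpos_deg n j)"
proof (rule finite_imageD)
  let ?f = "\<lambda>\<alpha> :: nat \<Rightarrow>\<^sub>0 int. restrict (Poly_Mapping.lookup \<alpha>) {1..n}"
  have "Poly_Mapping.lookup \<alpha> t \<ge> - j" if \<alpha>: "\<alpha> \<in> nonpos_deg n j" and t: "t \<in> {1..n}" for \<alpha> t
  proof -
    have n: "- Poly_Mapping.lookup \<alpha> s \<ge> 0" for s using \<alpha> by (simp add: nonpos_deg_def nonpos_exps_def)
    have "exp_deg \<alpha> = (\<Sum>s\<in>{1..n}. Poly_Mapping.lookup \<alpha> s)"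
      unfolding exp_deg_def
      by (rule sum.mono_neutral_left) (use \<alpha> in \<open>auto simp: nonpos_deg_def nonpos_exps_def in_keys_iff\<close>)
    then have "j = (\<Sum>s\<in>{1..n}. - Poly_Mapping.lookup \<alpha> s)" using \<alpha> by (simp add: nonpos_deg_def sum_negf)
    moreover have "- Poly_Mapping.lookup \<alpha> t \<le> (\<Sum>s\<in>{1..n}. - Poly_Mapping.lookup \<alpha> s)"
      using n t by (intro member_le_sum) auto
    ultimately show ?thesis by simp
  qed
  then have "?f ` nonpos_deg n j \<subseteq> PiE {1..n} (\<lambda>_. {- j..0})"
    by (auto simp: nonpos_deg_def nonpos_exps_def)
  then show "finite (?f ` nonpos_deg n j)" by (rule finite_subset) (auto intro: finite_PiE)
  show "inj_on ?f (nonpos_deg n j)"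
  proof (rule inj_onI, rule poly_mapping_eqI)
    fix \<alpha> \<beta> t assume *: "\<alpha> \<in> nonpos_deg n j" "\<beta> \<in> nonpos_deg n j" "?f \<alpha> = ?f \<beta>"
    show "Poly_Mapping.lookup \<alpha> t = Poly_Mapping.lookup \<beta> t"
    proof (cases "t \<in> {1..n}")
      case True
      then show ?thesis using fun_cong[OF *(3), of t] by simp
    next
      case False
      then have "t \<notin> Poly_Mapping.keys \<alpha>" "t \<notin> Poly_Mapping.keys \<beta>"
        using * by (auto simp: nonpos_deg_def nonpos_exps_def)
      then show ?thesis by (simp add: in_keys_iff)
    qed
  qed
qed

lemma form_op_split:
  assumes "N \<subseteq> N'" "finite N'"
  shows "form_op N' b q x \<alpha> = form_op N b q x \<alpha> + form_op (N' - N) b q x \<alpha>"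
  unfolding form_op_def by (rule ext) (simp add: sum.subset_diff[OF assms] add.commute)

lemma form_op_eq_0: "(\<And>t. t \<in> N \<Longrightarrow> x (\<alpha> - unit_exp t) = 0) \<Longrightarrow> form_op N b q x \<alpha> = 0"
  by (rule ext) (simp add: form_op_def)

context generic_forms
begin

abbreviation "SZ N p \<equiv> rel_cocyc \<Delta> N p :: (nat set \<Rightarrow> 'k) set"
abbreviation "SB N p \<equiv> rel_cobd \<Delta> N p :: (nat set \<Rightarrow> 'k) set"
abbreviation "supp \<equiv> Poly_Mapping.keys :: (nat \<Rightarrow>\<^sub>0 int) \<Rightarrow> nat set"
abbreviation "D \<equiv> nonpos_deg n"
abbreviation "op q \<equiv> form_op {1..n} a q"

text \<open>Descending induction on the largest size of supports on which the right-hand sides are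
  nonzero modulo coboundaries. A solution placed on supports of that size does not disturb larger
  ones, since the support of \<alpha> - e_t contains that of \<alpha>; what it adds on smaller
  supports is left to the induction.\<close>

lemma family_solve:
  assumes M: "1 \<le> M" "int M \<le> j"
    and y: "\<And>q \<alpha>. q \<in> {1..M} \<Longrightarrow> \<alpha> \<in> D j \<Longrightarrow> y q \<alpha> \<in> SZ (supp \<alpha>) p"
    and compat: "\<And>q q' \<alpha>. q \<in> {1..M} \<Longrightarrow> q' \<in> {1..M} \<Longrightarrow> \<alpha> \<in> D (j - 1) \<Longrightarrow> op q (y q') \<alpha> - op q' (y q) \<alpha> \<in> SB (supp \<alpha>) p"
  shows "\<exists>x. (\<forall>\<alpha>\<in>D (j + 1). x \<alpha> \<in> SZ (supp \<alpha>) p) \<and> (\<forall>q\<in>{1..M}. \<forall>\<alpha>\<in>D j. op q x \<alpha> - y q \<alpha> \<in> SB (supp \<alpha>) p)"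
proof -
  have "(\<And>q \<alpha>. q \<in> {1..M} \<Longrightarrow> \<alpha> \<in> D j \<Longrightarrow> y q \<alpha> \<in> SZ (supp \<alpha>) p) \<Longrightarrow>
    (\<And>q q' \<alpha>. q \<in> {1..M} \<Longrightarrow> q' \<in> {1..M} \<Longrightarrow> \<alpha> \<in> D (j - 1) \<Longrightarrow> op q (y q') \<alpha> - op q' (y q) \<alpha> \<in> SB (supp \<alpha>) p) \<Longrightarrow>
    (\<And>q \<alpha>. q \<in> {1..M} \<Longrightarrow> \<alpha> \<in> D j \<Longrightarrow> s < card (supp \<alpha>) \<Longrightarrow> y q \<alpha> \<in> SB (supp \<alpha>) p) \<Longrightarrow>
    \<exists>x. (\<forall>\<alpha>\<in>D (j + 1). x \<alpha> \<in> SZ (supp \<alpha>) p) \<and> (\<forall>q\<in>{1..M}. \<forall>\<alpha>\<in>D j. op q x \<alpha> - y q \<alpha> \<in> SB (supp \<alpha>) p)" for s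
  proof (induction s arbitrary: y)
    case 0
    \<comment> \<open>As j \<ge> 1, no exponent of degree -j has empty support: all right-hand sides
      are coboundaries by now, and x = 0 is a solution.\<close>
    have "0 < card (supp \<alpha>)" if "\<alpha> \<in> D j" for \<alpha>
    proof -
      have "supp \<alpha> \<noteq> {}" using that M by (auto simp: nonpos_deg_def exp_deg_def)
      then show ?thesis by (simp add: card_gt_0_iff)
    qed
    then have "y q \<alpha> \<in> SB (supp \<alpha>) p" if "q \<in> {1..M}" "\<alpha> \<in> D j" for q \<alpha>
      using 0(3) that by blast
    then have *: "- y q \<alpha> \<in> SB (supp \<alpha>) p" if "q \<in> {1..M}" "\<alpha> \<in> D j" for q \<alpha>
      using that by (intro submod_uminus[OF subsp_cobd])
    show ?case
    proof (intro exI[of _ "\<lambda>_. 0"] conjI ballI)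
      show "0 \<in> SZ (supp \<alpha>) p" for \<alpha> by (rule submod_0[OF subsp_cocyc])
      fix q \<alpha> assume q: "q \<in> {1..M}" "\<alpha> \<in> D j"
      have e: "op q (\<lambda>_. 0) \<alpha> = 0" by (rule form_op_eq_0) simp
      show "op q (\<lambda>_. 0) \<alpha> - y q \<alpha> \<in> SB (supp \<alpha>) p" unfolding e diff_0 by (rule *[OF q])
    qed
  next
    case (Suc s)
    have "\<exists>x. (\<forall>\<alpha>\<in>neg_exps N (j + 1). x \<alpha> \<in> SZ N p) \<and>
        (\<forall>q\<in>{1..M}. \<forall>\<alpha>\<in>neg_exps N j. form_op N a q x \<alpha> - y q \<alpha> \<in> SB N p)"
      if N: "N \<in> \<Delta>" "card N = Suc s" for N
    proof (rule local_solve[OF subsp_cocyc subsp_cobd, of "{1..M}" N "{1..min M (card N)}"])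
      have Nn: "N \<subseteq> {1..n}" using N faces_sub by auto
      then show "finite N" using finite_subset by blast
      show "col_indep a N {1..min M (card N)}"
        by (rule col_indep_subset[OF indep[OF N(1)]]) auto
      have D: "\<alpha> \<in> D i" "supp \<alpha> = N" if "\<alpha> \<in> neg_exps N i" for \<alpha> i
        using that Nn unfolding nonpos_deg_neg by (auto simp: neg_exps_def)
      show "y q \<alpha> \<in> SZ N p" if "q \<in> {1..M}" "\<alpha> \<in> neg_exps N j" for q \<alpha>
        using Suc.prems(1)[OF that(1) D(1)[OF that(2)]] D(2)[OF that(2)] by simp
      fix q q' \<alpha> assume q: "q \<in> {1..M}" "q' \<in> {1..M}" and \<alpha>: "\<alpha> \<in> neg_exps N (j - 1)"
      \<comment> \<open>Variables outside N lead to supports larger than N, where the right-hand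
        sides are coboundaries by hypothesis. So compatibility holds with the variables of N
        alone.\<close>
      have rest: "form_op ({1..n} - N) a q (y q') \<alpha> \<in> SB N p" if q': "q' \<in> {1..M}" for q q'
      proof (rule form_op_mem[OF subsp_cobd])
        fix t assume t: "t \<in> {1..n} - N"
        have k: "supp (\<alpha> - unit_exp t) = insert t N"
          using keys_minus_unit[of \<alpha> n t] D[OF \<alpha>] by (simp add: nonpos_deg_def)
        have "\<alpha> - unit_exp t \<in> D j" using nonpos_deg_minus[OF D(1)[OF \<alpha>], of t] t by simp
        moreover have "Suc s < card (insert t N)" using N t \<open>finite N\<close> by simp
        ultimately have "y q' (\<alpha> - unit_exp t) \<in> SB (insert t N) p"
          using Suc.prems(3)[OF q', of "\<alpha> - unit_exp t"] k by simp
        then show "y q' (\<alpha> - unit_exp t) \<in> SB N p" using rel_cobd_antimono[of N "insert t N"] by blast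
      qed
      have "op q (y q') \<alpha> - op q' (y q) \<alpha> \<in> SB N p"
        using Suc.prems(2)[OF q D(1)[OF \<alpha>]] unfolding D(2)[OF \<alpha>] .
      from submod_diff[OF subsp_cobd this submod_diff[OF subsp_cobd rest[OF q(2), of q] rest[OF q(1), of q']]]
      have "op q (y q') \<alpha> - op q' (y q) \<alpha> -
        (form_op ({1..n} - N) a q (y q') \<alpha> - form_op ({1..n} - N) a q' (y q) \<alpha>) \<in> SB N p" .
      also have "op q (y q') \<alpha> - op q' (y q) \<alpha> -
        (form_op ({1..n} - N) a q (y q') \<alpha> - form_op ({1..n} - N) a q' (y q) \<alpha>) =
        form_op N a q (y q') \<alpha> - form_op N a q' (y q) \<alpha>"
        unfolding form_op_split[OF Nn finite_atLeastAtMost] by (simp only: algebra_simps)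
      finally show "form_op N a q (y q') \<alpha> - form_op N a q' (y q) \<alpha> \<in> SB N p" .
    qed (use M in auto)
    then obtain xf where xf: "\<And>N \<alpha>. N \<in> \<Delta> \<Longrightarrow> card N = Suc s \<Longrightarrow> \<alpha> \<in> neg_exps N (j + 1) \<Longrightarrow> xf N \<alpha> \<in> SZ N p"
      "\<And>N q \<alpha>. N \<in> \<Delta> \<Longrightarrow> card N = Suc s \<Longrightarrow> q \<in> {1..M} \<Longrightarrow> \<alpha> \<in> neg_exps N j \<Longrightarrow> form_op N a q (xf N) \<alpha> - y q \<alpha> \<in> SB N p"
      by metis
    \<comment> \<open>The local solutions are independent of each other, since their supports
      differ. Nonfaces need no solution because they carry no cochains.\<close>
    define x1 where "x1 \<alpha> = (if supp \<alpha> \<in> \<Delta> \<and> card (supp \<alpha>) = Suc s then xf (supp \<alpha>) \<alpha> else 0)" for \<alpha>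
    have x1Z: "x1 \<alpha> \<in> SZ (supp \<alpha>) p" if "\<alpha> \<in> D (j + 1)" for \<alpha>
      using xf(1)[of "supp \<alpha>" \<alpha>] that submod_0[OF subsp_cocyc] by (auto simp: x1_def nonpos_deg_neg)
    define y1 where "y1 q \<alpha> = y q \<alpha> - op q x1 \<alpha>" for q \<alpha>
    have "\<exists>x. (\<forall>\<alpha>\<in>D (j + 1). x \<alpha> \<in> SZ (supp \<alpha>) p) \<and> (\<forall>q\<in>{1..M}. \<forall>\<alpha>\<in>D j. op q x \<alpha> - y1 q \<alpha> \<in> SB (supp \<alpha>) p)"
    proof (rule Suc.IH)
      fix q \<alpha> assume q: "q \<in> {1..M}" and \<alpha>: "\<alpha> \<in> D j"
      have \<alpha>': "\<alpha> \<in> nonpos_exps n" using \<alpha> by (simp add: nonpos_deg_def)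
      have "op q x1 \<alpha> \<in> SZ (supp \<alpha>) p"
      proof (rule form_op_mem[OF subsp_cocyc])
        fix t assume t: "t \<in> {1..n}"
        have "x1 (\<alpha> - unit_exp t) \<in> SZ (insert t (supp \<alpha>)) p"
          using x1Z[OF nonpos_deg_minus[OF \<alpha> t]] keys_minus_unit[OF \<alpha>', of t] by simp
        then show "x1 (\<alpha> - unit_exp t) \<in> SZ (supp \<alpha>) p"
          using rel_cocyc_antimono[of "supp \<alpha>" "insert t (supp \<alpha>)"] by blast
      qed
      then show "y1 q \<alpha> \<in> SZ (supp \<alpha>) p"
        unfolding y1_def using Suc.prems(1)[OF q \<alpha>] by (intro submod_diff[OF subsp_cocyc])
      assume card: "s < card (supp \<alpha>)"
      have far: "x1 (\<alpha> - unit_exp t) = 0" if "t \<in> {1..n} - supp \<alpha>" for t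
        using that card keys_minus_unit[OF \<alpha>', of t] by (simp add: x1_def)
      show "y1 q \<alpha> \<in> SB (supp \<alpha>) p"
      proof (cases "supp \<alpha> \<in> \<Delta> \<and> card (supp \<alpha>) = Suc s")
        case True
        have sub: "supp \<alpha> \<subseteq> {1..n}" using \<alpha>' by (simp add: nonpos_exps_def)
        have "op q x1 \<alpha> = form_op (supp \<alpha>) a q x1 \<alpha> + form_op ({1..n} - supp \<alpha>) a q x1 \<alpha>"
          by (rule form_op_split[OF sub finite_atLeastAtMost])
        also have "form_op ({1..n} - supp \<alpha>) a q x1 \<alpha> = 0" by (rule form_op_eq_0) (rule far)
        also have "form_op (supp \<alpha>) a q x1 \<alpha> = form_op (supp \<alpha>) a q (xf (supp \<alpha>)) \<alpha>"
          by (rule form_op_cong) (use True in \<open>simp add: x1_def keys_minus_unit[OF \<alpha>'] insert_absorb\<close>)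
        finally have e: "y1 q \<alpha> = - (form_op (supp \<alpha>) a q (xf (supp \<alpha>)) \<alpha> - y q \<alpha>)"
          unfolding y1_def by simp
        have "form_op (supp \<alpha>) a q (xf (supp \<alpha>)) \<alpha> - y q \<alpha> \<in> SB (supp \<alpha>) p"
          by (rule xf(2)) (use True q \<alpha> in \<open>auto simp: nonpos_deg_neg\<close>)
        then show ?thesis unfolding e by (rule submod_uminus[OF subsp_cobd])
      next
        case False
        have "op q x1 \<alpha> = 0"
        proof (rule form_op_eq_0)
          fix t assume t: "t \<in> {1..n}"
          show "x1 (\<alpha> - unit_exp t) = 0"
          proof (cases "t \<in> supp \<alpha>")
            case True
            then have "supp (\<alpha> - unit_exp t) = supp \<alpha>" using keys_minus_unit[OF \<alpha>', of t] by auto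
            then show ?thesis using False by (auto simp: x1_def)
          qed (use far t in auto)
        qed
        then have e: "y1 q \<alpha> = y q \<alpha>" by (simp add: y1_def)
        show ?thesis
        proof (cases "supp \<alpha> \<in> \<Delta>")
          case True
          then have "Suc s < card (supp \<alpha>)" using False card by auto
          then show ?thesis unfolding e by (rule Suc.prems(3)[OF q \<alpha>])
        next
          case nf: False
          have "y q \<alpha> \<in> rel_chains \<Delta> (supp \<alpha>) p" using Suc.prems(1)[OF q \<alpha>] by (simp add: rel_cocyc_alt)
          then have "y q \<alpha> = 0" by (rule rel_chains_nonface[OF closed nf])
          then show ?thesis unfolding e using submod_0[OF subsp_cobd] by metis
        qed
      qed
    next
      fix q q' \<alpha> assume q: "q \<in> {1..M}" "q' \<in> {1..M}" "\<alpha> \<in> D (j - 1)"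
      have "op q (y1 q') \<alpha> = op q (y q') \<alpha> - op q (op q' x1) \<alpha>" for q q'
        unfolding y1_def[abs_def] by (rule form_op_diff)
      then have "op q (y1 q') \<alpha> - op q' (y1 q) \<alpha> = op q (y q') \<alpha> - op q' (y q) \<alpha>"
        using form_op_commute[of "{1..n}" a q "{1..n}" a q' x1 \<alpha>] by (simp only:) simp
      then show "op q (y1 q') \<alpha> - op q' (y1 q) \<alpha> \<in> SB (supp \<alpha>) p" using Suc.prems(2)[OF q] by (simp only:)
    qed
    then obtain x2 where x2: "\<And>\<alpha>. \<alpha> \<in> D (j + 1) \<Longrightarrow> x2 \<alpha> \<in> SZ (supp \<alpha>) p"
      "\<And>q \<alpha>. q \<in> {1..M} \<Longrightarrow> \<alpha> \<in> D j \<Longrightarrow> op q x2 \<alpha> - y1 q \<alpha> \<in> SB (supp \<alpha>) p" by blast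
    show ?case
    proof (intro exI[of _ "\<lambda>\<alpha>. x1 \<alpha> + x2 \<alpha>"] conjI ballI)
      show "x1 \<alpha> + x2 \<alpha> \<in> SZ (supp \<alpha>) p" if "\<alpha> \<in> D (j + 1)" for \<alpha>
        using that by (intro submod_add[OF subsp_cocyc] x1Z x2(1))
      fix q \<alpha> assume q: "q \<in> {1..M}" "\<alpha> \<in> D j"
      have "op q (\<lambda>\<alpha>. x1 \<alpha> + x2 \<alpha>) \<alpha> - y q \<alpha> = op q x2 \<alpha> - y1 q \<alpha>"
        unfolding form_op_add y1_def by (simp only: algebra_simps)
      then show "op q (\<lambda>\<alpha>. x1 \<alpha> + x2 \<alpha>) \<alpha> - y q \<alpha> \<in> SB (supp \<alpha>) p" using x2(2)[OF q] by (simp only:)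
    qed
  qed
  \<comment> \<open>No support has more than n elements, so the hypothesis of the induction is
    vacuous at this point.\<close>
  note * = this[of n]
  show ?thesis
  proof (rule *)
    fix q \<alpha> assume "q \<in> {1..M}" "\<alpha> \<in> D j" "n < card (supp \<alpha>)"
    moreover from this have "card (supp \<alpha>) \<le> card {1..n}"
      by (intro card_mono) (auto simp: nonpos_deg_def nonpos_exps_def)
    ultimately show "y q \<alpha> \<in> SB (supp \<alpha>) p" by simp
  qed (fact y compat)+
qed

end

section \<open>Cone contraction, and coboundaries detected in fine degrees\<close>

lemma lookup_sgn: "Poly_Mapping.lookup (sgn_in G t * f) \<alpha> = sgn_in G t * Poly_Mapping.lookup (f :: 'k::field laurent) \<alpha>"
  by (cases "even (card {s \<in> G. s < t})") (simp_all add: sgn_in_def)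

lemma lookup_cdiff: "Poly_Mapping.lookup (cdiff X u G) \<alpha> = cdiff X (\<lambda>F. Poly_Mapping.lookup (u F :: 'k::field laurent) \<alpha>) G"
  by (simp add: cdiff_def lookup_sum lookup_sgn)

definition cone_op :: "nat \<Rightarrow> (nat set \<Rightarrow> 'r::comm_ring_1) \<Rightarrow> nat set \<Rightarrow> 'r" where
  "cone_op t c F = (if t \<in> F then 0 else sgn_in (insert t F) t * c (insert t F))"

text \<open>The contraction of a cone with apex t. For t outside F the mixed terms cancel in pairs,
  by the sign change on exchanging t with another vertex.\<close>

lemma cone_op_homotopy:
  assumes X: "subset_closed X" and F: "F \<in> X" "insert t F \<in> X"
  shows "cdiff X (cone_op t c) F + cone_op t (cdiff X c) F = c F"
proof -
  have fin: "finite F" using X F by (auto simp: subset_closed_def)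
  show ?thesis
  proof (cases "t \<in> F")
    case True
    have "cdiff X (cone_op t c) F = (\<Sum>s\<in>F. if s = t then c F else 0)"
      using F True by (simp add: cdiff_def cone_op_def insert_absorb cong: sum.cong) (auto intro!: sum.cong simp: insert_absorb)
    also have "\<dots> = c F" using True fin by simp
    finally show ?thesis using True by (simp add: cone_op_def)
  next
    case False
    let ?G = "insert t F"
    have "cone_op t (cdiff X c) F = sgn_in ?G t * (\<Sum>s\<in>?G. sgn_in ?G s * c (?G - {s}))"
      using F False by (simp add: cone_op_def cdiff_def)
    also have "\<dots> = sgn_in ?G t * (sgn_in ?G t * c F) + (\<Sum>s\<in>F. sgn_in ?G t * (sgn_in ?G s * c (?G - {s})))"
      using fin False by (simp add: distrib_left sum_distrib_left)
    finally have 1: "cone_op t (cdiff X c) F = c F + (\<Sum>s\<in>F. sgn_in ?G t * (sgn_in ?G s * c (?G - {s})))" by simp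
    have "cdiff X (cone_op t c) F = (\<Sum>s\<in>F. sgn_in F s * (sgn_in (?G - {s}) t * c (?G - {s})))"
    proof -
      have "insert t (F - {s}) = ?G - {s}" if "s \<in> F" for s using that False by auto
      then show ?thesis using F False by (simp add: cdiff_def cone_op_def cong: sum.cong)
    qed
    also have "\<dots> = (\<Sum>s\<in>F. - (sgn_in ?G t * (sgn_in ?G s * c (?G - {s}))))"
    proof (intro sum.cong refl)
      fix s assume s: "s \<in> F"
      have "sgn_in ?G s * sgn_in (?G - {s}) t = - (sgn_in ?G t * sgn_in (?G - {t}) s :: 'a)"
        using s fin False by (intro sgn_in_swap) auto
      moreover have "?G - {t} = F" using False by auto
      ultimately have "sgn_in ?G s * sgn_in (?G - {s}) t = - (sgn_in ?G t * sgn_in F s :: 'a)" by simp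
      then have "sgn_in ?G t * sgn_in ?G s * (sgn_in ?G s * sgn_in (?G - {s}) t) * sgn_in F s =
          sgn_in ?G t * sgn_in ?G s * - (sgn_in ?G t * sgn_in F s :: 'a) * sgn_in F s" by simp
      then have "sgn_in F s * sgn_in (?G - {s}) t * sgn_in ?G t = - (sgn_in ?G s :: 'a)"
        by (simp add: ac_simps)
      then have "sgn_in F s * sgn_in (?G - {s}) t * sgn_in ?G t * sgn_in ?G t = - (sgn_in ?G s * sgn_in ?G t :: 'a)"
        by simp
      then have "sgn_in F s * sgn_in (?G - {s}) t = - (sgn_in ?G t * sgn_in ?G s :: 'a)"
        by (simp add: ac_simps)
      then show "sgn_in F s * (sgn_in (?G - {s}) t * c (?G - {s})) = - (sgn_in ?G t * (sgn_in ?G s * c (?G - {s})))"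
        by (simp flip: mult.assoc)
    qed
    finally show ?thesis using 1 by (simp add: sum_negf)
  qed
qed

context generic_forms
begin

abbreviation "X \<equiv> Pow {1..n}"

text \<open>The component in fine degree \<alpha>. Entries at nonfaces are dropped since they are
  zero modulo \<open>J 0\<close>; for \<alpha> \<le> 0 nothing else is, because the support of
  \<alpha> lies in F.\<close>

definition fam :: "(nat set \<Rightarrow> 'k laurent) \<Rightarrow> (nat \<Rightarrow>\<^sub>0 int) \<Rightarrow> nat set \<Rightarrow> 'k" where
  "fam u \<alpha> = (\<lambda>F. if F \<in> \<Delta> then Poly_Mapping.lookup (u F) \<alpha> else 0)"

lemma C_iff:
  "u \<in> C p \<longleftrightarrow> (\<forall>F \<alpha>. Poly_Mapping.lookup (u F) \<alpha> \<noteq> 0 \<longrightarrow> F \<in> subsets_of_card n p \<and> supp \<alpha> \<subseteq> {1..n} \<and>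
     (\<forall>t. Poly_Mapping.lookup \<alpha> t < 0 \<longrightarrow> t \<in> F))"
proof -
  have 0: "u F = 0 \<longleftrightarrow> (\<forall>\<alpha>. Poly_Mapping.lookup (u F) \<alpha> = 0)" for F
    by (auto intro: poly_mapping_eqI)
  have 1: "u F \<in> L F \<longleftrightarrow> (\<forall>\<alpha>. Poly_Mapping.lookup (u F) \<alpha> \<noteq> 0 \<longrightarrow> supp \<alpha> \<subseteq> {1..n} \<and>
      (\<forall>t. Poly_Mapping.lookup \<alpha> t < 0 \<longrightarrow> t \<in> F))" if "F \<in> subsets_of_card n p" for F
    unfolding Lpoly_iff[OF subsets_of_cardD(1)[OF that]] Ball_def in_keys_iff[of _ "u F"] by blast
  show ?thesis unfolding cochains_def using 0 1 by blast
qed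

lemma CJ0_iff:
  "u \<in> CJ 0 p \<longleftrightarrow> u \<in> C p \<and> (\<forall>F \<alpha>. Poly_Mapping.lookup (u F) \<alpha> \<noteq> 0 \<longrightarrow> F \<union> supp \<alpha> \<notin> \<Delta>)"
proof -
  have 0: "u F = 0 \<Longrightarrow> Poly_Mapping.lookup (u F) \<alpha> = 0" for F \<alpha> by simp
  have 1: "u F \<in> J 0 F \<longleftrightarrow> u F \<in> L F \<and> (\<forall>\<alpha>. Poly_Mapping.lookup (u F) \<alpha> \<noteq> 0 \<longrightarrow> F \<union> supp \<alpha> \<notin> \<Delta>)"
    if "F \<in> subsets_of_card n p" for F
    unfolding J_0 loc_nonface_iff[OF closed subsets_of_cardD(1)[OF that]] Lpoly_iff[OF subsets_of_cardD(1)[OF that]] Ball_def in_keys_iff[of _ "u F"] by blast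
  show ?thesis unfolding cochains_def using 0 1 by blast
qed

lemma nonpos_supp:
  assumes "u \<in> C p" "\<alpha> \<in> nonpos_exps n" "Poly_Mapping.lookup (u F) \<alpha> \<noteq> 0"
  shows "supp \<alpha> \<subseteq> F" "F \<in> subsets_of_card n p"
proof -
  have "t \<in> F" if "t \<in> supp \<alpha>" for t
  proof -
    have "Poly_Mapping.lookup \<alpha> t < 0" using assms(2) that by (auto simp: nonpos_exps_def in_keys_iff less_le)
    then show ?thesis using assms by (simp add: C_iff)
  qed
  then show "supp \<alpha> \<subseteq> F" "F \<in> subsets_of_card n p" using assms by (auto simp: C_iff)
qed

lemma fam_chains: "u \<in> C p \<Longrightarrow> \<alpha> \<in> nonpos_exps n \<Longrightarrow> fam u \<alpha> \<in> rel_chains \<Delta> (supp \<alpha>) p"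
  using nonpos_supp[of u p \<alpha>] by (auto simp: rel_chains_def fam_def subsets_of_card_def)

lemma fam_diff: "fam (u - v) \<alpha> = fam u \<alpha> - fam v \<alpha>"
  by (simp add: fam_def fun_eq_iff lookup_minus)

lemma fam_cdiff: "fam (\<delta> u) \<alpha> = cdiff \<Delta> (fam u \<alpha>)"
proof (rule ext)
  fix G
  show "fam (\<delta> u) \<alpha> G = cdiff \<Delta> (fam u \<alpha>) G"
  proof (cases "G \<in> \<Delta>")
    case True
    then have "G \<in> X" "G - {t} \<in> \<Delta>" for t using faces_sub closed by (auto simp: subset_closed_def)
    then show ?thesis using True by (simp add: fam_def lookup_cdiff) (simp add: cdiff_def fam_def)
  qed (simp add: fam_def cdiff_def)
qed

lemma fam_CJ: "u \<in> CJ 0 p \<Longrightarrow> \<alpha> \<in> nonpos_exps n \<Longrightarrow> fam u \<alpha> = 0"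
proof (rule ext)
  fix F assume u: "u \<in> CJ 0 p" and \<alpha>: "\<alpha> \<in> nonpos_exps n"
  have uC: "u \<in> C p" using u by (simp add: CJ0_iff)
  show "fam u \<alpha> F = 0 F"
  proof (rule ccontr)
    assume "fam u \<alpha> F \<noteq> 0 F"
    then have nz: "Poly_Mapping.lookup (u F) \<alpha> \<noteq> 0" "F \<in> \<Delta>" by (auto simp: fam_def split: if_splits)
    then have "F \<union> supp \<alpha> = F" using nonpos_supp(1)[OF uC \<alpha> nz(1)] by auto
    then have "F \<union> supp \<alpha> \<in> \<Delta>" using nz(2) by metis
    then show False using u nz(1) unfolding CJ0_iff by blast
  qed
qed

lemma fam_Z: "u \<in> Z 0 p \<Longrightarrow> \<alpha> \<in> nonpos_exps n \<Longrightarrow> fam u \<alpha> \<in> SZ (supp \<alpha>) p"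
  using fam_chains[of u p \<alpha>] fam_CJ[of "\<delta> u" "p + 1" \<alpha>] by (simp add: rel_cocyc_alt cech_cocycles_def fam_cdiff)

lemma fam_B:
  assumes "u \<in> B 0 p" "\<alpha> \<in> nonpos_exps n"
  shows "fam u \<alpha> \<in> SB (supp \<alpha>) p"
proof -
  obtain v where v: "v \<in> C (p - 1)" "u - \<delta> v \<in> CJ 0 p" using assms by (auto simp: cech_coboundaries_def)
  have "fam u \<alpha> - cdiff \<Delta> (fam v \<alpha>) = 0"
    using fam_CJ[OF v(2) assms(2)] unfolding fam_diff fam_cdiff .
  then have "fam u \<alpha> = cdiff \<Delta> (fam v \<alpha>)" by (simp only: right_minus_eq)
  then show ?thesis unfolding rel_cobd_def using fam_chains[OF v(1) assms(2)] by blast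
qed

lemma fam_tact: "fam (tact q u) \<alpha> = op q (fam u) \<alpha>"
  by (rule ext) (simp add: fam_def tact_def form_op_def lookup_linear_form_mult)

definition realize :: "(nat \<Rightarrow>\<^sub>0 int) set \<Rightarrow> ((nat \<Rightarrow>\<^sub>0 int) \<Rightarrow> nat set \<Rightarrow> 'k) \<Rightarrow> nat set \<Rightarrow> 'k laurent" where
  "realize A x F = (\<Sum>\<alpha>\<in>A. Poly_Mapping.single \<alpha> (x \<alpha> F))"

lemma lookup_realize: "finite A \<Longrightarrow> Poly_Mapping.lookup (realize A x F) \<alpha> = (if \<alpha> \<in> A then x \<alpha> F else 0)"
  by (simp add: realize_def lookup_sum lookup_single when_def)

lemma realize_C:
  assumes A: "finite A" "A \<subseteq> nonpos_exps n" and x: "\<And>\<alpha>. \<alpha> \<in> A \<Longrightarrow> x \<alpha> \<in> rel_chains \<Delta> (supp \<alpha>) p"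
  shows "realize A x \<in> C p"
  unfolding C_iff
proof (intro allI impI)
  fix F \<alpha> assume "Poly_Mapping.lookup (realize A x F) \<alpha> \<noteq> 0"
  then have nz: "\<alpha> \<in> A" "x \<alpha> F \<noteq> 0" using A by (auto simp: lookup_realize split: if_splits)
  then have F: "F \<in> \<Delta>" "supp \<alpha> \<subseteq> F" "int (card F) = p" using x[OF nz(1)] by (auto simp: rel_chains_def)
  have "t \<in> F" if "Poly_Mapping.lookup \<alpha> t < 0" for t
    using that F(2) by (auto simp: in_keys_iff subset_iff)
  then show "F \<in> subsets_of_card n p \<and> supp \<alpha> \<subseteq> {1..n} \<and> (\<forall>t. Poly_Mapping.lookup \<alpha> t < 0 \<longrightarrow> t \<in> F)"
    using F faces_sub by (auto simp: subsets_of_card_def)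
qed

lemma fam_realize:
  assumes "finite A" "\<alpha> \<in> A" "x \<alpha> \<in> rel_chains \<Delta> N p"
  shows "fam (realize A x) \<alpha> = x \<alpha>"
  using assms by (auto simp: fam_def lookup_realize fun_eq_iff rel_chains_def)

lemma lookup_delta_realize:
  assumes A: "finite A" and F: "F \<in> X" "F \<in> \<Delta>"
  shows "Poly_Mapping.lookup (\<delta> (realize A x) F) \<alpha> = (if \<alpha> \<in> A then cdiff \<Delta> (x \<alpha>) F else 0)"
  unfolding lookup_cdiff lookup_realize[OF A] using F by (simp add: cdiff_def)

text \<open>The differential of a realized family can be nonzero at nonfaces only, where its values
  belong to \<open>J 0\<close>.\<close>

lemma realize_Z:
  assumes A: "finite A" "A \<subseteq> nonpos_exps n" and x: "\<And>\<alpha>. \<alpha> \<in> A \<Longrightarrow> x \<alpha> \<in> SZ (supp \<alpha>) p"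
  shows "realize A x \<in> Z 0 p"
proof -
  have C: "realize A x \<in> C p" using x by (intro realize_C[OF A]) (simp add: rel_cocyc_alt)
  have "F \<union> supp \<alpha> \<notin> \<Delta>" if nz: "Poly_Mapping.lookup (\<delta> (realize A x) F) \<alpha> \<noteq> 0" for F \<alpha>
  proof
    assume "F \<union> supp \<alpha> \<in> \<Delta>"
    then have F: "F \<in> \<Delta>" using closed by (auto simp: subset_closed_def)
    then have "Poly_Mapping.lookup (\<delta> (realize A x) F) \<alpha> = (if \<alpha> \<in> A then cdiff \<Delta> (x \<alpha>) F else 0)"
      using faces_sub by (intro lookup_delta_realize A) auto
    also have "\<dots> = 0" using x[of \<alpha>] by (simp add: rel_cocyc_alt)
    finally show False using nz by simp
  qed
  then have "\<delta> (realize A x) \<in> CJ 0 (p + 1)"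
    unfolding CJ0_iff using cdiff_cochains[OF good_L C] by blast
  then show ?thesis using C by (simp add: cech_cocycles_def)
qed

text \<open>Contracts the parts of a cochain whose exponent is somewhere positive, by a cone over the
  first such variable.\<close>

definition first_pos :: "nat \<Rightarrow> (nat \<Rightarrow>\<^sub>0 int) \<Rightarrow> bool" where
  "first_pos t \<alpha> \<longleftrightarrow> Poly_Mapping.lookup \<alpha> t > 0 \<and> (\<forall>s<t. Poly_Mapping.lookup \<alpha> s \<le> 0)"

definition cone :: "(nat set \<Rightarrow> 'k laurent) \<Rightarrow> nat set \<Rightarrow> 'k laurent" where
  "cone u F = (\<Sum>t\<in>{1..n} - F. sgn_in (insert t F) t * restr (first_pos t) (u (insert t F)))"

lemma first_pos_unique: "first_pos t \<alpha> \<Longrightarrow> first_pos s \<alpha> \<Longrightarrow> s = t"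
  unfolding first_pos_def by (metis linorder_neqE_nat not_less)

lemma lookup_cone:
  assumes "first_pos t \<alpha>" "t \<in> {1..n}"
  shows "Poly_Mapping.lookup (cone u F) \<alpha> = cone_op t (\<lambda>F. Poly_Mapping.lookup (u F) \<alpha>) F"
proof -
  have iff: "first_pos s \<alpha> \<longleftrightarrow> s = t" for s using assms(1) first_pos_unique by blast
  have "Poly_Mapping.lookup (cone u F) \<alpha> =
      (\<Sum>s\<in>{1..n} - F. if s = t then sgn_in (insert t F) t * Poly_Mapping.lookup (u (insert t F)) \<alpha> else 0)"
    unfolding cone_def lookup_sum lookup_sgn lookup_restr
    by (rule sum.cong) (simp_all add: iff)
  then show ?thesis using assms(2) by (simp add: cone_op_def)
qed

lemma lookup_cone_nonpos: "(\<And>t. t \<in> {1..n} \<Longrightarrow> \<not> first_pos t \<alpha>) \<Longrightarrow> Poly_Mapping.lookup (cone u F) \<alpha> = 0"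
  unfolding cone_def lookup_sum lookup_sgn lookup_restr by simp

lemma cone_nonzero:
  assumes "Poly_Mapping.lookup (cone u F) \<alpha> \<noteq> 0"
  obtains t where "first_pos t \<alpha>" "t \<in> {1..n}" "t \<notin> F" "Poly_Mapping.lookup (u (insert t F)) \<alpha> \<noteq> 0"
proof -
  obtain t where t: "t \<in> {1..n}" "first_pos t \<alpha>" using assms lookup_cone_nonpos by blast
  then have "cone_op t (\<lambda>F. Poly_Mapping.lookup (u F) \<alpha>) F \<noteq> 0" using assms lookup_cone by simp
  then show ?thesis using that t by (auto simp: cone_op_def split: if_splits)
qed

lemma cone_C:
  assumes u: "u \<in> C p"
  shows "cone u \<in> C (p - 1)"
  unfolding C_iff
proof (intro allI impI)
  fix F \<alpha> assume "Poly_Mapping.lookup (cone u F) \<alpha> \<noteq> 0"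
  then obtain t where t: "first_pos t \<alpha>" "t \<in> {1..n}" "t \<notin> F" "Poly_Mapping.lookup (u (insert t F)) \<alpha> \<noteq> 0"
    by (rule cone_nonzero)
  then have *: "insert t F \<in> subsets_of_card n p" "supp \<alpha> \<subseteq> {1..n}"
    "\<forall>s. Poly_Mapping.lookup \<alpha> s < 0 \<longrightarrow> s \<in> insert t F" using u unfolding C_iff by blast+
  have "insert t F - {t} = F" using t by auto
  then have "F \<in> subsets_of_card n (p - 1)"
    using subsets_of_card_remove[of "insert t F" n t "p - 1"] * subsets_of_cardD(1)[OF *(1)] by simp
  moreover have "\<not> Poly_Mapping.lookup \<alpha> t < 0" using t(1) by (simp add: first_pos_def)
  ultimately show "F \<in> subsets_of_card n (p - 1) \<and> supp \<alpha> \<subseteq> {1..n} \<and> (\<forall>t. Poly_Mapping.lookup \<alpha> t < 0 \<longrightarrow> t \<in> F)"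
    using * by (metis insertE)
qed

lemma cone_CJ:
  assumes u: "u \<in> CJ 0 p"
  shows "cone u \<in> CJ 0 (p - 1)"
  unfolding CJ0_iff
proof (intro conjI allI impI)
  show "cone u \<in> C (p - 1)" using u by (intro cone_C) (simp add: CJ0_iff)
  fix F \<alpha> assume "Poly_Mapping.lookup (cone u F) \<alpha> \<noteq> 0"
  then obtain t where t: "first_pos t \<alpha>" "t \<in> {1..n}" "t \<notin> F" "Poly_Mapping.lookup (u (insert t F)) \<alpha> \<noteq> 0"
    by (rule cone_nonzero)
  then have "insert t F \<union> supp \<alpha> \<notin> \<Delta>" using u unfolding CJ0_iff by blast
  moreover have "t \<in> supp \<alpha>" using t(1) by (simp add: first_pos_def in_keys_iff)
  ultimately show "F \<union> supp \<alpha> \<notin> \<Delta>" by (simp add: insert_absorb)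
qed

lemma ex_first_pos:
  assumes "\<alpha> \<notin> nonpos_exps n" "supp \<alpha> \<subseteq> {1..n}"
  shows "\<exists>t\<in>{1..n}. first_pos t \<alpha>"
proof -
  have ex: "\<exists>t. Poly_Mapping.lookup \<alpha> t > 0" using assms by (auto simp: nonpos_exps_def not_le)
  define t where "t = (LEAST t. Poly_Mapping.lookup \<alpha> t > 0)"
  have "Poly_Mapping.lookup \<alpha> t > 0" unfolding t_def by (rule LeastI_ex[OF ex])
  moreover have "Poly_Mapping.lookup \<alpha> s \<le> 0" if "s < t" for s
    using not_less_Least[of s "\<lambda>t. Poly_Mapping.lookup \<alpha> t > 0"] that by (auto simp: t_def)
  ultimately have "first_pos t \<alpha>" "t \<in> supp \<alpha>" by (auto simp: first_pos_def in_keys_iff)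
  then show ?thesis using assms(2) by blast
qed

text \<open>For \<alpha> \<le> 0 the bounding cochains of the components are put together. In all
  other degrees \<open>cone u\<close> bounds u up to the cone of \<open>\<delta> u\<close>, and the
  cone preserves values in \<open>J 0\<close>.\<close>

lemma B_fine:
  assumes u: "u \<in> Z 0 p" and fam: "\<And>\<alpha>. \<alpha> \<in> nonpos_exps n \<Longrightarrow> fam u \<alpha> \<in> SB (supp \<alpha>) p"
  shows "u \<in> B 0 p"
proof -
  have uC: "u \<in> C p" and du: "\<delta> u \<in> CJ 0 (p + 1)" using u by (auto simp: cech_cocycles_def)
  have "\<exists>v. v \<in> rel_chains \<Delta> (supp \<alpha>) (p - 1) \<and> fam u \<alpha> = cdiff \<Delta> v" if "\<alpha> \<in> nonpos_exps n" for \<alpha>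
    using fam[OF that] by (auto simp: rel_cobd_def)
  then obtain v where v: "\<And>\<alpha>. \<alpha> \<in> nonpos_exps n \<Longrightarrow> v \<alpha> \<in> rel_chains \<Delta> (supp \<alpha>) (p - 1) \<and> fam u \<alpha> = cdiff \<Delta> (v \<alpha>)"
    by metis
  \<comment> \<open>Restricted to the exponents occurring in u, so that finitely many components
    make up each Laurent polynomial.\<close>
  define A where "A = nonpos_exps n \<inter> (\<Union>F\<in>X. Poly_Mapping.keys (u F))"
  have A: "finite A" "A \<subseteq> nonpos_exps n" by (auto simp: A_def)
  let ?w = "realize A v + cone u"
  have wC: "?w \<in> C (p - 1)"
    by (intro submod_add[OF sub_C] realize_C[OF A] cone_C[OF uC]) (use v A in blast)
  have dC: "u - \<delta> ?w \<in> C p" using cdiff_cochains[OF good_L wC] uC by (intro submod_diff[OF sub_C]) auto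
  have "F \<union> supp \<alpha> \<notin> \<Delta>" if nz: "Poly_Mapping.lookup ((u - \<delta> ?w) F) \<alpha> \<noteq> 0" for F \<alpha>
  proof
    assume face: "F \<union> supp \<alpha> \<in> \<Delta>"
    then have F: "F \<in> \<Delta>" using closed by (auto simp: subset_closed_def)
    have FX: "F \<in> X" using F faces_sub by auto
    have s: "supp \<alpha> \<subseteq> {1..n}" using dC nz unfolding C_iff by blast
    have split: "Poly_Mapping.lookup ((u - \<delta> ?w) F) \<alpha> = Poly_Mapping.lookup (u F) \<alpha> -
        Poly_Mapping.lookup (\<delta> (realize A v) F) \<alpha> - cdiff X (\<lambda>F. Poly_Mapping.lookup (cone u F) \<alpha>) F"
      by (simp add: cdiff_add lookup_minus lookup_add lookup_cdiff)
    have re: "Poly_Mapping.lookup (\<delta> (realize A v) F) \<alpha> = (if \<alpha> \<in> A then cdiff \<Delta> (v \<alpha>) F else 0)"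
      by (rule lookup_delta_realize[OF A(1) FX F])
    show False
    proof (cases "\<alpha> \<in> nonpos_exps n")
      case True
      have "\<not> first_pos t \<alpha>" for t
      proof -
        have "Poly_Mapping.lookup \<alpha> t \<le> 0" using True by (simp add: nonpos_exps_def)
        then show ?thesis by (simp add: first_pos_def)
      qed
      then have "Poly_Mapping.lookup (cone u F') \<alpha> = 0" for F' by (intro lookup_cone_nonpos)
      then have "cdiff X (\<lambda>F. Poly_Mapping.lookup (cone u F) \<alpha>) F = 0" by (simp add: cdiff_def)
      moreover have "Poly_Mapping.lookup (u F) \<alpha> = (if \<alpha> \<in> A then cdiff \<Delta> (v \<alpha>) F else 0)"
      proof (cases "\<alpha> \<in> A")
        case in_A: True
        have "Poly_Mapping.lookup (u F) \<alpha> = fam u \<alpha> F" using F by (simp add: fam_def)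
        also have "fam u \<alpha> = cdiff \<Delta> (v \<alpha>)" using v[OF True] by blast
        finally show ?thesis using in_A by simp
      next
        case False
        then have "\<alpha> \<notin> Poly_Mapping.keys (u F)" using True FX by (auto simp: A_def)
        then show ?thesis using False by (simp add: in_keys_iff)
      qed
      ultimately show False using nz unfolding split re by simp
    next
      case False
      obtain t where t: "t \<in> {1..n}" "first_pos t \<alpha>" using ex_first_pos[OF False s] by blast
      let ?c = "\<lambda>F. Poly_Mapping.lookup (u F) \<alpha>"
      have "(\<lambda>F. Poly_Mapping.lookup (cone u F) \<alpha>) = cone_op t ?c"
        by (rule ext) (rule lookup_cone[OF t(2,1)])
      moreover have "Poly_Mapping.lookup (cone (\<delta> u) F) \<alpha> = cone_op t (cdiff X ?c) F"
        unfolding lookup_cone[OF t(2,1)] by (simp add: lookup_cdiff)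
      moreover have "cdiff X (cone_op t ?c) F + cone_op t (cdiff X ?c) F = ?c F"
        using FX t by (intro cone_op_homotopy[OF subset_closed_Pow]) auto
      moreover have "\<alpha> \<notin> A" using False A by blast
      ultimately have "Poly_Mapping.lookup ((u - \<delta> ?w) F) \<alpha> = Poly_Mapping.lookup (cone (\<delta> u) F) \<alpha>"
        unfolding split re by (simp add: algebra_simps)
      then show False using nz cone_CJ[OF du] face by (auto simp: CJ0_iff)
    qed
  qed
  then have "u - \<delta> ?w \<in> CJ 0 p" unfolding CJ0_iff using dC by blast
  then show ?thesis using uC wC by (intro B_I)
qed

lemma D_nonpos: "\<alpha> \<in> D j \<Longrightarrow> \<alpha> \<in> nonpos_exps n"
  by (simp add: nonpos_deg_def)

lemma fam_off_degree: "hom_deg j u \<Longrightarrow> exp_deg \<alpha> \<noteq> j \<Longrightarrow> fam u \<alpha> = 0"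
  by (rule ext) (metis fam_def hom_deg_def in_keys_iff zero_fun_apply)

lemma B_fine_deg:
  assumes u: "u \<in> Z 0 p" "hom_deg (- j) u" and fam: "\<And>\<alpha>. \<alpha> \<in> D j \<Longrightarrow> fam u \<alpha> \<in> SB (supp \<alpha>) p"
  shows "u \<in> B 0 p"
proof (rule B_fine[OF u(1)])
  fix \<alpha> assume \<alpha>: "\<alpha> \<in> nonpos_exps n"
  show "fam u \<alpha> \<in> SB (supp \<alpha>) p"
  proof (cases "exp_deg \<alpha> = - j")
    case True
    then show ?thesis using fam \<alpha> by (simp add: nonpos_deg_def)
  next
    case False
    then have "fam u \<alpha> = 0" by (rule fam_off_degree[OF u(2)])
    then show ?thesis using submod_0[OF subsp_cobd] by metis
  qed
qed

lemma hom_deg_realize: "A \<subseteq> D j \<Longrightarrow> finite A \<Longrightarrow> hom_deg (- j) (realize A x)"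
  by (auto simp: hom_deg_def in_keys_iff lookup_realize nonpos_deg_def split: if_splits)

text \<open>The right-hand sides are 0 for the first m forms and w for the last; they are compatible
  because theta_q w bounds for q \<le> m. The first m equations put the solution into the common
  kernel. The hypothesis m < i is the condition that the number of equations does not exceed j =
  i.\<close>

lemma theta_surjective:
  assumes m: "int m < i" and w: "w \<in> K m p" "hom_deg (- i) w"
  shows "\<exists>x\<in>K m p. hom_deg (- i - 1) x \<and> tact (Suc m) x - w \<in> B 0 p"
proof -
  have wZ: "w \<in> Z 0 p" and wB: "\<And>q. q \<in> {1..m} \<Longrightarrow> tact q w \<in> B 0 p" using w(1) unfolding K_def by blast+
  define y where "y q = (if q = Suc m then fam w else (\<lambda>_. 0))" for q
  have op0: "op q (\<lambda>_. 0) \<alpha> = 0" for q \<alpha> by (rule form_op_eq_0) simp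
  have "\<exists>x. (\<forall>\<alpha>\<in>D (i + 1). x \<alpha> \<in> SZ (supp \<alpha>) p) \<and>
      (\<forall>q\<in>{1..Suc m}. \<forall>\<alpha>\<in>D i. op q x \<alpha> - y q \<alpha> \<in> SB (supp \<alpha>) p)"
  proof (rule family_solve)
    show "y q \<alpha> \<in> SZ (supp \<alpha>) p" if "\<alpha> \<in> D i" for q \<alpha>
      using fam_Z[OF wZ D_nonpos[OF that]] submod_0[OF subsp_cocyc] by (auto simp: y_def)
    fix q q' \<alpha> assume q: "q \<in> {1..Suc m}" "q' \<in> {1..Suc m}" and \<alpha>: "\<alpha> \<in> D (i - 1)"
    have 1: "op q (fam w) \<alpha> \<in> SB (supp \<alpha>) p" if "q \<in> {1..m}" for q
      using fam_B[OF wB[OF that] D_nonpos[OF \<alpha>]] unfolding fam_tact .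
    consider "q = q'" | "q = Suc m" "q' \<in> {1..m}" | "q' = Suc m" "q \<in> {1..m}" | "q \<in> {1..m}" "q' \<in> {1..m}"
      using q by force
    then show "op q (y q') \<alpha> - op q' (y q) \<alpha> \<in> SB (supp \<alpha>) p"
    proof cases
      case 1
      have "op q (y q') \<alpha> - op q' (y q) \<alpha> = 0" unfolding 1 by (rule right_minus_eq[THEN iffD2]) (rule refl)
      then show ?thesis using submod_0[OF subsp_cobd] by metis
    next
      case 2
      have e: "op q (y q') \<alpha> - op q' (y q) \<alpha> = - op q' (fam w) \<alpha>" using 2 by (simp add: y_def op0)
      show ?thesis unfolding e by (rule submod_uminus[OF subsp_cobd 1[OF 2(2)]])
    next
      case 3
      have e: "op q (y q') \<alpha> - op q' (y q) \<alpha> = op q (fam w) \<alpha>" using 3 by (simp add: y_def op0)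
      show ?thesis unfolding e by (rule 1[OF 3(2)])
    next
      case 4
      have e: "op q (y q') \<alpha> - op q' (y q) \<alpha> = 0" using 4 by (simp add: y_def op0)
      show ?thesis unfolding e by (rule submod_0[OF subsp_cobd])
    qed
  qed (use m in auto)
  then obtain x where x: "\<And>\<alpha>. \<alpha> \<in> D (i + 1) \<Longrightarrow> x \<alpha> \<in> SZ (supp \<alpha>) p"
    "\<And>q \<alpha>. q \<in> {1..Suc m} \<Longrightarrow> \<alpha> \<in> D i \<Longrightarrow> op q x \<alpha> - y q \<alpha> \<in> SB (supp \<alpha>) p" by blast
  let ?x = "realize (D (i + 1)) x"
  have fin: "finite (D (i + 1))" and sub: "D (i + 1) \<subseteq> nonpos_exps n"
    using D_nonpos by (auto intro: finite_nonpos_deg)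
  have xZ: "?x \<in> Z 0 p" by (rule realize_Z[OF fin sub x(1)])
  have xh: "hom_deg (- (i + 1)) ?x" by (rule hom_deg_realize[OF subset_refl fin])
  then have xh': "hom_deg (- i - 1) ?x" by simp
  have famx: "op q (fam ?x) \<alpha> = op q x \<alpha>" if "\<alpha> \<in> D i" for q \<alpha>
  proof (rule form_op_cong)
    fix t assume "t \<in> {1..n}"
    then have \<beta>: "\<alpha> - unit_exp t \<in> D (i + 1)" by (rule nonpos_deg_minus[OF that])
    then have "x (\<alpha> - unit_exp t) \<in> rel_chains \<Delta> (supp (\<alpha> - unit_exp t)) p" using x(1) by (simp add: rel_cocyc_alt)
    then show "fam ?x (\<alpha> - unit_exp t) = x (\<alpha> - unit_exp t)" by (rule fam_realize[OF fin \<beta>])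
  qed
  have "tact q ?x \<in> B 0 p" if q: "q \<in> {1..m}" for q
  proof (rule B_fine_deg[OF tact_Z[OF xZ] hom_deg_tact[OF xh']])
    fix \<alpha> assume \<alpha>: "\<alpha> \<in> D i"
    have "y q \<alpha> = 0" using q by (auto simp: y_def)
    then have "op q x \<alpha> \<in> SB (supp \<alpha>) p" using x(2)[of q \<alpha>] q \<alpha> by (simp del: minus_apply) 
    then show "fam (tact q ?x) \<alpha> \<in> SB (supp \<alpha>) p" unfolding fam_tact famx[OF \<alpha>] .
  qed
  moreover have "tact (Suc m) ?x - w \<in> B 0 p"
  proof (rule B_fine_deg[OF submod_diff[OF sub_Z tact_Z[OF xZ] wZ] hom_deg_diff[OF hom_deg_tact[OF xh'] w(2)]])
    fix \<alpha> assume \<alpha>: "\<alpha> \<in> D i"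
    have "op (Suc m) x \<alpha> - y (Suc m) \<alpha> \<in> SB (supp \<alpha>) p" using \<alpha> by (intro x(2)) auto
    moreover have "y (Suc m) = fam w" by (simp add: y_def)
    ultimately show "fam (tact (Suc m) ?x - w) \<alpha> \<in> SB (supp \<alpha>) p"
      unfolding fam_diff fam_tact famx[OF \<alpha>] by metis
  qed
  ultimately show ?thesis using xZ xh' unfolding K_def by blast
qed

end

section \<open>Linear algebra modulo a subspace\<close>

section \<open>Dimensions of subquotients\<close>

lemma presentsD:
  assumes "presents R act A D \<rho> M"
  shows "action R act" "submod R act A" "submod R act D" "D \<subseteq> A" "carrier M = \<rho> ` A" "\<zero>\<^bsub>M\<^esub> = \<rho> 0"
    and "x \<in> A \<Longrightarrow> y \<in> A \<Longrightarrow> \<rho> (x + y) = \<rho> x \<oplus>\<^bsub>M\<^esub> \<rho> y"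
    and "r \<in> carrier R \<Longrightarrow> x \<in> A \<Longrightarrow> \<rho> (act r x) = r \<odot>\<^bsub>M\<^esub> \<rho> x"
    and "x \<in> A \<Longrightarrow> y \<in> A \<Longrightarrow> \<rho> x = \<rho> y \<longleftrightarrow> x - y \<in> D"
  using assms unfolding presents_def by blast+

definition spans :: "('k::field \<Rightarrow> 'x::ab_group_add \<Rightarrow> 'x) \<Rightarrow> 'x set \<Rightarrow> 'x set \<Rightarrow> 'j set \<Rightarrow> ('j \<Rightarrow> 'x) \<Rightarrow> bool" where
  "spans act A D J b \<longleftrightarrow> finite J \<and> (\<forall>j\<in>J. b j \<in> A) \<and> (\<forall>x\<in>A. \<exists>c. x - (\<Sum>j\<in>J. act (c j) (b j)) \<in> D)"

definition indep_mod :: "('k::field \<Rightarrow> 'x::ab_group_add \<Rightarrow> 'x) \<Rightarrow> 'x set \<Rightarrow> 'j set \<Rightarrow> ('j \<Rightarrow> 'x) \<Rightarrow> bool" where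
  "indep_mod act D J b \<longleftrightarrow> (\<forall>c. (\<Sum>j\<in>J. act (c j) (b j)) \<in> D \<longrightarrow> (\<forall>j\<in>J. c j = 0))"

text \<open>The dimension of A / D expressed by vectors of A, so that it can be moved along
  correspondences of representatives.\<close>

definition hasdim :: "('k::field \<Rightarrow> 'x::ab_group_add \<Rightarrow> 'x) \<Rightarrow> 'x set \<Rightarrow> 'x set \<Rightarrow> nat \<Rightarrow> bool" where
  "hasdim act A D N \<longleftrightarrow> (\<exists>b. spans act A D {..<N} b \<and> indep_mod act D {..<N} b)"

lemma hasdimI:
  assumes s: "spans act A D J b" and i: "indep_mod act D J b"
  shows "hasdim act A D (card J)"
proof -
  have J: "finite J" using s by (simp add: spans_def)
  obtain h where h: "bij_betw h {..<card J} J"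
    using ex_bij_betw_nat_finite[OF J] by (auto simp: atLeast0LessThan)
  have hJ: "h i \<in> J" if "i < card J" for i using bij_betwE[OF h] that by auto
  have "\<exists>c. x - (\<Sum>i<card J. act (c i) (b (h i))) \<in> D" if x: "x \<in> A" for x
  proof -
    obtain c where "x - (\<Sum>j\<in>J. act (c j) (b j)) \<in> D" using s x by (auto simp: spans_def)
    then have "x - (\<Sum>i<card J. act (c (h i)) (b (h i))) \<in> D"
      by (simp add: sum.reindex_bij_betw[OF h, of "\<lambda>j. act (c j) (b j)"])
    then show ?thesis by (rule exI[of _ "\<lambda>i. c (h i)"])
  qed
  then have 1: "spans act A D {..<card J} (b \<circ> h)" using s hJ by (auto simp: spans_def)
  have "c i = 0" if c: "(\<Sum>i<card J. act (c i) (b (h i))) \<in> D" and i: "i < card J" for c i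
  proof -
    let ?g = "inv_into {..<card J} h"
    have g: "?g (h k) = k" if "k < card J" for k
      using h that by (intro inv_into_f_f) (auto simp: bij_betw_def)
    have "(\<Sum>j\<in>J. act (c (?g j)) (b j)) = (\<Sum>i<card J. act (c (?g (h i))) (b (h i)))"
      by (rule sum.reindex_bij_betw[OF h, symmetric])
    also have "\<dots> = (\<Sum>i<card J. act (c i) (b (h i)))" by (intro sum.cong) (auto simp: g)
    finally have "(\<Sum>j\<in>J. act (c (?g j)) (b j)) \<in> D" using c by simp
    then have "c (?g (h i)) = 0"
      using assms(2)[unfolded indep_mod_def, rule_format, of "\<lambda>j. c (?g j)" "h i"] hJ[OF i] by simp
    then show ?thesis by (simp add: g[OF i])
  qed
  then have "indep_mod act D {..<card J} (b \<circ> h)" by (auto simp: indep_mod_def)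
  with 1 show ?thesis unfolding hasdim_def by blast
qed

lemma hasdim_zero: "0 \<in> D \<Longrightarrow> A \<subseteq> D \<Longrightarrow> hasdim act A D 0"
  by (auto simp: hasdim_def spans_def indep_mod_def)

text \<open>The counterpart of \<open>presents_iso\<close> for dimensions: partners of the basis
  vectors are chosen, and linear combinations with the same coefficients are again related.\<close>

lemma hasdim_transfer:
  assumes A: "hasdim act1 A1 D1 N" "0 \<in> A1" and D2: "submod R act2 D2"
    and dom: "\<And>x y. Q x y \<Longrightarrow> x \<in> A1 \<and> y \<in> A2"
    and tot: "\<And>x. x \<in> A1 \<Longrightarrow> \<exists>y. Q x y"
    and sur: "\<And>y. y \<in> A2 \<Longrightarrow> \<exists>x y'. Q x y' \<and> y - y' \<in> D2"
    and diff: "\<And>x y x' y'. Q x y \<Longrightarrow> Q x' y' \<Longrightarrow> Q (x - x') (y - y')"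
    and smul: "\<And>r x y. Q x y \<Longrightarrow> Q (act1 r x) (act2 r y)"
    and ker: "\<And>x y. Q x y \<Longrightarrow> x \<in> D1 \<longleftrightarrow> y \<in> D2"
  shows "hasdim act2 A2 D2 N"
proof -
  obtain b where s: "spans act1 A1 D1 {..<N} b" and i: "indep_mod act1 D1 {..<N} b"
    using A by (auto simp: hasdim_def)
  have "\<exists>y. Q (b j) y" if "j < N" for j using s that tot by (auto simp: spans_def)
  then obtain b' where b': "\<And>j. j < N \<Longrightarrow> Q (b j) (b' j)" by metis
  obtain y0 where "Q 0 y0" using tot A(2) by blast
  then have Q0: "Q 0 0" using diff[of 0 y0 0 y0] by simp
  have add: "Q (x + x') (y + y')" if "Q x y" "Q x' y'" for x y x' y'
    using diff[OF that(1) diff[OF Q0 that(2)]] by simp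
  have Qsum: "Q (\<Sum>j\<in>J. act1 (c j) (b j)) (\<Sum>j\<in>J. act2 (c j) (b' j))" if "J \<subseteq> {..<N}" for c J
  proof -
    have "finite J" using that finite_subset by blast
    then show ?thesis using that
      by (induction J) (auto intro!: Q0 add smul b')
  qed
  have "\<exists>c. y - (\<Sum>j<N. act2 (c j) (b' j)) \<in> D2" if "y \<in> A2" for y
  proof -
    obtain x y' where xy: "Q x y'" "y - y' \<in> D2" using sur \<open>y \<in> A2\<close> by blast
    obtain c where c: "x - (\<Sum>j<N. act1 (c j) (b j)) \<in> D1" using s dom[OF xy(1)] by (auto simp: spans_def)
    have "y' - (\<Sum>j<N. act2 (c j) (b' j)) \<in> D2"
      using ker[OF diff[OF xy(1) Qsum[OF subset_refl, of c]]] c by simp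
    then have "(y - y') + (y' - (\<Sum>j<N. act2 (c j) (b' j))) \<in> D2" by (rule submod_add[OF D2 xy(2)])
    then show ?thesis by auto
  qed
  moreover have "b' j \<in> A2" if "j < N" for j using dom b' that by blast
  ultimately have "spans act2 A2 D2 {..<N} b'" by (auto simp: spans_def)
  moreover have "indep_mod act2 D2 {..<N} b'"
    unfolding indep_mod_def using i ker[OF Qsum[OF subset_refl]] by (auto simp: indep_mod_def)
  ultimately show ?thesis by (auto simp: hasdim_def)
qed

lemma field_class_ring: "field (class_ring :: 'k::field ring)"
  by (rule class_field)

locale vs_action = action "class_ring :: 'k ring" act for act :: "'k::field \<Rightarrow> 'x::ab_group_add \<Rightarrow> 'x"
begin

abbreviation "vsub \<equiv> submod (class_ring :: 'k ring) act"

lemma scale_diff: "act c (x - y) = act c x - act c y"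
  by (rule act_minus) simp

lemma scale_0_left [simp]: "act 0 x = 0"
  using act_plus[of 0 0 x] by simp

lemma scale_0_right [simp]: "act c 0 = 0"
  by (rule act_zero) simp

lemma scale_diff_left: "act (c - c') x = act c x - act c' x"
  using act_plus[of "c - c'" c' x] by (simp add: algebra_simps)

lemma scale_mult: "act (c * c') x = act c (act c' x)"
  using act_mult[of c c' x] by simp

lemma scale_sum: "act c (sum f J) = (\<Sum>j\<in>J. act c (f j))"
  by (rule act_sum) simp

lemma vsub_scale: "vsub A \<Longrightarrow> x \<in> A \<Longrightarrow> act c x \<in> A"
  using submod_act[of "class_ring :: 'k ring" act A c x] by simp

lemma vsub_lincomb: "vsub A \<Longrightarrow> (\<And>j. j \<in> J \<Longrightarrow> b j \<in> A) \<Longrightarrow> (\<Sum>j\<in>J. act (c j) (b j)) \<in> A"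
  by (rule submod_sum) (auto intro: vsub_scale)

text \<open>Additivity along E / D, A / D, A / E: a basis of the first and lifts of a basis of the
  last are joined.\<close>

lemma hasdim_ses:
  assumes E: "hasdim act E D N" "vsub E" "D \<subseteq> E" and A: "hasdim act A E M" "E \<subseteq> A"
  shows "hasdim act A D (N + M)"
proof -
  obtain b where b: "spans act E D {..<N} b" "indep_mod act D {..<N} b" using E by (auto simp: hasdim_def)
  obtain b' where b': "spans act A E {..<M} b'" "indep_mod act E {..<M} b'" using A by (auto simp: hasdim_def)
  let ?J = "{..<N} <+> {..<M}"
  have split: "(\<Sum>j\<in>?J. act (c j) (case_sum b b' j)) =
      (\<Sum>j<N. act (c (Inl j)) (b j)) + (\<Sum>j<M. act (c (Inr j)) (b' j))" for c
    by (simp add: sum.Plus)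
  have "\<exists>c. x - (\<Sum>j\<in>?J. act (c j) (case_sum b b' j)) \<in> D" if "x \<in> A" for x
  proof -
    obtain c' where "x - (\<Sum>j<M. act (c' j) (b' j)) \<in> E" using b' \<open>x \<in> A\<close> by (auto simp: spans_def)
    then obtain c where "x - (\<Sum>j<M. act (c' j) (b' j)) - (\<Sum>j<N. act (c j) (b j)) \<in> D"
      using b by (auto simp: spans_def)
    then have "x - (\<Sum>j\<in>?J. act (case_sum c c' j) (case_sum b b' j)) \<in> D"
      unfolding split by (simp add: diff_diff_eq add.commute)
    then show ?thesis by blast
  qed
  then have 1: "spans act A D ?J (case_sum b b')" using b b' A by (auto simp: spans_def)
  have "c j = 0" if c: "(\<Sum>j\<in>?J. act (c j) (case_sum b b' j)) \<in> D" and j: "j \<in> ?J" for c j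
  proof -
    have b_E: "(\<Sum>j<N. act (c (Inl j)) (b j)) \<in> E" using b by (intro vsub_lincomb E) (auto simp: spans_def)
    have "(\<Sum>j<N. act (c (Inl j)) (b j)) + (\<Sum>j<M. act (c (Inr j)) (b' j)) \<in> E" using c E(3) unfolding split by blast
    then have "(\<Sum>j<M. act (c (Inr j)) (b' j)) \<in> E" using submod_diff[OF E(2) _ b_E] by force
    then have 0: "c (Inr j) = 0" if "j < M" for j using b' that by (auto simp: indep_mod_def)
    then have "(\<Sum>j<M. act (c (Inr j)) (b' j)) = 0" by (intro sum.neutral) auto
    then have "(\<Sum>j<N. act (c (Inl j)) (b j)) \<in> D" using c unfolding split by simp
    then have "c (Inl j) = 0" if "j < N" for j using b that by (auto simp: indep_mod_def)
    then show ?thesis using 0 j by auto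
  qed
  then have "indep_mod act D ?J (case_sum b b')" by (auto simp: indep_mod_def)
  from hasdimI[OF 1 this] show ?thesis by (simp add: card_Plus)
qed

text \<open>While the generators are dependent modulo D, one with a nonzero coefficient in a
  relation can be removed.\<close>

lemma spans_hasdim:
  assumes D: "vsub D" and "spans act A D J b"
  shows "\<exists>N. hasdim act A D N"
proof -
  have "finite J" using assms by (simp add: spans_def)
  then show ?thesis using assms(2)
  proof (induction J rule: finite_psubset_induct)
    case (psubset J)
    show ?case
    proof (cases "indep_mod act D J b")
      case True
      then show ?thesis using hasdimI[OF psubset.prems] by blast
    next
      case False
      then obtain c k where c: "(\<Sum>j\<in>J. act (c j) (b j)) \<in> D" and k: "k \<in> J" "c k \<noteq> 0"
        by (auto simp: indep_mod_def)
      have "\<exists>a. x - (\<Sum>j\<in>J - {k}. act (a j) (b j)) \<in> D" if "x \<in> A" for x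
      proof -
        obtain a where a: "x - (\<Sum>j\<in>J. act (a j) (b j)) \<in> D" using psubset.prems \<open>x \<in> A\<close> by (auto simp: spans_def)
        \<comment> \<open>The relation is subtracted with the factor that makes the coefficient at k
          zero.\<close>
        let ?a = "\<lambda>j. a j - a k / c k * c j"
        have "(\<Sum>j\<in>J - {k}. act (?a j) (b j)) = (\<Sum>j\<in>J. act (?a j) (b j))"
          using k psubset.hyps by (simp add: sum.remove)
        also have "\<dots> = (\<Sum>j\<in>J. act (a j) (b j)) - act (a k / c k) (\<Sum>j\<in>J. act (c j) (b j))"
          by (simp only: scale_diff_left scale_mult sum_subtractf scale_sum)
        finally have "x - (\<Sum>j\<in>J - {k}. act (?a j) (b j)) =
            (x - (\<Sum>j\<in>J. act (a j) (b j))) + act (a k / c k) (\<Sum>j\<in>J. act (c j) (b j))" by simp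
        then have "x - (\<Sum>j\<in>J - {k}. act (?a j) (b j)) \<in> D"
          using submod_add[OF D a vsub_scale[OF D c, of "a k / c k"]] by (simp only:)
        then show ?thesis by (rule exI[of _ ?a])
      qed
      then have "spans act A D (J - {k}) b" using psubset.prems by (auto simp: spans_def)
      then show ?thesis using k by (intro psubset.IH) auto
    qed
  qed
qed

lemma hasdim_quot: "hasdim act A D N \<Longrightarrow> D \<subseteq> E \<Longrightarrow> vsub E \<Longrightarrow> \<exists>M. hasdim act A E M"
proof -
  assume A: "hasdim act A D N" "D \<subseteq> E" "vsub E"
  then obtain b where "spans act A D {..<N} b" by (auto simp: hasdim_def)
  then have "spans act A E {..<N} b" using A(2) unfolding spans_def by blast
  then show ?thesis by (rule spans_hasdim[OF A(3)])
qed

lemma presents_lincomb: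
  assumes P: "presents class_ring act A D \<rho> M" and J: "finite J" and b: "\<And>j. j \<in> J \<Longrightarrow> b j \<in> A"
  shows "(\<Oplus>\<^bsub>M\<^esub>j\<in>J. c j \<odot>\<^bsub>M\<^esub> \<rho> (b j)) = \<rho> (\<Sum>j\<in>J. act (c j) (b j))"
proof -
  interpret Module.module class_ring M by (rule presents_module[OF P])
  note A = presentsD(2)[OF P] and car = presentsD(5)[OF P]
  have sm: "\<rho> (act c x) = c \<odot>\<^bsub>M\<^esub> \<rho> x" if "x \<in> A" for c x
    by (rule presentsD(8)[OF P _ that]) simp
  have "(\<Oplus>\<^bsub>M\<^esub>j\<in>J. c j \<odot>\<^bsub>M\<^esub> \<rho> (b j)) = (\<Oplus>\<^bsub>M\<^esub>j\<in>J. \<rho> (act (c j) (b j)))"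
  proof (rule M.finsum_cong')
    show "(\<lambda>j. \<rho> (act (c j) (b j))) \<in> J \<rightarrow> carrier M" using b vsub_scale[OF A] unfolding car by blast
  qed (use b sm in auto)
  also have "\<dots> = \<rho> (\<Sum>j\<in>J. act (c j) (b j))"
    using b by (intro presents_finsum[OF P _ J] vsub_scale[OF A])
  finally show ?thesis .
qed

text \<open>Independence modulo D makes the images of the basis vectors pairwise distinct; only then
  does the basis, taken as a set, have N elements.\<close>

lemma presents_dim:
  assumes P: "presents class_ring act A D \<rho> M" and N: "hasdim act A D N"
  shows "vectorspace.fin_dim class_ring M \<and> vectorspace.dim class_ring M = N"
proof -
  interpret vectorspace class_ring M
    by (intro vectorspace.intro field_class_ring presents_module[OF P])
  note A = presentsD(2)[OF P] and D = presentsD(3)[OF P] and car = presentsD(5)[OF P] and z = presentsD(6)[OF P]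
    and eq = presentsD(9)[OF P]
  obtain b where b: "spans act A D {..<N} b" "indep_mod act D {..<N} b" using N by (auto simp: hasdim_def)
  have bA: "b j \<in> A" if "j < N" for j using b that by (auto simp: spans_def)
  have inj: "inj_on (\<lambda>j. \<rho> (b j)) {..<N}"
  proof (rule inj_onI, rule ccontr)
    fix i j assume ij: "i \<in> {..<N}" "j \<in> {..<N}" "\<rho> (b i) = \<rho> (b j)" "i \<noteq> j"
    let ?c = "\<lambda>k. (if k = i then 1 else 0) - (if k = j then 1 else 0)"
    have d: "act (if k = i then 1 else 0) (b k) = (if k = i then b k else 0)" for k i :: nat
      using act_one by simp
    have "(\<Sum>k<N. act (?c k) (b k)) = b i - b j"
      using ij(1,2) by (simp add: scale_diff_left sum_subtractf d sum.delta)
    also have "\<dots> \<in> D" using ij eq[OF bA bA, of i j] by simp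
    finally have "(\<Sum>k<N. act (?c k) (b k)) \<in> D" .
    from b(2)[unfolded indep_mod_def, rule_format, of ?c, OF this ij(1)]
    show False using ij(4) by simp
  qed
  let ?b = "(\<lambda>j. \<rho> (b j)) ` {..<N}"
  have sub: "?b \<subseteq> carrier M" using bA car by auto
  have lc: "lincomb a ?b = \<rho> (\<Sum>j<N. act (a (\<rho> (b j))) (b j))" for a
  proof -
    have "lincomb a ?b = (\<Oplus>\<^bsub>M\<^esub>j\<in>{..<N}. a (\<rho> (b j)) \<odot>\<^bsub>M\<^esub> \<rho> (b j))"
      unfolding lincomb_def using sub by (intro M.finsum_reindex inj) auto
    also have "\<dots> = \<rho> (\<Sum>j<N. act (a (\<rho> (b j))) (b j))"
      using bA by (intro presents_lincomb[OF P]) auto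
    finally show ?thesis .
  qed
  have sumA: "(\<Sum>j<N. act (c j) (b j)) \<in> A" for c using bA by (intro vsub_lincomb A) auto
  have "lin_indpt ?b"
  proof (rule finite_lin_indpt2[OF _ sub])
    fix a assume "lincomb a ?b = \<zero>\<^bsub>M\<^esub>"
    then have "(\<Sum>j<N. act (a (\<rho> (b j))) (b j)) \<in> D"
      unfolding lc z using eq[OF sumA submod_0[OF A]] by simp
    then show "\<forall>v\<in>?b. a v = \<zero>\<^bsub>class_ring\<^esub>" using b(2) by (auto simp: indep_mod_def)
  qed simp
  moreover have gen: "gen_set ?b"
  proof
    show "span ?b \<subseteq> carrier M" by (rule span_is_subset2[OF sub])
    show "carrier M \<subseteq> span ?b"
    proof
      fix v assume "v \<in> carrier M"
      then obtain x where x: "x \<in> A" "v = \<rho> x" using car by auto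
      then obtain c where c: "x - (\<Sum>j<N. act (c j) (b j)) \<in> D" using b by (auto simp: spans_def)
      let ?a = "\<lambda>v. c (inv_into {..<N} (\<lambda>j. \<rho> (b j)) v)"
      have "(\<Sum>j<N. act (?a (\<rho> (b j))) (b j)) = (\<Sum>j<N. act (c j) (b j))"
        by (intro sum.cong) (auto simp: inv_into_f_f[OF inj])
      then have "v = lincomb ?a ?b" unfolding lc using eq[OF x(1) sumA] c x by simp
      then show "v \<in> span ?b" using sub by (subst finite_span) auto
    qed
  qed
  ultimately have "basis ?b" using sub by (simp add: basis_def)
  then have "dim = card ?b" by (intro dim_basis) auto
  moreover have "fin_dim" unfolding fin_dim_def using sub gen by blast
  ultimately show ?thesis using inj by (simp add: card_image)
qed

text \<open>Both numbers are the dimension of one concrete quotient, for which uniqueness is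
  known.\<close>

lemma hasdim_unique:
  assumes "vsub A" "vsub D" "D \<subseteq> A" "hasdim act A D N" "hasdim act A D M"
  shows "N = M"
proof -
  let ?M = "\<lparr>carrier = A, mult = (\<lambda>_ _. 0), one = 0, zero = 0, add = (+), smult = act\<rparr>"
  have "presents class_ring act A {0} (\<lambda>x. x) ?M"
    unfolding presents_def using assms action_axioms by (auto simp: submod_def)
  then have "presents class_ring act A D (\<lambda>x. (\<lambda>x. x) ` D +>\<^bsub>?M\<^esub> x) (quot_module ?M ((\<lambda>x. x) ` D))"
    using assms by (intro presents_quot) (auto dest: submod_0)
  from presents_dim[OF this assms(4)] presents_dim[OF this assms(5)] show ?thesis by simp
qed

end

lemma vs_action_sscale: "vs_action (sscale :: 'k::field \<Rightarrow> ('s \<Rightarrow> 'k) \<Rightarrow> 's \<Rightarrow> 'k)"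
  by (intro vs_action.intro action_sscale)

text \<open>Evaluation at one point s: the induction hypothesis covers its kernel, and its image is
  zero or one-dimensional.\<close>

lemma hasdim_functions:
  assumes "finite S" "subsp V" "\<And>v s. v \<in> V \<Longrightarrow> s \<notin> S \<Longrightarrow> v s = (0 :: 'k::field)"
  shows "\<exists>N. hasdim sscale V {0} N"
  using assms
proof (induction S arbitrary: V)
  case empty
  then have "V \<subseteq> {0}" by (auto simp: fun_eq_iff)
  then show ?case using hasdim_zero[of "{0}" V] by blast
next
  case (insert s S)
  interpret vs_action sscale by (rule vs_action_sscale)
  let ?V = "{v \<in> V. v s = 0}"
  have V': "subsp ?V"
  proof (rule submodI)
    show "0 \<in> ?V" using submod_0[OF insert.prems(1)] by simp
    show "x - y \<in> ?V" if "x \<in> ?V" "y \<in> ?V" for x y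
      using that submod_diff[OF insert.prems(1), of x y] by simp
    show "sscale r x \<in> ?V" if "x \<in> ?V" for r x
      using that subsp_scale[OF insert.prems(1), of x r] by (simp add: sscale_def)
  qed
  have "\<exists>N. hasdim sscale ?V {0} N"
  proof (rule insert.IH[OF V'])
    fix v t assume "v \<in> ?V" "t \<notin> S"
    then show "v t = 0" using insert.prems(2)[of v t] by (cases "t = s") auto
  qed
  then obtain N where N: "hasdim sscale ?V {0} N" by blast
  show ?case
  proof (cases "\<exists>v\<in>V. v s \<noteq> 0")
    case True
    then obtain v where v: "v \<in> V" "v s \<noteq> 0" by blast
    have "x - (\<Sum>j\<in>{s}. sscale (x s / v s) v) \<in> ?V" if "x \<in> V" for x
    proof -
      have "x - sscale (x s / v s) v \<in> V"
        by (rule submod_diff[OF insert.prems(1) that subsp_scale[OF insert.prems(1) v(1)]])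
      moreover have "(x - sscale (x s / v s) v) s = 0" using v(2) by (simp add: sscale_def)
      ultimately show ?thesis by simp
    qed
    then have "\<exists>c. x - (\<Sum>j\<in>{s}. sscale (c j) v) \<in> ?V" if "x \<in> V" for x
      using that by (intro exI[of _ "\<lambda>_. x s / v s"])
    then have "spans sscale V ?V {s} (\<lambda>_. v)" using v(1) by (simp add: spans_def)
    moreover have "indep_mod sscale ?V {s} (\<lambda>_. v)" using v(2) by (simp add: indep_mod_def sscale_def)
    ultimately have "hasdim sscale V ?V (card {s})" by (rule hasdimI)
    moreover have "{0} \<subseteq> ?V" using submod_0[OF V'] by blast
    moreover have "?V \<subseteq> V" by blast
    ultimately show ?thesis using hasdim_ses[OF N V'] by blast
  next
    case False
    then have "?V = V" by auto
    then show ?thesis using N by metis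
  qed
qed

context vs_action
begin

text \<open>In coordinates with respect to a basis of A / D, the subquotient E / D becomes a space
  of functions on a finite set.\<close>

lemma hasdim_sub:
  assumes A: "hasdim act A D N" and E: "vsub E" "vsub D" "D \<subseteq> E" "E \<subseteq> A"
  shows "\<exists>M. hasdim act E D M"
proof -
  obtain b where b: "spans act A D {..<N} b" "indep_mod act D {..<N} b" using A by (auto simp: hasdim_def)
  let ?s = "\<lambda>c. \<Sum>j<N. act (c j) (b j)"
  let ?V = "{c. (\<forall>j. j \<notin> {..<N} \<longrightarrow> c j = 0) \<and> ?s c \<in> E}"
  have sdiff: "?s (c - c') = ?s c - ?s c'" for c c' by (simp add: scale_diff_left sum_subtractf)
  have smul: "?s (sscale r c) = act r (?s c)" for r c by (simp add: sscale_def scale_mult scale_sum)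
  have V: "subsp ?V"
  proof (rule submodI)
    show "0 \<in> ?V" using submod_0[OF E(1)] by simp
    show "x - y \<in> ?V" if "x \<in> ?V" "y \<in> ?V" for x y
      using that submod_diff[OF E(1), of "?s x" "?s y"] by (simp add: sdiff[unfolded fun_diff_def])
    show "sscale r x \<in> ?V" if "x \<in> ?V" for r x
      using that vsub_scale[OF E(1), of "?s x" r] smul[of r x] by (simp add: sscale_def)
  qed
  have "\<exists>M. hasdim sscale ?V {0} M"
  proof (rule hasdim_functions[OF finite_lessThan[of N] V])
    show "v s = 0" if "v \<in> ?V" "s \<notin> {..<N}" for v :: "nat \<Rightarrow> 'k" and s using that by blast
  qed
  then obtain M where M: "hasdim sscale ?V {0} M" by blast
  have "hasdim act E D M"
  proof (rule hasdim_transfer[where Q = "\<lambda>c x. c \<in> ?V \<and> x \<in> E \<and> x - ?s c \<in> D", OF M submod_0[OF V] E(2)])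
    show "c \<in> ?V \<and> x \<in> E" if "c \<in> ?V \<and> x \<in> E \<and> x - ?s c \<in> D" for c x using that by blast
    show "\<exists>x. c \<in> ?V \<and> x \<in> E \<and> x - ?s c \<in> D" if "c \<in> ?V" for c
      using that submod_0[OF E(2)] by (intro exI[of _ "?s c"]) auto
    show "\<exists>c x'. (c \<in> ?V \<and> x' \<in> E \<and> x' - ?s c \<in> D) \<and> x - x' \<in> D" if x: "x \<in> E" for x
    proof -
      obtain c where c: "x - ?s c \<in> D" using b(1) x E(4) unfolding spans_def by blast
      let ?c = "\<lambda>j. if j < N then c j else 0"
      have e: "?s ?c = ?s c" by (intro sum.cong) auto
      have "?s c \<in> E" using c x E(3) submod_diff_iff[OF E(1), of x "?s c"] by blast
      then have 1: "?c \<in> ?V \<and> x \<in> E \<and> x - ?s ?c \<in> D" using c x unfolding e by auto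
      have 2: "x - x \<in> D" using submod_0[OF E(2)] by simp
      show ?thesis by (rule exI, rule exI, rule conjI[OF 1 2])
    qed
    show "c - c' \<in> ?V \<and> x - x' \<in> E \<and> x - x' - ?s (c - c') \<in> D"
      if "c \<in> ?V \<and> x \<in> E \<and> x - ?s c \<in> D" "c' \<in> ?V \<and> x' \<in> E \<and> x' - ?s c' \<in> D" for c x c' x'
    proof (intro conjI)
      show "c - c' \<in> ?V" using that by (intro submod_diff[OF V]) auto
      show "x - x' \<in> E" using that by (intro submod_diff[OF E(1)]) auto
      have "x - x' - ?s (c - c') = (x - ?s c) - (x' - ?s c')" unfolding sdiff by simp
      then show "x - x' - ?s (c - c') \<in> D" using that submod_diff[OF E(2), of "x - ?s c" "x' - ?s c'"] by (simp only:)
    qed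
    show "sscale r c \<in> ?V \<and> act r x \<in> E \<and> act r x - ?s (sscale r c) \<in> D"
      if "c \<in> ?V \<and> x \<in> E \<and> x - ?s c \<in> D" for r c x
    proof (intro conjI)
      show "sscale r c \<in> ?V" using that by (intro subsp_scale[OF V]) auto
      show "act r x \<in> E" using that by (intro vsub_scale[OF E(1)]) auto
      show "act r x - ?s (sscale r c) \<in> D"
        unfolding smul scale_diff[symmetric] using that by (intro vsub_scale[OF E(2)]) auto
    qed
    show "c \<in> {0} \<longleftrightarrow> x \<in> D" if Q: "c \<in> ?V \<and> x \<in> E \<and> x - ?s c \<in> D" for c x
    proof
      assume "c \<in> {0}"
      then show "x \<in> D" using Q by simp
    next
      assume "x \<in> D"
      then have "?s c \<in> D" using submod_diff_iff[OF E(2), of x "?s c"] Q by blast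
      then have "c j = 0" for j using b(2) Q by (cases "j < N") (auto simp: indep_mod_def)
      then show "c \<in> {0}" by (simp add: fun_eq_iff)
    qed
  qed
  then show ?thesis by blast
qed

lemma hasdim_kernel:
  assumes "hasdim act A D N" "hasdim act A E M" and v: "vsub A" "vsub E" "vsub D" "D \<subseteq> E" "E \<subseteq> A"
  shows "hasdim act E D (N - M) \<and> M \<le> N"
proof -
  obtain L where L: "hasdim act E D L" using hasdim_sub[OF assms(1) v(2,3,4,5)] by blast
  have "hasdim act A D (L + M)" by (rule hasdim_ses[OF L v(2,4) assms(2) v(5)])
  moreover have "D \<subseteq> A" using v by blast
  ultimately have "L + M = N" using hasdim_unique v assms(1) by blast
  then show ?thesis using L by auto
qed

end

lemma presents_vspace:
  assumes P: "presents (poly_ring V) act A D \<rho> M"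
    and A': "submod class_ring (\<lambda>c. act (poly_const c)) A'" "A' \<subseteq> A" and act: "vs_action (\<lambda>c. act (poly_const c))"
  shows "presents class_ring (\<lambda>c. act (poly_const c)) A' (D \<inter> A') \<rho> (vspace M (\<rho> ` A'))"
proof -
  interpret vs_action "\<lambda>c. act (poly_const c)" by (rule act)
  have D: "act (poly_const c) x \<in> D" if "x \<in> D" for c x
    by (rule submod_act[OF presentsD(3)[OF P] _ that]) simp
  have "vsub (D \<inter> A')"
  proof (rule submodI)
    show "0 \<in> D \<inter> A'" using submod_0[OF presentsD(3)[OF P]] submod_0[OF A'(1)] by simp
    show "x - y \<in> D \<inter> A'" if "x \<in> D \<inter> A'" "y \<in> D \<inter> A'" for x y
      using that submod_diff[OF presentsD(3)[OF P], of x y] submod_diff[OF A'(1), of x y] by simp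
    show "act (poly_const c) x \<in> D \<inter> A'" if "x \<in> D \<inter> A'" for c x
      using that D vsub_scale[OF A'(1), of x c] by simp
  qed
  moreover have "\<rho> (x + y) = \<rho> x \<oplus>\<^bsub>M\<^esub> \<rho> y" "\<rho> x = \<rho> y \<longleftrightarrow> x - y \<in> D \<inter> A'" if "x \<in> A'" "y \<in> A'" for x y
  proof -
    have xy: "x \<in> A" "y \<in> A" using that A'(2) by auto
    show "\<rho> (x + y) = \<rho> x \<oplus>\<^bsub>M\<^esub> \<rho> y" by (rule presentsD(7)[OF P xy])
    show "\<rho> x = \<rho> y \<longleftrightarrow> x - y \<in> D \<inter> A'"
      using presentsD(9)[OF P xy] submod_diff[OF A'(1) that] by simp
  qed
  moreover have "\<rho> (act (poly_const c) x) = poly_const c \<odot>\<^bsub>M\<^esub> \<rho> x" if "x \<in> A'" for c x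
    using that A'(2) by (intro presentsD(8)[OF P]) auto
  ultimately show ?thesis
    using A' action_axioms presentsD(6)[OF P] unfolding presents_def vspace_def by simp
qed

section \<open>Identification with the cohomology records of the pair (\<Delta>, cost F)\<close>

section \<open>Relative simplicial cohomology\<close>

lemma filter_image: "(\<And>c. c \<in> A \<Longrightarrow> S (f c) \<longleftrightarrow> T c) \<Longrightarrow> {z \<in> f ` A. S z} = f ` {c \<in> A. T c}"
  by auto

lemma rel_diff_restrict:
  assumes \<Delta>: "subset_closed \<Delta>" and c: "c \<in> rel_chains \<Delta> N p"
  shows "rel_diff \<Delta> (cost \<Delta> N) (p - 1) (restrict c (rel_faces \<Delta> (cost \<Delta> N) (p - 1))) =
    restrict (cdiff \<Delta> c) (rel_faces \<Delta> (cost \<Delta> N) p)"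
proof (rule ext)
  fix \<sigma>
  let ?c = "restrict c (rel_faces \<Delta> (cost \<Delta> N) (p - 1))"
  show "rel_diff \<Delta> (cost \<Delta> N) (p - 1) ?c \<sigma> = restrict (cdiff \<Delta> c) (rel_faces \<Delta> (cost \<Delta> N) p) \<sigma>"
  proof (cases "\<sigma> \<in> rel_faces \<Delta> (cost \<Delta> N) p")
    case True
    then have \<sigma>: "\<sigma> \<in> \<Delta>" "int (card \<sigma>) = p + 1" by (auto simp: rel_faces_def)
    have "(if \<sigma> - {t} \<in> cost \<Delta> N then 0 else ?c (\<sigma> - {t})) = c (\<sigma> - {t})" if "t \<in> \<sigma>" for t
    proof -
      have f: "finite \<sigma>" "\<sigma> - {t} \<in> \<Delta>" using \<sigma>(1) \<Delta> by (auto simp: subset_closed_def)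
      have "card \<sigma> = Suc (card (\<sigma> - {t}))" using f that by (metis card_Suc_Diff1)
      then have "int (card (\<sigma> - {t})) = p" using \<sigma>(2) by simp
      moreover have "\<not> N \<subseteq> \<sigma> - {t} \<Longrightarrow> c (\<sigma> - {t}) = 0" using c unfolding rel_chains_def by blast
      ultimately show ?thesis using f by (auto simp: cost_def rel_faces_def)
    qed
    then show ?thesis using True \<sigma>(1) by (simp add: rel_diff_def cdiff_def sgn_in_def)
  qed (simp add: rel_diff_def)
qed

lemma presents_rel_cochains:
  "presents class_ring sscale (rel_chains \<Delta> N p) {0} (\<lambda>c. restrict c (rel_faces \<Delta> (cost \<Delta> N) (p - 1)))
    (rel_cochains \<Delta> (cost \<Delta> N) (p - 1) :: ('k::field, nat set \<Rightarrow> 'k) module)"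
proof -
  let ?R = "rel_faces \<Delta> (cost \<Delta> N) (p - 1)" and ?A = "rel_chains \<Delta> N p :: (nat set \<Rightarrow> 'k) set"
  have R: "F \<in> ?R \<longleftrightarrow> F \<in> \<Delta> \<and> N \<subseteq> F \<and> int (card F) = p" for F by (auto simp: rel_faces_def cost_def)
  have A: "c \<in> ?A \<longleftrightarrow> (\<forall>F. F \<notin> ?R \<longrightarrow> c F = 0)" for c unfolding R rel_chains_def by blast
  have func: "rel_cochains \<Delta> (cost \<Delta> N) (p - 1) = \<lparr>carrier = ?R \<rightarrow>\<^sub>E (UNIV :: 'k set), mult = (\<lambda>f g. restrict (\<lambda>v. 0) ?R),
      one = restrict (\<lambda>v. 0) ?R, zero = restrict (\<lambda>v. 0) ?R, add = (\<lambda>f g. restrict (\<lambda>v. f v + g v) ?R),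
      smult = (\<lambda>c f. restrict (\<lambda>v. c * f v) ?R)\<rparr>"
    unfolding rel_cochains_def class_ring.func_space_def by simp
  have "(\<lambda>c. restrict c ?R) ` ?A = ?R \<rightarrow>\<^sub>E UNIV"
  proof
    show "?R \<rightarrow>\<^sub>E UNIV \<subseteq> (\<lambda>c. restrict c ?R) ` ?A"
    proof
      fix f :: "nat set \<Rightarrow> 'k" assume f: "f \<in> ?R \<rightarrow>\<^sub>E UNIV"
      let ?c = "\<lambda>F. if F \<in> ?R then f F else 0"
      have "f = restrict ?c ?R" using f by (auto simp: fun_eq_iff PiE_def extensional_def)
      moreover have "?c \<in> ?A" unfolding A by simp
      ultimately show "f \<in> (\<lambda>c. restrict c ?R) ` ?A" by (rule image_eqI)
    qed
  qed auto
  moreover have "restrict x ?R = restrict y ?R \<longleftrightarrow> x - y \<in> {0}" if "x \<in> ?A" "y \<in> ?A" for x y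
  proof -
    have "restrict x ?R = restrict y ?R \<longleftrightarrow> (\<forall>F\<in>?R. x F = y F)" by (auto simp: fun_eq_iff restrict_def)
    also have "\<dots> \<longleftrightarrow> x = y" using that unfolding A fun_eq_iff by metis
    finally show ?thesis by simp
  qed
  moreover have "subsp {0 :: nat set \<Rightarrow> 'k}" by (rule submodI) (auto simp: sscale_def)
  moreover have "0 \<in> ?A" unfolding A by simp
  ultimately show ?thesis
    unfolding presents_def func using action_sscale subsp_chains[of \<Delta> N p]
    by (simp add: sscale_def restrict_def fun_eq_iff)
qed

lemma presents_face_cohomology:
  assumes \<Delta>: "subset_closed \<Delta>"
  shows "\<exists>\<rho>. presents class_ring sscale (rel_cocyc \<Delta> N p) (rel_cobd \<Delta> N p) \<rho>
    (face_cohomology \<Delta> N (p - 1) :: ('k::field, (nat set \<Rightarrow> 'k) set) module)"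
proof -
  let ?C = "rel_cochains \<Delta> (cost \<Delta> N) :: int \<Rightarrow> ('k, nat set \<Rightarrow> 'k) module" and ?\<delta> = "rel_diff \<Delta> (cost \<Delta> N)"
  let ?r = "\<lambda>p (c :: nat set \<Rightarrow> 'k). restrict c (rel_faces \<Delta> (cost \<Delta> N) (p - 1))"
  let ?A = "rel_cocyc \<Delta> N p :: (nat set \<Rightarrow> 'k) set"
  have P: "presents class_ring sscale (rel_chains \<Delta> N p) {0} (?r p) (?C (p - 1))" for p
    by (rule presents_rel_cochains)
  have d: "?\<delta> (p - 1) (?r p c) = ?r (p + 1) (cdiff \<Delta> c)" if "c \<in> rel_chains \<Delta> N p" for c p
    using rel_diff_restrict[OF \<Delta> that] by simp
  have cyc: "cocycles ?C ?\<delta> (p - 1) = ?r p ` ?A"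
  proof -
    have "?\<delta> (p - 1) (?r p c) = \<zero>\<^bsub>?C (p - 1 + 1)\<^esub> \<longleftrightarrow> cdiff \<Delta> c = 0" if c: "c \<in> rel_chains \<Delta> N p" for c
    proof -
      note Q = P[of "p + 1"]
      have "cdiff \<Delta> c \<in> rel_chains \<Delta> N (p + 1)" by (rule cdiff_rel_chains[OF \<Delta> c])
      then have "?r (p + 1) (cdiff \<Delta> c) = ?r (p + 1) 0 \<longleftrightarrow> cdiff \<Delta> c - 0 \<in> {0}"
        by (rule presentsD(9)[OF Q _ submod_0[OF subsp_chains]])
      then show ?thesis unfolding d[OF c] using presentsD(6)[OF Q] by simp
    qed
    then have "{z \<in> ?r p ` rel_chains \<Delta> N p. ?\<delta> (p - 1) z = \<zero>\<^bsub>?C (p - 1 + 1)\<^esub>} =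
        ?r p ` {c \<in> rel_chains \<Delta> N p. cdiff \<Delta> c = 0}" by (intro filter_image)
    moreover have "?A = {c \<in> rel_chains \<Delta> N p. cdiff \<Delta> c = 0}" by (auto simp: rel_cocyc_alt)
    ultimately show ?thesis unfolding cocycles_def presentsD(5)[OF P] by (simp only:)
  qed
  have bd: "coboundaries ?C ?\<delta> (p - 1) = ?r p ` rel_cobd \<Delta> N p"
  proof -
    have "coboundaries ?C ?\<delta> (p - 1) = (\<lambda>c. ?\<delta> (p - 1 - 1) (?r (p - 1) c)) ` rel_chains \<Delta> N (p - 1)"
      unfolding coboundaries_def presentsD(5)[OF P] image_image ..
    also have "\<dots> = (\<lambda>c. ?r p (cdiff \<Delta> c)) ` rel_chains \<Delta> N (p - 1)"
      using d[of _ "p - 1"] by (intro image_cong) auto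
    finally show ?thesis unfolding rel_cobd_def image_image .
  qed
  have sub: "?A \<subseteq> rel_chains \<Delta> N p" by (auto simp: rel_cocyc_alt)
  have "presents class_ring sscale ?A ({0} \<inter> ?A) (?r p) ((?C (p - 1))\<lparr>carrier := ?r p ` ?A\<rparr>)"
    by (rule presents_submod[OF P subsp_cocyc sub])
  then have "presents class_ring sscale ?A (rel_cobd \<Delta> N p)
      (\<lambda>c. ?r p ` rel_cobd \<Delta> N p +>\<^bsub>(?C (p - 1))\<lparr>carrier := ?r p ` ?A\<rparr>\<^esub> ?r p c)
      (quot_module ((?C (p - 1))\<lparr>carrier := ?r p ` ?A\<rparr>) (?r p ` rel_cobd \<Delta> N p))"
    using submod_0[OF subsp_cobd[of \<Delta> N p]] by (intro presents_quot subsp_cobd rel_cobd_cocyc[OF \<Delta>]) auto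
  then show ?thesis unfolding face_cohomology_def cohomology_def cyc bd by blast
qed

text \<open>The type argument pins the coefficient field, which \<Delta>, p and F do not determine;
  p - 1 converts the number of vertices into the dimension.\<close>

abbreviation face_betti :: "'k::field itself \<Rightarrow> nat set set \<Rightarrow> int \<Rightarrow> nat set \<Rightarrow> nat" where
  "face_betti K \<Delta> p F \<equiv> vectorspace.dim (class_ring :: 'k ring) (face_cohomology \<Delta> F (p - 1) :: ('k, _) module)"

lemma hasdim_face:
  assumes \<Delta>: "subset_closed \<Delta>" "finite \<Delta>"
  shows "hasdim sscale (rel_cocyc \<Delta> N p :: (nat set \<Rightarrow> 'k::field) set) (rel_cobd \<Delta> N p) (face_betti TYPE('k) \<Delta> p N)"
proof -
  interpret vs_action "sscale :: 'k \<Rightarrow> (nat set \<Rightarrow> 'k) \<Rightarrow> nat set \<Rightarrow> 'k" by (rule vs_action_sscale)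
  let ?A = "rel_cocyc \<Delta> N p :: (nat set \<Rightarrow> 'k) set"
  have "\<exists>M. hasdim sscale ?A {0} M"
    by (rule hasdim_functions[OF \<Delta>(2) subsp_cocyc]) (auto simp: rel_cocyc_def)
  then obtain M where M: "hasdim sscale ?A {0} M" by blast
  have "{0} \<subseteq> (rel_cobd \<Delta> N p :: (nat set \<Rightarrow> 'k) set)" using submod_0[OF subsp_cobd[of \<Delta> N p]] by simp
  then obtain M' where M': "hasdim sscale ?A (rel_cobd \<Delta> N p) M'" using hasdim_quot[OF M _ subsp_cobd] by blast
  obtain \<rho> where "presents class_ring sscale ?A (rel_cobd \<Delta> N p) \<rho> (face_cohomology \<Delta> N (p - 1))"
    using presents_face_cohomology[OF \<Delta>(1)] by blast
  from presents_dim[OF this M'] show ?thesis using M' by simp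
qed

lemma face_betti_nonface:
  assumes \<Delta>: "subset_closed \<Delta>" "finite \<Delta>" and "N \<notin> \<Delta>"
  shows "face_betti TYPE('k::field) \<Delta> p N = 0"
proof -
  interpret vs_action "sscale :: 'k \<Rightarrow> (nat set \<Rightarrow> 'k) \<Rightarrow> nat set \<Rightarrow> 'k" by (rule vs_action_sscale)
  have "c = 0" if "c \<in> rel_cocyc \<Delta> N p" for c :: "nat set \<Rightarrow> 'k"
    using that rel_chains_nonface[OF \<Delta>(1) assms(3), of c p] by (simp add: rel_cocyc_alt)
  then have "hasdim sscale (rel_cocyc \<Delta> N p) (rel_cobd \<Delta> N p :: (nat set \<Rightarrow> 'k) set) 0"
    using submod_0[OF subsp_cobd[of \<Delta> N p]] by (intro hasdim_zero) auto
  from hasdim_unique[OF subsp_cocyc subsp_cobd rel_cobd_cocyc[OF \<Delta>(1)] hasdim_face[OF \<Delta>] this] show ?thesis .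
qed

section \<open>Compositions with prescribed support\<close>

section \<open>Counting negative exponents\<close>

text \<open>With the value 0 for negative lower index, Pascal's rule holds for every integer
  b.\<close>

lemma binomial0_Suc: "binomial0 (Suc a) b = binomial0 a b + binomial0 a (b - 1)"
proof (cases "b \<le> 0")
  case True
  then show ?thesis by (cases "b = 0") (auto simp: binomial0_def)
next
  case False
  then have "nat b = Suc (nat (b - 1))" by simp
  then show ?thesis using False by (simp add: binomial0_def)
qed

lemma neg_exps_card_le:
  assumes "finite N" "\<alpha> \<in> neg_exps N j"
  shows "int (card N) \<le> j"
proof -
  have "j = (\<Sum>t\<in>N. - Poly_Mapping.lookup \<alpha> t)" using assms(2) by (auto simp: neg_exps_def exp_deg_def sum_negf)
  also have "\<dots> \<ge> (\<Sum>t\<in>N. 1)" using assms(2) by (intro sum_mono) (force simp: neg_exps_def)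
  finally show ?thesis by simp
qed

text \<open>For finite N these are the compositions of j into |N| positive parts. Adding
  \<open>unit_exp t\<close> maps them bijectively onto two disjoint families, according to whether
  the entry at t was -1, which yields Pascal's rule. The case j = 0 is separate because
  \<open>j - 1\<close> is truncated.\<close>

lemma card_neg_exps:
  "N \<subseteq> {1..n} \<Longrightarrow> card (neg_exps N (int j)) = (if j = 0 then if N = {} then 1 else 0 else binomial0 (j - 1) (int (card N) - 1))"
proof (induction j arbitrary: N)
  case 0
  have fin: "finite N" by (rule finite_subset[OF 0]) simp
  show ?case
  proof (cases "N = {}")
    case True
    have "\<alpha> = 0" if "\<alpha> \<in> neg_exps {} 0" for \<alpha>
      using that by (intro poly_mapping_eqI) (auto simp: neg_exps_iff)
    moreover have "0 \<in> neg_exps {} 0" by (simp add: neg_exps_iff)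
    ultimately have "neg_exps {} 0 = {0}" by blast
    then show ?thesis using True by simp
  next
    case False
    then have "0 < card N" using fin by (simp add: card_gt_0_iff)
    then have "neg_exps N 0 = {}" using neg_exps_card_le[OF fin] by force
    then show ?thesis using False by simp
  qed
next
  case (Suc j)
  have fin: "finite N" by (rule finite_subset[OF Suc.prems]) simp
  show ?case
  proof (cases "N = {}")
    case True
    have "neg_exps {} (int (Suc j)) = {}"
    proof (rule ccontr)
      assume "neg_exps {} (int (Suc j)) \<noteq> {}"
      then obtain \<alpha> where "\<alpha> \<in> neg_exps {} (int (Suc j))" by blast
      then have "Poly_Mapping.keys \<alpha> = {}" "exp_deg \<alpha> = - int (Suc j)" by (auto simp: neg_exps_def)
      then show False by (simp add: exp_deg_def)
    qed
    then show ?thesis using True by (simp add: binomial0_def)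
  next
    case False
    then obtain t where t: "t \<in> N" by blast
    let ?f = "\<lambda>\<alpha>. \<alpha> + unit_exp t"
    have img: "?f ` neg_exps N (int (Suc j)) = neg_exps N (int j) \<union> neg_exps (N - {t}) (int j)"
    proof (intro subset_antisym subsetI)
      fix \<beta> assume "\<beta> \<in> ?f ` neg_exps N (int (Suc j))"
      then obtain \<alpha> where \<alpha>: "\<alpha> \<in> neg_exps N (int (Suc j))" "\<beta> = \<alpha> + unit_exp t" by blast
      have "Poly_Mapping.lookup \<alpha> t < 0" using \<alpha>(1) t by (simp add: neg_exps_iff)
      then show "\<beta> \<in> neg_exps N (int j) \<union> neg_exps (N - {t}) (int j)"
        using \<alpha> t by (cases "Poly_Mapping.lookup \<alpha> t = - 1") (auto simp: neg_exps_iff lookup_unit_add exp_deg_add)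
    next
      fix \<beta> assume "\<beta> \<in> neg_exps N (int j) \<union> neg_exps (N - {t}) (int j)"
      then have "\<beta> - unit_exp t \<in> neg_exps N (int (Suc j))"
        using t by (auto simp: neg_exps_iff lookup_unit_diff exp_deg_minus)
      moreover have "\<beta> = ?f (\<beta> - unit_exp t)" by simp
      ultimately show "\<beta> \<in> ?f ` neg_exps N (int (Suc j))" by (rule rev_image_eqI)
    qed
    have fin': "finite (neg_exps N' (int j))" if "N' \<subseteq> {1..n}" for N'
      by (rule finite_subset[OF _ finite_nonpos_deg[of n "int j"]]) (use that in \<open>auto simp: nonpos_deg_neg neg_exps_def\<close>)
    have "card (neg_exps N (int (Suc j))) = card (?f ` neg_exps N (int (Suc j)))"
      by (rule card_image[symmetric]) (simp add: inj_on_def)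
    also have "\<dots> = card (neg_exps N (int j)) + card (neg_exps (N - {t}) (int j))"
      unfolding img
    proof (rule card_Un_disjoint)
      show "neg_exps N (int j) \<inter> neg_exps (N - {t}) (int j) = {}" using t by (auto simp: neg_exps_def)
    qed (use Suc.prems in \<open>auto intro: fin'\<close>)
    finally have c: "card (neg_exps N (int (Suc j))) = card (neg_exps N (int j)) + card (neg_exps (N - {t}) (int j))" .
    have cN: "card N = Suc (card (N - {t}))" using t fin by (metis card_Suc_Diff1)
    have e: "N - {t} = {} \<longleftrightarrow> card (N - {t}) = 0" using fin by simp
    have "N - {t} \<subseteq> {1..n}" using Suc.prems by blast
    note IH = Suc.IH[OF Suc.prems] Suc.IH[OF this]
    show ?thesis
    proof (cases "j = 0")
      case True
      then show ?thesis unfolding c IH e using False by (auto simp: cN binomial0_def)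
    next
      case j: False
      then obtain k where "j = Suc k" by (cases j) auto
      then show ?thesis unfolding c IH using binomial0_Suc[of k "int (card (N - {t}))"] by (simp add: cN)
    qed
  qed
qed

section \<open>Common kernels measured by rank and nullity\<close>

section \<open>Dimensions of the graded pieces\<close>

abbreviation kact :: "'k::field \<Rightarrow> (nat set \<Rightarrow> 'k laurent) \<Rightarrow> nat set \<Rightarrow> 'k laurent" where
  "kact \<equiv> \<lambda>c. cact (poly_const c)"

lemma vs_action_kact: "vs_action kact"
  by unfold_locales
    (simp_all add: poly_const_add poly_const_mult emb.lin_ext_add emb.lin_ext_mult fun_eq_iff algebra_simps class_cring.is_cring)

lemma submod_kact: "submod (poly_ring V) cact A \<Longrightarrow> submod class_ring kact A"
  unfolding submod_def by auto

lemma lookup_kact: "Poly_Mapping.lookup (kact c u F) \<alpha> = c * Poly_Mapping.lookup (u F) \<alpha>"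
  by (simp add: emb_poly_const lookup_single_mult)

lemma hom_deg_kact: "hom_deg j u \<Longrightarrow> hom_deg j (kact c u)"
  unfolding hom_deg_def by (auto simp: in_keys_iff lookup_kact)

lemma hom_deg_0: "hom_deg j 0"
  by (simp add: hom_deg_def)

lemma submod_hom_deg:
  assumes "submod (poly_ring V) cact A"
  shows "submod class_ring kact {u \<in> A. hom_deg j u}"
proof (rule submodI)
  note A = submod_kact[OF assms]
  show "0 \<in> {u \<in> A. hom_deg j u}" using submod_0[OF A] by (simp add: hom_deg_0)
  show "x - y \<in> {u \<in> A. hom_deg j u}" if "x \<in> {u \<in> A. hom_deg j u}" "y \<in> {u \<in> A. hom_deg j u}" for x y
    using that submod_diff[OF A, of x y] hom_deg_diff[of j x y] by (simp only: mem_Collect_eq)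
  show "kact c x \<in> {u \<in> A. hom_deg j u}" if "x \<in> {u \<in> A. hom_deg j u}" for c x
    using that vs_action.vsub_scale[OF vs_action_kact A, of x c] hom_deg_kact[of j x c] by (simp only: mem_Collect_eq)
qed

context generic_forms
begin

interpretation k: vs_action "kact :: 'k \<Rightarrow> _" by (rule vs_action_kact)

definition Zd :: "nat \<Rightarrow> int \<Rightarrow> int \<Rightarrow> (nat set \<Rightarrow> 'k laurent) set" where
  "Zd m p j = {z \<in> Z m p. hom_deg j z}"

definition Bd :: "nat \<Rightarrow> int \<Rightarrow> int \<Rightarrow> (nat set \<Rightarrow> 'k laurent) set" where
  "Bd m p j = {z \<in> B m p. hom_deg j z}"

definition Kd :: "nat \<Rightarrow> int \<Rightarrow> int \<Rightarrow> (nat set \<Rightarrow> 'k laurent) set" where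
  "Kd m p j = {z \<in> K m p. hom_deg j z}"

lemma sub_Zd: "submod class_ring kact (Zd m p j)" and sub_Bd: "submod class_ring kact (Bd m p j)"
  and sub_Kd: "submod class_ring kact (Kd m p j)"
  unfolding Zd_def Bd_def Kd_def by (rule submod_hom_deg[OF sub_Z], rule submod_hom_deg[OF sub_B], rule submod_hom_deg[OF sub_K])

lemma Bd_Zd: "Bd m p j \<subseteq> Zd m p j"
  using B_Z by (auto simp: Bd_def Zd_def)

lemma Bd_Kd: "Bd 0 p j \<subseteq> Kd m p j"
  using B_Z tact_B by (auto simp: Bd_def Kd_def K_def)

lemma fam_kact: "fam (kact c u) \<alpha> = sscale c (fam u \<alpha>)"
  by (simp add: fam_def sscale_def fun_eq_iff lookup_kact)

lemma fam_realize_single: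
  assumes "c \<in> rel_chains \<Delta> N p"
  shows "fam (realize {\<alpha>} (\<lambda>_. c)) \<beta> = (if \<beta> = \<alpha> then c else 0)"
  using fam_realize[of "{\<alpha>}" \<alpha> "\<lambda>_. c" N p] assms by (auto simp: fam_def lookup_realize)

lemma finite_\<Delta>: "finite \<Delta>"
  by (rule finite_subset[OF faces_sub]) simp

text \<open>A filtration of the cocycles of degree -j. For empty S only coboundaries are left, and
  each exponent \<alpha> added to S contributes one relative cohomology group, that of the support
  of \<alpha>.\<close>

definition partial_Z :: "int \<Rightarrow> int \<Rightarrow> (nat \<Rightarrow>\<^sub>0 int) set \<Rightarrow> (nat set \<Rightarrow> 'k laurent) set" where
  "partial_Z p j S = {z \<in> Zd 0 p (- j). \<forall>\<alpha>\<in>D j - S. fam z \<alpha> \<in> SB (supp \<alpha>) p}"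

lemma sub_partial_Z: "submod class_ring kact (partial_Z p j S)"
proof (rule submodI)
  have 0: "fam 0 \<alpha> = 0" for \<alpha> by (simp add: fam_def fun_eq_iff)
  have "fam 0 \<alpha> \<in> SB (supp \<alpha>) p" for \<alpha> unfolding 0 by (rule submod_0[OF subsp_cobd])
  then show "0 \<in> partial_Z p j S" using submod_0[OF sub_Zd] by (simp add: partial_Z_def)
next
  fix x y assume xy: "x \<in> partial_Z p j S" "y \<in> partial_Z p j S"
  have "fam (x - y) \<alpha> \<in> SB (supp \<alpha>) p" if "\<alpha> \<in> D j - S" for \<alpha>
    unfolding fam_diff by (rule submod_diff[OF subsp_cobd]) (use xy that in \<open>simp_all add: partial_Z_def\<close>)
  moreover have "x - y \<in> Zd 0 p (- j)"
    by (rule submod_diff[OF sub_Zd]) (use xy in \<open>simp_all add: partial_Z_def\<close>)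
  ultimately show "x - y \<in> partial_Z p j S" by (simp only: partial_Z_def mem_Collect_eq) blast
next
  fix c :: 'k and x assume x: "x \<in> partial_Z p j S"
  have "fam (kact c x) \<alpha> \<in> SB (supp \<alpha>) p" if "\<alpha> \<in> D j - S" for \<alpha>
    unfolding fam_kact by (rule subsp_scale[OF subsp_cobd]) (use x that in \<open>simp add: partial_Z_def\<close>)
  moreover have "kact c x \<in> Zd 0 p (- j)"
    by (rule k.vsub_scale[OF sub_Zd]) (use x in \<open>simp add: partial_Z_def\<close>)
  ultimately show "kact c x \<in> partial_Z p j S" by (simp only: partial_Z_def mem_Collect_eq) blast
qed

text \<open>Modulo the smaller step a cocycle is determined by the class of its component at
  \<alpha>. Every relative cocycle occurs there, realized by a cocycle concentrated in the single
  degree \<alpha>.\<close>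

lemma partial_Z_insert:
  assumes \<alpha>: "\<alpha> \<in> D j" "\<alpha> \<notin> S"
  shows "hasdim kact (partial_Z p j (insert \<alpha> S)) (partial_Z p j S) (face_betti TYPE('k) \<Delta> p (supp \<alpha>))"
proof (rule hasdim_transfer[where Q = "\<lambda>c z. c \<in> SZ (supp \<alpha>) p \<and> z \<in> partial_Z p j (insert \<alpha> S) \<and> fam z \<alpha> = c",
      OF hasdim_face[OF closed finite_\<Delta>] submod_0[OF subsp_cocyc] sub_partial_Z])
  show "c \<in> SZ (supp \<alpha>) p \<and> z \<in> partial_Z p j (insert \<alpha> S)"
    if "c \<in> SZ (supp \<alpha>) p \<and> z \<in> partial_Z p j (insert \<alpha> S) \<and> fam z \<alpha> = c" for c z using that by blast
  show "\<exists>z. c \<in> SZ (supp \<alpha>) p \<and> z \<in> partial_Z p j (insert \<alpha> S) \<and> fam z \<alpha> = c" if c: "c \<in> SZ (supp \<alpha>) p" for c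
  proof -
    let ?z = "realize {\<alpha>} (\<lambda>_. c)"
    have f: "fam ?z \<beta> = (if \<beta> = \<alpha> then c else 0)" for \<beta>
      using c by (intro fam_realize_single[of c "supp \<alpha>" p]) (simp add: rel_cocyc_alt)
    have "?z \<in> Z 0 p" by (rule realize_Z) (use \<alpha> c D_nonpos in auto)
    moreover have "hom_deg (- j) ?z" using \<alpha> by (intro hom_deg_realize) auto
    ultimately have "?z \<in> Zd 0 p (- j)" by (simp add: Zd_def)
    moreover have "fam ?z \<beta> \<in> SB (supp \<beta>) p" if "\<beta> \<in> D j - insert \<alpha> S" for \<beta>
    proof -
      have "fam ?z \<beta> = 0" using that f by auto
      then show ?thesis using submod_0[OF subsp_cobd] by metis
    qed
    ultimately have "?z \<in> partial_Z p j (insert \<alpha> S)" by (simp only: partial_Z_def mem_Collect_eq) blast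
    moreover have "fam ?z \<alpha> = c" unfolding f by simp
    ultimately show ?thesis using c by (intro exI[of _ ?z] conjI)
  qed
  show "\<exists>c z'. (c \<in> SZ (supp \<alpha>) p \<and> z' \<in> partial_Z p j (insert \<alpha> S) \<and> fam z' \<alpha> = c) \<and> z - z' \<in> partial_Z p j S"
    if z: "z \<in> partial_Z p j (insert \<alpha> S)" for z
  proof -
    have "z \<in> Z 0 p" using z by (simp add: partial_Z_def Zd_def)
    then have 1: "fam z \<alpha> \<in> SZ (supp \<alpha>) p" by (rule fam_Z[OF _ D_nonpos[OF \<alpha>(1)]])
    have "z - z = 0" by simp
    then have 2: "z - z \<in> partial_Z p j S" using submod_0[OF sub_partial_Z] by metis
    show ?thesis by (rule exI, rule exI, intro conjI, rule 1, rule z, rule refl, rule 2)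
  qed
  show "c - c' \<in> SZ (supp \<alpha>) p \<and> z - z' \<in> partial_Z p j (insert \<alpha> S) \<and> fam (z - z') \<alpha> = c - c'"
    if "c \<in> SZ (supp \<alpha>) p \<and> z \<in> partial_Z p j (insert \<alpha> S) \<and> fam z \<alpha> = c"
      "c' \<in> SZ (supp \<alpha>) p \<and> z' \<in> partial_Z p j (insert \<alpha> S) \<and> fam z' \<alpha> = c'" for c z c' z'
    using that by (intro conjI submod_diff[OF subsp_cocyc] submod_diff[OF sub_partial_Z]) (auto simp only: fam_diff)
  show "sscale r c \<in> SZ (supp \<alpha>) p \<and> kact r z \<in> partial_Z p j (insert \<alpha> S) \<and> fam (kact r z) \<alpha> = sscale r c"
    if "c \<in> SZ (supp \<alpha>) p \<and> z \<in> partial_Z p j (insert \<alpha> S) \<and> fam z \<alpha> = c" for r c z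
    using that by (intro conjI subsp_scale[OF subsp_cocyc] k.vsub_scale[OF sub_partial_Z]) (auto simp only: fam_kact)
  show "c \<in> SB (supp \<alpha>) p \<longleftrightarrow> z \<in> partial_Z p j S"
    if "c \<in> SZ (supp \<alpha>) p \<and> z \<in> partial_Z p j (insert \<alpha> S) \<and> fam z \<alpha> = c" for c z
    using that \<alpha> unfolding partial_Z_def by blast
qed

lemma hasdim_Zd:
  "hasdim kact (Zd 0 p (- j)) (Bd 0 p (- j)) (\<Sum>\<alpha>\<in>D j. face_betti TYPE('k) \<Delta> p (supp \<alpha>))"
proof -
  have B: "partial_Z p j {} = Bd 0 p (- j)"
  proof (intro subset_antisym subsetI)
    fix z assume "z \<in> partial_Z p j {}"
    then have z: "z \<in> Z 0 p" "hom_deg (- j) z" "\<And>\<alpha>. \<alpha> \<in> D j \<Longrightarrow> fam z \<alpha> \<in> SB (supp \<alpha>) p"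
      by (auto simp: partial_Z_def Zd_def)
    then show "z \<in> Bd 0 p (- j)" using B_fine_deg[OF z] by (simp add: Bd_def)
  next
    fix z assume "z \<in> Bd 0 p (- j)"
    then have z: "z \<in> B 0 p" "hom_deg (- j) z" by (auto simp: Bd_def)
    then show "z \<in> partial_Z p j {}" using B_Z fam_B D_nonpos by (auto simp: partial_Z_def Zd_def)
  qed
  have "hasdim kact (partial_Z p j S) (partial_Z p j {}) (\<Sum>\<alpha>\<in>S. face_betti TYPE('k) \<Delta> p (supp \<alpha>))"
    if "finite S" "S \<subseteq> D j" for S
    using that
  proof (induction S)
    case empty
    show ?case by (simp add: hasdim_zero submod_0[OF sub_partial_Z])
  next
    case (insert \<alpha> S)
    have 1: "hasdim kact (partial_Z p j S) (partial_Z p j {}) (\<Sum>\<alpha>\<in>S. face_betti TYPE('k) \<Delta> p (supp \<alpha>))"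
      using insert by blast
    have "hasdim kact (partial_Z p j (insert \<alpha> S)) (partial_Z p j {})
        ((\<Sum>\<alpha>\<in>S. face_betti TYPE('k) \<Delta> p (supp \<alpha>)) + face_betti TYPE('k) \<Delta> p (supp \<alpha>))"
      by (rule k.hasdim_ses[OF 1 sub_partial_Z _ partial_Z_insert]) (use insert in \<open>auto simp: partial_Z_def\<close>)
    then show ?case using insert.hyps by (simp add: add.commute)
  qed
  from this[OF finite_nonpos_deg subset_refl] have "hasdim kact (partial_Z p j (D j)) (partial_Z p j {})
      (\<Sum>\<alpha>\<in>D j. face_betti TYPE('k) \<Delta> p (supp \<alpha>))" .
  moreover have "partial_Z p j (D j) = Zd 0 p (- j)" by (simp add: partial_Z_def)
  ultimately show ?thesis unfolding B by simp
qed

text \<open>A summand depends on \<alpha> only through its support F, and the number of exponents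
  with this support is the binomial coefficient; nonfaces contribute zero.\<close>

lemma sum_face_betti:
  "(\<Sum>\<alpha>\<in>D (int (Suc i)). face_betti TYPE('k) \<Delta> p (supp \<alpha>)) =
    (\<Sum>F\<in>\<Delta>. binomial0 i (int (card F) - 1) * face_betti TYPE('k) \<Delta> p F)"
proof -
  let ?h = "face_betti TYPE('k) \<Delta> p" and ?S = "{\<alpha> \<in> D (int (Suc i)). supp \<alpha> \<in> \<Delta>}"
  have "(\<Sum>\<alpha>\<in>D (int (Suc i)). ?h (supp \<alpha>)) = (\<Sum>\<alpha>\<in>?S. ?h (supp \<alpha>))"
  proof (rule sum.mono_neutral_right)
    show "\<forall>\<alpha>\<in>D (int (Suc i)) - ?S. ?h (supp \<alpha>) = 0"
      using face_betti_nonface[OF closed finite_\<Delta>, where 'k = 'k] by blast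
  qed (use finite_nonpos_deg in auto)
  also have "\<dots> = (\<Sum>F\<in>\<Delta>. \<Sum>\<alpha>\<in>{\<alpha> \<in> ?S. supp \<alpha> = F}. ?h (supp \<alpha>))"
    by (rule sum.group[symmetric]) (use finite_\<Delta> finite_nonpos_deg in auto)
  also have "\<dots> = (\<Sum>F\<in>\<Delta>. binomial0 i (int (card F) - 1) * ?h F)"
  proof (intro sum.cong refl)
    fix F assume F: "F \<in> \<Delta>"
    then have "F \<subseteq> {1..n}" using faces_sub by blast
    then have c: "card (neg_exps F (int (Suc i))) = binomial0 i (int (card F) - 1)" using card_neg_exps[of F n "Suc i"] by simp
    have "{\<alpha> \<in> ?S. supp \<alpha> = F} = neg_exps F (int (Suc i))"
      using F faces_sub unfolding nonpos_deg_neg neg_exps_def by blast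
    then have "(\<Sum>\<alpha>\<in>{\<alpha> \<in> ?S. supp \<alpha> = F}. ?h (supp \<alpha>)) = (\<Sum>\<alpha>\<in>neg_exps F (int (Suc i)). ?h F)"
      by (intro sum.cong) (auto simp: neg_exps_def)
    then show "(\<Sum>\<alpha>\<in>{\<alpha> \<in> ?S. supp \<alpha> = F}. ?h (supp \<alpha>)) = binomial0 i (int (card F) - 1) * ?h F"
      using c by simp
  qed
  finally show ?thesis .
qed

text \<open>theta_(m+1) maps the common kernel of the first m forms onto its part one degree higher,
  by \<open>theta_surjective\<close>; what it kills is the common kernel of m + 1 forms.\<close>

lemma hasdim_Kd_quot:
  assumes "int m < i" "hasdim kact (Kd m p (- i)) (Bd 0 p (- i)) N"
  shows "hasdim kact (Kd m p (- i - 1)) (Kd (Suc m) p (- i - 1)) N"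
proof (rule hasdim_transfer[where Q = "\<lambda>w x. w \<in> Kd m p (- i) \<and> x \<in> Kd m p (- i - 1) \<and> tact (Suc m) x - w \<in> B 0 p",
      OF assms(2) submod_0[OF sub_Kd] sub_Kd])
  show "w \<in> Kd m p (- i) \<and> x \<in> Kd m p (- i - 1)"
    if "w \<in> Kd m p (- i) \<and> x \<in> Kd m p (- i - 1) \<and> tact (Suc m) x - w \<in> B 0 p" for w x using that by blast
  show "\<exists>x. w \<in> Kd m p (- i) \<and> x \<in> Kd m p (- i - 1) \<and> tact (Suc m) x - w \<in> B 0 p" if "w \<in> Kd m p (- i)" for w
    using theta_surjective[OF assms(1), of w p] that unfolding Kd_def by blast
  show "\<exists>w x'. (w \<in> Kd m p (- i) \<and> x' \<in> Kd m p (- i - 1) \<and> tact (Suc m) x' - w \<in> B 0 p) \<and> x - x' \<in> Kd (Suc m) p (- i - 1)"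
    if x: "x \<in> Kd m p (- i - 1)" for x
  proof -
    have xK: "x \<in> K m p" "hom_deg (- i - 1) x" using x by (auto simp: Kd_def)
    have "tact (Suc m) x \<in> K m p" unfolding tact_def by (rule submod_act[OF sub_K _ xK(1)]) auto
    then have 1: "tact (Suc m) x \<in> Kd m p (- i)" using hom_deg_tact[OF xK(2)] by (simp add: Kd_def)
    have 2: "tact (Suc m) x - tact (Suc m) x \<in> B 0 p" using submod_0[OF sub_B] by (metis diff_self)
    have 3: "x - x \<in> Kd (Suc m) p (- i - 1)" using submod_0[OF sub_Kd] by (metis diff_self)
    show ?thesis by (rule exI, rule exI, intro conjI, rule 1, rule x, rule 2, rule 3)
  qed
  show "w - w' \<in> Kd m p (- i) \<and> x - x' \<in> Kd m p (- i - 1) \<and> tact (Suc m) (x - x') - (w - w') \<in> B 0 p"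
    if "w \<in> Kd m p (- i) \<and> x \<in> Kd m p (- i - 1) \<and> tact (Suc m) x - w \<in> B 0 p"
      "w' \<in> Kd m p (- i) \<and> x' \<in> Kd m p (- i - 1) \<and> tact (Suc m) x' - w' \<in> B 0 p" for w x w' x'
  proof -
    have e: "tact (Suc m) (x - x') - (w - w') = (tact (Suc m) x - w) - (tact (Suc m) x' - w')"
    proof -
      have "a - b - (c - d) = (a - c) - (b - d)" for a b c d :: "nat set \<Rightarrow> 'k laurent" by (simp add: algebra_simps)
      then show ?thesis unfolding tact_diff .
    qed
    show ?thesis unfolding e
      by (intro conjI submod_diff[OF sub_Kd] submod_diff[OF sub_B] that(1)[THEN conjunct1] that(2)[THEN conjunct1]
          that(1)[THEN conjunct2, THEN conjunct1] that(2)[THEN conjunct2, THEN conjunct1]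
          that(1)[THEN conjunct2, THEN conjunct2] that(2)[THEN conjunct2, THEN conjunct2])
  qed
  show "kact r w \<in> Kd m p (- i) \<and> kact r x \<in> Kd m p (- i - 1) \<and> tact (Suc m) (kact r x) - kact r w \<in> B 0 p"
    if "w \<in> Kd m p (- i) \<and> x \<in> Kd m p (- i - 1) \<and> tact (Suc m) x - w \<in> B 0 p" for r w x
  proof -
    have "kact r (tact (Suc m) x - w) \<in> B 0 p"
      by (rule k.vsub_scale[OF submod_kact[OF sub_B] that[THEN conjunct2, THEN conjunct2]])
    then have "tact (Suc m) (kact r x) - kact r w \<in> B 0 p" unfolding k.scale_diff tact_cact .
    then show ?thesis
      by (intro conjI k.vsub_scale[OF sub_Kd] that[THEN conjunct1] that[THEN conjunct2, THEN conjunct1])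
  qed
  show "w \<in> Bd 0 p (- i) \<longleftrightarrow> x \<in> Kd (Suc m) p (- i - 1)"
    if "w \<in> Kd m p (- i) \<and> x \<in> Kd m p (- i - 1) \<and> tact (Suc m) x - w \<in> B 0 p" for w x
    using that submod_diff_iff[OF sub_B, of "tact (Suc m) x" w 0 p] by (simp only: Bd_def Kd_def K_Suc mem_Collect_eq) blast
qed

text \<open>Rank and nullity: the dimension for m + 1 forms is the dimension for m forms in the same
  degree minus the one a degree higher. By Pascal's rule this difference lowers the bottom index of
  the binomial coefficient by one.\<close>

lemma hasdim_Kd:
  "hasdim kact (Kd m p (- int (Suc i) - int m)) (Bd 0 p (- int (Suc i) - int m))
    (\<Sum>F\<in>\<Delta>. binomial0 i (int (card F) - int m - 1) * face_betti TYPE('k) \<Delta> p F)"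
proof (induction m arbitrary: i)
  case 0
  have "Kd 0 p j = Zd 0 p j" for j by (simp add: Kd_def Zd_def K_def)
  then show ?case using hasdim_Zd[of p "int (Suc i)"] unfolding sum_face_betti by simp
next
  case (Suc m)
  let ?f = "\<lambda>m i. \<Sum>F\<in>\<Delta>. binomial0 i (int (card F) - int m - 1) * face_betti TYPE('k) \<Delta> p F"
  let ?j = "int (Suc i) + int m"
  have e: "- int (Suc (Suc i)) - int m = - ?j - 1" "- int (Suc i) - int (Suc m) = - ?j - 1" "- int (Suc i) - int m = - ?j" by auto
  have 1: "hasdim kact (Kd m p (- ?j - 1)) (Bd 0 p (- ?j - 1)) (?f m (Suc i))" using Suc.IH[of "Suc i"] unfolding e .
  have 2: "hasdim kact (Kd m p (- ?j - 1)) (Kd (Suc m) p (- ?j - 1)) (?f m i)"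
  proof (rule hasdim_Kd_quot)
    show "hasdim kact (Kd m p (- ?j)) (Bd 0 p (- ?j)) (?f m i)" unfolding e(3)[symmetric] by (rule Suc.IH)
  qed simp
  have "Kd (Suc m) p (- ?j - 1) \<subseteq> Kd m p (- ?j - 1)" by (auto simp: Kd_def K_Suc)
  then have "hasdim kact (Kd (Suc m) p (- ?j - 1)) (Bd 0 p (- ?j - 1)) (?f m (Suc i) - ?f m i)"
    using k.hasdim_kernel[OF 1 2 sub_Kd sub_Kd sub_Bd Bd_Kd] by blast
  moreover have "?f m (Suc i) = ?f m i + ?f (Suc m) i"
    unfolding binomial0_Suc sum.distrib[symmetric] distrib_right[symmetric]
    by (intro sum.cong refl arg_cong2[of _ _ _ _ "(*)"] arg_cong2[of _ _ _ _ "(+)"] arg_cong[of _ _ "binomial0 i"]) simp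
  ultimately show ?case unfolding e by simp
qed

lemma hasdim_reduced:
  assumes m: "m \<le> d" and p: "p \<ge> 1"
  shows "hasdim kact (Zd m p (- int (Suc i))) (Bd m p (- int (Suc i)))
    (\<Sum>F\<in>\<Delta>. binomial0 i (int (card F) - int m - 1) * face_betti TYPE('k) \<Delta> (p + int m) F)"
\<comment> \<open>\<open>Rel\<close> is read backwards, from the common kernel to the reduction,
  since the dimension is known for the kernel.\<close>
proof (rule hasdim_transfer[where Q = "\<lambda>w z. Rel m p z w \<and> hom_deg (- int (Suc i)) z \<and> hom_deg (- int (Suc i) - int m) w",
      OF hasdim_Kd submod_0[OF sub_Kd] sub_Bd])
  let ?j = "- int (Suc i)"
  have p0: "p \<ge> 0" using p by simp
  show "w \<in> Kd m (p + int m) (?j - int m) \<and> z \<in> Zd m p ?j"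
    if "Rel m p z w \<and> hom_deg ?j z \<and> hom_deg (?j - int m) w" for z w
    using that Rel_K[OF p0, of m z w] Rel_Z[of m p z w] by (simp add: Kd_def Zd_def)
  show "\<exists>z. Rel m p z w \<and> hom_deg ?j z \<and> hom_deg (?j - int m) w" if "w \<in> Kd m (p + int m) (?j - int m)" for w
    using Rel_graded(1)[OF theta_surjective m p, of "int (Suc i)" w] that by (auto simp: Kd_def)
  show "\<exists>w z'. (Rel m p z' w \<and> hom_deg ?j z' \<and> hom_deg (?j - int m) w) \<and> z - z' \<in> Bd m p ?j" if z: "z \<in> Zd m p ?j" for z
  proof -
    obtain w where w: "Rel m p z w" using Rel_total[OF p0] z by (auto simp: Zd_def)
    have "hc ?j z = z" using z by (simp add: Zd_def hom_deg_hc)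
    then have 1: "Rel m p z (hc (?j - int m) w)" using Rel_hc[OF w, of ?j] by simp
    have 2: "z - z \<in> Bd m p ?j" using submod_0[OF sub_Bd] by (metis diff_self)
    have 3: "hom_deg ?j z" using z by (simp add: Zd_def)
    show ?thesis by (rule exI, rule exI, intro conjI, rule 1, rule 3, rule hom_deg_hc_self, rule 2)
  qed
  show "Rel m p (z - z') (w - w') \<and> hom_deg ?j (z - z') \<and> hom_deg (?j - int m) (w - w')"
    if "Rel m p z w \<and> hom_deg ?j z \<and> hom_deg (?j - int m) w" "Rel m p z' w' \<and> hom_deg ?j z' \<and> hom_deg (?j - int m) w'"
    for z w z' w' using that Rel_diff hom_deg_diff by blast
  show "Rel m p (kact r z) (kact r w) \<and> hom_deg ?j (kact r z) \<and> hom_deg (?j - int m) (kact r w)"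
    if "Rel m p z w \<and> hom_deg ?j z \<and> hom_deg (?j - int m) w" for r z w
    using that by (intro conjI Rel_cact hom_deg_kact poly_ring_const) auto
  show "w \<in> Bd 0 (p + int m) (?j - int m) \<longleftrightarrow> z \<in> Bd m p ?j"
    if "Rel m p z w \<and> hom_deg ?j z \<and> hom_deg (?j - int m) w" for z w
    using that Rel_B_forward[OF p0, of m z w] Rel_graded(2)[OF theta_surjective m p, of "int (Suc i)" z w]
    by (auto simp: Bd_def)
qed

end

section \<open>Face determinants and Vandermonde witnesses\<close>

section \<open>Genericity\<close>

text \<open>Rows follow the vertices of F in increasing order; forms are counted from 1, whence
  \<open>Suc j\<close>. The entry type is left open so that the matrix of indeterminates is an
  instance.\<close>

definition face_matrix :: "(nat \<times> nat \<Rightarrow> 'r) \<Rightarrow> nat set \<Rightarrow> 'r mat" where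
  "face_matrix b F = mat (card F) (card F) (\<lambda>(i, j). b (sorted_list_of_set F ! i, Suc j))"

lemma face_matrix_carrier [simp, intro]: "face_matrix b F \<in> carrier_mat (card F) (card F)"
  by (simp add: face_matrix_def)

lemma dim_face_matrix [simp]: "dim_row (face_matrix b F) = card F" "dim_col (face_matrix b F) = card F"
  by (simp_all add: face_matrix_def)

lemma face_matrix_index: "i < card F \<Longrightarrow> j < card F \<Longrightarrow> face_matrix b F $$ (i, j) = b (sorted_list_of_set F ! i, Suc j)"
  by (simp add: face_matrix_def)

lemma face_nth:
  assumes "finite F" "t \<in> F"
  obtains i where "i < card F" "t = sorted_list_of_set F ! i"
proof -
  have "t \<in> set (sorted_list_of_set F)" using assms by simp
  then obtain i where "i < length (sorted_list_of_set F)" "sorted_list_of_set F ! i = t" by (metis in_set_conv_nth)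
  then show ?thesis using that[of i] assms(1) by simp
qed

lemma face_nth_mem: "finite F \<Longrightarrow> i < card F \<Longrightarrow> sorted_list_of_set F ! i \<in> F"
  using nth_mem[of i "sorted_list_of_set F"] by simp

lemma sum_from_1: "(\<Sum>p = 1..k. f p) = (\<Sum>j\<in>{0..<k}. f (Suc j))"
  unfolding One_nat_def by (simp add: sum.atLeast1_atMost_eq atLeast0LessThan)

lemma face_matrix_mult:
  assumes "i < card F" "v \<in> carrier_vec (card F)"
  shows "(face_matrix b F *\<^sub>v v) $ i = (\<Sum>j\<in>{0..<card F}. b (sorted_list_of_set F ! i, Suc j) * v $ j)"
  using assms by (simp add: face_matrix_def scalar_prod_def)

lemma det_col_indep:
  fixes a :: "nat \<times> nat \<Rightarrow> 'k::field"
  assumes F: "finite F" and det: "det (face_matrix a F) \<noteq> 0"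
  shows "col_indep a F {1..card F}"
  unfolding col_indep_def
proof (intro allI impI ballI)
  fix c p assume c: "\<forall>t\<in>F. (\<Sum>p = 1..card F. c p * a (t, p)) = 0" and p: "p \<in> {1..card F}"
  let ?v = "vec (card F) (\<lambda>j. c (Suc j))"
  have "face_matrix a F *\<^sub>v ?v = 0\<^sub>v (card F)"
  proof (rule eq_vecI)
    fix i assume "i < dim_vec (0\<^sub>v (card F))"
    then have i: "i < card F" by simp
    have "(face_matrix a F *\<^sub>v ?v) $ i = (\<Sum>j\<in>{0..<card F}. c (Suc j) * a (sorted_list_of_set F ! i, Suc j))"
      unfolding face_matrix_mult[OF i vec_carrier] by (intro sum.cong) simp_all
    also have "\<dots> = 0" using c face_nth_mem[OF F i] unfolding sum_from_1 by blast
    finally show "(face_matrix a F *\<^sub>v ?v) $ i = 0\<^sub>v (card F) $ i" using i by simp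
  qed (simp add: face_matrix_def)
  then have "?v = 0\<^sub>v (card F)" using det det_0_iff_vec_prod_zero_field[OF face_matrix_carrier, of a F] vec_carrier by blast
  moreover obtain j where j: "p = Suc j" "j < card F" using p by (cases p) auto
  ultimately show "c p = 0" by (metis index_vec index_zero_vec(1))
qed

lemma det_solve:
  fixes a :: "nat \<times> nat \<Rightarrow> 'k::field"
  assumes F: "finite F" and det: "det (face_matrix a F) \<noteq> 0" and t: "t \<in> F"
  shows "\<exists>c. \<forall>s\<in>F. (\<Sum>p = 1..card F. c p * a (s, p)) = (if s = t then 1 else 0)"
proof -
  let ?A = "face_matrix a F" and ?k = "card F"
  obtain m where m: "m < ?k" "t = sorted_list_of_set F ! m" using face_nth[OF F t] .
  \<comment> \<open>Column m of the inverse matrix, as adjugate over determinant;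
    \<open>p - 1\<close> turns the number of a form into a matrix index.\<close>
  let ?c = "\<lambda>p. adj_mat ?A $$ (p - 1, m) / det ?A"
  note adj = adj_mat[OF face_matrix_carrier[of a F]]
  have "(\<Sum>p = 1..?k. ?c p * a (s, p)) = (if s = t then 1 else 0)" if s: "s \<in> F" for s
  proof -
    obtain i where i: "i < ?k" "s = sorted_list_of_set F ! i" using face_nth[OF F s] .
    have "(\<Sum>j\<in>{0..<?k}. a (s, Suc j) * adj_mat ?A $$ (j, m)) = (?A * adj_mat ?A) $$ (i, m)"
      using i m carrier_matD[OF adj(1)] by (simp add: scalar_prod_def face_matrix_index)
    also have "\<dots> = (if i = m then det ?A else 0)" unfolding adj(2) using i m by simp
    also have "i = m \<longleftrightarrow> s = t" using i m F by (simp add: nth_eq_iff_index_eq)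
    finally have "(\<Sum>j\<in>{0..<?k}. a (s, Suc j) * adj_mat ?A $$ (j, m)) / det ?A = (if s = t then 1 else 0)"
      using det by simp
    then show ?thesis unfolding sum_from_1 by (simp add: sum_divide_distrib mult.commute)
  qed
  then show ?thesis by (intro exI[of _ ?c]) blast
qed

text \<open>A nonzero kernel vector would be the coefficient list of a nonzero polynomial of degree
  less than |F| that vanishes at the |F| distinct points g t.\<close>

lemma det_vandermonde:
  fixes g :: "nat \<Rightarrow> 'k::field"
  assumes F: "finite F" and g: "inj_on g F" and a: "\<And>t j. t \<in> F \<Longrightarrow> j < card F \<Longrightarrow> a (t, Suc j) = g t ^ j"
  shows "det (face_matrix a F) \<noteq> 0"
proof
  let ?k = "card F"
  assume "det (face_matrix a F) = 0"
  then obtain v where v: "v \<in> carrier_vec ?k" "v \<noteq> 0\<^sub>v ?k" "face_matrix a F *\<^sub>v v = 0\<^sub>v ?k"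
    using det_0_iff_vec_prod_zero_field[OF face_matrix_carrier, of a F] by blast
  let ?q = "\<Sum>j<?k. monom (v $ j) j"
  have coeff: "coeff ?q j = (if j < ?k then v $ j else 0)" for j
    by (simp add: coeff_sum coeff_monom)
  obtain j where j: "j < ?k" "v $ j \<noteq> 0"
  proof (rule ccontr)
    assume "\<not> thesis"
    then have "v = 0\<^sub>v ?k" using v(1) that by (intro eq_vecI) auto
    then show False using v(2) by blast
  qed
  then have q0: "?q \<noteq> 0" using coeff[of j] by force
  have deg: "degree ?q < ?k"
  proof (rule ccontr)
    assume "\<not> degree ?q < ?k"
    then have "coeff ?q (degree ?q) = 0" using coeff by simp
    then show False using q0 by (simp only: leading_coeff_0_iff)
  qed
  have "poly ?q (g t) = 0" if t: "t \<in> F" for t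
  proof -
    obtain i where i: "i < ?k" "t = sorted_list_of_set F ! i" using face_nth[OF F t] .
    have "poly ?q (g t) = (\<Sum>j\<in>{0..<?k}. a (t, Suc j) * v $ j)"
      unfolding poly_sum poly_monom atLeast0LessThan by (intro sum.cong) (simp_all add: a[OF t] mult.commute)
    also have "\<dots> = (face_matrix a F *\<^sub>v v) $ i" unfolding face_matrix_mult[OF i(1) v(1)] i(2) ..
    also have "\<dots> = 0" using i v(3) by simp
    finally show ?thesis .
  qed
  then have "g ` F \<subseteq> {x. poly ?q x = 0}" by blast
  then have "card (g ` F) \<le> card {x. poly ?q x = 0}" using poly_roots_finite[OF q0] by (intro card_mono)
  also have "\<dots> \<le> degree ?q" by (rule card_poly_roots_bound[OF q0])
  finally show False using deg card_image[OF g] by simp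
qed

interpretation poly_eval_hom: comm_ring_hom "poly_eval a" for a :: "'v \<Rightarrow> 'k::field"
  by unfold_locales
    (simp_all add: poly_eval_lin_ext poly_eval.lin_ext_add poly_eval.lin_ext_mult poly_eval.lin_ext_one poly_eval.lin_ext_zero)

lemma poly_eval_var: "poly_eval a (poly_var v) = a v"
  by (simp add: poly_eval_def poly_var_def)

definition generic_poly :: "nat set set \<Rightarrow> (nat \<times> nat, 'k::field) mpoly" where
  "generic_poly \<Delta> = (\<Prod>F\<in>\<Delta>. det (face_matrix poly_var F))"

lemma poly_eval_generic_poly: "poly_eval a (generic_poly \<Delta>) = (\<Prod>F\<in>\<Delta>. det (face_matrix a F))"
proof -
  have "map_mat (poly_eval a) (face_matrix poly_var F) = face_matrix a F" for F
    by (rule eq_matI) (simp_all add: face_matrix_def poly_eval_var)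
  then have "poly_eval a (det (face_matrix poly_var F)) = det (face_matrix a F)" for F
    by (metis poly_eval_hom.hom_det)
  then show ?thesis unfolding generic_poly_def poly_eval_lin_ext poly_eval.lin_ext_prod by simp
qed

lemma generic_poly_mem:
  assumes "\<Delta> \<subseteq> Pow {1..n}" "\<And>F. F \<in> \<Delta> \<Longrightarrow> card F \<le> d"
  shows "generic_poly \<Delta> \<in> carrier (poly_ring ({1..n} \<times> {1..d}))"
  unfolding generic_poly_def
proof (rule poly_ring_prod)
  fix F assume F: "F \<in> \<Delta>"
  have fin: "finite F" using F assms(1) finite_subset by blast
  have s: "signof p \<in> carrier (poly_ring V)" for p :: "nat \<Rightarrow> nat" and V
    by (auto simp: sign_def)
  show "det (face_matrix poly_var F) \<in> carrier (poly_ring ({1..n} \<times> {1..d}))"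
    unfolding det_def'[OF face_matrix_carrier]
  proof (intro poly_ring_sum poly_ring_mult poly_ring_prod s)
    fix p i assume p: "p \<in> {p. p permutes {0..<card F}}" and i: "i \<in> {0..<card F}"
    then have "p i < card F" using permutes_in_image[of p "{0..<card F}" i] by auto
    moreover have "sorted_list_of_set F ! i \<in> {1..n}" using face_nth_mem[OF fin, of i] i F assms(1) by (metis PowD atLeastLessThan_iff subsetD)
    ultimately show "face_matrix poly_var F $$ (i, p i) \<in> carrier (poly_ring ({1..n} \<times> {1..d}))"
      using i assms(2)[OF F] by (auto simp: face_matrix_index intro!: poly_ring_var)
  qed
qed

lemma ex_generic:
  assumes inf: "infinite (UNIV :: 'k::field set)" and \<Delta>: "subset_closed \<Delta>" "\<Delta> \<subseteq> Pow {1..n}"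
    and d: "\<And>F. F \<in> \<Delta> \<Longrightarrow> card F \<le> d"
  shows "\<exists>U :: (nat \<times> nat \<Rightarrow> 'k) set. zariski_open ({1..n} \<times> {1..d}) U \<and> U \<noteq> {} \<and> (\<forall>a\<in>U. generic_forms n d \<Delta> a)"
proof -
  let ?V = "{1..n} \<times> {1..d}"
  define U :: "(nat \<times> nat \<Rightarrow> 'k) set" where "U = {a \<in> ?V \<rightarrow>\<^sub>E UNIV. \<exists>f\<in>{generic_poly \<Delta>}. poly_eval a f \<noteq> 0}"
  have finF: "finite F" if "F \<in> \<Delta>" for F using that \<Delta>(2) finite_subset by blast
  have fin\<Delta>: "finite \<Delta>" using \<Delta>(2) finite_subset by blast
  have U: "a \<in> U \<longleftrightarrow> a \<in> ?V \<rightarrow>\<^sub>E UNIV \<and> (\<forall>F\<in>\<Delta>. det (face_matrix a F) \<noteq> 0)" for a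
    using fin\<Delta> by (simp add: U_def poly_eval_generic_poly)
  have "zariski_open ?V U"
    unfolding zariski_open_def U_def by (rule exI[of _ "{generic_poly \<Delta>}"]) (use generic_poly_mem[OF \<Delta>(2) d] in auto)
  moreover have "U \<noteq> {}"
  proof -
    obtain g :: "nat \<Rightarrow> 'k" where g: "inj g" using infinite_countable_subset[OF inf] by blast
    \<comment> \<open>An infinite field supplies pairwise distinct nodes g t. The exponent
      \<open>p - 1\<close> makes the column of the p-th form consist of the powers g t^(p-1),
      uniformly for all faces.\<close>
    let ?a = "restrict (\<lambda>(t, p). g t ^ (p - 1)) ?V"
    have "det (face_matrix ?a F) \<noteq> 0" if F: "F \<in> \<Delta>" for F
    proof (rule det_vandermonde[OF finF[OF F]])
      show "inj_on g F" using g by (auto simp: inj_on_def)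
      show "?a (t, Suc j) = g t ^ j" if "t \<in> F" "j < card F" for t j
      proof -
        have "t \<in> {1..n}" using that(1) F \<Delta>(2) by blast
        then show ?thesis using that(2) d[OF F] by simp
      qed
    qed
    then have "?a \<in> U" unfolding U by auto
    then show ?thesis by blast
  qed
  moreover have "generic_forms n d \<Delta> a" if "a \<in> U" for a
  proof -
    have det: "det (face_matrix a F) \<noteq> 0" if "F \<in> \<Delta>" for F using \<open>a \<in> U\<close> that by (simp add: U)
    show ?thesis by (intro generic_forms.intro \<Delta> d det_col_indep[OF finF det] det_solve[OF finF det])
  qed
  ultimately show ?thesis by blast
qed

lemma card_le_complex_dim:
  assumes "simplicial_complex n \<Delta>" "complex_dim \<Delta> = int d - 1" "F \<in> \<Delta>"
  shows "card F \<le> d"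
proof -
  have "finite \<Delta>" using assms(1) finite_subset by (auto simp: simplicial_complex_def)
  then have "int (card F) - 1 \<le> complex_dim \<Delta>" unfolding complex_dim_def using assms(3) by (intro Max_ge) auto
  then show ?thesis using assms(2) by simp
qed

section \<open>Parts in high degrees, and the isomorphism between truncations\<close>

section \<open>Graded submodules and truncations\<close>

lemma lookup_hc: "Poly_Mapping.lookup (hc j u F) \<alpha> = (if exp_deg \<alpha> = j then Poly_Mapping.lookup (u F) \<alpha> else 0)"
  by (simp add: hc_def lookup_restr)

lemma hc_0 [simp]: "hc j 0 = 0"
  using hc_diff[of j 0 0] by simp

lemma hc_sum: "hc j (sum f A) = (\<Sum>i\<in>A. hc j (f i))"
  by (induction A rule: infinite_finite_induct) (simp_all only: sum.infinite sum.empty sum.insert hc_0 hc_add not_False_eq_True)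

lemma hc_off_degree: "hom_deg j' u \<Longrightarrow> j' \<noteq> j \<Longrightarrow> hc j u = 0"
proof (intro ext poly_mapping_eqI)
  fix F \<alpha> assume "hom_deg j' u" "j' \<noteq> j"
  then have "Poly_Mapping.lookup (u F) \<alpha> = 0" if "exp_deg \<alpha> = j" using that by (metis hom_deg_def in_keys_iff)
  then show "Poly_Mapping.lookup (hc j u F) \<alpha> = Poly_Mapping.lookup (0 F) \<alpha>" by (simp add: lookup_hc)
qed

definition degs :: "nat \<Rightarrow> (nat set \<Rightarrow> 'k::field laurent) \<Rightarrow> int set" where
  "degs n u = exp_deg ` (\<Union>F\<in>Pow {1..n}. Poly_Mapping.keys (u F))"

lemma finite_degs: "finite (degs n u)"
  by (simp add: degs_def)

lemma sum_hc:
  assumes u: "\<And>F. F \<notin> Pow {1..n} \<Longrightarrow> u F = 0"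
  shows "(\<Sum>j\<in>degs n u. hc j u) = u"
proof (intro ext poly_mapping_eqI)
  fix F \<alpha>
  have "Poly_Mapping.lookup ((\<Sum>j\<in>degs n u. hc j u) F) \<alpha> = (if exp_deg \<alpha> \<in> degs n u then Poly_Mapping.lookup (u F) \<alpha> else 0)"
    using finite_degs[of n u] by (simp add: sum_fun_apply lookup_sum lookup_hc)
  also have "\<dots> = Poly_Mapping.lookup (u F) \<alpha>"
  proof (cases "Poly_Mapping.lookup (u F) \<alpha> = 0")
    case False
    then have "F \<in> Pow {1..n}" using u by fastforce
    moreover have "\<alpha> \<in> Poly_Mapping.keys (u F)" using False by (simp add: in_keys_iff)
    ultimately have "exp_deg \<alpha> \<in> degs n u" unfolding degs_def by blast
    then show ?thesis by simp
  qed simp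
  finally show "Poly_Mapping.lookup ((\<Sum>j\<in>degs n u. hc j u) F) \<alpha> = Poly_Mapping.lookup (u F) \<alpha>" .
qed

text \<open>An arbitrary scalar mixes degrees; each of its terms shifts them by its own
  degree.\<close>

lemma hc_cact:
  fixes r :: "(nat, 'k::field) mpoly"
  shows "hc j (cact r u) = (\<Sum>e\<in>Poly_Mapping.keys r. cact (Poly_Mapping.single e (Poly_Mapping.lookup r e)) (hc (j - int (exp_deg e)) u))"
proof -
  let ?m = "\<lambda>e. Poly_Mapping.single e (Poly_Mapping.lookup r e)"
  have "cact r u = (\<Sum>e\<in>Poly_Mapping.keys r. cact (?m e) u)"
  proof (rule ext)
    fix F
    have "emb r = (\<Sum>e\<in>Poly_Mapping.keys r. emb (?m e))"
      unfolding emb.lin_ext_sum[symmetric] using poly_mapping_sum_single[of r] by simp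
    then show "cact r u F = (\<Sum>e\<in>Poly_Mapping.keys r. cact (?m e) u) F"
      by (simp only: sum_fun_apply sum_distrib_right)
  qed
  moreover have "hc j (cact (?m e) u) = cact (?m e) (hc (j - int (exp_deg e)) u)" for e
    unfolding hc_def by (rule ext, rule hcomp_mult) (auto simp: keys_emb split: if_splits)
  ultimately show ?thesis by (simp only: hc_sum)
qed

text \<open>Representatives of the part of A / D in degrees \<ge> c: the components below c are zero
  in the quotient. As polynomials have no negative degrees, this part is a submodule
  (\<open>submod_above\<close>).\<close>

definition above :: "(nat set \<Rightarrow> 'k::field laurent) set \<Rightarrow> (nat set \<Rightarrow> 'k laurent) set \<Rightarrow> int \<Rightarrow> (nat set \<Rightarrow> 'k laurent) set" where
  "above A D c = {w \<in> A. \<forall>j<c. hc j w \<in> D}"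

lemma submod_above:
  assumes A: "submod (poly_ring {1..n}) cact A" and D: "submod (poly_ring {1..n}) cact D"
  shows "submod (poly_ring {1..n}) cact (above A D c)"
proof (rule submodI)
  show "0 \<in> above A D c" using submod_0[OF A] submod_0[OF D] by (simp add: above_def)
next
  fix x y assume xy: "x \<in> above A D c" "y \<in> above A D c"
  have "x - y \<in> A" by (rule submod_diff[OF A]) (use xy in \<open>simp_all add: above_def\<close>)
  moreover have "hc j (x - y) \<in> D" if "j < c" for j
    unfolding hc_diff by (rule submod_diff[OF D]) (use xy that in \<open>simp_all add: above_def\<close>)
  ultimately show "x - y \<in> above A D c" by (simp only: above_def mem_Collect_eq) blast
next
  fix r :: "(nat, 'a) mpoly" and x assume r: "r \<in> polys n" and x: "x \<in> above A D c"
  have "cact r x \<in> A" by (rule submod_act[OF A r]) (use x in \<open>simp add: above_def\<close>)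
  moreover have "hc j (cact r x) \<in> D" if j: "j < c" for j
    unfolding hc_cact
  proof (rule submod_sum[OF D], rule submod_act[OF D])
    fix e assume e: "e \<in> Poly_Mapping.keys r"
    then show "Poly_Mapping.single e (Poly_Mapping.lookup r e) \<in> polys n" using r by (auto simp: in_poly_ring)
    have "j - int (exp_deg e) < c" using j by simp
    then show "hc (j - int (exp_deg e)) x \<in> D" using x by (simp add: above_def)
  qed
  ultimately show "cact r x \<in> above A D c" by (simp only: above_def mem_Collect_eq) blast
qed

text \<open>A cochain is the sum of its finitely many components, and those outside the chosen
  degrees vanish modulo D. The map g translates indices into degrees, for families such as
  \<open>theta_ker\<close>, where the index i belongs to degree -(i + 1).\<close>

lemma sum_of_parts_graded:
  assumes P: "presents (poly_ring {1..n}) cact A D \<rho> M"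
    and A': "submod (poly_ring {1..n}) cact A'" "A' \<subseteq> A" and hc: "\<And>w j. w \<in> A' \<Longrightarrow> hc j w \<in> A'"
    and supp: "\<And>w F. w \<in> A' \<Longrightarrow> F \<notin> Pow {1..n} \<Longrightarrow> w F = 0" and g: "inj g"
    and G: "\<And>i. G i = \<rho> ` {w \<in> A'. hom_deg (g i) w}"
  shows "sum_of_parts M G J = \<rho> ` {w \<in> A'. \<forall>j. j \<notin> g ` J \<longrightarrow> hc j w \<in> D}"
proof -
  interpret Module.module "poly_ring {1..n}" M by (rule presents_module[OF P])
  note D = presentsD(3)[OF P] and car = presentsD(5)[OF P]
  show ?thesis
  proof (intro subset_antisym subsetI)
    fix x assume "x \<in> sum_of_parts M G J"
    then obtain K y where K: "finite K" "K \<subseteq> J" "y \<in> (\<Pi> i\<in>K. G i)" "x = (\<Oplus>\<^bsub>M\<^esub>i\<in>K. y i)"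
      by (auto simp: sum_of_parts_def)
    have "\<forall>i\<in>K. \<exists>w. w \<in> A' \<and> hom_deg (g i) w \<and> y i = \<rho> w" using K(3) unfolding G Pi_def by blast
    then obtain w where "\<forall>i\<in>K. w i \<in> A' \<and> hom_deg (g i) (w i) \<and> y i = \<rho> (w i)" using bchoice[of K] by meson
    then have w: "\<And>i. i \<in> K \<Longrightarrow> w i \<in> A'" "\<And>i. i \<in> K \<Longrightarrow> hom_deg (g i) (w i)" "\<And>i. i \<in> K \<Longrightarrow> y i = \<rho> (w i)"
      by auto
    have "x = (\<Oplus>\<^bsub>M\<^esub>i\<in>K. \<rho> (w i))" unfolding K(4)
    proof (rule M.finsum_cong')
      show "(\<lambda>i. \<rho> (w i)) \<in> K \<rightarrow> carrier M" using w(1) A'(2) unfolding car by blast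
    qed (use w(3) in auto)
    also have "\<dots> = \<rho> (\<Sum>i\<in>K. w i)" by (rule presents_finsum[OF P _ K(1)]) (use w(1) A'(2) in blast)
    finally have x: "x = \<rho> (\<Sum>i\<in>K. w i)" .
    have "hc j (\<Sum>i\<in>K. w i) \<in> D" if "j \<notin> g ` J" for j
    proof -
      have "hc j (w i) = 0" if "i \<in> K" for i
        by (rule hc_off_degree[OF w(2)[OF that]]) (use \<open>j \<notin> g ` J\<close> that K(2) in blast)
      then have "hc j (\<Sum>i\<in>K. w i) = 0" unfolding hc_sum by (rule sum.neutral[OF ballI])
      then show ?thesis using submod_0[OF D] by metis
    qed
    moreover have "(\<Sum>i\<in>K. w i) \<in> A'" by (rule submod_sum[OF A'(1) w(1)])
    ultimately show "x \<in> \<rho> ` {w \<in> A'. \<forall>j. j \<notin> g ` J \<longrightarrow> hc j w \<in> D}" unfolding x by blast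
  next
    fix x assume "x \<in> \<rho> ` {w \<in> A'. \<forall>j. j \<notin> g ` J \<longrightarrow> hc j w \<in> D}"
    then obtain w where w: "w \<in> A'" "\<And>j. j \<notin> g ` J \<Longrightarrow> hc j w \<in> D" "x = \<rho> w" by blast
    \<comment> \<open>Only degrees that occur in w contribute, and by injectivity of g finitely many
      indices belong to them.\<close>
    define K where "K = {i \<in> J. g i \<in> degs n w}"
    have "finite (g -` degs n w)" by (rule finite_vimageI[OF finite_degs g])
    then have K: "finite K" "K \<subseteq> J" by (auto simp: K_def elim: finite_subset[rotated])
    have "(\<Sum>i\<in>K. hc (g i) w) \<in> A'" by (rule submod_sum[OF A'(1) hc[OF w(1)]])
    then have A1: "(\<Sum>i\<in>K. hc (g i) w) \<in> A" using A'(2) by blast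
    have wsum: "(\<Sum>j\<in>degs n w. hc j w) = w" by (rule sum_hc) (rule supp[OF w(1)])
    have "(\<Sum>i\<in>K. hc (g i) w) = (\<Sum>j\<in>g ` K. hc j w)"
      by (simp add: sum.reindex[OF inj_on_subset[OF g subset_UNIV]] comp_def)
    also have "g ` K = degs n w \<inter> g ` J" by (auto simp: K_def)
    finally have "w - (\<Sum>i\<in>K. hc (g i) w) = (\<Sum>j\<in>degs n w - g ` J. hc j w)"
      using wsum sum.Int_Diff[OF finite_degs[of n w], of "\<lambda>j. hc j w" "g ` J"]
      by (metis add_diff_cancel_left')
    also have "\<dots> \<in> D" by (rule submod_sum[OF D]) (use w(2) in blast)
    finally have "x = \<rho> (\<Sum>i\<in>K. hc (g i) w)" using presentsD(9)[OF P _ A1, of w] A'(2) w by blast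
    also have "\<dots> = (\<Oplus>\<^bsub>M\<^esub>i\<in>K. \<rho> (hc (g i) w))"
      by (rule presents_finsum[OF P _ K(1), symmetric]) (use A'(2) hc[OF w(1)] in blast)
    finally have "x = (\<Oplus>\<^bsub>M\<^esub>i\<in>K. \<rho> (hc (g i) w))" .
    moreover have "(\<lambda>i. \<rho> (hc (g i) w)) \<in> (\<Pi> i\<in>K. G i)" unfolding G using hc[OF w(1)] hom_deg_hc_self by blast
    ultimately show "x \<in> sum_of_parts M G J" unfolding sum_of_parts_def using K by blast
  qed
qed

lemma presents_truncation:
  assumes P: "presents (poly_ring {1..n}) cact A D \<rho> M" and hc: "\<And>w j. w \<in> A \<Longrightarrow> hc j w \<in> A" "\<And>w j. w \<in> D \<Longrightarrow> hc j w \<in> D"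
    and supp: "\<And>w F. w \<in> A \<Longrightarrow> F \<notin> Pow {1..n} \<Longrightarrow> w F = 0" and G: "\<And>j. G j = \<rho> ` {w \<in> A. hom_deg j w}"
  shows "\<exists>\<tau>. presents (poly_ring {1..n}) cact A (above A D c) \<tau> (truncation M G c) \<and>
    (\<forall>j. truncation_deg M G c j = \<tau> ` {w \<in> A. hom_deg j w})"
proof -
  note A = presentsD(2)[OF P] and D = presentsD(3)[OF P] and DA = presentsD(4)[OF P]
  have "sum_of_parts M G {c..} = \<rho> ` {w \<in> A. \<forall>j. j \<notin> (\<lambda>i. i) ` {c..} \<longrightarrow> hc j w \<in> D}"
    by (rule sum_of_parts_graded[where g = "\<lambda>i. i", OF P A subset_refl]) (use hc supp G in auto)
  also have "{w \<in> A. \<forall>j. j \<notin> (\<lambda>i. i) ` {c..} \<longrightarrow> hc j w \<in> D} = above A D c" by (auto simp: above_def)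
  finally have e: "sum_of_parts M G {c..} = \<rho> ` above A D c" .
  have "D \<subseteq> above A D c" "above A D c \<subseteq> A" using DA hc(2) by (auto simp: above_def)
  then have "presents (poly_ring {1..n}) cact A (above A D c) (\<lambda>x. \<rho> ` above A D c +>\<^bsub>M\<^esub> \<rho> x) (truncation M G c)"
    unfolding truncation_def e by (intro presents_quot[OF P submod_above[OF A D]])
  moreover have "truncation_deg M G c j = (\<lambda>x. \<rho> ` above A D c +>\<^bsub>M\<^esub> \<rho> x) ` {w \<in> A. hom_deg j w}" for j
    unfolding truncation_deg_def e G image_image ..
  ultimately show ?thesis by blast
qed

context generic_forms
begin

interpretation k: vs_action "kact :: 'k \<Rightarrow> _" by (rule vs_action_kact)

lemma Z_supp: "w \<in> Z m p \<Longrightarrow> F \<notin> Pow {1..n} \<Longrightarrow> w F = 0"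
  using subsets_of_cardD(1)[of F n p] by (auto simp: cech_cocycles_def cochains_def)

lemma presents_H_reduced:
  "\<exists>\<rho>. presents (poly_ring {1..n}) cact (Z m p) (B m p) \<rho> (H_reduced n \<Delta> \<theta> m p) \<and>
    (\<forall>j. H_reduced_deg n \<Delta> \<theta> m p j = \<rho> ` Zd m p j)"
proof -
  interpret R: cyclic n "I m" "reduced_proj n \<Delta> \<theta> m" "reduced_module n \<Delta> \<theta> m"
    by (rule cyclic_reduced_module[OF closed]) auto
  have "presents (poly_ring {1..n}) cact (Z m p) (B m p) (R.coh_cls p) (H_reduced n \<Delta> \<theta> m p)"
    unfolding H_reduced_def J_def by (rule R.presents_local_cohomology)
  moreover have "H_reduced_deg n \<Delta> \<theta> m p j = R.coh_cls p ` Zd m p j" for j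
    unfolding H_reduced_deg_def reduced_module_deg_def[abs_def] Zd_def J_def by (rule R.local_cohomology_deg_cls)
  ultimately show ?thesis by blast
qed

lemma presents_H_face:
  "\<exists>\<rho>. presents (poly_ring {1..n}) cact (Z 0 p) (B 0 p) \<rho> (H_face n \<Delta> p) \<and>
    (\<forall>j. H_face_deg n \<Delta> p j = \<rho> ` Zd 0 p j)"
proof -
  interpret R: cyclic n "nonface_ideal n \<Delta>" "face_proj n \<Delta>" "face_module n \<Delta>" by (rule cyclic_face_module[OF closed])
  have J: "J 0 = loc (nonface_ideal n \<Delta>)" by (simp add: fun_eq_iff J_0)
  have "presents (poly_ring {1..n}) cact (Z 0 p) (B 0 p) (R.coh_cls p) (H_face n \<Delta> p)"
    unfolding H_face_def J by (rule R.presents_local_cohomology)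
  moreover have "H_face_deg n \<Delta> p j = R.coh_cls p ` Zd 0 p j" for j
    unfolding H_face_deg_def face_module_deg_def[abs_def] Zd_def J by (rule R.local_cohomology_deg_cls)
  ultimately show ?thesis by blast
qed

lemma K_Z: "K m p \<subseteq> Z 0 p" and B_K: "B 0 p \<subseteq> K m p"
  using B_Z tact_B by (auto simp: K_def)

lemma presents_theta_ker:
  "\<exists>\<rho>. presents (poly_ring {1..n}) cact (K m p) (B 0 p) \<rho> (theta_ker_module n \<Delta> \<theta> p m) \<and>
    (\<forall>i. theta_ker n \<Delta> \<theta> p m i = \<rho> ` Kd m p (- (i + 1)))"
proof -
  obtain \<rho> where P: "presents (poly_ring {1..n}) cact (Z 0 p) (B 0 p) \<rho> (H_face n \<Delta> p)"
    and deg: "\<And>j. H_face_deg n \<Delta> p j = \<rho> ` Zd 0 p j" using presents_H_face[of p] by (elim exE conjE) (rule that; blast)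
  have kill: "\<theta> q \<odot>\<^bsub>H_face n \<Delta> p\<^esub> \<rho> w = \<zero>\<^bsub>H_face n \<Delta> p\<^esub> \<longleftrightarrow> tact q w \<in> B 0 p" if w: "w \<in> Z 0 p" for q w
  proof -
    have "\<theta> q \<odot>\<^bsub>H_face n \<Delta> p\<^esub> \<rho> w = \<rho> (tact q w)"
      unfolding tact_def by (rule presentsD(8)[OF P _ w, symmetric]) auto
    then show ?thesis
      unfolding presentsD(6)[OF P] using presentsD(9)[OF P tact_Z[OF w] submod_0[OF sub_Z]] by simp
  qed
  have ker: "theta_ker n \<Delta> \<theta> p m i = \<rho> ` Kd m p (- (i + 1))" for i
  proof -
    have "theta_ker n \<Delta> \<theta> p m i = \<rho> ` {w \<in> Zd 0 p (- (i + 1)). \<forall>q\<in>{1..m}. tact q w \<in> B 0 p}"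
      unfolding theta_ker_def deg by (rule filter_image) (simp add: kill Zd_def)
    also have "{w \<in> Zd 0 p (- (i + 1)). \<forall>q\<in>{1..m}. tact q w \<in> B 0 p} = Kd m p (- (i + 1))"
      unfolding Zd_def Kd_def K_def by blast
    finally show ?thesis .
  qed
  have "sum_of_parts (H_face n \<Delta> p) (theta_ker n \<Delta> \<theta> p m) UNIV =
      \<rho> ` {w \<in> K m p. \<forall>j. j \<notin> (\<lambda>i. - (i + 1)) ` UNIV \<longrightarrow> hc j w \<in> B 0 p}"
  proof (rule sum_of_parts_graded[OF P sub_K K_Z])
    show "hc j w \<in> K m p" if "w \<in> K m p" for w j using that by (rule hc_K)
    show "w F = 0" if "w \<in> K m p" "F \<notin> Pow {1..n}" for w F using that Z_supp K_Z by blast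
    show "inj (\<lambda>i :: int. - (i + 1))" by (simp add: inj_def)
    show "theta_ker n \<Delta> \<theta> p m i = \<rho> ` {w \<in> K m p. hom_deg (- (i + 1)) w}" for i
      unfolding ker Kd_def ..
  qed
  also have "{w \<in> K m p. \<forall>j. j \<notin> (\<lambda>i. - (i + 1)) ` UNIV \<longrightarrow> hc j w \<in> B 0 p} = K m p"
  proof -
    have "j \<in> (\<lambda>i. - (i + 1)) ` UNIV" for j :: int by (rule image_eqI[of _ _ "- j - 1"]) simp_all
    then show ?thesis by blast
  qed
  finally have "theta_ker_module n \<Delta> \<theta> p m = (H_face n \<Delta> p)\<lparr>carrier := \<rho> ` K m p\<rparr>"
    by (simp add: theta_ker_module_def)
  then have "presents (poly_ring {1..n}) cact (K m p) (B 0 p \<inter> K m p) \<rho> (theta_ker_module n \<Delta> \<theta> p m)"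
    using presents_submod[OF P sub_K K_Z] by simp
  moreover have "B 0 p \<inter> K m p = B 0 p" using B_K by blast
  ultimately show ?thesis using ker by auto
qed

lemma presents_Zd:
  assumes P: "presents (poly_ring {1..n}) cact (Z m p) (B m p) \<rho> M"
  shows "presents class_ring kact (Zd m p j) (Bd m p j) \<rho> (vspace M (\<rho> ` Zd m p j))"
proof -
  have "B m p \<inter> Zd m p j = Bd m p j" using Bd_Zd by (auto simp: Bd_def Zd_def)
  moreover have "Zd m p j \<subseteq> Z m p" by (auto simp: Zd_def)
  ultimately show ?thesis using presents_vspace[OF P sub_Zd _ vs_action_kact] by metis
qed

lemma presents_Kd:
  assumes P: "presents (poly_ring {1..n}) cact (K m p) (B 0 p) \<rho> M"
  shows "presents class_ring kact (Kd m p j) (Bd 0 p j) \<rho> (vspace M (\<rho> ` Kd m p j))"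
proof -
  have "B 0 p \<inter> Kd m p j = Bd 0 p j" using Bd_Kd by (auto simp: Bd_def Kd_def)
  moreover have "Kd m p j \<subseteq> K m p" by (auto simp: Kd_def)
  ultimately show ?thesis using presents_vspace[OF P sub_Kd _ vs_action_kact] by metis
qed

lemma dim_reduced:
  assumes "m \<le> d" "0 < l" "0 < i"
  shows "vectorspace.fin_dim class_ring (vspace (H_reduced n \<Delta> \<theta> m (int l)) (H_reduced_deg n \<Delta> \<theta> m (int l) (- int i))) \<and>
    vectorspace.dim class_ring (vspace (H_reduced n \<Delta> \<theta> m (int l)) (H_reduced_deg n \<Delta> \<theta> m (int l) (- int i))) =
      (\<Sum>F\<in>\<Delta>. binomial0 (i - 1) (int (card F) - int m - 1) * face_betti TYPE('k) \<Delta> (int l + int m) F)"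
proof -
  obtain \<rho> where P: "presents (poly_ring {1..n}) cact (Z m (int l)) (B m (int l)) \<rho> (H_reduced n \<Delta> \<theta> m (int l))"
    and deg: "\<And>j. H_reduced_deg n \<Delta> \<theta> m (int l) j = \<rho> ` Zd m (int l) j" using presents_H_reduced[of m "int l"] by (elim exE conjE) (rule that; blast)
  obtain i' where i: "i = Suc i'" using assms(3) by (cases i) auto
  have "hasdim kact (Zd m (int l) (- int i)) (Bd m (int l) (- int i))
      (\<Sum>F\<in>\<Delta>. binomial0 (i - 1) (int (card F) - int m - 1) * face_betti TYPE('k) \<Delta> (int l + int m) F)"
    using hasdim_reduced[OF assms(1), of "int l" i'] assms(2) unfolding i by simp
  from k.presents_dim[OF presents_Zd[OF P] this] show ?thesis unfolding deg .
qed

text \<open>The correspondence is cut down to pairs that are homogeneous of degrees -i and -i - m;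
  the index i + m - 1 of the kernel stands for degree -(i + m).\<close>

lemma degree_iso:
  assumes m: "m \<le> d" and l: "0 < l" and i: "1 \<le> (i :: int)"
  shows "module_iso class_ring (vspace (H_reduced n \<Delta> \<theta> m (int l)) (H_reduced_deg n \<Delta> \<theta> m (int l) (- i)))
    (vspace (theta_ker_module n \<Delta> \<theta> (int l + int m) m) (theta_ker n \<Delta> \<theta> (int l + int m) m (i + int m - 1))) \<noteq> {}"
proof -
  let ?p = "int l"
  have p: "?p \<ge> 1" "?p \<ge> 0" using l by auto
  obtain \<rho> where P: "presents (poly_ring {1..n}) cact (Z m ?p) (B m ?p) \<rho> (H_reduced n \<Delta> \<theta> m ?p)"
    and deg: "\<And>j. H_reduced_deg n \<Delta> \<theta> m ?p j = \<rho> ` Zd m ?p j" using presents_H_reduced[of m ?p] by (elim exE conjE) (rule that; blast)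
  obtain \<sigma> where Q: "presents (poly_ring {1..n}) cact (K m (?p + int m)) (B 0 (?p + int m)) \<sigma> (theta_ker_module n \<Delta> \<theta> (?p + int m) m)"
    and ker: "\<And>i. theta_ker n \<Delta> \<theta> (?p + int m) m i = \<sigma> ` Kd m (?p + int m) (- (i + 1))" using presents_theta_ker[of m "?p + int m"] by (elim exE conjE) (rule that; blast)
  have e: "- (i + int m - 1 + 1) = - i - int m" by simp
  let ?Q = "\<lambda>z w. Rel m ?p z w \<and> hom_deg (- i) z \<and> hom_deg (- i - int m) w"
  have "\<exists>\<phi>\<in>module_iso class_ring (vspace (H_reduced n \<Delta> \<theta> m ?p) (\<rho> ` Zd m ?p (- i)))
      (vspace (theta_ker_module n \<Delta> \<theta> (?p + int m) m) (\<sigma> ` Kd m (?p + int m) (- i - int m))). \<forall>z w. ?Q z w \<longrightarrow> \<phi> (\<rho> z) = \<sigma> w"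
  proof (rule presents_iso[OF presents_Zd[OF P] presents_Kd[OF Q]])
    show "z \<in> Zd m ?p (- i) \<and> w \<in> Kd m (?p + int m) (- i - int m)" if "?Q z w" for z w
      using that Rel_K[OF p(2), of m z w] Rel_Z[of m ?p z w] by (simp add: Kd_def Zd_def)
    show "\<exists>w. ?Q z w" if z: "z \<in> Zd m ?p (- i)" for z
    proof -
      obtain w where w: "Rel m ?p z w" using Rel_total[OF p(2)] z by (auto simp: Zd_def)
      have "hom_deg (- i) z" "hc (- i) z = z" using z by (simp_all add: Zd_def hom_deg_hc)
      then show ?thesis using Rel_hc[OF w, of "- i"] hom_deg_hc_self by metis
    qed
    show "\<exists>z w'. ?Q z w' \<and> w - w' \<in> Bd 0 (?p + int m) (- i - int m)" if w: "w \<in> Kd m (?p + int m) (- i - int m)" for w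
    proof -
      obtain z where 1: "hom_deg (- i) z" "Rel m ?p z w"
        using Rel_graded(1)[OF theta_surjective m p(1) i, of w] w by (auto simp: Kd_def)
      have 2: "w - w \<in> Bd 0 (?p + int m) (- i - int m)" using submod_0[OF sub_Bd] by (metis diff_self)
      have 3: "hom_deg (- i - int m) w" using w by (simp add: Kd_def)
      show ?thesis by (rule exI, rule exI, intro conjI, rule 1(2), rule 1(1), rule 3, rule 2)
    qed
    show "?Q (z - z') (w - w')" if "?Q z w" "?Q z' w'" for z w z' w' using that Rel_diff hom_deg_diff by blast
    show "?Q (kact r z) (kact r w)" if "?Q z w" for r z w
      using that by (intro conjI Rel_cact hom_deg_kact poly_ring_const) auto
    show "z \<in> Bd m ?p (- i) \<longleftrightarrow> w \<in> Bd 0 (?p + int m) (- i - int m)" if "?Q z w" for z w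
      using that Rel_B_forward[OF p(2), of m z w] Rel_graded(2)[OF theta_surjective m p(1) i, of z w]
      by (auto simp: Bd_def)
  qed
  then show ?thesis unfolding deg ker e by blast
qed

lemma Rel_sum:
  assumes p: "p \<ge> 0" and "finite T" "\<And>j. j \<in> T \<Longrightarrow> Rel m p (z j) (w j)"
  shows "Rel m p (\<Sum>j\<in>T. z j) (\<Sum>j\<in>T. w j)"
  using assms(2,3)
proof (induction T)
  case empty
  obtain w where "Rel m p 0 w" using Rel_total[OF p submod_0[OF sub_Z]] by blast
  from Rel_diff[OF this this] have "Rel m p 0 0" by (simp only: diff_self)
  then show ?case unfolding sum.empty .
next
  case (insert j T)
  have j: "Rel m p (z j) (w j)" using insert.prems by blast
  have T: "Rel m p (\<Sum>j\<in>T. z j) (\<Sum>j\<in>T. w j)" using insert by blast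
  \<comment> \<open>A sum rewritten with differences only, so that \<open>Rel_diff\<close>
    applies.\<close>
  have "Rel m p (z j - (z j - z j - (\<Sum>j\<in>T. z j))) (w j - (w j - w j - (\<Sum>j\<in>T. w j)))"
    by (intro Rel_diff j T)
  then show ?case unfolding sum.insert[OF insert.hyps] by (simp only: diff_self diff_0 diff_minus_eq_add)
qed

lemma Rel_B_iff:
  assumes "m \<le> d" "p \<ge> 1" "i \<ge> 1" "Rel m p z w" "hom_deg (- i) z"
  shows "z \<in> B m p \<longleftrightarrow> w \<in> B 0 (p + int m)"
  using assms Rel_B_forward[of p m z w] Rel_graded(2)[OF theta_surjective assms(1), of p i z w] by auto

text \<open>Here \<open>Rel\<close> is used without fixing a degree, which makes the resulting map
  S-linear. Modulo \<open>above\<close>, only components below degree 0 count for the reduction and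
  only those below -m for the kernel. \<open>Rel_hc\<close> matches them, and for each of them the
  degreewise result applies.\<close>

lemma truncation_iso:
  assumes m: "m \<le> d" and l: "0 < l"
  shows "\<exists>\<phi>\<in>module_iso (poly_ring {1..n})
      (truncation (H_reduced n \<Delta> \<theta> m (int l)) (H_reduced_deg n \<Delta> \<theta> m (int l)) 0)
      (truncation (theta_ker_module n \<Delta> \<theta> (int l + int m) m) (theta_ker_deg n \<Delta> \<theta> (int l + int m) m) (- int m)).
    \<forall>i :: int. 1 \<le> i \<longrightarrow>
      \<phi> ` truncation_deg (H_reduced n \<Delta> \<theta> m (int l)) (H_reduced_deg n \<Delta> \<theta> m (int l)) 0 (- i) =
      truncation_deg (theta_ker_module n \<Delta> \<theta> (int l + int m) m) (theta_ker_deg n \<Delta> \<theta> (int l + int m) m) (- int m)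
        (- ((i + int m - 1) + 1))"
proof -
  let ?p = "int l" and ?H = "H_reduced n \<Delta> \<theta> m (int l)" and ?K = "theta_ker_module n \<Delta> \<theta> (int l + int m) m"
  let ?Hd = "H_reduced_deg n \<Delta> \<theta> m (int l)" and ?Kd = "theta_ker_deg n \<Delta> \<theta> (int l + int m) m"
  have p: "?p \<ge> 1" "?p \<ge> 0" using l by auto
  let ?q = "?p + int m"
  obtain \<rho> where P: "presents (poly_ring {1..n}) cact (Z m ?p) (B m ?p) \<rho> ?H"
    and deg: "\<And>j. ?Hd j = \<rho> ` Zd m ?p j" using presents_H_reduced[of m ?p] by (elim exE conjE) (rule that; blast)
  obtain \<sigma> where Q: "presents (poly_ring {1..n}) cact (K m ?q) (B 0 ?q) \<sigma> ?K"
    and ker: "\<And>i. theta_ker n \<Delta> \<theta> ?q m i = \<sigma> ` Kd m ?q (- (i + 1))" using presents_theta_ker[of m "?p + int m"] by (elim exE conjE) (rule that; blast)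
  have Kd: "?Kd j = \<sigma> ` {w \<in> K m ?q. hom_deg j w}" for j by (simp add: theta_ker_deg_def ker Kd_def)
  have "\<exists>\<tau>. presents (poly_ring {1..n}) cact (K m ?q) (above (K m ?q) (B 0 ?q) (- int m)) \<tau> (truncation ?K ?Kd (- int m)) \<and>
      (\<forall>j. truncation_deg ?K ?Kd (- int m) j = \<tau> ` {w \<in> K m ?q. hom_deg j w})"
  proof (rule presents_truncation[OF Q _ _ _ Kd])
    show "hc j w \<in> K m ?q" if "w \<in> K m ?q" for w j using that by (rule hc_K)
    show "hc j w \<in> B 0 ?q" if "w \<in> B 0 ?q" for w j using that by (rule hc_B)
    show "w F = 0" if "w \<in> K m ?q" "F \<notin> Pow {1..n}" for w F using that Z_supp K_Z by blast
  qed
  then obtain \<sigma>' where Q': "presents (poly_ring {1..n}) cact (K m ?q) (above (K m ?q) (B 0 ?q) (- int m)) \<sigma>' (truncation ?K ?Kd (- int m))"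
    and ker': "\<And>j. truncation_deg ?K ?Kd (- int m) j = \<sigma>' ` {w \<in> K m ?q. hom_deg j w}" by (elim exE conjE) (rule that; blast)
  have Hd: "?Hd j = \<rho> ` {w \<in> Z m ?p. hom_deg j w}" for j by (simp add: deg Zd_def)
  have "\<exists>\<tau>. presents (poly_ring {1..n}) cact (Z m ?p) (above (Z m ?p) (B m ?p) 0) \<tau> (truncation ?H ?Hd 0) \<and>
      (\<forall>j. truncation_deg ?H ?Hd 0 j = \<tau> ` {w \<in> Z m ?p. hom_deg j w})"
  proof (rule presents_truncation[OF P _ _ _ Hd])
    show "hc j w \<in> Z m ?p" if "w \<in> Z m ?p" for w j using that by (rule hc_Z)
    show "hc j w \<in> B m ?p" if "w \<in> B m ?p" for w j using that by (rule hc_B)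
    show "w F = 0" if "w \<in> Z m ?p" "F \<notin> Pow {1..n}" for w F using that by (rule Z_supp)
  qed
  then obtain \<rho>' where P': "presents (poly_ring {1..n}) cact (Z m ?p) (above (Z m ?p) (B m ?p) 0) \<rho>' (truncation ?H ?Hd 0)"
    and deg': "\<And>j. truncation_deg ?H ?Hd 0 j = \<rho>' ` {w \<in> Z m ?p. hom_deg j w}" by (elim exE conjE) (rule that; blast)
  have lift: "\<exists>z. hom_deg j z \<and> Rel m ?p z w" if "j < 0" "w \<in> K m ?q" "hom_deg (j - int m) w" for j w
    using Rel_graded(1)[OF theta_surjective m p(1), of "- j" w] that by simp
  have ker_iff: "hc j z \<in> B m ?p \<longleftrightarrow> hc (j - int m) w \<in> B 0 ?q" if "Rel m ?p z w" "j < 0" for j z w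
  proof -
    have R: "Rel m ?p (hc j z) (hc (j - int m) w)" by (rule Rel_hc[OF that(1)])
    have "hom_deg (- (- j)) (hc j z)" using hom_deg_hc_self[of j z] by simp
    moreover have "1 \<le> - j" using that(2) by simp
    ultimately show ?thesis using Rel_B_iff[OF m p(1) _ R] by blast
  qed
  have "\<exists>\<phi>\<in>module_iso (poly_ring {1..n}) (truncation ?H ?Hd 0) (truncation ?K ?Kd (- int m)).
      \<forall>z w. Rel m ?p z w \<longrightarrow> \<phi> (\<rho>' z) = \<sigma>' w"
  proof (rule presents_iso[OF P' Q'])
    show "z \<in> Z m ?p \<and> w \<in> K m ?q" if "Rel m ?p z w" for z w
      using Rel_K[OF p(2) that] Rel_Z[OF that] by blast
    show "\<exists>w. Rel m ?p z w" if "z \<in> Z m ?p" for z using Rel_total[OF p(2) that] .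
    show "Rel m ?p (z - z') (w - w')" if "Rel m ?p z w" "Rel m ?p z' w'" for z w z' w' using that by (rule Rel_diff)
    show "Rel m ?p (cact r z) (cact r w)" if "r \<in> polys n" "Rel m ?p z w" for r z w using that by (rule Rel_cact)
    show "z \<in> above (Z m ?p) (B m ?p) 0 \<longleftrightarrow> w \<in> above (K m ?q) (B 0 ?q) (- int m)" if R: "Rel m ?p z w" for z w
    proof -
      have "(\<forall>j<0. hc j z \<in> B m ?p) \<longleftrightarrow> (\<forall>j<0. hc (j - int m) w \<in> B 0 ?q)" using ker_iff[OF R] by blast
      also have "\<dots> \<longleftrightarrow> (\<forall>j< - int m. hc j w \<in> B 0 ?q)"
      proof (intro iffI allI impI)
        fix j assume *: "\<forall>j<0. hc (j - int m) w \<in> B 0 ?q" and "j < - int m"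
        then have "j + int m < 0" by simp
        with * have "hc (j + int m - int m) w \<in> B 0 ?q" by blast
        then show "hc j w \<in> B 0 ?q" by simp
      next
        fix j :: int assume *: "\<forall>j< - int m. hc j w \<in> B 0 ?q" and "j < 0"
        then have "j - int m < - int m" by simp
        with * show "hc (j - int m) w \<in> B 0 ?q" by blast
      qed
      finally show ?thesis using Rel_K[OF p(2) R] Rel_Z[OF R] by (simp add: above_def)
    qed
    show "\<exists>z w'. Rel m ?p z w' \<and> w - w' \<in> above (K m ?q) (B 0 ?q) (- int m)" if w: "w \<in> K m ?q" for w
    proof -
      \<comment> \<open>Components of w in degrees \<ge> -m need not have a partner, but they vanish
        in the truncation. The finitely many others are lifted one by one, and their lifts are
        added.\<close>
      let ?T = "degs n w \<inter> {..< - int m}"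
      have fin: "finite ?T" using finite_degs by blast
      have "\<exists>z. Rel m ?p z (hc j w)" if "j \<in> ?T" for j
        using lift[of "j + int m" "hc j w"] hc_K[OF w] hom_deg_hc_self[of j w] that by auto
      then obtain z where z: "\<And>j. j \<in> ?T \<Longrightarrow> Rel m ?p (z j) (hc j w)" by metis
      let ?w = "\<Sum>j\<in>?T. hc j w"
      have R: "Rel m ?p (\<Sum>j\<in>?T. z j) ?w" by (rule Rel_sum[OF p(2) fin z])
      have "w F = 0" if "F \<notin> Pow {1..n}" for F using Z_supp[OF _ that] K_Z w by blast
      then have wsum: "(\<Sum>j\<in>degs n w. hc j w) = w" by (rule sum_hc)
      have "w - ?w = (\<Sum>j\<in>degs n w - {..< - int m}. hc j w)"
        using wsum sum.Int_Diff[OF finite_degs[of n w], of "\<lambda>j. hc j w" "{..< - int m}"] by (metis add_diff_cancel_left')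
      then have "hc j (w - ?w) = (\<Sum>i\<in>degs n w - {..< - int m}. hc j (hc i w))" for j by (simp only: hc_sum)
      moreover have "(\<Sum>i\<in>degs n w - {..< - int m}. hc j (hc i w)) = 0" if "j < - int m" for j
        using that by (intro sum.neutral ballI hc_off_degree[OF hom_deg_hc_self]) auto
      ultimately have hc0: "hc j (w - ?w) \<in> B 0 ?q" if "j < - int m" for j using that submod_0[OF sub_B] by metis
      have "w - ?w \<in> K m ?q" using w by (intro submod_diff[OF sub_K] submod_sum[OF sub_K] hc_K)
      then have "w - ?w \<in> above (K m ?q) (B 0 ?q) (- int m)" using hc0 unfolding above_def by blast
      then show ?thesis using R by blast
    qed
  qed
  then obtain \<phi> where \<phi>: "\<phi> \<in> module_iso (poly_ring {1..n}) (truncation ?H ?Hd 0) (truncation ?K ?Kd (- int m))"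
    "\<And>z w. Rel m ?p z w \<Longrightarrow> \<phi> (\<rho>' z) = \<sigma>' w" by blast
  have "\<phi> ` truncation_deg ?H ?Hd 0 (- i) = truncation_deg ?K ?Kd (- int m) (- ((i + int m - 1) + 1))" if i: "1 \<le> i" for i
  proof -
    have e: "- ((i + int m - 1) + 1) = - i - int m" by simp
    show ?thesis unfolding deg' ker' e
    proof (intro subset_antisym subsetI)
      fix x assume "x \<in> \<phi> ` \<rho>' ` {w \<in> Z m ?p. hom_deg (- i) w}"
      then obtain z where z: "z \<in> Z m ?p" "hom_deg (- i) z" "x = \<phi> (\<rho>' z)" by blast
      obtain w where "Rel m ?p z w" using Rel_total[OF p(2) z(1)] by blast
      then have R: "Rel m ?p z (hc (- i - int m) w)" using Rel_hc[of m ?p z w "- i"] z(2) by (simp add: hom_deg_hc)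
      then have "x = \<sigma>' (hc (- i - int m) w)" using \<phi>(2) z(3) by blast
      then show "x \<in> \<sigma>' ` {w \<in> K m ?q. hom_deg (- i - int m) w}" using Rel_K[OF p(2) R] hom_deg_hc_self by blast
    next
      fix x assume "x \<in> \<sigma>' ` {w \<in> K m ?q. hom_deg (- i - int m) w}"
      then obtain w where w: "w \<in> K m ?q" "hom_deg (- i - int m) w" "x = \<sigma>' w" by blast
      then obtain z where z: "hom_deg (- i) z" "Rel m ?p z w" using lift[of "- i" w] i by auto
      then have "x = \<phi> (\<rho>' z)" using \<phi>(2) w(3) by simp
      then show "x \<in> \<phi> ` \<rho>' ` {w \<in> Z m ?p. hom_deg (- i) w}" using z Rel_Z[OF z(2)] by blast
    qed
  qed
  then show ?thesis using \<phi>(1) by blast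
qed

end

section \<open>Isomorphism and dimension formula on the open set of generic coefficients\<close>

theorem theorem5p3:
  fixes n d :: nat and \<Delta> :: "nat set set"
  assumes "infinite (UNIV :: 'k::field set)"
    and "simplicial_complex n \<Delta>"
    and "complex_dim \<Delta> = int d - 1"
  shows "\<exists>U :: (nat \<times> nat \<Rightarrow> 'k) set. zariski_open ({1..n} \<times> {1..d}) U \<and> U \<noteq> {} \<and>
    (\<forall>a \<in> U. let \<theta> = linear_form n a in
      (\<forall>m l :: nat. m \<le> d \<and> 0 < l \<and> l \<le> d - m \<longrightarrow>
        (let H = H_reduced n \<Delta> \<theta> m (int l);
             H_deg = H_reduced_deg n \<Delta> \<theta> m (int l);
             K = theta_ker_module n \<Delta> \<theta> (int l + int m) m;
             K_deg = theta_ker_deg n \<Delta> \<theta> (int l + int m) m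
         in
          (\<exists>\<phi> \<in> module_iso (poly_ring {1..n}) (truncation H H_deg 0) (truncation K K_deg (- int m)).
             \<forall>i :: int. 1 \<le> i \<longrightarrow>
               \<phi> ` truncation_deg H H_deg 0 (- i) =
               truncation_deg K K_deg (- int m) (- ((i + int m - 1) + 1))) \<and>
          (\<forall>i :: int. 1 \<le> i \<longrightarrow>
             module_iso class_ring
               (vspace H (H_deg (- i)))
               (vspace K (theta_ker n \<Delta> \<theta> (int l + int m) m (i + int m - 1))) \<noteq> {}))) \<and>
      (\<forall>m l i :: nat. m \<le> d \<and> 0 < l \<and> 0 < i \<longrightarrow>
        (let V = vspace (H_reduced n \<Delta> \<theta> m (int l)) (H_reduced_deg n \<Delta> \<theta> m (int l) (- int i))
         in
          vectorspace.fin_dim class_ring V \<and>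
          vectorspace.dim class_ring V =
            (\<Sum>F \<in> \<Delta>. binomial0 (i - 1) (int (card F) - int m - 1) *
               vectorspace.dim (class_ring :: 'k ring)
                 (face_cohomology \<Delta> F (int l + int m - 1))))))"
proof -
  have faces: "\<Delta> \<subseteq> Pow {1..n}" using assms(2) by (simp add: simplicial_complex_def)
  have "\<exists>U :: (nat \<times> nat \<Rightarrow> 'k) set. zariski_open ({1..n} \<times> {1..d}) U \<and> U \<noteq> {} \<and> (\<forall>a\<in>U. generic_forms n d \<Delta> a)"
    by (rule ex_generic[OF assms(1) simplicial_subset_closed[OF assms(2)] faces card_le_complex_dim[OF assms(2,3)]])
  then obtain U :: "(nat \<times> nat \<Rightarrow> 'k) set" where U: "zariski_open ({1..n} \<times> {1..d}) U" "U \<noteq> {}"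
    and generic: "\<And>a. a \<in> U \<Longrightarrow> generic_forms n d \<Delta> a"
    by (elim exE conjE) (rule that, assumption, assumption, erule bspec, assumption)
  show ?thesis
    unfolding Let_def
  proof (rule exI[of _ U], rule conjI[OF U(1)], rule conjI[OF U(2)], rule ballI, rule conjI, goal_cases)
    case (1 a)
    interpret generic_forms n d \<Delta> a by (rule generic[OF 1])
    show ?case by (intro allI impI conjI truncation_iso degree_iso; simp)
  next
    case (2 a)
    interpret generic_forms n d \<Delta> a by (rule generic[OF 2])
    show ?case by (intro allI impI dim_reduced; simp)
  qed
qed

end
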